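(* Let $\Omega\subset\mathbb{R}^d$ be open and let $u\in L^\infty(\Omega)$ be an entropy solution of $\operatorname{div}[A(u)]=0$ in $\Omega$ such that the genuine nonlinearity condition (GN) holds. Let $J\subset\Omega$ be the jump set of $u$. Then $u$ is continuous outside of $J$, in the sense that for every $x\in\Omega\setminus J$, $$\lim_{r\to 0}\left(\operatorname*{ess\,sup}_{B_r(x)}u-\operatorname*{ess\,inf}_{B_r(x)}u\right)=0 .$$
   Context: $A:\mathbb{R}\to\mathbb{R}^d$ is a given function and $a=A'$. The equation is $\operatorname{div}[A(u)]=a(u)\cdot\nabla u=0$. Entropy solution: $u\in L^\infty(\Omega)$ is an entropy solution in $\Omega$ if for every convex $\eta:\mathbb{R}\to\mathbb{R}$, with $q:\mathbb{R}\to\mathbb{R}^d$ such that $q_i'(v)=\eta'(v)a_i(v)$ for $i=1,\dots,d$, and every smooth compactly supported $\varphi\ge 0$ in $\Omega$, one has $\int_\Omega q(u)\cdot\nabla\varphi\,dx\ge 0$. (GN): $a$ is $C^1$ and there exist $\alpha\in(0,1]$ and $C>0$ such that for every $\xi\in\mathbb{R}^d$ with $|\xi|=1$ and every $\delta>0$, $|\{v\in I: |a(v)\cdot\xi|<\delta\}|\le C\delta^\alpha$, where $I$ is a closed interval containing the image of $u$. Kinetic measure: let $f(x,v)=1$ if $0<v<u(x)$, $f(x,v)=-1$ if $u(x)<v<0$, and $f(x,v)=0$ otherwise. It is known that $u$ is an entropy solution if and only if there is a nonnegative measure $\mu$ on $\Omega\times\mathbb{R}$ with $a(v)\cdot\nabla_x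 f=\partial_v\mu$ in the sense of distributions; $\mu$ is the kinetic entropy dissipation measure of $u$. Jump set: $J=\left\{x\in\Omega:\limsup_{r\to0}\frac{\mu(B_r(x)\times\mathbb{R})}{r^{d-1}}>0\right\}$. *)

theory Defs
  imports "HOL-Analysis.Analysis" "HOL-Probability.Essential_Supremum"
begin

definition grad :: "('a::euclidean_space \<Rightarrow> real) \<Rightarrow> 'a \<Rightarrow> 'a" where
  "grad \<phi> x = (THE D. GDERIV \<phi> x :> D)"

primrec Ck_function :: "nat \<Rightarrow> ('a::euclidean_space \<Rightarrow> real) \<Rightarrow> bool" where
  "Ck_function 0 \<phi> \<longleftrightarrow> continuous_on UNIV \<phi>"
| "Ck_function (Suc k) \<phi> \<longleftrightarrow>
     (\<forall>x. \<phi> differentiable (at x)) \<and> (\<forall>b\<in>Basis. Ck_function k (\<lambda>x. grad \<phi> x \<bullet> b))"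

definition test_functions :: "'a::euclidean_space set \<Rightarrow> ('a \<Rightarrow> real) set" where
  "test_functions U =
     {\<phi>. (\<forall>k. Ck_function k \<phi>) \<and>
         compact (closure {x. \<phi> x \<noteq> 0}) \<and> closure {x. \<phi> x \<noteq> 0} \<subseteq> U}"

definition Linfinity :: "'a::euclidean_space set \<Rightarrow> ('a \<Rightarrow> real) set" where
  "Linfinity U =
     {u. u \<in> borel_measurable (lebesgue_on U) \<and> (\<exists>K. AE x in lebesgue_on U. \<bar>u x\<bar> \<le> K)}"

(* A convex function need not be differentiable everywhere, so q' = \<eta>' a is required
   exactly at the points where \<eta> is differentiable, i.e. off a countable set. Together with
   the continuity of q this determines q up to an additive constant: for continuous a,
   q v = q 0 + (integral of \<eta>' a from 0 to v). *)
definition entropy_flux ::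
    "(real \<Rightarrow> 'a::euclidean_space) \<Rightarrow> (real \<Rightarrow> real) \<Rightarrow> (real \<Rightarrow> 'a) \<Rightarrow> bool" where
  "entropy_flux a \<eta> q \<longleftrightarrow>
     continuous_on UNIV q \<and>
     (\<forall>v. \<eta> differentiable (at v) \<longrightarrow>
          (q has_vector_derivative deriv \<eta> v *\<^sub>R a v) (at v))"

definition entropy_solution ::
    "'a::euclidean_space set \<Rightarrow> (real \<Rightarrow> 'a) \<Rightarrow> ('a \<Rightarrow> real) \<Rightarrow> bool" where
  "entropy_solution U a u \<longleftrightarrow>
     u \<in> Linfinity U \<and>
     (\<forall>\<eta> q \<phi>. convex_on UNIV \<eta> \<and> entropy_flux a \<eta> q \<and>
              \<phi> \<in> test_functions U \<and> (\<forall>x. \<phi> x \<ge> 0) \<longrightarrow>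
        (LINT x|lebesgue_on U. q (u x) \<bullet> grad \<phi> x) \<ge> 0)"

definition genuinely_nonlinear :: "(real \<Rightarrow> 'a::euclidean_space) \<Rightarrow> real set \<Rightarrow> bool" where
  "genuinely_nonlinear a I \<longleftrightarrow>
     a C1_differentiable_on UNIV \<and>
     (\<exists>\<alpha> C. 0 < \<alpha> \<and> \<alpha> \<le> 1 \<and> 0 < C \<and>
        (\<forall>\<xi> \<delta>. norm \<xi> = 1 \<and> 0 < \<delta> \<longrightarrow>
           emeasure lebesgue {v \<in> I. \<bar>a v \<bullet> \<xi>\<bar> < \<delta>} \<le> ennreal (C * \<delta> powr \<alpha>)))"

definition kinetic_function :: "('a \<Rightarrow> real) \<Rightarrow> 'a \<Rightarrow> real \<Rightarrow> real" where
  "kinetic_function u x v =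
     (if 0 < v \<and> v < u x then 1 else if u x < v \<and> v < 0 then - 1 else 0)"

(* \<mu> is a nonnegative Borel measure on U \<times> \<real>, finite on compact sets (as needed for it to be
   a distribution), and a(v) . grad_x f = d\<mu>/dv is tested against \<phi>; both sides change sign
   when the derivatives are moved onto \<phi>. *)
definition kinetic_measure ::
    "'a::euclidean_space set \<Rightarrow> (real \<Rightarrow> 'a) \<Rightarrow> ('a \<Rightarrow> real) \<Rightarrow> ('a \<times> real) measure \<Rightarrow> bool" where
  "kinetic_measure U a u \<mu> \<longleftrightarrow>
     sets \<mu> = sets (restrict_space borel (U \<times> UNIV)) \<and>
     (\<forall>K. compact K \<and> K \<subseteq> U \<times> UNIV \<longrightarrow> emeasure \<mu> K < \<infinity>) \<and>
     (\<forall>\<phi> \<in> test_functions (U \<times> UNIV).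
        (LINT (x, v)|lebesgue_on (U \<times> UNIV).
            kinetic_function u x v * (a v \<bullet> grad (\<lambda>y. \<phi> (y, v)) x))
        = (LINT (x, v)|\<mu>. deriv (\<lambda>w. \<phi> (x, w)) v))"

(* The limsup only sees radii r with ball x r \<subseteq> U, for which ball x r \<times> UNIV is in sets \<mu>. *)
definition jump_set :: "'a::euclidean_space set \<Rightarrow> ('a \<times> real) measure \<Rightarrow> 'a set" where
  "jump_set U \<mu> =
     {x \<in> U. Limsup (at_right 0)
               (\<lambda>r. emeasure \<mu> (ball x r \<times> UNIV) / ennreal (r ^ (DIM('a) - 1))) > 0}"

definition essinf :: "'a measure \<Rightarrow> ('a \<Rightarrow> ereal) \<Rightarrow> ereal" where
  "essinf M f = - esssup M (\<lambda>x. - f x)"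

end

theory Submission
  imports Defs
begin

text \<open>Everything is read off the kinetic formulation \<open>a(v) \<cdot> \<nabla>\<^sub>x f = \<partial>\<^sub>v \<mu>\<close>. For levels \<open>k < w\<close> and a bump
  \<open>\<psi>\<close> supported in \<open>[k, w]\<close>, the matrix field \<open>\<integral> \<psi> f a \<otimes> a dv\<close> has divergence controlled by \<open>\<mu>\<close>;
  it vanishes where \<open>u \<le> k\<close> and equals a constant matrix \<open>T\<close>, positive definite by (GN), where \<open>u \<ge> w\<close>.
  Pairing it with the derivative of a potential of \<open>{u \<ge> w}\<close> adapted to \<open>T\<^sup>-\<^sup>1\<close> (a compensated
  compactness identity) bounds \<open>|{u \<ge> w}|\<close> by \<open>|{k < u < w}|\<close> plus a superlinear term. Summing over
  many thin windows absorbs the first term and a De Giorgi iteration follows: if \<open>u \<le> k\<close> holds on most of a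
  ball, then \<open>u \<le> k + l\<close> almost everywhere on a smaller ball; likewise from below. At a point outside the jump set the
  blow-ups have vanishing dissipation, so their sublevel sets asymptotically spread along every direction
  \<open>a v\<close>, and these directions span by (GN). Fed back into the window inequality, this
  shows that for every pair of levels \<open>u\<close> is mostly above the lower or mostly below the upper one, and
  the De Giorgi lemma applied to a fine grid of levels makes the oscillation small.\<close>

subsection \<open>Compactly supported functions of class C1\<close>

text \<open>The scheme stands on one constant. Where \<open>k < u < w\<close> the matrix field is
  neither 0 nor \<open>T\<close>, and its pairing with the derivative of the potential is estimated
  by Cauchy-Schwarz in the metric of \<open>T\<close> itself. What remains is the trace of the
  identity, that is the dimension, however degenerate the window. Ellipticity is lost only
  polynomially in the width of the window and only in front of a superlinear power of the measure,
  so the many thin windows come at a price that the iteration can pay. The same inequality is used a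
  second time without smallness. It compares the mass of a piece E of {u >= w} with the part of the
  unit-scale average of E that lies in {u >= w}. In the iteration this average is a quadratic
  remainder; in the blow-up it has full size, but if {u < w} captures a fixed share of it, that
  share is gained. Providing the share uniformly over E is the purpose of spreading. The measure is
  replaced by a domination inequality between entropy fluxes. Dilations preserve it and v -> -v
  carries it to the flux a(-v), so bounds from below need no separate argument.\<close>

definition c1c :: "('a::euclidean_space) set \<Rightarrow> ('a \<Rightarrow> real) \<Rightarrow> ('a \<Rightarrow> 'a) \<Rightarrow> bool" where
  "c1c U f f' \<longleftrightarrow> (\<forall>x. (f has_derivative (\<lambda>h. f' x \<bullet> h)) (at x)) \<and> continuous_on UNIV f' \<and>
     (\<exists>K. compact K \<and> K \<subseteq> U \<and> (\<forall>x. x \<notin> K \<longrightarrow> f x = 0))"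

lemma c1c_mono: "c1c U f f' \<Longrightarrow> U \<subseteq> V \<Longrightarrow> c1c V f f'"
  unfolding c1c_def by (meson subset_trans)

lemma c1c_deriv: "c1c U f f' \<Longrightarrow> (f has_derivative (\<lambda>h. f' x \<bullet> h)) (at x)"
  by (auto simp: c1c_def)

lemma c1c_cont: "c1c U f f' \<Longrightarrow> continuous_on UNIV f"
  by (meson c1c_deriv has_derivative_continuous continuous_at_imp_continuous_on)

lemma c1c_cont': "c1c U f f' \<Longrightarrow> continuous_on UNIV f'"
  by (auto simp: c1c_def)

lemma c1c_support:
  assumes "c1c U f f'"
  obtains K where "compact K" "K \<subseteq> U" "\<And>x. x \<notin> K \<Longrightarrow> f x = 0" "\<And>x. x \<notin> K \<Longrightarrow> f' x = 0"
proof -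
  obtain K where K: "compact K" "K \<subseteq> U" "\<And>x. x \<notin> K \<Longrightarrow> f x = 0"
    using assms by (auto simp: c1c_def)
  have "f' x = 0" if "x \<notin> K" for x
  proof -
    have "open (- K)" using K(1) by (simp add: compact_imp_closed open_Compl)
    have "((\<lambda>_. 0) has_derivative (\<lambda>h. f' x \<bullet> h)) (at x)"
      by (rule has_derivative_transform_within_open[OF c1c_deriv[OF assms] \<open>open (- K)\<close>]) (use that K in auto)
    then have "(\<lambda>h. f' x \<bullet> h) = (\<lambda>h. 0)"
      using has_derivative_unique has_derivative_const by blast
    then have "f' x \<bullet> f' x = 0" by meson
    then show ?thesis by simp
  qed
  with K show ?thesis using that by blast
qed

lemma compact_support_uniform:
  fixes f :: "'a::euclidean_space \<Rightarrow> 'b::euclidean_space"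
  assumes "continuous_on UNIV f" "compact K" "\<And>x. x \<notin> K \<Longrightarrow> f x = 0" "0 < e"
  shows "\<exists>d>0. \<forall>x h. norm h < d \<longrightarrow> norm (f (x + h) - f x) < e"
proof -
  obtain R where R: "K \<subseteq> ball 0 R" using assms(2) bounded_subset_ballD[OF compact_imp_bounded] by blast
  have "uniformly_continuous_on (cball 0 (R+1)) f"
    by (rule compact_uniformly_continuous) (auto intro: continuous_on_subset[OF assms(1)])
  then obtain d where d: "d > 0" "\<And>x x'. x \<in> cball 0 (R+1) \<Longrightarrow> x' \<in> cball 0 (R+1) \<Longrightarrow> dist x' x < d \<Longrightarrow> dist (f x') (f x) < e"
    unfolding uniformly_continuous_on_def using assms(4) by meson
  have "norm (f (x + h) - f x) < e" if "norm h < min d 1" for x h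
  proof (cases "x \<in> cball 0 (R+1) \<and> x + h \<in> cball 0 (R+1)")
    case True
    then show ?thesis using d(2)[of x "x+h"] that by (simp add: dist_norm)
  next
    case False
    have "norm (x+h) \<le> norm x + norm h" "norm x \<le> norm (x+h) + norm h"
      using norm_triangle_ineq[of x h] norm_triangle_ineq[of "x+h" "-h"] by auto
    then have "x \<notin> ball 0 R" "x + h \<notin> ball 0 R" using False that by auto
    then have "f x = 0" "f (x+h) = 0" using assms(3) R by blast+
    then show ?thesis using assms(4) by simp
  qed
  then show ?thesis using d(1) by (intro exI[of _ "min d 1"]) auto
qed

lemma compact_support_bounded:
  fixes f :: "'a::euclidean_space \<Rightarrow> 'b::euclidean_space"
  assumes "continuous_on UNIV f" "compact K" "\<And>x. x \<notin> K \<Longrightarrow> f x = 0"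
  shows "\<exists>B>0. \<forall>x. norm (f x) \<le> B"
proof -
  have "bounded (f ` K)" by (intro compact_imp_bounded compact_continuous_image continuous_on_subset[OF assms(1)] assms(2)) auto
  then obtain B where "B > 0" "\<forall>x\<in>K. norm (f x) \<le> B" by (auto simp: bounded_pos)
  then show ?thesis using assms(3) by (metis less_imp_le norm_zero)
qed

lemma c1c_bounds:
  assumes "c1c U f f'"
  obtains B where "B > 0" "\<And>x. \<bar>f x\<bar> \<le> B" "\<And>x. norm (f' x) \<le> B"
proof -
  obtain K where K: "compact K" "K \<subseteq> U" "\<And>x. x \<notin> K \<Longrightarrow> f x = 0" "\<And>x. x \<notin> K \<Longrightarrow> f' x = 0"
    using c1c_support[OF assms] by metis
  obtain B1 B2 where "B1>0" "\<forall>x. norm (f x) \<le> B1" "B2>0" "\<forall>x. norm (f' x) \<le> B2"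
    using compact_support_bounded[OF c1c_cont[OF assms] K(1,3)] compact_support_bounded[OF c1c_cont'[OF assms] K(1,4)] by auto
  then show ?thesis by (intro that[of "max B1 B2"]) (auto simp: le_max_iff_disj)
qed

lemma c1c_lipschitz:
  assumes "c1c U f f'" "\<And>x. norm (f' x) \<le> B"
  shows "\<bar>f (x + h) - f x\<bar> \<le> B * norm h"
proof -
  have "norm (f (x + h) - f x) \<le> B * norm ((x + h) - x)"
  proof (rule differentiable_bound[of UNIV f "\<lambda>x h. f' x \<bullet> h"])
    fix y
    show "onorm ((\<bullet>) (f' y)) \<le> B"
      by (intro onorm_le) (metis Cauchy_Schwarz_ineq2 assms(2) mult_right_mono norm_ge_zero order_trans real_norm_def)
  qed (use c1c_deriv[OF assms(1)] in \<open>auto intro: has_derivative_at_withinI\<close>)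
  then show ?thesis by simp
qed

text \<open>The mean value inequality is applied to \<open>f\<close> minus its linearisation at
  \<open>x\<close>. The modulus is that of \<open>f'\<close>, which is uniform by compactness, so
  \<open>d\<close> does not depend on \<open>x\<close>; this is what allows difference quotients to
  be exchanged for derivatives under integrals over the whole space.\<close>

lemma c1c_uniform_deriv:
  assumes "c1c U f f'" "e > 0"
  shows "\<exists>d>0. \<forall>x h. norm h < d \<longrightarrow> \<bar>f (x + h) - f x - f' x \<bullet> h\<bar> \<le> e * norm h"
proof -
  obtain K where K: "compact K" "K \<subseteq> U" "\<And>x. x \<notin> K \<Longrightarrow> f x = 0" "\<And>x. x \<notin> K \<Longrightarrow> f' x = 0"
    using c1c_support[OF assms(1)] by metis
  obtain d where d: "d > 0" "\<And>x h. norm h < d \<Longrightarrow> norm (f' (x + h) - f' x) < e"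
    using compact_support_uniform[OF c1c_cont'[OF assms(1)] K(1,4) assms(2)] by auto
  have "\<bar>f (x + h) - f x - f' x \<bullet> h\<bar> \<le> e * norm h" if "norm h < d" for x h
  proof -
    have "norm ((\<lambda>y. f y - f' x \<bullet> y) (x + h) - (\<lambda>y. f y - f' x \<bullet> y) x) \<le> e * norm ((x + h) - x)"
    proof (rule differentiable_bound[of "ball x d" _ "\<lambda>y h. f' y \<bullet> h - f' x \<bullet> h"])
      fix y assume y: "y \<in> ball x d"
      show "((\<lambda>y. f y - f' x \<bullet> y) has_derivative (\<lambda>h. f' y \<bullet> h - f' x \<bullet> h)) (at y within ball x d)"
        by (intro derivative_intros has_derivative_at_withinI[OF c1c_deriv[OF assms(1)]])
      have "norm (f' y - f' x) \<le> e" using d(2)[of "y - x" x] y by (simp add: dist_norm norm_minus_commute)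
      then have "\<bar>(f' y - f' x) \<bullet> h\<bar> \<le> e * norm h" for h
        using Cauchy_Schwarz_ineq2[of "f' y - f' x" h] by (meson mult_right_mono norm_ge_zero order_trans)
      then show "onorm (\<lambda>h. f' y \<bullet> h - f' x \<bullet> h) \<le> e"
        by (intro onorm_le) (simp add: inner_diff_left)
    qed (use that d in \<open>auto simp: dist_norm\<close>)
    then show ?thesis by (simp add: inner_right_distrib algebra_simps)
  qed
  then show ?thesis using d(1) by blast
qed

lemma integrable_bounded_times_compact_support:
  fixes f :: "'a::euclidean_space \<Rightarrow> 'b::euclidean_space" and g :: "'a \<Rightarrow> real"
  assumes "continuous_on UNIV f" "compact K" "\<And>x. x \<notin> K \<Longrightarrow> f x = 0"
    "g \<in> borel_measurable borel" "\<And>x. \<bar>g x\<bar> \<le> B"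
  shows "integrable lborel (\<lambda>x. g x *\<^sub>R f x)"
proof (rule Bochner_Integration.integrable_bound)
  show "integrable lborel (\<lambda>x. B *\<^sub>R (indicator K x *\<^sub>R f x))"
    by (intro integrable_scaleR_right borel_integrable_compact assms(2) continuous_on_subset[OF assms(1)]) auto
  show "(\<lambda>x. g x *\<^sub>R f x) \<in> borel_measurable lborel"
    using assms(4) borel_measurable_continuous_onI[OF assms(1)] by measurable
  show "AE x in lborel. norm (g x *\<^sub>R f x) \<le> norm (B *\<^sub>R (indicator K x *\<^sub>R f x))"
  proof (rule AE_I2)
    fix x
    have "\<bar>g x\<bar> * norm (f x) \<le> \<bar>B\<bar> * norm (f x)"
      using assms(5)[of x] by (intro mult_right_mono) auto
    then show "norm (g x *\<^sub>R f x) \<le> norm (B *\<^sub>R (indicator K x *\<^sub>R f x))"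
      using assms(3)[of x] by (cases "x \<in> K") auto
  qed
qed

lemma integrable_compact_support:
  fixes f :: "'a::euclidean_space \<Rightarrow> 'b::euclidean_space"
  assumes "continuous_on UNIV f" "compact K" "\<And>x. x \<notin> K \<Longrightarrow> f x = 0"
  shows "integrable lborel f"
  using integrable_bounded_times_compact_support[OF assms, of "\<lambda>_. 1" 1] by simp

lemma integrable_indicator_bounded:
  fixes S :: "'a::euclidean_space set"
  assumes "bounded S" "S \<in> sets borel"
  shows "integrable lborel (indicator S :: _ \<Rightarrow> real)"
  using emeasure_bounded_finite[OF assms(1)] assms(2) by (intro integrable_real_indicator) auto

lemma lborel_integral_affine:
  fixes f :: "'a::euclidean_space \<Rightarrow> 'b::{banach, second_countable_topology}"
  assumes [measurable]: "f \<in> borel_measurable borel" and "c \<noteq> 0"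
  shows "(\<integral>x. f x \<partial>lborel) = \<bar>c\<bar> ^ DIM('a) *\<^sub>R (\<integral>x. f (t + c *\<^sub>R x) \<partial>lborel)"
  by (subst lborel_affine[OF assms(2), of t]) (subst integral_density; simp add: integral_distr)

lemma lborel_integral_translate:
  fixes f :: "'a::euclidean_space \<Rightarrow> 'b::{banach, second_countable_topology}"
  assumes "f \<in> borel_measurable borel"
  shows "(\<integral>x. f (t + x) \<partial>lborel) = (\<integral>x. f x \<partial>lborel)"
  using lborel_integral_affine[OF assms, of 1 t] by simp

lemma lborel_integral_reflect:
  fixes f :: "'a::euclidean_space \<Rightarrow> 'b::{banach, second_countable_topology}"
  assumes "f \<in> borel_measurable borel"
  shows "(\<integral>x. f (t - x) \<partial>lborel) = (\<integral>x. f x \<partial>lborel)"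
  using lborel_integral_affine[OF assms, of "-1" t] by simp

lemma integrable_lborel_reflect:
  fixes f :: "'a::euclidean_space \<Rightarrow> 'b::{banach, second_countable_topology}"
  assumes "integrable lborel f"
  shows "integrable lborel (\<lambda>x. f (t - x))"
proof -
  have [measurable]: "f \<in> borel_measurable borel" using assms by auto
  have "integrable (density (distr lborel borel (\<lambda>x. t + (-1) *\<^sub>R x)) (\<lambda>_. ennreal (\<bar>-1\<bar>^DIM('a)))) f"
    using assms lborel_affine[of "-1::real" t] by simp
  then show ?thesis by (subst (asm) integrable_density) (auto simp: integrable_distr_eq)
qed

text \<open>Both sides are limits of the same integral of difference quotients, by translation invariance.\<close>

lemma integral_c1c_deriv_commute:
  fixes a b :: "'a::euclidean_space"
  assumes f: "c1c U f f'" and g: "c1c U g g'"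
  shows "(\<integral>x. (f' x \<bullet> a) * (g' x \<bullet> b) \<partial>lborel) = (\<integral>x. (f' x \<bullet> b) * (g' x \<bullet> a) \<partial>lborel)"
proof -
  define h where "h n = 1 / real (Suc n)" for n
  have h: "0 < h n" "h n \<le> 1" "h \<longlonglongrightarrow> 0" for n
    unfolding h_def using LIMSEQ_Suc[OF lim_1_over_n] by auto
  define D where "D f c n x = (f (x + h n *\<^sub>R c) - f x) / h n" for f :: "'a \<Rightarrow> real" and c n x
  have lim: "(\<lambda>n. D f c n x) \<longlonglongrightarrow> f' x \<bullet> c" if "c1c U f f'" for f f' c x
  proof -
    have "((\<lambda>t. (f (x + t *\<^sub>R c) - f x) / t) \<longlongrightarrow> f' x \<bullet> c) (at 0)"
    proof -
      have "((\<lambda>t. f (x + t *\<^sub>R c)) has_derivative (\<lambda>t. f' (x + 0 *\<^sub>R c) \<bullet> (t *\<^sub>R c))) (at 0)"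
        by (rule has_derivative_compose[of "\<lambda>t. x + t *\<^sub>R c" "\<lambda>t. t *\<^sub>R c"])
           (auto intro!: derivative_eq_intros simp: c1c_deriv[OF that])
      then have "((\<lambda>t. f (x + t *\<^sub>R c)) has_field_derivative (f' x \<bullet> c)) (at 0)"
        by (simp add: has_field_derivative_def mult.commute[of _ "f' x \<bullet> c"] cong: if_cong)
      then show ?thesis by (simp add: has_field_derivative_iff)
    qed
    moreover have "filterlim h (at 0) sequentially"
      using h by (auto simp: filterlim_at intro!: always_eventually) (metis less_irrefl)
    ultimately show ?thesis unfolding D_def by (rule filterlim_compose)
  qed
  obtain R where R: "R > 0" "\<And>x. norm x > R \<Longrightarrow> f x = 0 \<and> g x = 0"
  proof -
    obtain K1 K2 where K: "compact K1" "\<And>x. x \<notin> K1 \<Longrightarrow> f x = 0" "compact K2" "\<And>x. x \<notin> K2 \<Longrightarrow> g x = 0"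
      using f g by (auto simp: c1c_def)
    then have "bounded (K1 \<union> K2)" by (simp add: compact_imp_bounded)
    then obtain R where "R>0" "\<forall>x\<in>K1 \<union> K2. norm x \<le> R" by (auto simp: bounded_pos)
    then show ?thesis using K by (intro that[of R]) (auto simp: not_le[symmetric])
  qed
  obtain B1 where B1: "B1 > 0" "\<And>x. norm (f' x) \<le> B1" using c1c_bounds[OF f] by metis
  obtain B2 where B2: "B2 > 0" "\<And>x. norm (g' x) \<le> B2" using c1c_bounds[OF g] by metis
  have [measurable]: "f \<in> borel_measurable borel" "g \<in> borel_measurable borel"
    using c1c_cont[OF f] c1c_cont[OF g] by (auto intro: borel_measurable_continuous_onI)
  have [measurable]: "f' \<in> borel_measurable borel" "g' \<in> borel_measurable borel"
    using c1c_cont'[OF f] c1c_cont'[OF g] by (auto intro: borel_measurable_continuous_onI)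
  have bnd: "\<bar>D f a n x\<bar> \<le> B1 * norm a" "\<bar>D g a n x\<bar> \<le> B2 * norm a" for n x a
    using c1c_lipschitz[OF f B1(2), of x "h n *\<^sub>R a"] c1c_lipschitz[OF g B2(2), of x "h n *\<^sub>R a"] h(1)[of n]
    by (simp_all add: D_def field_simps)
  have conv: "(\<lambda>n. \<integral>x. D f a n x * D g b n x \<partial>lborel) \<longlonglongrightarrow> (\<integral>x. (f' x \<bullet> a) * (g' x \<bullet> b) \<partial>lborel)" for a b
  proof (rule integral_dominated_convergence[where w = "\<lambda>x. (B1 * norm a * (B2 * norm b)) * indicator (cball 0 (R + norm a + norm b)) x"])
    show "integrable lborel (\<lambda>x. (B1 * norm a * (B2 * norm b)) * indicator (cball 0 (R + norm a + norm b)) x :: real)"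
      by (intro integrable_mult_right integrable_indicator_bounded) auto
    show "AE x in lborel. (\<lambda>n. D f a n x * D g b n x) \<longlonglongrightarrow> (f' x \<bullet> a) * (g' x \<bullet> b)"
      by (intro AE_I2 tendsto_mult lim f g)
    show "AE x in lborel. norm (D f a n x * D g b n x) \<le> (B1 * norm a * (B2 * norm b)) * indicator (cball 0 (R + norm a + norm b)) x" for n
    proof (rule AE_I2)
      fix x :: 'a
      show "norm (D f a n x * D g b n x) \<le> (B1 * norm a * (B2 * norm b)) * indicator (cball 0 (R + norm a + norm b)) x"
      proof (cases "norm x \<le> R + norm a + norm b")
        case True
        then show ?thesis using mult_mono[OF bnd(1)[of a n x] bnd(2)[of b n x]] B1 by (simp add: abs_mult)
      next
        case False
        have "norm (h n *\<^sub>R a) \<le> norm a" using h(1,2)[of n] by (simp add: mult_left_le_one_le)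
        moreover have "norm x \<le> norm (x + h n *\<^sub>R a) + norm (h n *\<^sub>R a)"
          using norm_triangle_ineq[of "x + h n *\<^sub>R a" "- (h n *\<^sub>R a)"] by simp
        ultimately have "norm (x + h n *\<^sub>R a) > R" "norm x > R" using False norm_ge_zero[of a] norm_ge_zero[of b] by linarith+
        then have "f (x + h n *\<^sub>R a) = 0" "f x = 0" using R(2) by auto
        then show ?thesis using B1 B2 by (simp add: D_def)
      qed
    qed
  qed (auto simp: D_def)
  have int: "integrable lborel (\<lambda>x. f (x + u) * g (x + v))" for u v
  proof -
    have "continuous_on UNIV (\<lambda>x. f (x + u) * g (x + v))"
      by (intro continuous_intros continuous_on_compose2[OF c1c_cont[OF f]] continuous_on_compose2[OF c1c_cont[OF g]]) auto
    moreover have "f (x + u) * g (x + v) = 0" if "x \<notin> cball 0 (R + norm u)" for x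
      using R(2)[of "x+u"] that norm_triangle_ineq[of "x + u" "-u"] by auto
    ultimately show ?thesis by (intro integrable_compact_support[of _ "cball 0 (R + norm u)"]) auto
  qed
  have "(\<integral>x. D f a n x * D g b n x \<partial>lborel) = (\<integral>x. D f (- b) n x * D g (- a) n x \<partial>lborel)" for n
  proof -
    \<comment> \<open>By translation invariance the integral of a product of two translates depends
      only on the difference of the shifts. Expanding the difference quotients in terms of
      \<open>P\<close> gives an expression that is unchanged when \<open>(a, b)\<close> is replaced
      by \<open>(- b, - a)\<close>; in the limit the two signs cancel and the directions have
      changed places.\<close>
    define P where "P c = (\<integral>x. f x * g (x + c) \<partial>lborel)" for c
    have P: "(\<integral>x. f (x + u) * g (x + v) \<partial>lborel) = P (v - u)" for u v
      unfolding P_def using lborel_integral_translate[of "\<lambda>x. f x * g (x + (v - u))" u]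
      by (simp add: algebra_simps)
    have 1: "(\<integral>x. D f a n x * D g b n x \<partial>lborel) = (P (h n *\<^sub>R b - h n *\<^sub>R a) - P (- h n *\<^sub>R a) - P (h n *\<^sub>R b) + P 0) / (h n)^2" for a b
    proof -
      let ?a = "h n *\<^sub>R a" and ?b = "h n *\<^sub>R b"
      have "(\<integral>x. D f a n x * D g b n x \<partial>lborel) = (\<integral>x. (f (x + ?a) * g (x + ?b) - f (x + ?a) * g (x+0) - f (x+0) * g (x + ?b) + f (x+0) * g (x+0)) / (h n)^2 \<partial>lborel)"
        by (simp add: D_def algebra_simps power2_eq_square diff_divide_distrib add_divide_distrib)
      also have "\<dots> = (P (?b - ?a) - P (0 - ?a) - P (?b - 0) + P (0-0)) / (h n)^2"
        unfolding integral_divide_zero P[symmetric]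
        by (simp only: Bochner_Integration.integral_add Bochner_Integration.integral_diff int Bochner_Integration.integrable_add Bochner_Integration.integrable_diff)
      finally show ?thesis by simp
    qed
    show ?thesis
      unfolding 1[of a b] 1[of "- b" "- a"] by (simp add: algebra_simps)
  qed
  then show ?thesis using conv[of a b] conv[of "- b" "- a"] LIMSEQ_unique by auto
qed

text \<open>A difference quotient has integral zero by translation invariance, and for short steps
  it is uniformly close to the directional derivative, with both supported in the common ball
  \<open>S\<close>.\<close>

lemma integral_c1c_deriv_eq_0:
  fixes e :: "'a::euclidean_space"
  assumes f: "c1c U f f'"
  shows "(\<integral>x. f' x \<bullet> e \<partial>lborel) = 0"
proof -
  obtain K where K: "compact K" "K \<subseteq> U" "\<And>x. x \<notin> K \<Longrightarrow> f x = 0" "\<And>x. x \<notin> K \<Longrightarrow> f' x = 0"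
    using c1c_support[OF f] by metis
  obtain R where R: "R > 0" "K \<subseteq> ball 0 R"
    using bounded_subset_ballD[OF compact_imp_bounded[OF K(1)], of 0] by auto
  define S where "S = cball (0::'a) (R + norm e)"
  have zero: "f x = 0" "f' x = 0" "f (x + t *\<^sub>R e) = 0" if "x \<notin> S" "\<bar>t\<bar> \<le> 1" for x t
  proof -
    have "norm (t *\<^sub>R e) \<le> norm e" using that(2) by (simp add: mult_left_le_one_le)
    moreover have "norm x \<le> norm (x + t *\<^sub>R e) + norm (t *\<^sub>R e)"
      using norm_triangle_ineq[of "x + t *\<^sub>R e" "- (t *\<^sub>R e)"] by simp
    moreover have "norm x > R + norm e" using that(1) by (simp add: S_def)
    ultimately have "norm x \<ge> R" "norm (x + t *\<^sub>R e) \<ge> R"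
      using norm_ge_zero[of e] by linarith+
    then have "x \<notin> ball 0 R" "x + t *\<^sub>R e \<notin> ball 0 R" by auto
    then show "f x = 0" "f' x = 0" "f (x + t *\<^sub>R e) = 0" using K R by blast+
  qed
  have int: "integrable lborel f" "integrable lborel (\<lambda>x. f' x \<bullet> e)"
    using integrable_compact_support[OF c1c_cont[OF f] K(1,3)] integrable_compact_support[OF c1c_cont'[OF f] K(1,4)] by auto
  have [measurable]: "f \<in> borel_measurable borel" using c1c_cont[OF f] by (rule borel_measurable_continuous_onI)
  have S: "integrable lborel (indicator S :: 'a \<Rightarrow> real)"
    unfolding S_def by (intro integrable_indicator_bounded) auto
  have "\<bar>\<integral>x. f' x \<bullet> e \<partial>lborel\<bar> \<le> \<epsilon> * (norm e * measure lborel S)" if eps: "\<epsilon> > 0" for \<epsilon>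
  proof -
    obtain d where d: "d > 0" "\<And>x h. norm h < d \<Longrightarrow> \<bar>f (x + h) - f x - f' x \<bullet> h\<bar> \<le> \<epsilon> * norm h"
      using c1c_uniform_deriv[OF f eps] by auto
    define t where "t = min 1 (d / (2 * (norm e + 1)))"
    have t: "0 < t" "t \<le> 1" "norm (t *\<^sub>R e) < d"
    proof -
      show "0 < t" "t \<le> 1" using d(1) by (auto simp: t_def add_nonneg_pos)
      have "t * norm e \<le> d / (2 * (norm e + 1)) * norm e" by (intro mult_right_mono) (auto simp: t_def)
      also have "\<dots> < d"
      proof -
        have p1: "2 * (norm e + 1) > 0" by (simp add: add_nonneg_pos)
        have p2: "norm e < 2 * (norm e + 1)" by (smt (verit) norm_ge_zero)
        have "d * norm e < d * (2 * (norm e + 1))" by (rule mult_strict_left_mono[OF p2 d(1)])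
        then show ?thesis using p1 by (simp only: times_divide_eq_left pos_divide_less_eq)
      qed
      finally show "norm (t *\<^sub>R e) < d" using \<open>0 < t\<close> by simp
    qed
    have int2: "integrable lborel (\<lambda>x. f (t *\<^sub>R e + x))"
      using integrable_lborel_reflect[OF integrable_lborel_reflect[OF int(1), of 0], of "- (t *\<^sub>R e)"] by (simp add: add.commute)
    have "(\<integral>x. f' x \<bullet> e \<partial>lborel) = (\<integral>x. f' x \<bullet> e - (f (t *\<^sub>R e + x) - f x) / t \<partial>lborel)"
      using int int2 lborel_integral_translate[of f "t *\<^sub>R e"] by simp
    also have "\<bar>\<dots>\<bar> \<le> (\<integral>x. \<epsilon> * norm e * indicator S x \<partial>lborel)"
    proof (rule integral_abs_bound[THEN order_trans], rule integral_mono)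
      show "integrable lborel (\<lambda>x. \<bar>f' x \<bullet> e - (f (t *\<^sub>R e + x) - f x) / t\<bar>)" using int int2 by simp
      show "integrable lborel (\<lambda>x. \<epsilon> * norm e * indicator S x)" using S by (intro integrable_mult_right)
      fix x
      have *: "\<bar>f (x + t *\<^sub>R e) - f x - f' x \<bullet> (t *\<^sub>R e)\<bar> \<le> \<epsilon> * norm (t *\<^sub>R e)" by (rule d(2)) (rule t)
      have "f' x \<bullet> e - (f (t *\<^sub>R e + x) - f x) / t = - (f (x + t *\<^sub>R e) - f x - f' x \<bullet> (t *\<^sub>R e)) / t"
        using t(1) by (simp add: field_simps)
      also have "\<bar>\<dots>\<bar> \<le> \<epsilon> * norm e" using * t(1) by (simp add: field_simps)
      finally have "\<bar>f' x \<bullet> e - (f (t *\<^sub>R e + x) - f x) / t\<bar> \<le> \<epsilon> * norm e" .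
      then show "\<bar>f' x \<bullet> e - (f (t *\<^sub>R e + x) - f x) / t\<bar> \<le> \<epsilon> * norm e * indicator S x"
        using zero[of x t] t by (cases "x \<in> S") (auto simp: add.commute)
    qed
    also have "\<dots> = \<epsilon> * (norm e * measure lborel S)" by simp
    finally show ?thesis .
  qed
  then have "\<bar>\<integral>x. f' x \<bullet> e \<partial>lborel\<bar> \<le> 0 + \<epsilon>" if "\<epsilon> > 0" for \<epsilon>
  proof -
    define c where "c = norm e * measure lborel S"
    have c: "c \<ge> 0" by (simp add: c_def)
    have "\<bar>\<integral>x. f' x \<bullet> e \<partial>lborel\<bar> \<le> (\<epsilon> / (c + 1)) * c"
      unfolding c_def[symmetric] using \<open>\<And>\<epsilon>. 0 < \<epsilon> \<Longrightarrow> _ \<epsilon>\<close>[of "\<epsilon> / (c+1)"] c that by (simp add: c_def add_nonneg_pos)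
    also have "\<dots> \<le> \<epsilon>" using c that by (simp add: field_simps)
    finally show ?thesis by simp
  qed
  then show ?thesis using field_le_epsilon[of "\<bar>\<integral>x. f' x \<bullet> e \<partial>lborel\<bar>" 0] by simp
qed

section \<open>Convolution of an integrable weight with a C1 function\<close>

definition conv :: "('a::euclidean_space \<Rightarrow> real) \<Rightarrow> ('a \<Rightarrow> 'b::euclidean_space) \<Rightarrow> 'a \<Rightarrow> 'b" where
  "conv w f x = (\<integral>y. w y *\<^sub>R f (x - y) \<partial>lborel)"

lemma integrable_conv:
  fixes f :: "'a::euclidean_space \<Rightarrow> 'b::euclidean_space"
  assumes "integrable lborel w" "f \<in> borel_measurable borel" "\<And>x. norm (f x) \<le> B"
  shows "integrable lborel (\<lambda>y. w y *\<^sub>R f (x - y))"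
proof (rule Bochner_Integration.integrable_bound)
  show "integrable lborel (\<lambda>y. B * w y)" using assms(1) by simp
  show "(\<lambda>y. w y *\<^sub>R f (x - y)) \<in> borel_measurable lborel"
    using assms(1,2) by measurable
  have "0 \<le> B" using assms(3) norm_ge_zero order_trans by blast
  then have "\<bar>w y\<bar> * norm (f (x - y)) \<le> \<bar>w y\<bar> * \<bar>B\<bar>" for y
    using assms(3)[of "x - y"] by (intro mult_left_mono) auto
  then show "AE y in lborel. norm (w y *\<^sub>R f (x - y)) \<le> norm (B * w y)"
    by (simp add: abs_mult mult.commute)
qed

lemma norm_conv_le:
  fixes f :: "'a::euclidean_space \<Rightarrow> 'b::euclidean_space"
  assumes "integrable lborel w" "f \<in> borel_measurable borel" "\<And>x. norm (f x) \<le> B"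
  shows "norm (conv w f x) \<le> (\<integral>y. \<bar>w y\<bar> \<partial>lborel) * B"
proof -
  have "norm (conv w f x) \<le> (\<integral>y. norm (w y *\<^sub>R f (x - y)) \<partial>lborel)"
    unfolding conv_def by (rule integral_norm_bound)
  also have "\<dots> \<le> (\<integral>y. \<bar>w y\<bar> * B \<partial>lborel)"
    using assms(3) by (intro integral_mono integrable_norm integrable_conv[OF assms] integrable_mult_left)
      (auto simp: assms(1) intro: mult_left_mono)
  finally show ?thesis by simp
qed

lemma conv_zero:
  assumes "\<And>y. y \<notin> L \<Longrightarrow> w y = 0" "\<And>z. z \<notin> K \<Longrightarrow> f z = 0" "x \<notin> {y + z |y z. y \<in> L \<and> z \<in> K}"
  shows "conv w f x = 0"
proof -
  have "w y *\<^sub>R f (x - y) = 0" for y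
  proof -
    have "y \<notin> L \<or> x - y \<notin> K"
    proof (rule ccontr)
      assume "\<not> ?thesis"
      then have "x = y + (x - y)" "y \<in> L" "x - y \<in> K" by auto
      then show False using assms(3) by blast
    qed
    then show ?thesis using assms(1,2) by auto
  qed
  then have "(\<lambda>y. w y *\<^sub>R f (x - y)) = (\<lambda>y. 0)" by blast
  then show ?thesis by (simp add: conv_def)
qed

lemma conv_continuous:
  fixes f :: "'a::euclidean_space \<Rightarrow> 'b::euclidean_space"
  assumes w: "integrable lborel w" and f: "continuous_on UNIV f" "compact K" "\<And>x. x \<notin> K \<Longrightarrow> f x = 0"
  shows "continuous_on UNIV (conv w f)"
proof -
  have [measurable]: "f \<in> borel_measurable borel" using f(1) by (rule borel_measurable_continuous_onI)
  obtain B where B: "\<And>x. norm (f x) \<le> B" using compact_support_bounded[OF f] by auto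
  define c where "c = (\<integral>y. \<bar>w y\<bar> \<partial>lborel)"
  have c: "c \<ge> 0" by (simp add: c_def)
  show ?thesis
  proof (clarsimp simp: continuous_on_iff dist_norm)
    fix x :: 'a and e :: real assume e: "e > 0"
    then have e': "e / (c+1) > 0" using c by simp
    obtain d where d: "d > 0" "\<And>x h. norm h < d \<Longrightarrow> norm (f (x + h) - f x) < e / (c+1)"
      using compact_support_uniform[OF f e'] by blast
    show "\<exists>d>0. \<forall>x'. norm (x' - x) < d \<longrightarrow> norm (conv w f x' - conv w f x) < e"
    proof (intro exI conjI allI impI)
      fix x' assume x': "norm (x' - x) < d"
      have "conv w f x' - conv w f x = (\<integral>y. w y *\<^sub>R (f (x' - y) - f (x - y)) \<partial>lborel)"
        unfolding conv_def by (subst Bochner_Integration.integral_diff[symmetric])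
          (auto intro!: integrable_conv[OF w _ B] simp: scaleR_diff_right)
      also have "norm \<dots> \<le> (\<integral>y. norm (w y *\<^sub>R (f (x' - y) - f (x - y))) \<partial>lborel)" by (rule integral_norm_bound)
      also have "\<dots> \<le> (\<integral>y. \<bar>w y\<bar> * (e / (c+1)) \<partial>lborel)"
      proof (intro integral_mono integrable_norm)
        show "integrable lborel (\<lambda>y. w y *\<^sub>R (f (x' - y) - f (x - y)))"
          unfolding scaleR_diff_right by (intro Bochner_Integration.integrable_diff integrable_conv[OF w _ B]) auto
        show "integrable lborel (\<lambda>y. \<bar>w y\<bar> * (e / (c+1)))" using w by (intro integrable_mult_left) auto
        fix y
        show "norm (w y *\<^sub>R (f (x' - y) - f (x - y))) \<le> \<bar>w y\<bar> * (e / (c+1))"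
        proof -
          have "norm (f (x' - y) - f (x - y)) \<le> e / (c+1)" using d(2)[OF x', of "x - y"] by (simp add: algebra_simps)
          then show ?thesis unfolding norm_scaleR by (intro mult_left_mono) auto
        qed
      qed
      also have "\<dots> = c * (e / (c+1))" by (simp add: c_def)
      also have "\<dots> < e" using c e by (simp add: field_simps)
      finally show "norm (conv w f x' - conv w f x) < e" .
    qed (rule d)
  qed
qed

text \<open>All derivatives fall on \<open>f\<close>, so the weight \<open>w\<close> only has to be
  integrable. This covers both uses: \<open>w\<close> is a mollifier when test functions are made,
  and the indicator of a measurable set when potentials are made. The error of linearisation is
  uniform by \<open>c1c_uniform_deriv\<close> and is integrated against
  \<open>\<bar>w\<bar>\<close>.\<close>

lemma conv_c1c:
  assumes w: "integrable lborel w" "compact L" "\<And>y. y \<notin> L \<Longrightarrow> w y = 0"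
    and f: "c1c UNIV f f'" and K: "compact K" "\<And>x. x \<notin> K \<Longrightarrow> f x = 0"
    and U: "\<And>y z. y \<in> L \<Longrightarrow> z \<in> K \<Longrightarrow> y + z \<in> U"
  shows "c1c U (conv w f) (conv w f')"
  unfolding c1c_def
proof (intro conjI exI allI)
  obtain K' where K': "compact K'" "\<And>x. x \<notin> K' \<Longrightarrow> f' x = 0" using c1c_support[OF f] by metis
  show "continuous_on UNIV (conv w f')" by (rule conv_continuous[OF w(1) c1c_cont'[OF f] K'])
  show "compact {y + z |y z. y \<in> L \<and> z \<in> K}" using compact_sums[OF w(2) K(1)] by simp
  show "{y + z |y z. y \<in> L \<and> z \<in> K} \<subseteq> U" using U by auto
  show "x \<notin> {y + z |y z. y \<in> L \<and> z \<in> K} \<longrightarrow> conv w f x = 0" for x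
    using conv_zero[of L w K f x, OF w(3) K(2)] by auto
  fix x
  obtain B where B: "\<And>x. \<bar>f x\<bar> \<le> B" "\<And>x. norm (f' x) \<le> B" using c1c_bounds[OF f] by metis
  have [measurable]: "f \<in> borel_measurable borel" using c1c_cont[OF f] by (rule borel_measurable_continuous_onI)
  have [measurable]: "f' \<in> borel_measurable borel" using c1c_cont'[OF f] by (rule borel_measurable_continuous_onI)
  have i1: "integrable lborel (\<lambda>y. w y *\<^sub>R f (x - y))" for x using B by (intro integrable_conv[OF w(1)]) auto
  have i2: "integrable lborel (\<lambda>y. w y *\<^sub>R f' (x - y))" for x using B by (intro integrable_conv[OF w(1)]) auto
  define c where "c = (\<integral>y. \<bar>w y\<bar> \<partial>lborel)"
  have c: "c \<ge> 0" by (simp add: c_def)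
  show "(conv w f has_derivative (\<bullet>) (conv w f' x)) (at x)"
    unfolding has_derivative_at_alt
  proof (intro conjI allI impI)
    show "bounded_linear ((\<bullet>) (conv w f' x))" by (rule bounded_linear_inner_right)
    fix e :: real assume e: "e > 0"
    then have e': "e / (c+1) > 0" using c by simp
    obtain d where d: "d > 0" "\<And>x h. norm h < d \<Longrightarrow> \<bar>f (x + h) - f x - f' x \<bullet> h\<bar> \<le> e / (c+1) * norm h"
      using c1c_uniform_deriv[OF f e'] by blast
    show "\<exists>d>0. \<forall>y. norm (y - x) < d \<longrightarrow> norm (conv w f y - conv w f x - conv w f' x \<bullet> (y - x)) \<le> e * norm (y - x)"
    proof (intro exI conjI allI impI)
      fix x' assume x': "norm (x' - x) < d"
      have i3: "integrable lborel (\<lambda>y. (w y *\<^sub>R f' (x - y)) \<bullet> (x' - x))"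
        by (rule integrable_inner_left) (rule i2)
      have eq: "conv w f x' - conv w f x - conv w f' x \<bullet> (x' - x)
          = (\<integral>y. w y *\<^sub>R f (x' - y) - w y *\<^sub>R f (x - y) - (w y *\<^sub>R f' (x - y)) \<bullet> (x' - x) \<partial>lborel)"
      proof -
        have "(\<integral>y. w y *\<^sub>R f (x' - y) - w y *\<^sub>R f (x - y) - (w y *\<^sub>R f' (x - y)) \<bullet> (x' - x) \<partial>lborel)
          = (\<integral>y. w y *\<^sub>R f (x' - y) \<partial>lborel) - (\<integral>y. w y *\<^sub>R f (x - y) \<partial>lborel)
            - (\<integral>y. (w y *\<^sub>R f' (x - y)) \<bullet> (x' - x) \<partial>lborel)"
          using i1 i3 by (simp only: Bochner_Integration.integral_diff Bochner_Integration.integrable_diff)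
        also have "(\<integral>y. (w y *\<^sub>R f' (x - y)) \<bullet> (x' - x) \<partial>lborel) = (\<integral>y. w y *\<^sub>R f' (x - y) \<partial>lborel) \<bullet> (x' - x)"
          by (rule integral_inner_left) (rule i2)
        finally show ?thesis by (simp add: conv_def)
      qed
      have "\<bar>conv w f x' - conv w f x - conv w f' x \<bullet> (x' - x)\<bar> \<le> (\<integral>y. \<bar>w y *\<^sub>R f (x' - y) - w y *\<^sub>R f (x - y) - (w y *\<^sub>R f' (x - y)) \<bullet> (x' - x)\<bar> \<partial>lborel)"
        unfolding eq by (rule integral_abs_bound)
      also have "\<dots> \<le> (\<integral>y. \<bar>w y\<bar> * (e / (c+1) * norm (x' - x)) \<partial>lborel)"
      proof (rule integral_mono)
        show "integrable lborel (\<lambda>y. \<bar>w y *\<^sub>R f (x' - y) - w y *\<^sub>R f (x - y) - (w y *\<^sub>R f' (x - y)) \<bullet> (x' - x)\<bar>)"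
          by (rule integrable_abs[OF Bochner_Integration.integrable_diff[OF Bochner_Integration.integrable_diff[OF i1 i1] i3]])
        show "integrable lborel (\<lambda>y. \<bar>w y\<bar> * (e / (c+1) * norm (x' - x)))" using w(1) by (intro integrable_mult_left) auto
        fix y
        have "\<bar>w y *\<^sub>R f (x' - y) - w y *\<^sub>R f (x - y) - (w y *\<^sub>R f' (x - y)) \<bullet> (x' - x)\<bar>
          = \<bar>w y\<bar> * \<bar>f (x' - y) - f (x - y) - f' (x - y) \<bullet> (x' - x)\<bar>"
          unfolding abs_mult[symmetric] by (simp add: algebra_simps)
        also have "\<dots> \<le> \<bar>w y\<bar> * (e / (c+1) * norm (x' - x))"
          using d(2)[OF x', of "x - y"] by (intro mult_left_mono) (auto simp: algebra_simps)
        finally show "\<bar>w y *\<^sub>R f (x' - y) - w y *\<^sub>R f (x - y) - (w y *\<^sub>R f' (x - y)) \<bullet> (x' - x)\<bar> \<le> \<bar>w y\<bar> * (e / (c+1) * norm (x' - x))" .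
      qed
      also have "\<dots> = c / (c+1) * (e * norm (x' - x))" by (simp add: c_def)
      also have "\<dots> \<le> 1 * (e * norm (x' - x))" using c e by (intro mult_right_mono) auto
      finally show "norm (conv w f x' - conv w f x - conv w f' x \<bullet> (x' - x)) \<le> e * norm (x' - x)" by simp
    qed (rule d)
  qed
qed

section \<open>Smooth test functions and mollification\<close>

lemma grad_eqI:
  assumes "(f has_derivative (\<lambda>h. D \<bullet> h)) (at x)"
  shows "grad f x = D"
  unfolding grad_def
proof (rule the_equality)
  show "GDERIV f x :> D" using assms by (simp add: gderiv_def inner_commute)
  fix E assume "GDERIV f x :> E"
  then have "(f has_derivative (\<lambda>h. h \<bullet> E)) (at x)" by (simp add: gderiv_def)
  with assms have "(\<lambda>h. D \<bullet> h) = (\<lambda>h. h \<bullet> E)" using has_derivative_unique by blast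
  then have "D \<bullet> (D - E) = (D - E) \<bullet> E" by meson
  then have "(D - E) \<bullet> (D - E) = 0" by (simp add: inner_diff_left inner_diff_right inner_commute)
  then show "E = D" by simp
qed

lemma differentiable_has_grad:
  fixes f :: "'a::euclidean_space \<Rightarrow> real"
  assumes "f differentiable (at x)"
  shows "(f has_derivative (\<lambda>h. grad f x \<bullet> h)) (at x)"
proof -
  obtain D where D: "(f has_derivative D) (at x)" using assms by (auto simp: differentiable_def)
  then interpret linear D by (rule has_derivative_linear)
  have "D h = (\<Sum>b\<in>Basis. D b *\<^sub>R b) \<bullet> h" for h
  proof -
    have "D h = D (\<Sum>b\<in>Basis. (h \<bullet> b) *\<^sub>R b)" by (simp add: euclidean_representation)
    also have "\<dots> = (\<Sum>b\<in>Basis. (h \<bullet> b) * D b)" by (simp add: sum scale)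
    also have "\<dots> = (\<Sum>b\<in>Basis. D b * (b \<bullet> h))" by (simp add: inner_commute mult.commute)
    also have "\<dots> = (\<Sum>b\<in>Basis. D b *\<^sub>R b) \<bullet> h" by (simp add: inner_sum_left)
    finally show ?thesis .
  qed
  then have "D = (\<lambda>h. (\<Sum>b\<in>Basis. D b *\<^sub>R b) \<bullet> h)" by blast
  with D have d: "(f has_derivative (\<lambda>h. (\<Sum>b\<in>Basis. D b *\<^sub>R b) \<bullet> h)) (at x)" by metis
  show ?thesis unfolding grad_eqI[OF d] by (rule d)
qed

lemma Ck_SucI:
  assumes "\<And>x. (f has_derivative (\<lambda>h. f' x \<bullet> h)) (at x)" "\<And>b. b \<in> Basis \<Longrightarrow> Ck_function k (\<lambda>x. f' x \<bullet> b)"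
  shows "Ck_function (Suc k) f"
proof -
  have "grad f = f'" using grad_eqI[OF assms(1)] by blast
  then show ?thesis using assms by (auto simp: differentiable_def)
qed

lemma Ck_SucD:
  assumes "Ck_function (Suc k) f"
  shows "(f has_derivative (\<lambda>h. grad f x \<bullet> h)) (at x)" "b \<in> Basis \<Longrightarrow> Ck_function k (\<lambda>x. grad f x \<bullet> b)"
  using assms by (auto intro: differentiable_has_grad)

lemma Ck_imp_continuous: "Ck_function k f \<Longrightarrow> continuous_on UNIV f"
  by (cases k) (auto intro!: differentiable_imp_continuous_on simp: differentiable_on_def)

lemma Ck_Suc_imp_Ck: "Ck_function (Suc k) f \<Longrightarrow> Ck_function k f"
proof (induction k arbitrary: f)
  case 0
  then show ?case using Ck_imp_continuous[OF 0] by simp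
next
  case (Suc k)
  show ?case by (rule Ck_SucI[OF Ck_SucD(1)[OF Suc.prems]]) (intro Suc.IH Ck_SucD(2)[OF Suc.prems])
qed

lemma Ck_const [simp]: "Ck_function k (\<lambda>x. c)"
proof (induction k arbitrary: c)
  case (Suc k)
  show ?case by (rule Ck_SucI[where f' = "\<lambda>_. 0"]) (use Suc in auto)
qed simp

lemma Ck_inner: "Ck_function k (\<lambda>x. x \<bullet> c)"
proof (cases k)
  case (Suc j)
  show ?thesis unfolding Suc
    by (rule Ck_SucI[where f' = "\<lambda>_. c"]) (auto intro!: derivative_eq_intros simp: inner_commute)
qed (auto intro!: continuous_intros)

lemma Ck_add: "Ck_function k f \<Longrightarrow> Ck_function k g \<Longrightarrow> Ck_function k (\<lambda>x. f x + g x)"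
proof (induction k arbitrary: f g)
  case (Suc k)
  show ?case
  proof (rule Ck_SucI[where f' = "\<lambda>x. grad f x + grad g x"])
    show "((\<lambda>x. f x + g x) has_derivative (\<lambda>h. (grad f x + grad g x) \<bullet> h)) (at x)" for x
      by (auto intro!: derivative_eq_intros Ck_SucD(1)[OF Suc.prems(1)] Ck_SucD(1)[OF Suc.prems(2)] simp: inner_add_left)
  qed (simp add: inner_add_left Suc.IH Ck_SucD(2)[OF Suc.prems(1)] Ck_SucD(2)[OF Suc.prems(2)])
qed (auto intro!: continuous_intros)

lemma Ck_mult: "Ck_function k f \<Longrightarrow> Ck_function k g \<Longrightarrow> Ck_function k (\<lambda>x. f x * g x)"
proof (induction k arbitrary: f g)
  case (Suc k)
  show ?case
  proof (rule Ck_SucI[where f' = "\<lambda>x. f x *\<^sub>R grad g x + g x *\<^sub>R grad f x"])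
    show "((\<lambda>x. f x * g x) has_derivative (\<lambda>h. (f x *\<^sub>R grad g x + g x *\<^sub>R grad f x) \<bullet> h)) (at x)" for x
      by (auto intro!: derivative_eq_intros Ck_SucD(1)[OF Suc.prems(1)] Ck_SucD(1)[OF Suc.prems(2)] simp: inner_add_left algebra_simps)
    fix b :: 'a assume b: "b \<in> Basis"
    show "Ck_function k (\<lambda>x. (f x *\<^sub>R grad g x + g x *\<^sub>R grad f x) \<bullet> b)"
      unfolding inner_add_left inner_scaleR_left
      by (intro Ck_add Suc.IH Ck_Suc_imp_Ck[OF Suc.prems(1)] Ck_Suc_imp_Ck[OF Suc.prems(2)] Ck_SucD(2)[OF Suc.prems(1) b] Ck_SucD(2)[OF Suc.prems(2) b])
  qed
qed (auto intro!: continuous_intros)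

text \<open>The factors \<open>inverse t ^ n\<close> are there to make the family closed under
  differentiation: the derivative of member \<open>n\<close> combines members \<open>n + 2\<close>
  and \<open>n + 1\<close>. Smoothness then becomes an induction inside one family.\<close>

definition flat :: "nat \<Rightarrow> real \<Rightarrow> real" where
  "flat n t = (if t > 0 then exp (- inverse t) * inverse t ^ n else 0)"

lemma flat_nonneg: "0 \<le> flat n t"
  by (simp add: flat_def)

lemma flat_tendsto_0: "(flat n \<longlongrightarrow> 0) (at 0)"
proof (rule filterlim_split_at)
  show "(flat n \<longlongrightarrow> 0) (at_left 0)"
    by (rule tendsto_eventually) (auto simp: flat_def eventually_at_left[of "-1"] intro!: exI[of _ "-1"])
  have "((\<lambda>s::real. s ^ n / exp s) \<longlongrightarrow> 0) at_top" by (rule tendsto_power_div_exp_0)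
  then have "((\<lambda>t. inverse t ^ n / exp (inverse t)) \<longlongrightarrow> (0::real)) (at_right 0)"
    by (rule filterlim_compose) (rule filterlim_inverse_at_top_right)
  moreover have "\<forall>\<^sub>F t in at_right 0. inverse t ^ n / exp (inverse t) = flat n t"
    by (auto simp: flat_def eventually_at_right[of _ 1] exp_minus field_simps intro!: exI[of _ 1])
  ultimately show "(flat n \<longlongrightarrow> 0) (at_right 0)" by (rule Lim_transform_eventually)
qed

lemma DERIV_flat: "(flat n has_real_derivative flat (n + 2) t - real n * flat (n + 1) t) (at t)"
proof -
  consider "t > 0" | "t < 0" | "t = 0" by linarith
  then show ?thesis
  proof cases
    case 1
    have "((\<lambda>t. exp (- inverse t) * inverse t ^ n) has_real_derivative flat (n + 2) t - real n * flat (n + 1) t) (at t)"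
    proof -
      have i: "(inverse has_real_derivative - (inverse t ^ 2)) (at t)"
        using DERIV_inverse[of t] 1 by (simp add: numeral_2_eq_2)
      have "((\<lambda>t. exp (- inverse t) * inverse t ^ n) has_real_derivative
          exp (- inverse t) * (- (- (inverse t ^ 2))) * inverse t ^ n
          + (real n * (- (inverse t ^ 2) * inverse t ^ (n - Suc 0))) * exp (- inverse t)) (at t)"
        by (rule DERIV_mult[OF DERIV_fun_exp[OF DERIV_minus[OF i]] DERIV_power[OF i]])
      moreover have "exp (- inverse t) * (- (- (inverse t ^ 2))) * inverse t ^ n
          + (real n * (- (inverse t ^ 2) * inverse t ^ (n - Suc 0))) * exp (- inverse t)
          = flat (n + 2) t - real n * flat (n + 1) t"
        using 1 by (cases n) (auto simp: flat_def power2_eq_square algebra_simps)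
      ultimately show ?thesis by simp
    qed
    then show ?thesis
      by (rule has_field_derivative_transform_within_open[where S = "{0<..}"]) (use 1 in \<open>auto simp: flat_def\<close>)
  next
    case 2
    have "((\<lambda>t. 0) has_real_derivative flat (n + 2) t - real n * flat (n + 1) t) (at t)"
      using 2 by (simp add: flat_def)
    then show ?thesis
      by (rule has_field_derivative_transform_within_open[where S = "{..<0}"]) (use 2 in \<open>auto simp: flat_def\<close>)
  next
    case 3
    \<comment> \<open>The difference quotient at 0 is itself the next member of the family, which
      tends to 0.\<close>
    have "\<forall>\<^sub>F y in at 0. flat (n + 1) y = (flat n y - flat n 0) / (y - 0)"
      by (auto simp: flat_def eventually_at_filter field_simps)
    from Lim_transform_eventually[OF flat_tendsto_0 this] show ?thesis
      by (simp add: 3 has_field_derivative_iff flat_def)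
  qed
qed

text \<open>The gradient is \<open>x\<close> times a combination of bumps with shifted
  \<open>n\<close>, so the induction on the order of differentiability has to range over all
  \<open>n\<close> at once.\<close>

lemma Ck_bump:
  fixes c :: real
  shows "Ck_function k (\<lambda>x::'a::euclidean_space. flat n (1 - c * (x \<bullet> x)))"
proof (induction k arbitrary: n)
  case 0
  have "continuous_on UNIV (flat n)"
    using DERIV_flat DERIV_isCont continuous_at_imp_continuous_on by blast
  then have "continuous_on UNIV (\<lambda>x::'a. flat n (1 - c * (x \<bullet> x)))"
    by (rule continuous_on_compose2) (auto intro!: continuous_intros)
  then show ?case by simp
next
  case (Suc k)
  show ?case
  proof (rule Ck_SucI[where f' = "\<lambda>x. ((flat (n + 2) (1 - c * (x \<bullet> x)) + (- real n) * flat (n + 1) (1 - c * (x \<bullet> x))) * (- 2 * c)) *\<^sub>R x"])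
    show "((\<lambda>x. flat n (1 - c * (x \<bullet> x))) has_derivative
       (\<lambda>h. (((flat (n + 2) (1 - c * (x \<bullet> x)) + (- real n) * flat (n + 1) (1 - c * (x \<bullet> x))) * (- 2 * c)) *\<^sub>R x) \<bullet> h)) (at x)" for x :: 'a
    proof -
      have "((\<lambda>x. 1 - c * (x \<bullet> x)) has_derivative (\<lambda>h. - 2 * c * (x \<bullet> h))) (at x)"
        by (auto intro!: derivative_eq_intros simp: inner_commute algebra_simps)
      from DERIV_compose_FDERIV[OF DERIV_flat[of n "1 - c * (x \<bullet> x)"] this]
      show ?thesis by (rule has_derivative_eq_rhs) (simp add: fun_eq_iff mult_ac)
    qed
    fix b :: 'a assume b: "b \<in> Basis"
    show "Ck_function k (\<lambda>x. (((flat (n + 2) (1 - c * (x \<bullet> x)) + (- real n) * flat (n + 1) (1 - c * (x \<bullet> x))) * (- 2 * c)) *\<^sub>R x) \<bullet> b)"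
      unfolding inner_scaleR_left
      by (intro Ck_mult Ck_add Suc.IH Ck_const Ck_inner)
  qed
qed

lemma Ck_c1c:
  assumes "Ck_function (Suc k) g" "compact K" "\<And>x. x \<notin> K \<Longrightarrow> g x = 0"
  shows "c1c UNIV g (grad g)"
proof -
  have "continuous_on UNIV (grad g)"
    by (rule continuous_on_componentwise[THEN iffD2]) (use Ck_imp_continuous Ck_SucD(2)[OF assms(1)] in blast)
  then show ?thesis using assms Ck_SucD(1)[OF assms(1)] by (auto simp: c1c_def)
qed

lemma Ck_conv:
  assumes "integrable lborel w" "compact L" "\<And>y. y \<notin> L \<Longrightarrow> w y = 0" "compact K"
  shows "Ck_function k g \<Longrightarrow> (\<And>x. x \<notin> K \<Longrightarrow> g x = 0) \<Longrightarrow> Ck_function k (conv w g)"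
proof (induction k arbitrary: g)
  case 0
  then show ?case using conv_continuous[OF assms(1) _ assms(4), of g] by simp
next
  case (Suc k)
  have c: "c1c UNIV g (grad g)" by (rule Ck_c1c[OF Suc.prems(1) assms(4) Suc.prems(2)])
  have c2: "c1c UNIV (conv w g) (conv w (grad g))"
    by (rule conv_c1c[OF assms(1-3) c assms(4) Suc.prems(2)]) auto
  obtain B where B: "\<And>x. norm (grad g x) \<le> B" using c1c_bounds[OF c] by metis
  have zero: "grad g x = 0" if "x \<notin> K" for x
  proof -
    have "c1c K g (grad g)"
      using c assms(4) Suc.prems(2) by (auto simp: c1c_def)
    then obtain K' where K': "K' \<subseteq> K" "\<And>x. x \<notin> K' \<Longrightarrow> grad g x = 0" using c1c_support[of K g "grad g"] by metis
    have "x \<notin> K'" using K'(1) that by blast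
    then show ?thesis by (rule K'(2))
  qed
  have [measurable]: "grad g \<in> borel_measurable borel" using c1c_cont'[OF c] by (rule borel_measurable_continuous_onI)
  show ?case
  proof (rule Ck_SucI[OF c1c_deriv[OF c2]])
    fix b :: 'a assume b: "b \<in> Basis"
    have "conv w (grad g) x \<bullet> b = conv w (\<lambda>x. grad g x \<bullet> b) x" for x
      unfolding conv_def by (subst integral_inner_left[symmetric]) (auto intro!: integrable_conv[OF assms(1) _ B])
    then show "Ck_function k (\<lambda>x. conv w (grad g) x \<bullet> b)"
      using Suc.IH[OF Ck_SucD(2)[OF Suc.prems(1) b]] zero by simp
  qed
qed

lemma conv_commute:
  fixes w f :: "'a::euclidean_space \<Rightarrow> real"
  assumes [measurable]: "w \<in> borel_measurable borel" "f \<in> borel_measurable borel"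
  shows "conv w f x = conv f w x"
  unfolding conv_def using lborel_integral_reflect[of "\<lambda>y. w y *\<^sub>R f (x - y)" x] by (simp add: mult.commute)

lemma conv_approx:
  fixes f :: "'a::euclidean_space \<Rightarrow> 'b::euclidean_space"
  assumes w: "integrable lborel w" "\<And>y. 0 \<le> w y" "(\<integral>y. w y \<partial>lborel) = 1" "\<And>y. norm y \<ge> d \<Longrightarrow> w y = 0"
    and f: "continuous_on UNIV f" "compact K" "\<And>x. x \<notin> K \<Longrightarrow> f x = 0"
    and d: "\<And>x h. norm h < d \<Longrightarrow> norm (f (x + h) - f x) < e"
  shows "norm (conv w f x - f x) \<le> e"
proof -
  have [measurable]: "f \<in> borel_measurable borel" using f(1) by (rule borel_measurable_continuous_onI)
  obtain B where B: "\<And>x. norm (f x) \<le> B" using compact_support_bounded[OF f] by auto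
  have i1: "integrable lborel (\<lambda>y. w y *\<^sub>R f (x - y))" by (rule integrable_conv[OF w(1) _ B]) simp
  have i2: "integrable lborel (\<lambda>y. w y *\<^sub>R f x)" using w(1) by (intro integrable_scaleR_left) auto
  have "conv w f x - f x = (\<integral>y. w y *\<^sub>R f (x - y) \<partial>lborel) - (\<integral>y. w y *\<^sub>R f x \<partial>lborel)"
    using w(1,3) by (simp add: conv_def)
  also have "\<dots> = (\<integral>y. w y *\<^sub>R f (x - y) - w y *\<^sub>R f x \<partial>lborel)"
    by (rule Bochner_Integration.integral_diff[OF i1 i2, symmetric])
  finally have eq: "conv w f x - f x = (\<integral>y. w y *\<^sub>R f (x - y) - w y *\<^sub>R f x \<partial>lborel)" .
  have "norm (conv w f x - f x) \<le> (\<integral>y. norm (w y *\<^sub>R f (x - y) - w y *\<^sub>R f x) \<partial>lborel)"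
    unfolding eq by (rule integral_norm_bound)
  also have "\<dots> \<le> (\<integral>y. w y * e \<partial>lborel)"
  proof (rule integral_mono)
    show "integrable lborel (\<lambda>y. norm (w y *\<^sub>R f (x - y) - w y *\<^sub>R f x))"
      by (intro integrable_norm Bochner_Integration.integrable_diff i1 i2)
    show "integrable lborel (\<lambda>y. w y * e)" using w(1) by simp
    fix y
    show "norm (w y *\<^sub>R f (x - y) - w y *\<^sub>R f x) \<le> w y * e"
    proof (cases "norm y < d")
      case True
      have "norm (f (x - y) - f x) < e" using d[of "- y" x] True by simp
      then have "w y * norm (f (x - y) - f x) \<le> w y * e" using w(2)[of y] by (intro mult_left_mono) auto
      then show ?thesis using w(2)[of y] by (simp add: scaleR_diff_right[symmetric])
    next
      case False
      then show ?thesis using w(4)[of y] by simp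
    qed
  qed
  also have "\<dots> = e" using w(3) by simp
  finally show ?thesis .
qed

lemma mollifier_exists:
  assumes "d > 0"
  shows "\<exists>w::'a::euclidean_space \<Rightarrow> real. (\<forall>k. Ck_function k w) \<and> integrable lborel w \<and> (\<forall>y. 0 \<le> w y) \<and>
    (\<integral>y. w y \<partial>lborel) = 1 \<and> (\<forall>y. norm y \<ge> d \<longrightarrow> w y = 0)"
proof -
  define g where "g = (\<lambda>x::'a. flat 0 (1 - inverse (d^2) * (x \<bullet> x)))"
  have Ck: "Ck_function k g" for k unfolding g_def by (rule Ck_bump)
  have nonneg: "0 \<le> g x" for x by (simp add: g_def flat_nonneg)
  have zero: "g x = 0" if "norm x \<ge> d" for x
  proof -
    have "d^2 \<le> (norm x)^2" using that assms by (intro power_mono) auto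
    then show ?thesis using assms by (simp add: g_def flat_def power2_norm_eq_inner field_simps)
  qed
  have cont: "continuous_on UNIV g" using Ck[of 0] by simp
  have int: "integrable lborel g"
    using zero by (intro integrable_compact_support[OF cont, of "cball 0 d"]) auto
  have pos: "(\<integral>y. g y \<partial>lborel) > 0"
  proof -
    have "\<exists>r>0. \<forall>x. norm x < r \<longrightarrow> g x > g 0 / 2"
    proof -
      have "g 0 > 0" by (simp add: g_def flat_def)
      then have "\<exists>r>0. \<forall>x. dist x 0 < r \<longrightarrow> dist (g x) (g 0) < g 0 / 2"
        using cont unfolding continuous_on_iff by (metis UNIV_I half_gt_zero)
      then show ?thesis by (auto simp: dist_real_def abs_less_iff) (smt (verit) field_sum_of_halves)
    qed
    then obtain r where r: "r > 0" "\<And>x. norm x < r \<Longrightarrow> g x > g 0 / 2" by auto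
    have "0 < g 0 / 2 * measure lborel (ball (0::'a) r)"
      using r(1) content_ball_pos[of r "0::'a"] by (simp add: g_def flat_def)
    also have "\<dots> = (\<integral>y. g 0 / 2 * indicator (ball (0::'a) r) y \<partial>lborel)" by simp
    also have "\<dots> \<le> (\<integral>y. g y \<partial>lborel)"
      using r nonneg by (intro integral_mono int integrable_mult_right integrable_indicator_bounded)
        (auto simp: indicator_def less_imp_le)
    finally show ?thesis .
  qed
  define c where "c = (\<integral>y. g y \<partial>lborel)"
  show ?thesis
  proof (intro exI[of _ "\<lambda>x. g x * inverse c"] conjI allI impI)
    show "Ck_function k (\<lambda>x. g x * inverse c)" for k by (intro Ck_mult Ck Ck_const)
    show "integrable lborel (\<lambda>x. g x * inverse c)" using int by simp
    show "(\<integral>y. g y * inverse c \<partial>lborel) = 1" using pos by (simp add: c_def)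
  qed (use nonneg zero pos in \<open>auto simp: c_def\<close>)
qed

text \<open>The compact set \<open>K\<close> is fixed before the accuracy \<open>e\<close>. The
  errors are later integrated against a measure that is only known to be finite on compact sets, so
  supports that vary with \<open>e\<close> would be of no use.\<close>

lemma c1c_smooth_approx:
  assumes U: "open U" and f: "c1c U f f'"
  obtains K where "compact K" "K \<subseteq> U"
    "\<And>e. e > 0 \<Longrightarrow> \<exists>\<phi>\<in>test_functions U. c1c K \<phi> (grad \<phi>) \<and> (\<forall>x. \<bar>\<phi> x - f x\<bar> \<le> e \<and> norm (grad \<phi> x - f' x) \<le> e)"
proof -
  obtain K0 where K0: "compact K0" "K0 \<subseteq> U" "\<And>x. x \<notin> K0 \<Longrightarrow> f x = 0" "\<And>x. x \<notin> K0 \<Longrightarrow> f' x = 0"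
    using c1c_support[OF f] by metis
  obtain d0 where d0: "d0 > 0" "{x + y |x y. x \<in> K0 \<and> y \<in> cball 0 d0} \<subseteq> U"
  proof -
    obtain e where e: "e > 0" "(\<Union>x\<in>K0. ball x e) \<subseteq> U"
      using compact_subset_open_imp_ball_epsilon_subset[OF K0(1) U K0(2)] by blast
    have "x + y \<in> U" if "x \<in> K0" "norm y \<le> e / 2" for x y
    proof -
      have "x + y \<in> ball x e" using that(2) e(1) by (simp add: dist_norm)
      then show ?thesis using e(2) that(1) by blast
    qed
    then show thesis using e(1) by (intro that[of "e/2"]) auto
  qed
  define K where "K = {x + y |x y. x \<in> K0 \<and> y \<in> cball 0 d0}"
  have K: "compact K" "K \<subseteq> U" unfolding K_def by (rule compact_sums[OF K0(1) compact_cball]) (rule d0(2))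
  have f0: "c1c UNIV f f'" using c1c_mono[OF f] by blast
  have m[measurable]: "f \<in> borel_measurable borel" using c1c_cont[OF f] by (rule borel_measurable_continuous_onI)
  have "\<exists>\<phi>\<in>test_functions U. c1c K \<phi> (grad \<phi>) \<and> (\<forall>x. \<bar>\<phi> x - f x\<bar> \<le> e \<and> norm (grad \<phi> x - f' x) \<le> e)" if e: "e > 0" for e
  proof -
    obtain d1 where d1: "d1 > 0" "\<And>x h. norm h < d1 \<Longrightarrow> norm (f (x + h) - f x) < e"
      using compact_support_uniform[OF c1c_cont[OF f] K0(1,3) e] by auto
    obtain d2 where d2: "d2 > 0" "\<And>x h. norm h < d2 \<Longrightarrow> norm (f' (x + h) - f' x) < e"
      using compact_support_uniform[OF c1c_cont'[OF f] K0(1,4) e] by auto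
    define d where "d = min d0 (min d1 d2)"
    have d: "d > 0" "d \<le> d0" "d \<le> d1" "d \<le> d2" using d0 d1 d2 by (auto simp: d_def)
    obtain w :: "'a \<Rightarrow> real" where w: "\<And>k. Ck_function k w" "integrable lborel w" "\<And>y. 0 \<le> w y" "(\<integral>y. w y \<partial>lborel) = 1" "\<And>y. norm y \<ge> d \<Longrightarrow> w y = 0"
      using mollifier_exists[OF d(1), where 'a = 'a] by blast
    have wz: "w y = 0" if "y \<notin> cball 0 d0" for y using w(5)[of y] that d by auto
    have [measurable]: "w \<in> borel_measurable borel" using w(1)[of 0] by (auto intro: borel_measurable_continuous_onI)
    define \<phi> where "\<phi> = conv w f"
    have c: "c1c K \<phi> (conv w f')"
      unfolding \<phi>_def by (rule conv_c1c[OF w(2) compact_cball[of 0 d0] wz f0 K0(1,3)]) (auto simp: K_def, metis add.commute)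
    have g: "grad \<phi> = conv w f'" using grad_eqI[OF c1c_deriv[OF c]] by blast
    \<comment> \<open>Read in this order the derivatives fall on the mollifier, which gives
      smoothness of every order; in the other order they fall on \<open>f\<close>, which gives the
      convergence of the gradients.\<close>
    have "\<phi> = conv f w" unfolding \<phi>_def by (rule ext) (rule conv_commute; measurable)
    moreover have "Ck_function k (conv f w)" for k
      by (rule Ck_conv[OF integrable_compact_support[OF c1c_cont[OF f] K0(1,3)] K0(1,3) compact_cball[of 0 d0] w(1) wz])
    ultimately have Ck: "Ck_function k \<phi>" for k by simp
    have z: "\<phi> x = 0" if "x \<notin> K" for x
    proof -
      obtain K' where K': "K' \<subseteq> K" "\<And>x. x \<notin> K' \<Longrightarrow> \<phi> x = 0" using c1c_support[OF c] by metis
      have "x \<notin> K'" using K'(1) that by blast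
      then show ?thesis by (rule K'(2))
    qed
    then have "closure {x. \<phi> x \<noteq> 0} \<subseteq> K" using compact_imp_closed[OF K(1)] by (intro closure_minimal) auto
    then have "\<phi> \<in> test_functions U"
      using K Ck bounded_subset[OF compact_imp_bounded[OF K(1)], of "{x. \<phi> x \<noteq> 0}"] z
      unfolding test_functions_def by (auto simp: compact_closure)
    moreover have "\<bar>\<phi> x - f x\<bar> \<le> e" for x
      using conv_approx[OF w(2-5) c1c_cont[OF f] K0(1,3) d1(2)] d by (simp add: \<phi>_def)
    moreover have "norm (conv w f' x - f' x) \<le> e" for x
      using conv_approx[OF w(2-5) c1c_cont'[OF f] K0(1,4) d2(2)] d by simp
    ultimately show ?thesis using c g by (intro bexI[of _ \<phi>]) auto
  qed
  then show ?thesis using that K by blast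
qed

subsection \<open>The kernel attached to an elliptic matrix\<close>

lemma antiderivative_exists:
  fixes f :: "real \<Rightarrow> 'a::euclidean_space"
  assumes "continuous_on UNIV f"
  shows "\<exists>F. F c = 0 \<and> (\<forall>t. (F has_vector_derivative f t) (at t))"
proof (intro exI[of _ "\<lambda>u::real. LBINT y=ereal c..ereal u. f y"] conjI allI)
  let ?F = "\<lambda>u::real. LBINT y=ereal c..ereal u. f y"
  show "?F c = 0" by simp
  fix t :: real
  define l r where "l = min c t - 1" and "r = max c t + 1"
  have "(?F has_vector_derivative f t) (at t within {l..r})"
    by (rule interval_integral_FTC2) (auto simp: l_def r_def intro: continuous_on_subset[OF assms])
  moreover have "at t within {l..r} = at t"
    by (rule at_within_interior) (auto simp: l_def r_def)
  ultimately show "(?F has_vector_derivative f t) (at t)" by simp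
qed

lemma DERIV_max_0_sq: "((\<lambda>t::real. (max 0 t)\<^sup>2) has_real_derivative 2 * max 0 t) (at t)"
proof -
  consider "t > 0" | "t < 0" | "t = 0" by linarith
  then show ?thesis
  proof cases
    case 1
    have "((\<lambda>t. t\<^sup>2) has_real_derivative 2 * max 0 t) (at t)" using 1 by (auto intro!: derivative_eq_intros)
    then show ?thesis
      by (rule has_field_derivative_transform_within_open[where S = "{0<..}"]) (use 1 in auto)
  next
    case 2
    have "((\<lambda>t. 0) has_real_derivative 2 * max 0 t) (at t)" using 2 by simp
    then show ?thesis
      by (rule has_field_derivative_transform_within_open[where S = "{..<0}"]) (use 2 in auto)
  next
    case 3
    have "((\<lambda>y. (max 0 y)\<^sup>2 / y) \<longlongrightarrow> 0) (at (0::real))"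
    proof (rule tendsto_rabs_zero_cancel, rule tendsto_sandwich[where f = "\<lambda>_. 0" and h = "\<lambda>y. \<bar>y\<bar>"])
      show "\<forall>\<^sub>F y in at 0. \<bar>(max 0 y)\<^sup>2 / y\<bar> \<le> \<bar>y::real\<bar>"
        by (rule always_eventually) (auto simp: max_def power2_eq_square)
      show "((\<lambda>y. \<bar>y\<bar>) \<longlongrightarrow> 0) (at (0::real))" by (auto intro!: tendsto_eq_intros)
    qed auto
    then show ?thesis using 3 by (simp add: has_field_derivative_iff)
  qed
qed

text \<open>The support stays away from 0, so negative powers multiplied by \<open>bump\<close> are
  harmless at the origin; the squares make it C1.\<close>

definition bump :: "real \<Rightarrow> real" where
  "bump t = (max 0 (t - 1/4))\<^sup>2 * (max 0 (1 - t))\<^sup>2"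

definition bump' :: "real \<Rightarrow> real" where
  "bump' t = 2 * max 0 (t - 1/4) * (max 0 (1 - t))\<^sup>2 - (max 0 (t - 1/4))\<^sup>2 * (2 * max 0 (1 - t))"

lemma DERIV_bump: "(bump has_real_derivative bump' t) (at t)"
proof -
  have 1: "((\<lambda>t::real. (max 0 (t - 1/4))\<^sup>2) has_real_derivative 2 * max 0 (t - 1/4)) (at t)"
  proof -
    have g: "((\<lambda>t. t - 1/4) has_real_derivative 1) (at t)" by (auto intro!: derivative_eq_intros)
    from DERIV_chain2[where f = "\<lambda>t::real. (max 0 t)\<^sup>2", OF DERIV_max_0_sq g] show ?thesis by simp
  qed
  have 2: "((\<lambda>t::real. (max 0 (1 - t))\<^sup>2) has_real_derivative - (2 * max 0 (1 - t))) (at t)"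
  proof -
    have g: "((\<lambda>t. 1 - t) has_real_derivative -1) (at t)" by (auto intro!: derivative_eq_intros)
    from DERIV_chain2[where f = "\<lambda>t::real. (max 0 t)\<^sup>2", OF DERIV_max_0_sq g] show ?thesis by simp
  qed
  show ?thesis
    unfolding bump_def[abs_def] using DERIV_mult[OF 1 2] by (rule DERIV_cong) (simp add: bump'_def)
qed

lemma bump_continuous: "continuous_on S bump" "continuous_on S bump'"
  unfolding bump_def[abs_def] bump'_def[abs_def] by (auto intro!: continuous_intros)

lemma bump_nonneg: "0 \<le> bump t" by (simp add: bump_def)

lemma bump_eq_0: "t \<le> 1/4 \<or> 1 \<le> t \<Longrightarrow> bump t = 0" "t \<le> 1/4 \<or> 1 \<le> t \<Longrightarrow> bump' t = 0"
  by (auto simp: bump_def bump'_def)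

lemma bump_le_1: "bump t \<le> 1"
proof (cases "1/4 < t \<and> t < 1")
  case True
  then have "(t - 1/4)\<^sup>2 \<le> 1\<^sup>2" "(1 - t)\<^sup>2 \<le> 1\<^sup>2" by (intro power_mono; simp)+
  then have "(t - 1/4)\<^sup>2 * (1 - t)\<^sup>2 \<le> 1 * 1" by (intro mult_mono) auto
  then show ?thesis using True by (simp add: bump_def)
next
  case False
  then show ?thesis using bump_eq_0[of t] by auto
qed

lemma bump_lower: assumes "3/8 \<le> t" "t \<le> 7/8" shows "1/4096 \<le> bump t"
proof -
  have "(1/8)\<^sup>2 \<le> (t - 1/4)\<^sup>2" "(1/8)\<^sup>2 \<le> (1 - t)\<^sup>2" using assms by (intro power_mono; simp)+
  then have "(1/8)\<^sup>2 * (1/8)\<^sup>2 \<le> (t - 1/4)\<^sup>2 * (1 - t)\<^sup>2" by (intro mult_mono) auto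
  then show ?thesis using assms by (simp add: bump_def power2_eq_square)
qed

text \<open>A smooth transition that is not normalised: beyond 1 it has the constant value
  \<open>step 1\<close>. It enters only through differences at two scales, or divided by
  \<open>step 1\<close>.\<close>

definition step :: "real \<Rightarrow> real" where
  "step = (SOME F. F 0 = 0 \<and> (\<forall>t. (F has_vector_derivative bump t) (at t)))"

lemma step_0: "step 0 = 0" and DERIV_step: "(step has_real_derivative bump t) (at t)"
proof -
  have "step 0 = 0 \<and> (\<forall>t. (step has_vector_derivative bump t) (at t))"
    using someI_ex[OF antiderivative_exists[OF bump_continuous(1), of 0]] unfolding step_def[symmetric] .
  then show "step 0 = 0" "(step has_real_derivative bump t) (at t)"
    by (auto simp: has_real_derivative_iff_has_vector_derivative)
qed

lemma step_continuous: "continuous_on S step"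
  using DERIV_step DERIV_isCont continuous_at_imp_continuous_on by blast

lemma step_mono: "s \<le> t \<Longrightarrow> step s \<le> step t"
  using DERIV_nonneg_imp_nondecreasing[of s t step] DERIV_step bump_nonneg by blast

lemma step_eq_0: assumes "t \<le> 1/4" shows "step t = 0"
proof -
  consider "t = 0" | "t < 0" | "0 < t" by linarith
  then show ?thesis
  proof cases
    case 2
    then obtain z where z: "t < z" "z < 0" "step 0 - step t = (0 - t) * bump z"
      using MVT2[of t 0 step bump] DERIV_step by blast
    then show ?thesis using bump_eq_0[of z] step_0 by simp
  next
    case 3
    then obtain z where z: "0 < z" "z < t" "step t - step 0 = (t - 0) * bump z"
      using MVT2[of 0 t step bump] DERIV_step by blast
    then show ?thesis using bump_eq_0[of z] step_0 assms by simp
  qed (simp add: step_0)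
qed

lemma step_eq_1: assumes "1 \<le> t" shows "step t = step 1"
proof (cases "t = 1")
  case False
  then have "1 < t" using assms by simp
  then obtain z where z: "1 < z" "step t - step 1 = (t - 1) * bump z"
    using MVT2[of 1 t step bump] DERIV_step by blast
  then show ?thesis using bump_eq_0[of z] by simp
qed simp

lemma step_bounds: "0 \<le> step t" "step t \<le> 1"
proof -
  show "0 \<le> step t" using step_mono[of "min 0 t" t] step_eq_0[of "min 0 t"] by simp
  obtain z where z: "step 1 - step 0 = (1 - 0) * bump z"
    using MVT2[of 0 1 step bump] DERIV_step by auto
  then have "step 1 \<le> 1" using bump_le_1[of z] step_0 by simp
  moreover have "step t \<le> step (max 1 t)" by (rule step_mono) simp
  ultimately show "step t \<le> 1" using step_eq_1[of "max 1 t"] by simp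
qed

section \<open>The truncated fundamental solution of an elliptic operator\<close>

locale ellip =
  fixes T A :: "real^'d^'d" and lam :: real
  assumes T_sym: "transpose T = T" and A_sym: "transpose A = A" and TA: "T ** A = mat 1"
    and lam: "0 < lam" and T_lower: "\<And>x. lam * (x \<bullet> x) \<le> x \<bullet> (T *v x)"
    and T_upper: "\<And>x. x \<bullet> (T *v x) \<le> (x \<bullet> x) / 4"
begin

definition q :: "real^'d \<Rightarrow> real" where "q x = x \<bullet> (A *v x)"

lemma T_A: "T *v (A *v x) = x" by (simp add: matrix_vector_mul_assoc TA)

lemma T_inner: "x \<bullet> (T *v y) = (T *v x) \<bullet> y"
  using dot_lmul_matrix[of x T y] T_sym by (metis transpose_matrix_vector)

lemma A_inner: "x \<bullet> (A *v y) = (A *v x) \<bullet> y"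
  using dot_lmul_matrix[of x A y] A_sym by (metis transpose_matrix_vector)

lemma q_eq: "q x = (A *v x) \<bullet> (T *v (A *v x))"
  by (simp add: T_A q_def inner_commute)

lemma norm_A: "norm (A *v x) \<le> norm x / lam"
proof -
  let ?z = "A *v x"
  have "lam * (norm ?z)\<^sup>2 \<le> ?z \<bullet> x" using T_lower[of ?z] by (simp add: T_A power2_norm_eq_inner)
  also have "\<dots> \<le> norm ?z * norm x" by (rule norm_cauchy_schwarz)
  finally have "norm ?z * (lam * norm ?z) \<le> norm ?z * norm x" by (simp add: power2_eq_square mult_ac)
  then have "norm ?z = 0 \<or> lam * norm ?z \<le> norm x" by (smt (verit) mult_le_cancel_left_pos norm_ge_zero)
  then show ?thesis using lam by (auto simp: field_simps)
qed

lemma q_upper: "q x \<le> (norm x)\<^sup>2 / lam"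
proof -
  have "q x \<le> norm x * norm (A *v x)" unfolding q_def by (rule norm_cauchy_schwarz)
  also have "\<dots> \<le> norm x * (norm x / lam)" by (intro mult_left_mono norm_A) auto
  finally show ?thesis by (simp add: power2_eq_square)
qed

lemma T_cauchy_schwarz: "(x \<bullet> (T *v y))\<^sup>2 \<le> (x \<bullet> (T *v x)) * (y \<bullet> (T *v y))"
proof -
  let ?X = "x \<bullet> (T *v x)" and ?Y = "y \<bullet> (T *v y)" and ?Z = "x \<bullet> (T *v y)"
  have nonneg: "0 \<le> w \<bullet> (T *v w)" for w
    using T_lower[of w] lam by (meson inner_ge_zero less_imp_le mult_nonneg_nonneg order_trans)
  show ?thesis
  proof (cases "y = 0")
    case False
    have Y: "?Y > 0" using T_lower[of y] lam False by (meson inner_gt_zero_iff less_le_trans mult_pos_pos)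
    have sym: "y \<bullet> (T *v x) = ?Z" by (metis T_inner inner_commute)
    let ?w = "?Y *\<^sub>R x - ?Z *\<^sub>R y"
    have "?w \<bullet> (T *v ?w) = ?Y * (?X * ?Y - ?Z\<^sup>2)"
      by (simp add: matrix_vector_mult_diff_distrib matrix_vector_mult_scaleR inner_diff_left inner_diff_right sym algebra_simps power2_eq_square)
    then have "0 \<le> ?Y * (?X * ?Y - ?Z\<^sup>2)" using nonneg[of ?w] by simp
    then show ?thesis using Y by (simp add: zero_le_mult_iff)
  qed simp
qed

text \<open>Cauchy-Schwarz for the form of \<open>T\<close>, applied to \<open>x\<close> and
  \<open>A x\<close>, together with the normalisation 1/4 in \<open>T_upper\<close>. The resulting
  factor 4 confines the region \<open>q x < 1\<close>, and with it every kernel below, to the ball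
  of radius 1/2.\<close>

lemma q_lower: "4 * (norm x)\<^sup>2 \<le> q x"
proof -
  let ?z = "A *v x"
  have "((norm x)\<^sup>2)\<^sup>2 = (x \<bullet> (T *v ?z))\<^sup>2" by (simp add: T_A power2_norm_eq_inner)
  also have "\<dots> \<le> (x \<bullet> (T *v x)) * q x" using T_cauchy_schwarz[of x ?z] by (simp add: q_eq)
  also have "\<dots> \<le> (norm x)\<^sup>2 / 4 * q x"
  proof (intro mult_right_mono)
    show "0 \<le> q x" unfolding q_eq using T_lower[of ?z] lam by (meson inner_ge_zero less_imp_le mult_nonneg_nonneg order_trans)
  qed (use T_upper[of x] in \<open>simp add: power2_norm_eq_inner\<close>)
  finally have "(norm x)\<^sup>2 * (4 * (norm x)\<^sup>2) \<le> (norm x)\<^sup>2 * q x" by (simp add: power2_eq_square)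
  then show ?thesis
    by (cases "x = 0") (auto simp: q_def mult_le_cancel_left_pos)
qed

lemma q_nonneg: "0 \<le> q x" using q_lower[of x] by (smt (verit) zero_le_power2)

lemma q_scale: "q (c *\<^sub>R x) = c\<^sup>2 * q x"
  by (simp add: q_def matrix_vector_mult_scaleR power2_eq_square)

lemma q_add_le: "sqrt (q (x + y)) \<le> sqrt (q x) + sqrt (q y)"
proof -
  have "(x \<bullet> (A *v y))\<^sup>2 \<le> q x * q y"
    using T_cauchy_schwarz[of "A *v x" "A *v y"] unfolding T_A q_eq by (simp add: A_inner)
  then have "x \<bullet> (A *v y) \<le> sqrt (q x) * sqrt (q y)"
    by (metis real_le_rsqrt real_sqrt_mult)
  moreover have "q (x + y) = q x + 2 * (x \<bullet> (A *v y)) + q y"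
  proof -
    have "y \<bullet> (A *v x) = x \<bullet> (A *v y)" by (metis A_inner inner_commute)
    then show ?thesis by (simp add: q_def matrix_vector_right_distrib inner_add_left inner_add_right)
  qed
  ultimately have "q (x + y) \<le> (sqrt (q x) + sqrt (q y))\<^sup>2"
    by (simp add: power2_sum q_nonneg)
  then show ?thesis by (meson add_nonneg_nonneg q_nonneg real_le_lsqrt real_sqrt_ge_zero)
qed

lemma q_has_derivative: "(q has_derivative (\<lambda>h. 2 * ((A *v x) \<bullet> h))) (at x)"
proof -
  have A: "((\<lambda>x. A *v x) has_derivative (\<lambda>h. A *v h)) (at x)"
    by (rule bounded_linear_imp_has_derivative) (rule matrix_vector_mul_bounded_linear)
  have "x \<bullet> (A *v h) + h \<bullet> (A *v x) = 2 * ((A *v x) \<bullet> h)" for h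
    using A_inner[of x h] inner_commute[of h "A *v x"] by simp
  then show ?thesis
    using has_derivative_inner[OF has_derivative_ident A] unfolding q_def[abs_def] by simp
qed

lemma q_continuous: "continuous_on S q"
  using q_has_derivative has_derivative_continuous continuous_at_imp_continuous_on by blast

lemma trace_TA: "(\<Sum>i\<in>UNIV. \<Sum>j\<in>UNIV. T $ i $ j * A $ i $ j) = real CARD('d)"
proof -
  have "(\<Sum>j\<in>UNIV. T $ i $ j * A $ i $ j) = (T ** A) $ i $ i" for i
    using A_sym by (simp add: matrix_matrix_mult_def) (metis (no_types, lifting) transpose_def vec_lambda_beta)
  then show ?thesis by (simp add: TA mat_def)
qed

lemma T_quadratic: "(\<Sum>i\<in>UNIV. \<Sum>j\<in>UNIV. T $ i $ j * (x $ i * x $ j)) = x \<bullet> (T *v x)"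
  by (simp add: inner_vec_def matrix_vector_mult_def sum_distrib_left mult_ac)

text \<open>At \<open>r = q x\<close>, the power \<open>r powr (- d / 2)\<close> times
  \<open>A x\<close> is up to a constant the gradient of the fundamental solution of the operator
  with coefficient matrix \<open>T\<close>. The difference of two steps cuts it off below scale
  \<open>s\<close> and above scale 1.\<close>

definition \<kappa> :: "real \<Rightarrow> real \<Rightarrow> real" where
  "\<kappa> s r = r powr (- real CARD('d) / 2) * (step (r / s\<^sup>2) - step r)"

definition \<kappa>' :: "real \<Rightarrow> real \<Rightarrow> real" where
  "\<kappa>' s r = (- real CARD('d) / 2) * r powr (- real CARD('d) / 2 - 1) * (step (r / s\<^sup>2) - step r)
     + r powr (- real CARD('d) / 2) * (bump (r / s\<^sup>2) / s\<^sup>2 - bump r)"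

lemma kappa_small:
  assumes "0 < s" "s \<le> 1" "r \<le> s\<^sup>2 / 4"
  shows "\<kappa> s r = 0" "\<kappa>' s r = 0"
proof -
  have "s\<^sup>2 \<le> 1\<^sup>2" using assms by (intro power_mono) auto
  then have "r \<le> 1/4" "r / s\<^sup>2 \<le> 1/4" using assms by (auto simp: field_simps)
  then show "\<kappa> s r = 0" "\<kappa>' s r = 0" using bump_eq_0 step_eq_0 by (auto simp: \<kappa>_def \<kappa>'_def)
qed

lemma kappa_large:
  assumes "0 < s" "s \<le> 1" "1 \<le> r"
  shows "\<kappa> s r = 0" "\<kappa>' s r = 0"
proof -
  have "s\<^sup>2 \<le> 1\<^sup>2" using assms by (intro power_mono) auto
  then have "1 \<le> r / s\<^sup>2" using assms by (auto simp: field_simps)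
  then show "\<kappa> s r = 0" "\<kappa>' s r = 0" using assms bump_eq_0 step_eq_1[of r] step_eq_1[of "r / s\<^sup>2"] by (auto simp: \<kappa>_def \<kappa>'_def)
qed

lemma DERIV_kappa:
  assumes "0 < s" "s \<le> 1"
  shows "(\<kappa> s has_real_derivative \<kappa>' s r) (at r)"
proof (cases "r > 0")
  case True
  have d1: "((\<lambda>r. r powr (- real CARD('d) / 2)) has_real_derivative (- real CARD('d) / 2) * r powr (- real CARD('d) / 2 - 1)) (at r)"
    using True by (intro has_real_derivative_powr) auto
  have d2: "((\<lambda>r. step (r / s\<^sup>2)) has_real_derivative bump (r / s\<^sup>2) * (1 / s\<^sup>2)) (at r)"
    by (rule DERIV_chain2[OF DERIV_step DERIV_cdivide[OF DERIV_ident]])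
  have "((\<lambda>r. r powr (- real CARD('d) / 2) * (step (r / s\<^sup>2) - step r)) has_real_derivative
     (- real CARD('d) / 2) * r powr (- real CARD('d) / 2 - 1) * (step (r / s\<^sup>2) - step r) + (bump (r / s\<^sup>2) * (1 / s\<^sup>2) - bump r) * r powr (- real CARD('d) / 2)) (at r)"
    by (rule DERIV_mult[OF d1 DERIV_diff[OF d2 DERIV_step]])
  then show ?thesis unfolding \<kappa>_def[abs_def] by (rule DERIV_cong) (simp add: \<kappa>'_def)
next
  case False
  have "0 < s\<^sup>2 / 4" using assms by simp
  with False have lt: "r < s\<^sup>2 / 4" by linarith
  then have "r \<le> s\<^sup>2 / 4" by simp
  then have 0: "\<kappa>' s r = 0" using assms by (intro kappa_small)
  have "((\<lambda>_. 0) has_real_derivative 0) (at r)" by simp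
  then show ?thesis unfolding 0
    by (rule has_field_derivative_transform_within_open[where S = "{..<s\<^sup>2/4}"])
      (use lt assms kappa_small in auto)
qed

lemma kappa'_continuous:
  assumes "0 < s" "s \<le> 1"
  shows "continuous_on UNIV (\<kappa>' s)"
proof -
  have 1: "continuous_on {0<..} (\<kappa>' s)"
  proof -
    have "continuous_on {0<..} (\<lambda>r. step (r / s\<^sup>2))" "continuous_on {0<..} step"
      using assms by (auto intro!: continuous_intros continuous_on_compose2[of UNIV step] step_continuous)
    moreover have "continuous_on {0<..} (\<lambda>r. bump (r / s\<^sup>2))"
      using assms by (auto intro!: continuous_intros continuous_on_compose2[OF bump_continuous(1)])
    ultimately show ?thesis unfolding \<kappa>'_def[abs_def] using assms
      by (auto intro!: continuous_intros bump_continuous)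
  qed
  have 2: "continuous_on {..<s\<^sup>2/4} (\<kappa>' s)"
    using kappa_small(2)[OF assms] by (subst continuous_on_cong[of _ _ _ "\<lambda>_. 0"]) auto
  have "continuous_on ({0<..} \<union> {..<s\<^sup>2/4}) (\<kappa>' s)"
    by (rule continuous_on_open_Un) (auto intro: 1 2)
  moreover have "{0<..} \<union> {..<s\<^sup>2/4} = UNIV" using assms by (auto simp: not_less) (smt (verit) zero_less_power)
  ultimately show ?thesis by simp
qed

text \<open>A function of \<open>q\<close> times half the gradient of \<open>q\<close>, hence the
  gradient of a function of \<open>q\<close>. This is why its derivative \<open>W'\<close> is a
  symmetric matrix, on which the compensated compactness identity depends.\<close>

definition W :: "real \<Rightarrow> 'd \<Rightarrow> real^'d \<Rightarrow> real" where
  "W s i x = \<kappa> s (q x) * (A *v x) $ i"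

definition W' :: "real \<Rightarrow> 'd \<Rightarrow> real^'d \<Rightarrow> real^'d" where
  "W' s i x = (2 * \<kappa>' s (q x) * (A *v x) $ i) *\<^sub>R (A *v x) + \<kappa> s (q x) *\<^sub>R (A $ i)"

lemma q_ge_1: assumes "norm x \<ge> 1/2" shows "q x \<ge> 1"
proof -
  have "(1/2)\<^sup>2 \<le> (norm x)\<^sup>2" using assms by (intro power_mono) auto
  then show ?thesis using q_lower[of x] by (simp add: power2_eq_square)
qed

lemma W_zero: "0 < s \<Longrightarrow> s \<le> 1 \<Longrightarrow> x \<notin> cball 0 (1/2) \<Longrightarrow> W s i x = 0"
  using q_ge_1[of x] kappa_large[of s "q x"] by (auto simp: W_def)

lemma W_c1c:
  assumes "0 < s" "s \<le> 1"
  shows "c1c UNIV (W s i) (W' s i)"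
  unfolding c1c_def
proof (intro conjI exI[of _ "cball 0 (1/2)"] allI impI)
  fix x
  have A: "((\<lambda>x. (A *v x) $ i) has_derivative (\<lambda>h. (A *v h) $ i)) (at x)"
    by (rule bounded_linear_imp_has_derivative)
      (rule bounded_linear_compose[OF bounded_linear_vec_nth matrix_vector_mul_bounded_linear])
  have k: "((\<lambda>x. \<kappa> s (q x)) has_derivative (\<lambda>h. 2 * ((A *v x) \<bullet> h) * \<kappa>' s (q x))) (at x)"
    by (rule DERIV_compose_FDERIV[OF DERIV_kappa[OF assms] q_has_derivative])
  show "(W s i has_derivative (\<bullet>) (W' s i x)) (at x)"
    unfolding W_def[abs_def]
    by (rule has_derivative_eq_rhs[OF has_derivative_mult[OF k A]])
      (simp add: fun_eq_iff W'_def inner_add_left matrix_vector_mul_component mult_ac)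
  have kc: "continuous_on UNIV (\<lambda>x. \<kappa> s (q x))" "continuous_on UNIV (\<lambda>x. \<kappa>' s (q x))"
    by (auto intro!: continuous_on_compose2[of UNIV "\<kappa> s"] continuous_on_compose2[OF kappa'_continuous[OF assms]]
       q_continuous DERIV_continuous_on DERIV_kappa assms)
  then show "continuous_on UNIV (W' s i)"
    unfolding W'_def[abs_def] by (intro continuous_intros)
  show "x \<notin> cball 0 (1/2) \<Longrightarrow> W s i x = 0" by (rule W_zero[OF assms])
qed auto

lemma W'_sym: "W' s i x $ j = W' s j x $ i"
proof -
  have "A $ i $ j = A $ j $ i" using A_sym by (metis transpose_def vec_lambda_beta)
  then show ?thesis by (simp add: W'_def)
qed

text \<open>The density produced where the cutoff at scale 1 acts; \<open>\<rho>s s\<close> is its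
  dilation of the same mass. Neither is normalised, the common mass being \<open>cA\<close>.\<close>

definition \<rho> :: "real^'d \<Rightarrow> real" where
  "\<rho> x = 2 * q x powr (1 - real CARD('d) / 2) * bump (q x)"

definition \<rho>s :: "real \<Rightarrow> real^'d \<Rightarrow> real" where
  "\<rho>s s x = (1 / s) ^ CARD('d) * \<rho> ((1 / s) *\<^sub>R x)"

text \<open>The exponent \<open>- d / 2\<close> is the one for which the derivative of the power
  cancels the contribution \<open>d\<close> of the trace of \<open>T A\<close>. Only the derivatives
  of the two cutoffs survive: an approximate Dirac mass at scale \<open>s\<close>, compensated by
  one fixed density at scale 1.\<close>

lemma trace_W':
  assumes "0 < s" "s \<le> 1"
  shows "(\<Sum>i\<in>UNIV. \<Sum>j\<in>UNIV. T $ i $ j * W' s i x $ j) = \<rho>s s x - \<rho> x"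
proof -
  let ?r = "q x"
  have "(\<Sum>i\<in>UNIV. \<Sum>j\<in>UNIV. T $ i $ j * W' s i x $ j) =
    2 * \<kappa>' s ?r * (\<Sum>i\<in>UNIV. \<Sum>j\<in>UNIV. T $ i $ j * ((A *v x) $ i * (A *v x) $ j))
    + \<kappa> s ?r * (\<Sum>i\<in>UNIV. \<Sum>j\<in>UNIV. T $ i $ j * A $ i $ j)"
    by (simp add: W'_def sum_distrib_left sum.distrib algebra_simps)
  also have "\<dots> = 2 * \<kappa>' s ?r * ?r + \<kappa> s ?r * real CARD('d)" by (simp add: T_quadratic q_eq trace_TA)
  also have "\<dots> = \<rho>s s x - \<rho> x"
  proof (cases "?r > 0")
    case True
    let ?p = "?r powr (- real CARD('d) / 2)"
    have p1: "?r powr (- real CARD('d) / 2 - 1) * ?r = ?p" using True by (simp add: powr_diff)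
    have p2: "?r powr (1 - real CARD('d) / 2) = ?p * ?r" using True by (simp add: powr_add[of ?r 1 "- real CARD('d)/2", simplified])
    have p3: "(?r / s\<^sup>2) powr (1 - real CARD('d) / 2) = (1/s) powr (2 - real CARD('d)) * (?p * ?r)"
    proof -
      have "(1 / s)\<^sup>2 = (1 / s) powr 2" using assms by (simp add: powr_numeral)
      then have "((1 / s)\<^sup>2) powr (1 - real CARD('d) / 2) = (1 / s) powr (2 - real CARD('d))" by (simp add: powr_powr algebra_simps)
      moreover have "?r / s\<^sup>2 = (1 / s)\<^sup>2 * ?r" by (simp add: power_divide)
      ultimately show ?thesis using p2 True assms by (simp add: powr_mult)
    qed
    have p4: "(1 / s) ^ CARD('d) * (1/s) powr (2 - real CARD('d)) = 1 / s\<^sup>2"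
    proof -
      have "(1 / s) ^ CARD('d) = (1 / s) powr real CARD('d)" using assms by (simp add: powr_realpow)
      then have "(1 / s) ^ CARD('d) * (1/s) powr (2 - real CARD('d)) = (1 / s) powr 2" using assms by (simp add: powr_add[symmetric])
      also have "\<dots> = (1 / s)\<^sup>2" using assms by (simp add: powr_numeral)
      finally show ?thesis by (simp add: power_divide)
    qed
    have "\<rho>s s x = 2 * ((1 / s) ^ CARD('d) * (1/s) powr (2 - real CARD('d))) * ?p * ?r * bump (?r / s\<^sup>2)"
      by (simp add: \<rho>s_def \<rho>_def q_scale p3 power_divide)
    also have "\<dots> = 2 * ?p * ?r * (bump (?r / s\<^sup>2) / s\<^sup>2)" unfolding p4 by simp
    finally have rs: "\<rho>s s x = 2 * ?p * ?r * (bump (?r / s\<^sup>2) / s\<^sup>2)" .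
    have "2 * \<kappa>' s ?r * ?r + \<kappa> s ?r * real CARD('d) = - real CARD('d) * (?r powr (- real CARD('d) / 2 - 1) * ?r) * (step (?r / s\<^sup>2) - step ?r)
       + 2 * ?p * ?r * (bump (?r / s\<^sup>2) / s\<^sup>2 - bump ?r) + real CARD('d) * ?p * (step (?r / s\<^sup>2) - step ?r)"
      by (simp add: \<kappa>'_def \<kappa>_def field_simps)
    also have "\<dots> = \<rho>s s x - \<rho> x" unfolding p1 rs by (simp add: \<rho>_def p2 algebra_simps)
    finally show ?thesis .
  next
    case False
    then have "?r = 0" using q_nonneg[of x] by simp
    then show ?thesis using kappa_small[OF assms, of 0] by (simp add: \<rho>s_def \<rho>_def q_scale)
  qed
  finally show ?thesis .
qed

end

section \<open>Mollified indicators and potentials of a set\<close>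

lemma integrable_bounded_support:
  fixes f :: "'a::euclidean_space \<Rightarrow> 'b::{banach, second_countable_topology}"
  assumes "f \<in> borel_measurable borel" "\<And>x. norm (f x) \<le> B" "bounded S" "\<And>x. x \<notin> S \<Longrightarrow> f x = 0"
  shows "integrable lborel f"
proof -
  obtain R where R: "S \<subseteq> ball 0 R" using bounded_subset_ballD[OF assms(3), of 0] by auto
  show ?thesis
  proof (rule Bochner_Integration.integrable_bound)
    show "integrable lborel (\<lambda>x. B * indicator (ball (0::'a) R) x)"
      by (intro integrable_mult_right integrable_indicator_bounded) auto
    show "AE x in lborel. norm (f x) \<le> norm (B * indicator (ball (0::'a) R) x :: real)"
    proof (rule AE_I2)
      fix x :: 'a
      show "norm (f x) \<le> norm (B * indicator (ball (0::'a) R) x :: real)"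
      proof (cases "x \<in> ball 0 R")
        case True
        then show ?thesis using assms(2)[of x] by simp
      next
        case False
        then have "x \<notin> S" using R by blast
        then show ?thesis using assms(4) by simp
      qed
    qed
  qed (use assms(1) in simp)
qed

lemma Fubini_bounded_support:
  fixes f :: "'a::euclidean_space \<Rightarrow> 'b::euclidean_space \<Rightarrow> real"
  assumes m': "(\<lambda>(x, y). f x y) \<in> borel_measurable (borel \<Otimes>\<^sub>M borel)" and b: "\<And>x y. \<bar>f x y\<bar> \<le> B"
    and S: "bounded S" "bounded S'" "\<And>x y. x \<notin> S \<or> y \<notin> S' \<Longrightarrow> f x y = 0"
  shows "(\<integral>x. (\<integral>y. f x y \<partial>lborel) \<partial>lborel) = (\<integral>y. (\<integral>x. f x y \<partial>lborel) \<partial>lborel)"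
    "integrable lborel (\<lambda>x. \<integral>y. f x y \<partial>lborel)"
proof -
  have m: "(\<lambda>z. f (fst z) (snd z)) \<in> borel_measurable borel"
    using m' by (simp add: borel_prod case_prod_beta')
  have "integrable lborel (\<lambda>z. f (fst z) (snd z))"
    by (rule integrable_bounded_support[OF m _ bounded_Times[OF S(1,2)]]) (use b S(3) in \<open>auto simp: mem_Times_iff\<close>)
  then have i: "integrable (lborel \<Otimes>\<^sub>M lborel) (\<lambda>(x, y). f x y)"
    by (simp add: lborel_prod case_prod_beta')
  show "(\<integral>x. (\<integral>y. f x y \<partial>lborel) \<partial>lborel) = (\<integral>y. (\<integral>x. f x y \<partial>lborel) \<partial>lborel)"
    using lborel_pair.Fubini_integral[OF i] by simp
  show "integrable lborel (\<lambda>x. \<integral>y. f x y \<partial>lborel)"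
    using lborel_pair.integrable_fst'[OF i] by simp
qed

lemma integral_conv:
  fixes w f :: "'a::euclidean_space \<Rightarrow> real"
  assumes [measurable]: "w \<in> borel_measurable borel" "f \<in> borel_measurable borel"
    and w: "\<And>x. \<bar>w x\<bar> \<le> B" "bounded S" "\<And>x. x \<notin> S \<Longrightarrow> w x = 0"
    and f: "\<And>x. \<bar>f x\<bar> \<le> C" "bounded L" "\<And>x. x \<notin> L \<Longrightarrow> f x = 0"
  shows "(\<integral>x. conv w f x \<partial>lborel) = (\<integral>x. w x \<partial>lborel) * (\<integral>x. f x \<partial>lborel)"
proof -
  have z: "w y * f (x - y) = 0" if "x \<notin> (\<lambda>(y, z). y + z) ` (S \<times> L) \<or> y \<notin> S" for x y
    using w(3)[of y] f(3)[of "x - y"] that by (force simp: image_iff)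
  have bnd: "bounded ((\<lambda>(y, z). y + z) ` (S \<times> L))" by (rule bounded_plus[OF w(2) f(2)])
  have "(\<integral>x. conv w f x \<partial>lborel) = (\<integral>x. (\<integral>y. w y * f (x - y) \<partial>lborel) \<partial>lborel)" by (simp add: conv_def)
  also have "\<dots> = (\<integral>y. (\<integral>x. w y * f (x - y) \<partial>lborel) \<partial>lborel)"
  proof (rule Fubini_bounded_support(1)[OF _ _ bnd w(2) z])
    show "\<bar>w y * f (x - y)\<bar> \<le> B * C" for x y
      unfolding abs_mult by (intro mult_mono w f order_trans[OF abs_ge_zero w(1)]) auto
  qed measurable
  also have "\<dots> = (\<integral>y. w y * (\<integral>x. f x \<partial>lborel) \<partial>lborel)"
    using lborel_integral_translate[of f "- y" for y] by (simp add: algebra_simps)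
  finally show ?thesis by simp
qed

text \<open>Inner and outer regularity: squeeze a compact set \<open>K \<subseteq> E\<close> and an open set around \<open>K\<close>.\<close>

lemma measure_inter_shift:
  fixes E :: "'a::euclidean_space set"
  assumes E: "E \<in> sets borel" "bounded E" and e: "e > 0"
  shows "\<exists>d>0. \<forall>h. norm h < d \<longrightarrow> measure lborel E - e \<le> (\<integral>x. indicator E x * indicator E (x - h) \<partial>lborel)"
proof -
  have El: "E \<in> sets lebesgue" using E(1) by simp
  have small: "measure lebesgue S < e / 2" if "S \<in> lmeasurable" "emeasure lebesgue S < ennreal (e / 2)" for S :: "'a set"
    using that e by (simp add: emeasure_eq_measure2 ennreal_less_iff)
  have e2: "e / 2 > 0" using e by simp
  obtain K where K: "closed K" "K \<subseteq> E" "E - K \<in> lmeasurable" "measure lebesgue (E - K) < e / 2"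
    using sets_lebesgue_inner_closed[OF El e2] small by metis
  have cK: "compact K" using K(1) bounded_subset[OF E(2) K(2)] by (simp add: compact_eq_bounded_closed)
  then have Kl: "K \<in> sets lebesgue" "K \<in> sets borel" by (simp_all add: borel_compact)
  obtain O' where O': "open O'" "K \<subseteq> O'" "O' - K \<in> lmeasurable" "measure lebesgue (O' - K) < e / 2"
    using sets_lebesgue_outer_open[OF Kl(1) e2] small by metis
  obtain d where d: "d > 0" "(\<Union>x\<in>K. ball x d) \<subseteq> O'"
    using compact_subset_open_imp_ball_epsilon_subset[OF cK O'(1,2)] by blast
  have Kfin: "emeasure lborel K < \<infinity>" by (rule emeasure_bounded_finite[OF compact_imp_bounded[OF cK]])
  have Efin: "emeasure lborel E < \<infinity>" by (rule emeasure_bounded_finite[OF E(2)])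
  have mE: "measure lborel E = measure lborel K + measure lborel (E - K)"
    using measure_Diff[of lborel E K] K(2) E(1) Kl(2) Efin by simp
  have mEK: "measure lborel (E - K) < e / 2" using K(4) E(1) Kl(2) by simp
  have OK: "O' - K \<in> sets borel" using O'(1) Kl(2) by auto
  have OKfin: "emeasure lborel (O' - K) < \<infinity>"
    using O'(3) OK by (auto simp: fmeasurable_def)
  have mOK: "measure lborel (O' - K) < e / 2" using O'(4) OK by simp
  show ?thesis
  proof (intro exI conjI allI impI)
    fix h :: 'a assume h: "norm h < d"
    have i1: "integrable lborel (indicator K :: 'a \<Rightarrow> real)" "integrable lborel (indicator (O' - K) :: 'a \<Rightarrow> real)"
      using Kfin Kl OK OKfin by (auto intro!: integrable_real_indicator)
    have i2: "integrable lborel (\<lambda>x. indicator K (x - h) :: real)"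
      using integrable_lborel_reflect[OF integrable_lborel_reflect[OF i1(1), of 0], of h] by simp
    have "(\<integral>x. indicator K (x - h) \<partial>lborel) = (\<integral>x. indicator K x \<partial>lborel :: real)"
      using lborel_integral_translate[of "indicator K :: 'a \<Rightarrow> real" "- h"] Kl(2) by simp
    then have "measure lborel E - e \<le> (\<integral>x. indicator K (x - h) - indicator (O' - K) x \<partial>lborel)"
      using i1 i2 mE mEK mOK Kl OK by simp
    also have "\<dots> \<le> (\<integral>x. indicator E x * indicator E (x - h) \<partial>lborel)"
    proof (rule integral_mono)
      show "integrable lborel (\<lambda>x. indicator K (x - h) - indicator (O' - K) x :: real)" using i1 i2 by simp
      show "integrable lborel (\<lambda>x. indicator E x * indicator E (x - h) :: real)"
        by (rule integrable_bounded_support[OF _ _ E(2), of _ 1]) (use E(1) in \<open>auto simp: indicator_def\<close>)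
      fix x
      have "x \<in> O'" if "x - h \<in> K"
      proof -
        have "x \<in> ball (x - h) d" using h by (simp add: dist_norm)
        then show ?thesis using d(2) that by blast
      qed
      then show "indicator K (x - h) - indicator (O' - K) x \<le> (indicator E x * indicator E (x - h) :: real)"
        using K(2) by (auto simp: indicator_def)
    qed
    finally show "measure lborel E - e \<le> (\<integral>x. indicator E x * indicator E (x - h) \<partial>lborel)" .
  qed (rule d)
qed

context ellip
begin

definition cA :: real where "cA = (\<integral>x. \<rho> x \<partial>lborel)"

lemma rho_nonneg: "0 \<le> \<rho> x" "0 < s \<Longrightarrow> 0 \<le> \<rho>s s x"
  by (auto simp: \<rho>_def \<rho>s_def bump_nonneg)

lemma rho_zero: "norm x \<ge> 1/2 \<Longrightarrow> \<rho> x = 0"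
  using q_ge_1[of x] bump_eq_0[of "q x"] by (auto simp: \<rho>_def)

lemma rho_le: "\<rho> x \<le> 2 * 4 ^ CARD('d)"
proof (cases "1/4 < q x \<and> q x < 1")
  case True
  have "q x powr (1 - real CARD('d) / 2) \<le> 4 ^ CARD('d)"
  proof -
    have "q x powr (1 - real CARD('d) / 2) \<le> q x powr (- real CARD('d))"
      using True by (intro powr_mono') auto
    also have "\<dots> \<le> (1/4) powr (- real CARD('d))"
      using True by (intro powr_mono2') auto
    also have "\<dots> = 4 ^ CARD('d)" by (simp add: powr_minus powr_realpow power_divide field_simps)
    finally show ?thesis .
  qed
  then have "q x powr (1 - real CARD('d) / 2) * bump (q x) \<le> 4 ^ CARD('d) * 1"
    using bump_le_1 bump_nonneg by (intro mult_mono) auto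
  then show ?thesis by (simp add: \<rho>_def)
next
  case False
  then show ?thesis using bump_eq_0[of "q x"] by (auto simp: \<rho>_def)
qed

lemma powr_bump_continuous: "continuous_on UNIV (\<lambda>t. t powr p * bump t)"
proof -
  have "continuous_on ({0<..} \<union> {..<1/4}) (\<lambda>t. t powr p * bump t)"
  proof (rule continuous_on_open_Un)
    show "continuous_on {0<..} (\<lambda>t. t powr p * bump t)"
      by (auto intro!: continuous_intros bump_continuous)
    show "continuous_on {..<1/4} (\<lambda>t. t powr p * bump t)"
      using bump_eq_0 by (subst continuous_on_cong[of _ _ _ "\<lambda>_. 0"]) auto
  qed auto
  moreover have "{0<..} \<union> {..<1/4} = (UNIV :: real set)" by auto
  ultimately show ?thesis by simp
qed

lemma rho_continuous: "continuous_on UNIV \<rho>"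
proof -
  have "continuous_on UNIV (\<lambda>x. (\<lambda>t. t powr (1 - real CARD('d) / 2) * bump t) (q x))"
    by (rule continuous_on_compose2[OF powr_bump_continuous q_continuous]) auto
  then show ?thesis unfolding \<rho>_def[abs_def] by (simp add: mult.assoc continuous_on_mult_left)
qed

lemma rhos_continuous: "continuous_on UNIV (\<rho>s s)"
  unfolding \<rho>s_def[abs_def]
  by (intro continuous_on_mult_left continuous_on_compose2[OF rho_continuous]) (auto intro!: continuous_intros)

lemma rhos_zero: assumes "0 < s" "norm x \<ge> s / 2" shows "\<rho>s s x = 0"
proof -
  have "norm ((1/s) *\<^sub>R x) \<ge> 1/2" using assms by (simp add: field_simps)
  then show ?thesis using rho_zero[of "(1/s) *\<^sub>R x"] by (simp add: \<rho>s_def)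
qed

lemma rho_borel [measurable]: "\<rho> \<in> borel_measurable borel" "\<rho>s s \<in> borel_measurable borel"
  using rho_continuous rhos_continuous by (auto intro: borel_measurable_continuous_onI)

lemma rho_integrable: "integrable lborel \<rho>"
  by (rule integrable_compact_support[OF rho_continuous compact_cball[of 0 "1/2"]]) (auto intro: rho_zero)

lemma rhos_integrable: "0 < s \<Longrightarrow> integrable lborel (\<rho>s s)"
  by (rule integrable_compact_support[OF rhos_continuous compact_cball[of 0 "s/2"]]) (auto intro: rhos_zero)

lemma rhos_integral: "0 < s \<Longrightarrow> (\<integral>x. \<rho>s s x \<partial>lborel) = cA"
  using lborel_integral_affine[of \<rho> "1/s" 0] by (simp add: cA_def \<rho>s_def)

lemma rhos_bounded: "0 < s \<Longrightarrow> \<bar>\<rho>s s x\<bar> \<le> (1 / s) ^ CARD('d) * (2 * 4 ^ CARD('d))"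
  unfolding \<rho>s_def using rho_le[of "(1/s) *\<^sub>R x"] rho_nonneg(1)[of "(1/s) *\<^sub>R x"]
  by (auto simp: abs_mult intro!: mult_left_mono)

lemma rhos_1: "\<rho>s 1 = \<rho>" by (simp add: \<rho>s_def[abs_def])

lemma cA_nonneg: "0 \<le> cA" unfolding cA_def using rho_nonneg by (intro Bochner_Integration.integral_nonneg) auto

context
  fixes E :: "(real^'d) set"
  assumes E: "E \<in> sets borel" "E \<subseteq> cball 0 (1/4)"
begin

lemma E_bounded: "bounded E" using E(2) bounded_subset bounded_cball by blast

lemma E_int: "integrable lborel (indicator E :: _ \<Rightarrow> real)"
  by (rule integrable_indicator_bounded[OF E_bounded E(1)])

lemma E_out: "y \<notin> cball 0 (1/4) \<Longrightarrow> (indicator E y :: real) = 0" using E(2) by (auto simp: indicator_def)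

text \<open>The kernels convolved with the indicator of \<open>E\<close>. For small \<open>s\<close>
  the function \<open>Fs s\<close> concentrates on \<open>E\<close> with total mass
  \<open>cA\<close> times the measure of \<open>E\<close>; \<open>Fs 1\<close> is the same mass
  averaged at unit scale. The field \<open>X s\<close> has the difference of the two as its trace
  against \<open>T\<close>.\<close>

definition Fs :: "real \<Rightarrow> real^'d \<Rightarrow> real" where "Fs s = conv (indicator E) (\<rho>s s)"
definition X :: "real \<Rightarrow> 'd \<Rightarrow> real^'d \<Rightarrow> real" where "X s i = conv (indicator E) (W s i)"
definition X' :: "real \<Rightarrow> 'd \<Rightarrow> real^'d \<Rightarrow> real^'d" where "X' s i = conv (indicator E) (W' s i)"

lemma Fs_bounds: assumes "0 < s" shows "0 \<le> Fs s x" "Fs s x \<le> cA"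
proof -
  note [measurable] = E(1)
  have eq: "Fs s x = (\<integral>y. \<rho>s s y * indicator E (x - y) \<partial>lborel)"
    unfolding Fs_def by (subst conv_commute) (auto simp: conv_def)
  show "0 \<le> Fs s x" unfolding eq using rho_nonneg(2)[OF assms] by (intro Bochner_Integration.integral_nonneg) auto
  show "Fs s x \<le> cA" unfolding eq rhos_integral[OF assms, symmetric]
  proof (rule integral_mono)
    show "integrable lborel (\<lambda>y. \<rho>s s y * indicator E (x - y))"
      using integrable_conv[OF rhos_integrable[OF assms], of "indicator E :: _ \<Rightarrow> real" 1 x] by (simp add: indicator_def)
  qed (use rhos_integrable[OF assms] rho_nonneg(2)[OF assms] in \<open>auto simp: indicator_def\<close>)
qed

lemma Fs_continuous: "0 < s \<Longrightarrow> continuous_on UNIV (Fs s)"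
  unfolding Fs_def by (rule conv_continuous[OF E_int rhos_continuous compact_cball[of 0 "s/2"]]) (auto intro: rhos_zero)

lemma Fs_zero: assumes "0 < s" "s \<le> 1" "x \<notin> cball 0 (3/4)" shows "Fs s x = 0"
proof -
  have "x \<notin> {y + z |y z. y \<in> cball 0 (1/4) \<and> z \<in> cball 0 (s/2)}"
  proof
    assume "x \<in> {y + z |y z. y \<in> cball 0 (1/4) \<and> z \<in> cball 0 (s/2)}"
    then obtain y z where yz: "x = y + z" "norm y \<le> 1/4" "norm z \<le> s/2" by auto
    then have "norm x \<le> 3/4" unfolding yz(1) using norm_triangle_ineq[of y z] assms(2) by linarith
    then show False using assms(3) by simp
  qed
  then show ?thesis unfolding Fs_def
    using conv_zero[of "cball 0 (1/4)" "indicator E" "cball 0 (s/2)" "\<rho>s s" x] E_out rhos_zero[OF assms(1)] by auto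
qed

lemma Fs_integrable: "0 < s \<Longrightarrow> s \<le> 1 \<Longrightarrow> integrable lborel (Fs s)"
  by (rule integrable_compact_support[OF Fs_continuous compact_cball[of 0 "3/4"]]) (auto intro: Fs_zero)

lemma Fs_integral: assumes "0 < s" shows "(\<integral>x. Fs s x \<partial>lborel) = cA * measure lborel E"
proof -
  have "(\<integral>x. Fs s x \<partial>lborel) = (\<integral>x. indicator E x \<partial>lborel) * (\<integral>x. \<rho>s s x \<partial>lborel)"
    unfolding Fs_def
    by (rule integral_conv[OF _ _ _ bounded_cball[of 0 "1/4"] E_out rhos_bounded[OF assms] bounded_cball[of 0 "s/2"], where B = 1])
      (use E(1) rhos_zero[OF assms] in \<open>auto simp: indicator_def\<close>)
  then show ?thesis using rhos_integral[OF assms] E(1) by simp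
qed

text \<open>The bound has to be linear in the measure of \<open>E\<close>. Since both functions take
  values in \<open>[0, cA]\<close>, the square of the difference is at most \<open>cA\<close> times
  their sum, whose integral is known.\<close>

lemma Fs_diff_L2:
  assumes "0 < s" "s \<le> 1"
  shows "(\<integral>x. (Fs s x - Fs 1 x)\<^sup>2 \<partial>lborel) \<le> 2 * cA\<^sup>2 * measure lborel E"
proof -
  have "(\<integral>x. (Fs s x - Fs 1 x)\<^sup>2 \<partial>lborel) \<le> (\<integral>x. cA * (Fs s x + Fs 1 x) \<partial>lborel)"
  proof (rule integral_mono)
    show "integrable lborel (\<lambda>x. (Fs s x - Fs 1 x)\<^sup>2)"
      by (rule integrable_compact_support[OF _ compact_cball[of 0 "3/4"]])
        (use Fs_zero[OF assms] Fs_zero[of 1] assms in \<open>auto intro!: continuous_intros Fs_continuous\<close>)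
    show "integrable lborel (\<lambda>x. cA * (Fs s x + Fs 1 x))" using Fs_integrable assms by simp
    fix x
    have *: "(a - b)\<^sup>2 \<le> c * (a + b)" if "0 \<le> a" "a \<le> c" "0 \<le> b" "b \<le> c" for a b c :: real
    proof -
      have "a * a \<le> c * a" "b * b \<le> c * b" "0 \<le> a * b" using that by (auto intro: mult_right_mono)
      then show ?thesis by (simp add: power2_eq_square algebra_simps)
    qed
    show "(Fs s x - Fs 1 x)\<^sup>2 \<le> cA * (Fs s x + Fs 1 x)"
      by (rule *) (use Fs_bounds assms in auto)
  qed
  also have "\<dots> = cA * (cA * measure lborel E + cA * measure lborel E)"
    using Fs_integrable[of s] Fs_integrable[of 1] Fs_integral[of s] Fs_integral[of 1] assms by simp
  finally show ?thesis by (simp add: power2_eq_square)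
qed

text \<open>After Fubini the integral is an average, with weight \<open>\<rho>s s y\<close>, of the
  measures of \<open>E\<close> intersected with its translate by \<open>y\<close>. The weight lives
  at \<open>norm y < s\<close>, where these measures are close to the measure of
  \<open>E\<close>.\<close>

lemma Fs_concentrates:
  assumes "e > 0"
  shows "\<exists>d>0. \<forall>s. 0 < s \<and> s < d \<longrightarrow> cA * (measure lborel E - e) \<le> (\<integral>x. indicator E x * Fs s x \<partial>lborel)"
proof -
  note [measurable] = E(1)
  obtain d where d: "d > 0" "\<And>h. norm h < d \<Longrightarrow> measure lborel E - e \<le> (\<integral>x. indicator E x * indicator E (x - h) \<partial>lborel)"
    using measure_inter_shift[OF E(1) E_bounded assms] by auto
  have "cA * (measure lborel E - e) \<le> (\<integral>x. indicator E x * Fs s x \<partial>lborel)" if s: "0 < s" "s < d" for s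
  proof -
    have "(\<integral>x. indicator E x * Fs s x \<partial>lborel) = (\<integral>x. (\<integral>y. \<rho>s s y * (indicator E x * indicator E (x - y)) \<partial>lborel) \<partial>lborel)"
    proof (rule Bochner_Integration.integral_cong[OF refl])
      fix x
      have "Fs s x = (\<integral>y. \<rho>s s y * indicator E (x - y) \<partial>lborel)"
        unfolding Fs_def by (subst conv_commute) (auto simp: conv_def)
      then show "indicator E x * Fs s x = (\<integral>y. \<rho>s s y * (indicator E x * indicator E (x - y)) \<partial>lborel)"
        by (simp add: mult.left_commute[of _ "indicator E x"])
    qed
    also have "\<dots> = (\<integral>y. (\<integral>x. \<rho>s s y * (indicator E x * indicator E (x - y)) \<partial>lborel) \<partial>lborel)"
    proof (rule Fubini_bounded_support(1)[OF _ _ bounded_cball[of 0 "1/4"] bounded_cball[of 0 "s/2"]])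
      show "\<bar>\<rho>s s y * (indicator E x * indicator E (x - y))\<bar> \<le> (1 / s) ^ CARD('d) * (2 * 4 ^ CARD('d))" for x y
        using rhos_bounded[OF s(1), of y] s(1) by (auto simp: indicator_def)
      show "x \<notin> cball 0 (1/4) \<or> y \<notin> cball 0 (s/2) \<Longrightarrow> \<rho>s s y * (indicator E x * indicator E (x - y)) = 0" for x y
        using E_out[of x] rhos_zero[OF s(1), of y] by auto
    qed measurable
    also have "\<dots> = (\<integral>y. \<rho>s s y * (\<integral>x. indicator E x * indicator E (x - y) \<partial>lborel) \<partial>lborel)" by simp
    also have "\<dots> \<ge> (\<integral>y. \<rho>s s y * (measure lborel E - e) \<partial>lborel)"
    proof (rule integral_mono)
      show "integrable lborel (\<lambda>y. \<rho>s s y * (measure lborel E - e))" using rhos_integrable[OF s(1)] by simp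
      have "integrable lborel (\<lambda>y. (\<integral>x. indicator E x * indicator E (x - y) \<partial>lborel) * \<rho>s s y)"
      proof -
        have m: "(\<lambda>y. (\<integral>x. indicator E x * indicator E (x - y) \<partial>lborel :: real)) \<in> borel_measurable borel" by measurable
        have b: "\<bar>\<integral>x. indicator E x * indicator E (x - y) \<partial>lborel\<bar> \<le> measure lborel E" for y
        proof -
          have "\<bar>\<integral>x. indicator E x * indicator E (x - y) \<partial>lborel\<bar> \<le> (\<integral>x. \<bar>indicator E x * indicator E (x - y)\<bar> \<partial>lborel :: real)"
            by (rule integral_abs_bound)
          also have "\<dots> \<le> (\<integral>x. indicator E x \<partial>lborel)"
            by (rule integral_mono[OF integrable_bounded_support[OF _ _ E_bounded, of _ 1] E_int]) (auto simp: indicator_def)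
          finally show ?thesis using E(1) by simp
        qed
        have z: "\<rho>s s y = 0" if "y \<notin> cball 0 (s/2)" for y using rhos_zero[OF s(1), of y] that by simp
        show ?thesis
          using integrable_bounded_times_compact_support[OF rhos_continuous[of s] compact_cball[of 0 "s/2"] z m b] by simp
      qed
      then show "integrable lborel (\<lambda>y. \<rho>s s y * (\<integral>x. indicator E x * indicator E (x - y) \<partial>lborel))" by (simp add: mult.commute)
      fix y
      show "\<rho>s s y * (measure lborel E - e) \<le> \<rho>s s y * (\<integral>x. indicator E x * indicator E (x - y) \<partial>lborel)"
      proof (cases "norm y < s")
        case True
        then show ?thesis using d(2)[of y] s rho_nonneg(2)[OF s(1)] by (intro mult_left_mono) auto
      next
        case False
        then show ?thesis using rhos_zero[OF s(1), of y] s by auto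
      qed
    qed
    finally show ?thesis using rhos_integral[OF s(1)] by simp
  qed
  then show ?thesis using d(1) by auto
qed

lemma X_c1c: assumes "0 < s" "s \<le> 1" shows "c1c (cball 0 (3/4)) (X s i) (X' s i)"
  unfolding X_def X'_def
proof (rule conv_c1c[OF E_int compact_cball[of 0 "1/4"] E_out W_c1c[OF assms] compact_cball[of 0 "1/2"] W_zero[OF assms]])
  show "y + z \<in> cball 0 (3/4)" if "y \<in> cball 0 (1/4)" "z \<in> cball 0 (1/2)" for y z :: "real^'d"
    using that norm_triangle_ineq[of y z] by simp
qed

lemma X'_conv: assumes "0 < s" "s \<le> 1"
  shows "X' s i x $ j = conv (indicator E) (\<lambda>x. W' s i x $ j) x" "integrable lborel (\<lambda>y. indicator E y *\<^sub>R W' s i (x - y) $ j)"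
proof -
  obtain B where B: "\<And>x. norm (W' s i x) \<le> B" using c1c_bounds[OF W_c1c[OF assms]] by metis
  have [measurable]: "W' s i \<in> borel_measurable borel" using c1c_cont'[OF W_c1c[OF assms]] by (rule borel_measurable_continuous_onI)
  have i: "integrable lborel (\<lambda>y. indicator E y *\<^sub>R W' s i (x - y))" by (rule integrable_conv[OF E_int _ B]) simp
  show "X' s i x $ j = conv (indicator E) (\<lambda>x. W' s i x $ j) x"
    unfolding X'_def conv_def using integral_bounded_linear[OF bounded_linear_vec_nth i, of j] by simp
  show "integrable lborel (\<lambda>y. indicator E y *\<^sub>R W' s i (x - y) $ j)"
    using integrable_bounded_linear[OF bounded_linear_vec_nth i, of j] by simp
qed

lemma X'_sym: "0 < s \<Longrightarrow> s \<le> 1 \<Longrightarrow> X' s i x $ j = X' s j x $ i"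
  by (simp add: X'_conv(1) W'_sym[of s i _ j])

text \<open>The equation that the potential solves: at each point, \<open>T\<close> paired with the
  derivative of \<open>X\<close> is \<open>trace_W'\<close> integrated over
  \<open>E\<close>.\<close>

lemma X'_trace:
  assumes "0 < s" "s \<le> 1"
  shows "(\<Sum>i\<in>UNIV. \<Sum>j\<in>UNIV. T $ i $ j * X' s i x $ j) = Fs s x - Fs 1 x"
proof -
  have i: "integrable lborel (\<lambda>y. indicator E y *\<^sub>R \<rho>s s (x - y))" if "0 < s" for s
    by (rule integrable_conv[OF E_int]) (use rhos_bounded[OF that] in auto)
  have "(\<Sum>i\<in>UNIV. \<Sum>j\<in>UNIV. T $ i $ j * X' s i x $ j)
    = (\<integral>y. (\<Sum>i\<in>UNIV. \<Sum>j\<in>UNIV. T $ i $ j * (indicator E y *\<^sub>R W' s i (x - y) $ j)) \<partial>lborel)"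
    using X'_conv[OF assms] by (simp add: conv_def)
  also have "\<dots> = (\<integral>y. indicator E y * (\<Sum>i\<in>UNIV. \<Sum>j\<in>UNIV. T $ i $ j * W' s i (x - y) $ j) \<partial>lborel)"
    by (simp add: sum_distrib_left mult_ac)
  also have "\<dots> = (\<integral>y. indicator E y *\<^sub>R \<rho>s s (x - y) - indicator E y *\<^sub>R \<rho>s 1 (x - y) \<partial>lborel)"
    by (simp add: trace_W'[OF assms] rhos_1 algebra_simps)
  also have "\<dots> = Fs s x - Fs 1 x" using i[of s] i[of 1] assms by (simp add: Fs_def conv_def)
  finally show ?thesis .
qed

end

end

section \<open>Sup bound of the potential and the compensated compactness identity\<close>

context ellip
begin

text \<open>This is the trace of \<open>T H T H\<close>. It is the quadratic form that
  Cauchy-Schwarz leaves where the matrix field is only partly filled, and the one whose integral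
  over the derivative of a potential can be computed exactly.\<close>

definition \<tau> :: "('d \<Rightarrow> 'd \<Rightarrow> real) \<Rightarrow> real" where
  "\<tau> H = (\<Sum>i\<in>UNIV. \<Sum>j\<in>UNIV. \<Sum>k\<in>UNIV. \<Sum>l\<in>UNIV. T $ i $ j * T $ k $ l * (H j k * H l i))"

definition unit_vol :: real where "unit_vol = measure lborel (cball (0::real^'d) 1)"

lemma unit_vol_nonneg: "0 \<le> unit_vol" by (simp add: unit_vol_def)

lemma measure_cball_scale:
  assumes "0 \<le> r" shows "measure lborel (cball (x::real^'d) r) = unit_vol * r ^ CARD('d)"
  using content_cball[OF assms, of x] content_cball[of 1 "0::real^'d"] by (simp add: unit_vol_def)

text \<open>The kernel has size \<open>norm z\<close> to the power \<open>1 - d\<close>. Dominating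
  it by multiples of indicators of dyadic balls prepares the scale by scale estimate of the
  potential. The truncation is taken at powers of 1/2, so that \<open>J\<close> counts the
  scales.\<close>

lemma W_bound:
  fixes z :: "real^'d"
  shows "\<bar>W ((1/2)^J) i z\<bar> \<le> (\<Sum>j\<le>J. 2 ^ CARD('d) / lam * ((2^j) ^ CARD('d) / 2^j) * indicator (cball 0 ((1/2)^j)) z)"
    (is "_ \<le> (\<Sum>j\<le>J. ?t j)")
proof -
  have t_nonneg: "0 \<le> ?t j" for j using lam by simp
  have half_sq: "((1/2::real)^j)\<^sup>2 = (1/4)^j" for j by (simp only: power2_eq_square power_mult_distrib[symmetric]) simp
  let ?s = "(1/2::real)^J"
  have s: "0 < ?s" "?s \<le> 1" by (auto simp: power_le_one)
  show ?thesis
  proof (cases "?s\<^sup>2 / 4 < q z \<and> q z < 1")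
    case False
    then have "\<kappa> ?s (q z) = 0" using kappa_small[OF s, of "q z"] kappa_large[OF s, of "q z"] by auto
    then show ?thesis using t_nonneg by (simp add: W_def sum_nonneg)
  next
    case True
    then have qJ: "(1/4) ^ (Suc J) \<le> q z"
      using half_sq[of J] by simp
    \<comment> \<open>The dyadic shell containing \<open>z\<close>: \<open>q z\<close> lies between
      \<open>(1/4) ^ (j + 1)\<close> and \<open>(1/4) ^ j\<close>. The lower bound controls the
      power of \<open>q z\<close>, the upper one gives
      \<open>norm z \<le> (1/2) ^ j\<close>.\<close>
    define j where "j = (LEAST j. (1/4) ^ (Suc j) \<le> q z)"
    have j1: "(1/4) ^ (Suc j) \<le> q z" unfolding j_def by (rule LeastI[of _ J]) (rule qJ)
    have jJ: "j \<le> J" unfolding j_def by (rule Least_le) (rule qJ)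
    have j2: "q z \<le> (1/4) ^ j"
    proof (cases j)
      case (Suc k)
      then have "\<not> (1/4) ^ (Suc k) \<le> q z" using not_less_Least[of k "\<lambda>j. (1/4) ^ (Suc j) \<le> q z"] unfolding j_def by simp
      then show ?thesis using Suc by simp
    qed (use True in simp)
    define b where "b = (1/2::real)^j"
    have b: "0 < b" "b\<^sup>2 = (1/4)^j" "1 / b = 2^j" unfolding b_def by (simp_all only: half_sq) (simp_all add: power_divide)
    have nz: "norm z \<le> b"
    proof -
      have "4 * (norm z)\<^sup>2 \<le> b\<^sup>2" using q_lower[of z] j2 b by simp
      then have "(norm z)\<^sup>2 \<le> b\<^sup>2" using zero_le_power2[of "norm z"] by linarith
      then show ?thesis using b(1) by (simp add: power2_le_iff_abs_le)
    qed
    have k: "\<bar>\<kappa> ?s (q z)\<bar> \<le> (2 / b) ^ CARD('d)"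
    proof -
      have q0: "(b / 2)\<^sup>2 \<le> q z" using j1 b by (simp add: power_divide)
      have "q z powr (- real CARD('d) / 2) \<le> ((b / 2)\<^sup>2) powr (- real CARD('d) / 2)"
        using q0 b by (intro powr_mono2') auto
      also have "\<dots> = (b / 2) powr (- real CARD('d))"
      proof -
        have "(b / 2)\<^sup>2 = (b / 2) powr 2" using b by (simp add: powr_numeral)
        then show ?thesis by (simp add: powr_powr)
      qed
      also have "\<dots> = (2 / b) ^ CARD('d)" using b by (simp add: powr_minus powr_realpow power_divide field_simps)
      finally have p: "q z powr (- real CARD('d) / 2) \<le> (2 / b) ^ CARD('d)" .
      have "\<bar>step (q z / ?s\<^sup>2) - step (q z)\<bar> \<le> 1"
        using step_bounds[of "q z / ?s\<^sup>2"] step_bounds[of "q z"] by linarith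
      then have "q z powr (- real CARD('d) / 2) * \<bar>step (q z / ?s\<^sup>2) - step (q z)\<bar> \<le> (2 / b) ^ CARD('d) * 1"
        using p b by (intro mult_mono) auto
      then show ?thesis by (simp add: \<kappa>_def abs_mult)
    qed
    have A: "\<bar>(A *v z) $ i\<bar> \<le> b / lam"
      using component_le_norm_cart[of "A *v z" i] norm_A[of z] nz lam by (smt (verit) divide_right_mono)
    have "\<bar>W ?s i z\<bar> \<le> (2 / b) ^ CARD('d) * (b / lam)"
      unfolding W_def abs_mult using b by (intro mult_mono k A) auto
    also have "\<dots> = ?t j"
    proof -
      have "2 / b = 2 * (1 / b)" by simp
      then have "2 / b = 2 * 2^j" unfolding b(3) .
      then have "(2 / b) ^ CARD('d) = 2 ^ CARD('d) * (2^j) ^ CARD('d)" by (simp only: power_mult_distrib)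
      moreover have "b = 1 / 2^j" by (simp add: b_def power_divide)
      moreover have "z \<in> cball 0 ((1/2)^j)" using nz by (simp add: b_def)
      ultimately show ?thesis by simp
    qed
    also have "\<dots> \<le> (\<Sum>j\<le>J. ?t j)" using t_nonneg jJ by (intro member_le_sum) auto
    finally show ?thesis .
  qed
qed

lemma min_le_powr:
  fixes a b t :: real
  assumes "0 \<le> a" "0 \<le> b" "0 \<le> t" "t \<le> 1"
  shows "min a b \<le> a powr t * b powr (1 - t)"
proof -
  define m where "m = min a b"
  have m: "0 \<le> m" "m \<le> a" "m \<le> b" using assms by (auto simp: m_def)
  have "m = m powr t * m powr (1 - t)" if "m \<noteq> 0" using m that by (simp add: powr_add[symmetric])
  also have "m powr t * m powr (1 - t) \<le> a powr t * b powr (1 - t)"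
    using m assms by (intro mult_mono powr_mono2) auto
  finally show ?thesis using m_def by (cases "m = 0") auto
qed

context
  fixes E :: "(real^'d) set"
  assumes E: "E \<in> sets borel" "E \<subseteq> cball 0 (1/4)"
begin

text \<open>At radius b, a ball meets \<open>E\<close> in measure at most the minimum of the measure
  of \<open>E\<close> and a multiple of b^d. Interpolating with exponent 1/(2d), strictly below the
  critical 1/d, leaves a factor sqrt b, so the sum over scales is geometric and the bound does not
  depend on \<open>J\<close>. The positive power of the measure of \<open>E\<close> gained here
  makes the dissipation term superlinear.\<close>

lemma X_bound:
  fixes x :: "real^'d"
  shows "\<bar>X E ((1/2)^J) i x\<bar> \<le> 4 * (2 ^ CARD('d) / lam) * (1 + unit_vol) * measure lborel E powr (1 / (2 * real CARD('d)))"
proof -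
  note [measurable] = E(1)
  let ?d = "CARD('d)" and ?e = "measure lborel E" and ?th = "1 / (2 * real CARD('d))"
  let ?K = "2 ^ CARD('d) / lam"
  let ?s = "(1/2::real)^J"
  have s: "0 < ?s" "?s \<le> 1" by (auto simp: power_le_one)
  have "1 \<le> CARD('d)" by (simp add: Suc_leI)
  then have "1 \<le> real CARD('d)" by linarith
  moreover have "0 \<le> 1 / (2 * c)" "1 / (2 * c) \<le> 1" if "1 \<le> c" for c :: real using that by (auto simp: field_simps)
  ultimately have th: "0 \<le> ?th" "?th \<le> 1" by blast+
  have K: "0 \<le> ?K" using lam by simp
  have i1: "integrable lborel (\<lambda>y. indicator E y * indicator (cball 0 r) (x - y) :: real)" for r
    by (rule integrable_bounded_support[OF _ _ E_bounded[OF E], of _ 1]) (auto simp: indicator_def)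
  obtain B where B: "\<And>x. \<bar>W ?s i x\<bar> \<le> B" using c1c_bounds[OF W_c1c[OF s]] by metis
  have [measurable]: "W ?s i \<in> borel_measurable borel" using c1c_cont[OF W_c1c[OF s]] by (rule borel_measurable_continuous_onI)
  have i2: "integrable lborel (\<lambda>y. indicator E y *\<^sub>R W ?s i (x - y))"
    by (rule integrable_conv[OF E_int[OF E]]) (use B in auto)
  have tm: "(2^j) ^ ?d / 2^j * (\<integral>y. indicator E y * indicator (cball 0 ((1/2)^j)) (x - y) \<partial>lborel)
     \<le> (1 + unit_vol) * ?e powr ?th * (sqrt (1/2)) ^ j" for j
  proof -
    define b where "b = (1/2::real)^j"
    have b: "0 < b" "b \<le> 1" "2^j = 1 / b" by (auto simp: b_def power_divide power_le_one)
    let ?I = "\<integral>y. indicator E y * indicator (cball 0 b) (x - y) \<partial>lborel :: real"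
    have "?I \<le> (\<integral>y. indicator E y \<partial>lborel)"
      by (rule integral_mono[OF i1 E_int[OF E]]) (auto simp: indicator_def)
    then have I1: "?I \<le> ?e" using E(1) by simp
    have "?I \<le> (\<integral>y. indicator (cball x b) y \<partial>lborel)"
      by (rule integral_mono[OF i1 integrable_indicator_bounded]) (auto simp: indicator_def dist_norm norm_minus_commute)
    then have I2: "?I \<le> unit_vol * b ^ ?d" using b measure_cball_scale[of b x] by simp
    have "?I \<le> min ?e (unit_vol * b ^ ?d)" using I1 I2 by simp
    also have "\<dots> \<le> ?e powr ?th * (unit_vol * b ^ ?d) powr (1 - ?th)"
      using unit_vol_nonneg b th by (intro min_le_powr) auto
    also have "(unit_vol * b ^ ?d) powr (1 - ?th) = unit_vol powr (1 - ?th) * b powr (?d - 1/2)"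
    proof -
      have "(b ^ ?d) powr (1 - ?th) = b powr (real ?d * (1 - ?th))"
        using b by (simp add: powr_realpow[symmetric] powr_powr)
      also have "real ?d * (1 - ?th) = real ?d - 1/2" by (simp add: field_simps)
      finally show ?thesis using unit_vol_nonneg b by (simp add: powr_mult)
    qed
    also have "unit_vol powr (1 - ?th) \<le> 1 + unit_vol"
    proof (cases "unit_vol \<le> 1")
      case True
      then have "unit_vol powr (1 - ?th) \<le> 1" using unit_vol_nonneg th by (intro powr_le1) auto
      then show ?thesis using unit_vol_nonneg by simp
    next
      case False
      then have "unit_vol powr (1 - ?th) \<le> unit_vol powr 1" using th by (intro powr_mono) auto
      then show ?thesis using False by simp
    qed
    finally have I: "?I \<le> ?e powr ?th * ((1 + unit_vol) * b powr (?d - 1/2))"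
      by (simp add: mult_left_mono mult_right_mono)
    have pw: "(1 / b) ^ ?d * b * b powr (?d - 1/2) = (sqrt (1/2)) ^ j"
    proof -
      have "(1 / b) ^ ?d * b * b powr (?d - 1/2) = b powr (- real ?d) * b powr 1 * b powr (?d - 1/2)"
        using b by (simp add: powr_minus powr_realpow power_divide field_simps)
      also have "\<dots> = b powr (1/2)" by (simp only: powr_add[symmetric]) simp
      also have "\<dots> = sqrt b" using b by (simp add: powr_half_sqrt)
      also have "\<dots> = (sqrt (1/2)) ^ j" by (simp add: b_def real_sqrt_power)
      finally show ?thesis .
    qed
    have "(2^j) ^ ?d / 2^j * ?I = ((1 / b) ^ ?d * b) * ?I" unfolding b(3) by simp
    also have "\<dots> \<le> ((1 / b) ^ ?d * b) * (?e powr ?th * ((1 + unit_vol) * b powr (?d - 1/2)))"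
      using b by (intro mult_left_mono I) auto
    also have "\<dots> = (1 + unit_vol) * ?e powr ?th * ((1 / b) ^ ?d * b * b powr (?d - 1/2))" by (simp add: mult_ac)
    finally show ?thesis unfolding pw unfolding b_def .
  qed
  have "\<bar>X E ?s i x\<bar> \<le> (\<integral>y. \<bar>indicator E y *\<^sub>R W ?s i (x - y)\<bar> \<partial>lborel)"
    unfolding X_def[OF E] conv_def by (rule integral_abs_bound)
  also have "\<dots> \<le> (\<integral>y. (\<Sum>j\<le>J. ?K * ((2^j) ^ ?d / 2^j) * (indicator E y * indicator (cball 0 ((1/2)^j)) (x - y))) \<partial>lborel)"
  proof (rule integral_mono)
    show "integrable lborel (\<lambda>y. \<bar>indicator E y *\<^sub>R W ?s i (x - y)\<bar>)" using i2 by (rule integrable_abs)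
    show "integrable lborel (\<lambda>y. \<Sum>j\<le>J. ?K * ((2^j) ^ ?d / 2^j) * (indicator E y * indicator (cball 0 ((1/2)^j)) (x - y)))"
      by (intro Bochner_Integration.integrable_sum integrable_mult_right i1)
    fix y
    show "\<bar>indicator E y *\<^sub>R W ?s i (x - y)\<bar> \<le> (\<Sum>j\<le>J. ?K * ((2^j) ^ ?d / 2^j) * (indicator E y * indicator (cball 0 ((1/2)^j)) (x - y)))"
      using W_bound[of J i "x - y"] by (cases "y \<in> E") auto
  qed
  also have "\<dots> = (\<Sum>j\<le>J. ?K * ((2^j) ^ ?d / 2^j * (\<integral>y. indicator E y * indicator (cball 0 ((1/2)^j)) (x - y) \<partial>lborel)))"
    using i1 by (simp add: mult.assoc)
  also have "\<dots> \<le> (\<Sum>j\<le>J. ?K * ((1 + unit_vol) * ?e powr ?th * (sqrt (1/2)) ^ j))"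
    by (intro sum_mono mult_left_mono tm K)
  also have "\<dots> = ?K * ((1 + unit_vol) * ?e powr ?th) * (\<Sum>j\<le>J. (sqrt (1/2)) ^ j)"
    unfolding sum_distrib_left by (simp only: mult.assoc)
  also have "\<dots> \<le> ?K * ((1 + unit_vol) * ?e powr ?th) * 4"
  proof (intro mult_left_mono)
    have r: "0 \<le> sqrt (1/2::real)" "sqrt (1/2::real) \<le> 3/4"
      by simp (rule real_le_lsqrt, simp_all add: power2_eq_square)
    have "(\<Sum>j\<le>J. (sqrt (1/2::real)) ^ j) = (1 - sqrt (1/2) ^ Suc J) / (1 - sqrt (1/2))"
    proof -
      have "sqrt (1/2::real) \<noteq> 1" using r(2) by linarith
      then show ?thesis unfolding sum_gp0 by (simp only: if_False)
    qed
    also have "\<dots> \<le> 1 / (1 - sqrt (1/2))" using r by (intro divide_right_mono) auto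
    also have "\<dots> \<le> 1 / (1 - 3/4)" using r by (intro divide_left_mono) auto
    finally show "(\<Sum>j\<le>J. (sqrt (1/2::real)) ^ j) \<le> 4" by simp
  next
    show "0 \<le> ?K * ((1 + unit_vol) * ?e powr ?th)" using K unit_vol_nonneg by (intro mult_nonneg_nonneg) auto
  qed
  finally show ?thesis by (simp add: mult_ac)
qed

lemma X'_prod_integrable:
  assumes "0 < s" "s \<le> 1"
  shows "integrable lborel (\<lambda>x. X' E s i x $ j * X' E s k x $ l)"
proof (rule integrable_compact_support[OF _ compact_cball[of 0 "3/4"]])
  show "continuous_on UNIV (\<lambda>x. X' E s i x $ j * X' E s k x $ l)"
    using c1c_cont'[OF X_c1c[OF E assms]] by (intro continuous_intros) auto
  fix x :: "real^'d" assume x: "x \<notin> cball 0 (3/4)"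
  obtain K where "K \<subseteq> cball 0 (3/4)" "\<And>x. x \<notin> K \<Longrightarrow> X' E s i x = 0"
    using c1c_support[OF X_c1c[OF E assms, of i]] by metis
  then have "X' E s i x = 0" using x by blast
  then show "X' E s i x $ j * X' E s k x $ l = 0" by simp
qed

lemma X'_zero:
  assumes "0 < s" "s \<le> 1" "x \<notin> cball 0 (3/4)"
  shows "X' E s i x = 0"
proof -
  obtain K where "K \<subseteq> cball 0 (3/4)" "\<And>x. x \<notin> K \<Longrightarrow> X' E s i x = 0"
    using c1c_support[OF X_c1c[OF E assms(1,2), of i]] by metis
  then show ?thesis using assms(3) by blast
qed

lemma tau_integrable:
  assumes "0 < s" "s \<le> 1"
  shows "integrable lborel (\<lambda>x. \<tau> (\<lambda>i j. X' E s i x $ j))"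
  unfolding \<tau>_def by (intro Bochner_Integration.integrable_sum integrable_mult_right X'_prod_integrable[OF assms])

text \<open>Pointwise, the trace of \<open>T DX T DX\<close> and the square of the trace of
  \<open>T DX\<close> are different. Under the integral they agree: \<open>DX\<close> is symmetric,
  and two directions of differentiation may be exchanged by
  \<open>integral_c1c_deriv_commute\<close>. The square is explicit by
  \<open>X'_trace\<close>.\<close>

lemma tau_integral:
  assumes "0 < s" "s \<le> 1"
  shows "(\<integral>x. \<tau> (\<lambda>i j. X' E s i x $ j) \<partial>lborel) \<le> 2 * cA\<^sup>2 * measure lborel E"
proof -
  note int = X'_prod_integrable[OF assms]
  have comm: "(\<integral>x. X' E s j x $ k * X' E s l x $ i \<partial>lborel) = (\<integral>x. X' E s k x $ l * X' E s i x $ j \<partial>lborel)" for i j k l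
  proof -
    have "(\<integral>x. X' E s j x $ k * X' E s l x $ i \<partial>lborel) = (\<integral>x. X' E s k x $ j * X' E s i x $ l \<partial>lborel)"
      by (simp add: X'_sym[OF E assms, of j _ k] X'_sym[OF E assms, of l _ i])
    also have "\<dots> = (\<integral>x. X' E s k x $ l * X' E s i x $ j \<partial>lborel)"
      using integral_c1c_deriv_commute[OF X_c1c[OF E assms, of k] X_c1c[OF E assms, of i], of "axis j 1" "axis l 1"]
      by (simp add: inner_axis)
    finally show ?thesis .
  qed
  have "(\<integral>x. \<tau> (\<lambda>i j. X' E s i x $ j) \<partial>lborel) = (\<Sum>i\<in>UNIV. \<Sum>j\<in>UNIV. \<Sum>k\<in>UNIV. \<Sum>l\<in>UNIV. T $ i $ j * T $ k $ l * (\<integral>x. X' E s j x $ k * X' E s l x $ i \<partial>lborel))"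
    unfolding \<tau>_def by (simp add: int Bochner_Integration.integrable_sum)
  also have "\<dots> = (\<Sum>i\<in>UNIV. \<Sum>j\<in>UNIV. \<Sum>k\<in>UNIV. \<Sum>l\<in>UNIV. T $ i $ j * T $ k $ l * (\<integral>x. X' E s k x $ l * X' E s i x $ j \<partial>lborel))"
    by (intro sum.cong refl arg_cong2[where f = times] comm)
  also have "\<dots> = (\<integral>x. (\<Sum>i\<in>UNIV. \<Sum>j\<in>UNIV. \<Sum>k\<in>UNIV. \<Sum>l\<in>UNIV. T $ i $ j * T $ k $ l * (X' E s k x $ l * X' E s i x $ j)) \<partial>lborel)"
    by (simp add: int Bochner_Integration.integrable_sum)
  also have "\<dots> = (\<integral>x. (Fs E s x - Fs E 1 x)\<^sup>2 \<partial>lborel)"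
  proof (rule Bochner_Integration.integral_cong[OF refl])
    fix x
    show "(\<Sum>i\<in>UNIV. \<Sum>j\<in>UNIV. \<Sum>k\<in>UNIV. \<Sum>l\<in>UNIV. T $ i $ j * T $ k $ l * (X' E s k x $ l * X' E s i x $ j)) = (Fs E s x - Fs E 1 x)\<^sup>2"
      unfolding X'_trace[OF E assms, symmetric] power2_eq_square sum_product
      by (simp add: sum_distrib_left sum_distrib_right mult_ac) (rule sum.cong[OF refl], rule sum.swap)
  qed
  also have "\<dots> \<le> 2 * cA\<^sup>2 * measure lborel E" by (rule Fs_diff_L2[OF E assms])
  finally show ?thesis .
qed

text \<open>The main estimate. \<open>Tu\<close> stands for the truncated matrix field: it equals \<open>T\<close> on \<open>L\<close>, vanishes off
  \<open>L \<union> V\<close>, and on \<open>V\<close> it is controlled through Cauchy--Schwarz. Pairing \<open>Tu\<close> with the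
  derivative of \<open>X\<close>, which solves \<open>T : DX = Fs s - Fs 1\<close>, and letting \<open>s\<close> tend to 0 bounds the measure of \<open>E\<close>.\<close>

lemma key_inequality:
  fixes \<epsilon> B D :: real
  assumes Tu: "\<And>i j. (\<lambda>x. Tu x i j) \<in> borel_measurable borel" "\<And>x i j. \<bar>Tu x i j\<bar> \<le> B"
    and L: "L \<in> sets borel" "E \<subseteq> L" "\<And>x i j. x \<in> L \<Longrightarrow> Tu x i j = T $ i $ j"
    and V: "V \<in> sets borel" "\<And>x i j. x \<notin> L \<Longrightarrow> x \<notin> V \<Longrightarrow> Tu x i j = 0"
    and e: "\<epsilon> > 0"
    and VH: "\<And>x H. x \<in> V \<Longrightarrow> (\<And>i j. H i j = H j i) \<Longrightarrow>
        \<bar>\<Sum>i\<in>UNIV. \<Sum>j\<in>UNIV. Tu x i j * H i j\<bar> \<le> (\<epsilon> * CARD('d) + \<tau> H / \<epsilon>) / 2"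
    and tau: "\<And>H. (\<And>i j. H i j = H j i) \<Longrightarrow> 0 \<le> \<tau> H"
    and D: "\<And>J. (\<integral>x. (\<Sum>i\<in>UNIV. \<Sum>j\<in>UNIV. Tu x i j * X' E ((1/2)^J) i x $ j) \<partial>lborel) \<le> D"
  shows "cA * measure lborel E \<le> (\<integral>x. indicator L x * Fs E 1 x \<partial>lborel)
     + \<epsilon> * CARD('d) / 2 * measure lborel (V \<inter> cball 0 (3/4)) + cA\<^sup>2 * measure lborel E / \<epsilon> + D" (is "_ \<le> ?R")
proof -
  note [measurable] = E(1) L(1) V(1)
  have main: "(\<integral>x. indicator E x * Fs E ((1/2)^J) x \<partial>lborel) \<le> ?R" for J
  proof -
    let ?s = "(1/2::real)^J"
    have s: "0 < ?s" "?s \<le> 1" by (auto simp: power_le_one)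
    define P where "P x = (\<Sum>i\<in>UNIV. \<Sum>j\<in>UNIV. Tu x i j * X' E ?s i x $ j)" for x
    let ?H = "\<lambda>x i j. X' E ?s i x $ j"
    have iP: "integrable lborel P"
      unfolding P_def
    proof (intro Bochner_Integration.integrable_sum)
      fix i j
      show "integrable lborel (\<lambda>x. Tu x i j * X' E ?s i x $ j)"
        using integrable_bounded_times_compact_support[of "\<lambda>x. X' E ?s i x $ j" "cball 0 (3/4)", OF _ compact_cball _ Tu(1)[of i j] Tu(2)]
          c1c_cont'[OF X_c1c[OF E s, of i]] X'_zero[OF s]
        by (simp add: continuous_on_component)
    qed
    have iF: "integrable lborel (\<lambda>x. indicator S x * Fs E r x)" if "S \<in> sets borel" "0 < r" "r \<le> 1" for S r
      using integrable_bounded_times_compact_support[OF Fs_continuous[OF E that(2)] compact_cball[of 0 "3/4"] _ borel_measurable_indicator[OF that(1)], of 1]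
        Fs_zero[OF E that(2,3)] by (auto simp: indicator_def)
    have iV: "integrable lborel (indicator (V \<inter> cball 0 (3/4)) :: real^'d \<Rightarrow> real)"
      by (intro integrable_indicator_bounded) auto
    have "(\<integral>x. indicator E x * Fs E ?s x \<partial>lborel) \<le> (\<integral>x. indicator L x * Fs E 1 x + P x
        + (\<epsilon> * CARD('d) / 2 * indicator (V \<inter> cball 0 (3/4)) x + \<tau> (?H x) / (2 * \<epsilon>)) \<partial>lborel)"
    proof (rule integral_mono)
      show "integrable lborel (\<lambda>x. indicator E x * Fs E ?s x)" using iF[OF E(1)] s by simp
      show "integrable lborel (\<lambda>x. indicator L x * Fs E 1 x + P x
        + (\<epsilon> * CARD('d) / 2 * indicator (V \<inter> cball 0 (3/4)) x + \<tau> (?H x) / (2 * \<epsilon>)))"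
        using iF[OF L(1), of 1] iP iV tau_integrable[OF s] by (intro Bochner_Integration.integrable_add integrable_mult_right integrable_divide) auto
      fix x
      have sym: "?H x i j = ?H x j i" for i j by (rule X'_sym[OF E s])
      have t0: "0 \<le> \<tau> (?H x) / (2 * \<epsilon>)" using tau[of "?H x"] sym e by simp
      have F0: "0 \<le> Fs E ?s x" "0 \<le> Fs E 1 x" using Fs_bounds[OF E] s by auto
      have V0: "0 \<le> \<epsilon> * CARD('d) / 2 * indicator (V \<inter> cball 0 (3/4)) x" using e by simp
      show "indicator E x * Fs E ?s x \<le> indicator L x * Fs E 1 x + P x
        + (\<epsilon> * CARD('d) / 2 * indicator (V \<inter> cball 0 (3/4)) x + \<tau> (?H x) / (2 * \<epsilon>))"
      \<comment> \<open>On \<open>L\<close> the pairing is exactly \<open>Fs s - Fs 1\<close>, which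
        accounts for both terms in \<open>Fs\<close>. Off \<open>L\<close> there is nothing on the
        left, and the pairing is nonzero only on \<open>V\<close> within the support of the
        potential, where the hypothesis on \<open>V\<close> applies.\<close>
      proof (cases "x \<in> L")
        case True
        then have "P x = Fs E ?s x - Fs E 1 x" unfolding P_def using L(3) X'_trace[OF E s] by simp
        then show ?thesis using True t0 F0 V0 by (auto simp: indicator_def)
      next
        case False
        then have xE: "x \<notin> E" using L(2) by blast
        show ?thesis
        proof (cases "x \<in> V \<inter> cball 0 (3/4)")
          case True
          have "\<bar>P x\<bar> \<le> (\<epsilon> * CARD('d) + \<tau> (?H x) / \<epsilon>) / 2"
            unfolding P_def by (rule VH) (use True sym in auto)
          then have "- P x \<le> (\<epsilon> * CARD('d) + \<tau> (?H x) / \<epsilon>) / 2" by linarith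
          then have "0 \<le> P x + (\<epsilon> * CARD('d) / 2 + \<tau> (?H x) / (2 * \<epsilon>))" by (simp add: add_divide_distrib)
          then show ?thesis using True False xE by simp
        next
          case F: False
          then have "P x = 0" using V(2)[OF False] X'_zero[OF s] by (auto simp: P_def)
          then show ?thesis using F False xE t0 by simp
        qed
      qed
    qed
    also have "\<dots> = (\<integral>x. indicator L x * Fs E 1 x \<partial>lborel) + (\<integral>x. P x \<partial>lborel)
        + (\<epsilon> * CARD('d) / 2 * measure lborel (V \<inter> cball 0 (3/4)) + (\<integral>x. \<tau> (?H x) \<partial>lborel) / (2 * \<epsilon>))"
      using iF[OF L(1), of 1] iP iV tau_integrable[OF s] by simp
    also have "\<dots> \<le> ?R"
    proof -
      have "(\<integral>x. \<tau> (?H x) \<partial>lborel) / (2 * \<epsilon>) \<le> (2 * cA\<^sup>2 * measure lborel E) / (2 * \<epsilon>)"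
        using e by (intro divide_right_mono tau_integral[OF s]) auto
      then show ?thesis using D[of J] by (simp add: P_def)
    qed
    finally show ?thesis .
  qed
  show ?thesis
  proof (rule field_le_epsilon)
    fix e' :: real assume e': "e' > 0"
    then have "e' / (cA + 1) > 0" using cA_nonneg by simp
    \<comment> \<open>The scale \<open>s\<close> is sent to 0 along powers of 1/2 at the very end,
      since none of the terms on the right depends on it.\<close>
    then obtain d where d: "d > 0" "\<And>s. 0 < s \<Longrightarrow> s < d \<Longrightarrow> cA * (measure lborel E - e' / (cA + 1)) \<le> (\<integral>x. indicator E x * Fs E s x \<partial>lborel)"
      using Fs_concentrates[OF E] by metis
    obtain J where J: "(1/2::real)^J < d" using real_arch_pow_inv[OF d(1), of "1/2"] by auto
    have "cA * (measure lborel E - e' / (cA + 1)) \<le> ?R" using d(2)[OF _ J] main[of J] by simp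
    moreover have "cA * (e' / (cA + 1)) \<le> e'" using cA_nonneg e' by (simp add: field_simps)
    ultimately show "cA * measure lborel E \<le> ?R + e'" by (simp add: algebra_simps)
  qed
qed

end

end

subsection \<open>Kinetic solutions and the averaged matrix of a window\<close>

text \<open>\<open>g\<close> is the derivative of an entropy, \<open>g'\<close> its second
  derivative and \<open>G\<close> the entropy flux. Bounded support is asked of \<open>g'\<close>
  and not of \<open>g\<close>, which may tend to different constants at the two ends.\<close>

definition fl :: "(real \<Rightarrow> 'a::euclidean_space) \<Rightarrow> (real \<Rightarrow> real) \<Rightarrow> (real \<Rightarrow> real) \<Rightarrow> (real \<Rightarrow> 'a) \<Rightarrow> bool" where
  "fl a g g' G \<longleftrightarrow> (\<forall>v. (g has_real_derivative g' v) (at v)) \<and> continuous_on UNIV g' \<and>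
     (\<exists>N. \<forall>v. N < \<bar>v\<bar> \<longrightarrow> g' v = 0) \<and> (\<forall>v. (G has_vector_derivative g v *\<^sub>R a v) (at v))"

text \<open>The kinetic formulation with the measure eliminated. If the pairing of
  \<open>G (u x)\<close> with the gradient of \<open>ph\<close> is the integral of \<open>ph\<close>
  times \<open>g'\<close> against a nonnegative measure, then domination of \<open>ph\<close> by
  \<open>\<xi>\<close> and of \<open>g'\<close> by \<open>h'\<close> gives this inequality. The
  right-hand side takes over the role of the dissipation.\<close>

definition kin :: "(real \<Rightarrow> 'a::euclidean_space) \<Rightarrow> ('a \<Rightarrow> real) \<Rightarrow> 'a set \<Rightarrow> bool" where
  "kin a u U \<longleftrightarrow> (\<forall>ph ph' \<xi> \<xi>' g g' G h h' H.
     c1c U ph ph' \<and> c1c U \<xi> \<xi>' \<and> fl a g g' G \<and> fl a h h' H \<and> (\<forall>x. \<bar>ph x\<bar> \<le> \<xi> x) \<and> (\<forall>v. \<bar>g' v\<bar> \<le> h' v) \<longrightarrow>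
     \<bar>\<integral>x. G (u x) \<bullet> ph' x \<partial>lborel\<bar> \<le> (\<integral>x. H (u x) \<bullet> \<xi>' x \<partial>lborel))"

lemma c1c_scale: "c1c U f f' \<Longrightarrow> c1c U (\<lambda>x. c * f x) (\<lambda>x. c *\<^sub>R f' x)"
  unfolding c1c_def by (auto intro!: derivative_eq_intros continuous_intros)

lemma fl_scale: "fl a g g' G \<Longrightarrow> fl a (\<lambda>v. c * g v) (\<lambda>v. c * g' v) (\<lambda>v. c *\<^sub>R G v)"
  unfolding fl_def by (auto intro!: derivative_eq_intros continuous_intros simp: has_real_derivative_iff_has_vector_derivative)

lemma fl_continuous: "fl a g g' G \<Longrightarrow> continuous_on UNIV G"
  unfolding fl_def by (meson continuous_at_imp_continuous_on has_vector_derivative_continuous)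

lemma kinD:
  assumes "kin a u U" "c1c U ph ph'" "c1c U \<xi> \<xi>'" "fl a g g' G" "fl a h h' H" "\<And>x. \<bar>ph x\<bar> \<le> \<xi> x" "\<And>v. \<bar>g' v\<bar> \<le> h' v"
  shows "\<bar>\<integral>x. G (u x) \<bullet> ph' x \<partial>lborel\<bar> \<le> (\<integral>x. H (u x) \<bullet> \<xi>' x \<partial>lborel)"
  using assms unfolding kin_def by meson

lemma kin_bound:
  assumes k: "kin a u U" and ph: "c1c U ph ph'" and \<xi>: "c1c U \<xi> \<xi>'" and g: "fl a g g' G" and h: "fl a h h' H"
    and M: "\<And>x. \<bar>ph x\<bar> \<le> M * \<xi> x" and K: "\<And>v. \<bar>g' v\<bar> \<le> K * h' v"
  shows "\<bar>\<integral>x. G (u x) \<bullet> ph' x \<partial>lborel\<bar> \<le> M * K * (\<integral>x. H (u x) \<bullet> \<xi>' x \<partial>lborel)"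
  using kinD[OF k ph c1c_scale[OF \<xi>, of M] g fl_scale[OF h, of K] M K] by (simp add: mult_ac)

lemma AM_GM_sq:
  fixes z P R e :: real
  assumes "z\<^sup>2 \<le> P * R" "0 \<le> P" "0 \<le> R" "e > 0"
  shows "\<bar>z\<bar> \<le> (e * P + R / e) / 2"
proof -
  have "z\<^sup>2 \<le> ((e * P + R / e) / 2)\<^sup>2"
  proof -
    have "((e * P + R / e) / 2)\<^sup>2 - P * R = ((e * P - R / e) / 2)\<^sup>2" using assms(4) by (simp add: power2_eq_square field_simps)
    then show ?thesis using assms(1) zero_le_power2[of "(e * P - R / e) / 2"] by linarith
  qed
  then show ?thesis using assms by (simp add: power2_le_iff_abs_le)
qed

locale flux_gn =
  fixes a a' :: "real \<Rightarrow> real^'d" and lo hi Cg pg :: real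
  assumes a_deriv: "\<And>v. (a has_vector_derivative a' v) (at v)" and a'_cont: "continuous_on UNIV a'"
    and Cg: "Cg > 0" and pg: "pg > 0"
    and GN: "\<And>\<xi> \<delta>. norm \<xi> = 1 \<Longrightarrow> 0 < \<delta> \<Longrightarrow> measure lborel {v \<in> {lo..hi}. \<bar>a v \<bullet> \<xi>\<bar> < \<delta>} \<le> Cg * \<delta> powr pg"
begin

lemma a_cont: "continuous_on S a"
  by (meson a_deriv continuous_at_imp_continuous_on has_vector_derivative_continuous)

lemma a_comp_deriv: "((\<lambda>v. a v $ i) has_real_derivative a' v $ i) (at v)"
  unfolding has_real_derivative_iff_has_vector_derivative
  by (rule bounded_linear.has_vector_derivative[OF bounded_linear_vec_nth a_deriv])

definition Ba :: real where
  "Ba = (SOME B. B \<ge> 1 \<and> (\<forall>v\<in>{lo..hi}. norm (a v) \<le> B \<and> norm (a' v) \<le> B))"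

lemma Ba: "Ba \<ge> 1" "v \<in> {lo..hi} \<Longrightarrow> norm (a v) \<le> Ba" "v \<in> {lo..hi} \<Longrightarrow> norm (a' v) \<le> Ba"
proof -
  have "bounded (a ` {lo..hi})" "bounded (a' ` {lo..hi})"
    by (intro compact_imp_bounded compact_continuous_image a_cont continuous_on_subset[OF a'_cont]; simp)+
  then obtain B1 B2 where "\<forall>v\<in>{lo..hi}. norm (a v) \<le> B1" "\<forall>v\<in>{lo..hi}. norm (a' v) \<le> B2"
    by (auto simp: bounded_iff)
  then have "\<exists>B. B \<ge> 1 \<and> (\<forall>v\<in>{lo..hi}. norm (a v) \<le> B \<and> norm (a' v) \<le> B)"
    by (intro exI[of _ "max 1 (max B1 B2)"]) (auto simp: le_max_iff_disj)
  from someI_ex[OF this] show "Ba \<ge> 1" "v \<in> {lo..hi} \<Longrightarrow> norm (a v) \<le> Ba" "v \<in> {lo..hi} \<Longrightarrow> norm (a' v) \<le> Ba"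
    unfolding Ba_def[symmetric] by blast+
qed

text \<open>The normalisation behind the bound 1/4 for \<open>T\<close>: inside a window the two
  squared factors of \<open>\<psi>\<close> contribute at most the fourth power of
  \<open>1 + (hi - lo)\<close>, the length of the window one more, and \<open>a \<otimes> a\<close>
  the square of \<open>Ba\<close>.\<close>

definition c0 :: real where "c0 = 1 / (4 * (1 + \<bar>hi - lo\<bar>) ^ 5 * Ba\<^sup>2)"

lemma c0_pos: "c0 > 0"
proof -
  have "(1 + \<bar>hi - lo\<bar>) > 0" by linarith
  then show ?thesis using Ba(1) unfolding c0_def by (intro divide_pos_pos mult_pos_pos zero_less_power) auto
qed

text \<open>The squares make the weight C1 across both ends of the window, so that
  \<open>\<psi>\<close> times a component of \<open>a\<close> is admissible as an entropy
  derivative. Their order also fixes the power of the window length in \<open>lam\<close>.\<close>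

definition \<psi> :: "real \<Rightarrow> real \<Rightarrow> real \<Rightarrow> real" where
  "\<psi> k w v = c0 * ((max 0 (v - k))\<^sup>2 * (max 0 (w - v))\<^sup>2)"

definition \<psi>' :: "real \<Rightarrow> real \<Rightarrow> real \<Rightarrow> real" where
  "\<psi>' k w v = c0 * (2 * max 0 (v - k) * (max 0 (w - v))\<^sup>2 - (max 0 (v - k))\<^sup>2 * (2 * max 0 (w - v)))"

lemma DERIV_psi: "(\<psi> k w has_real_derivative \<psi>' k w v) (at v)"
proof -
  have 1: "((\<lambda>t::real. (max 0 (t - k))\<^sup>2) has_real_derivative 2 * max 0 (v - k)) (at v)"
  proof -
    have g: "((\<lambda>t. t - k) has_real_derivative 1) (at v)" by (auto intro!: derivative_eq_intros)
    from DERIV_chain2[where f = "\<lambda>t::real. (max 0 t)\<^sup>2", OF DERIV_max_0_sq g] show ?thesis by simp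
  qed
  have 2: "((\<lambda>t::real. (max 0 (w - t))\<^sup>2) has_real_derivative - (2 * max 0 (w - v))) (at v)"
  proof -
    have g: "((\<lambda>t. w - t) has_real_derivative -1) (at v)" by (auto intro!: derivative_eq_intros)
    from DERIV_chain2[where f = "\<lambda>t::real. (max 0 t)\<^sup>2", OF DERIV_max_0_sq g] show ?thesis by simp
  qed
  show ?thesis
    unfolding \<psi>_def[abs_def] using DERIV_cmult[OF DERIV_mult[OF 1 2], of c0] by (rule DERIV_cong) (simp add: \<psi>'_def)
qed

lemma psi_cont: "continuous_on S (\<psi> k w)" "continuous_on S (\<psi>' k w)"
  unfolding \<psi>_def[abs_def] \<psi>'_def[abs_def] by (auto intro!: continuous_intros)

lemma psi_nonneg: "0 \<le> \<psi> k w v" using c0_pos by (simp add: \<psi>_def)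

lemma psi_zero: "v \<notin> {k..w} \<Longrightarrow> \<psi> k w v = 0" "v \<notin> {k..w} \<Longrightarrow> \<psi>' k w v = 0"
  by (auto simp: \<psi>_def \<psi>'_def)

end

locale window = flux_gn a a' lo hi Cg pg for a a' :: "real \<Rightarrow> real^'d" and lo hi Cg pg +
  fixes k w :: real
  assumes kw: "lo \<le> k" "k < w" "w \<le> hi"
begin

lemma len: "0 < w - k" "w - k \<le> hi - lo" "0 < hi - lo" using kw by auto

lemma psi_le: "\<psi> k w v \<le> 1 / (4 * (1 + (hi - lo)) * Ba\<^sup>2)"
proof (cases "v \<in> {k..w}")
  case True
  let ?D = "1 + (hi - lo)"
  have D: "?D > 0" using len by simp
  have "(max 0 (v - k))\<^sup>2 \<le> ?D\<^sup>2" "(max 0 (w - v))\<^sup>2 \<le> ?D\<^sup>2" using True len by (intro power_mono; simp)+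
  then have "(max 0 (v - k))\<^sup>2 * (max 0 (w - v))\<^sup>2 \<le> ?D\<^sup>2 * ?D\<^sup>2" by (intro mult_mono) auto
  then have "\<psi> k w v \<le> c0 * (?D\<^sup>2 * ?D\<^sup>2)" unfolding \<psi>_def using c0_pos by (intro mult_left_mono) auto
  also have "?D\<^sup>2 * ?D\<^sup>2 = ?D ^ 4" by (simp flip: power_add)
  also have "c0 * ?D ^ 4 = 1 / (4 * ?D * Ba\<^sup>2)"
  proof -
    have "?D ^ 5 = ?D * ?D ^ 4" by (simp add: power_Suc[symmetric])
    then show ?thesis unfolding c0_def using D len by simp
  qed
  finally show ?thesis .
next
  case False
  then show ?thesis using psi_zero[OF False] len by simp
qed

lemma psi_prod_integrable:
  assumes "continuous_on UNIV f"
  shows "integrable lborel (\<lambda>v. \<psi> k w v * (f v :: real))"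
  by (rule integrable_compact_support[OF _ compact_Icc[of k w]]) (auto intro!: continuous_intros psi_cont assms simp: psi_zero)

lemma a_comp_cont: "continuous_on S (\<lambda>v. a v $ i)" by (intro continuous_intros a_cont)

definition T :: "real^'d^'d" where "T = (\<chi> i j. \<integral>v. \<psi> k w v * (a v $ i * a v $ j) \<partial>lborel)"

lemma aa_integrable: "integrable lborel (\<lambda>v. \<psi> k w v * (a v $ i * a v $ j))"
  by (intro psi_prod_integrable continuous_intros a_comp_cont)

lemma integral_quadratic: "(\<integral>v. \<psi> k w v * (\<Sum>i\<in>UNIV. \<Sum>j\<in>UNIV. M i j * (a v $ i * a v $ j)) \<partial>lborel)
   = (\<Sum>i\<in>UNIV. \<Sum>j\<in>UNIV. M i j * T $ i $ j)"
proof -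
  have "(\<integral>v. \<psi> k w v * (\<Sum>i\<in>UNIV. \<Sum>j\<in>UNIV. M i j * (a v $ i * a v $ j)) \<partial>lborel)
    = (\<integral>v. (\<Sum>i\<in>UNIV. \<Sum>j\<in>UNIV. M i j * (\<psi> k w v * (a v $ i * a v $ j))) \<partial>lborel)"
    by (simp add: sum_distrib_left mult_ac)
  also have "\<dots> = (\<Sum>i\<in>UNIV. \<Sum>j\<in>UNIV. M i j * T $ i $ j)"
    by (simp add: aa_integrable Bochner_Integration.integrable_sum T_def)
  finally show ?thesis .
qed

lemma quad_form: "(\<Sum>i\<in>UNIV. \<Sum>j\<in>UNIV. x $ i * y $ j * (a v $ i * a v $ j)) = (a v \<bullet> x) * (a v \<bullet> y)"
  by (simp add: inner_vec_def sum_product mult_ac)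

lemma T_inner_eq: "x \<bullet> (T *v y) = (\<integral>v. \<psi> k w v * ((a v \<bullet> x) * (a v \<bullet> y)) \<partial>lborel)"
proof -
  have "x \<bullet> (T *v y) = (\<Sum>i\<in>UNIV. \<Sum>j\<in>UNIV. (x $ i * y $ j) * T $ i $ j)"
    by (simp add: inner_vec_def matrix_vector_mult_def sum_distrib_left mult_ac)
  then show ?thesis unfolding integral_quadratic[symmetric] quad_form .
qed

lemma T_sym: "transpose T = T"
  by (simp add: T_def transpose_def mult.commute)

definition lam :: real where "lam = c0 * ((w - k) / 4) ^ 5 * ((w - k) / (4 * Cg)) powr (2 / pg)"

lemma lam_pos: "0 < lam" unfolding lam_def using c0_pos len Cg by simp

lemma ax_integrable: "integrable lborel (\<lambda>v. \<psi> k w v * ((a v \<bullet> x) * (a v \<bullet> y)))"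
  by (intro psi_prod_integrable continuous_intros a_cont)

lemma T_upper: "x \<bullet> (T *v x) \<le> (x \<bullet> x) / 4"
proof -
  have "x \<bullet> (T *v x) \<le> (\<integral>v. (1 / (4 * (1 + (hi - lo))) * (x \<bullet> x)) * indicator {k..w} v \<partial>lborel)"
    unfolding T_inner_eq
  proof (rule integral_mono[OF ax_integrable])
    show "integrable lborel (\<lambda>v. (1 / (4 * (1 + (hi - lo))) * (x \<bullet> x)) * indicator {k..w} v)"
      by (intro integrable_mult_right integrable_indicator_bounded) auto
    fix v
    show "\<psi> k w v * ((a v \<bullet> x) * (a v \<bullet> x)) \<le> (1 / (4 * (1 + (hi - lo))) * (x \<bullet> x)) * indicator {k..w} v"
    proof (cases "v \<in> {k..w}")
      case True
      then have "norm (a v) \<le> Ba" using kw by (intro Ba(2)) auto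
      then have "\<bar>a v \<bullet> x\<bar> \<le> Ba * norm x"
        using Cauchy_Schwarz_ineq2[of "a v" x] by (meson mult_right_mono norm_ge_zero order_trans)
      then have "(a v \<bullet> x)\<^sup>2 \<le> (Ba * norm x)\<^sup>2" using Ba(1) by (simp add: power2_le_iff_abs_le)
      then have "\<psi> k w v * (a v \<bullet> x)\<^sup>2 \<le> 1 / (4 * (1 + (hi - lo)) * Ba\<^sup>2) * (Ba * norm x)\<^sup>2"
        using len by (intro mult_mono psi_le) auto
      also have "\<dots> = 1 / (4 * (1 + (hi - lo))) * (x \<bullet> x)"
        using Ba(1) by (simp add: power_mult_distrib power2_norm_eq_inner[symmetric])
      finally show ?thesis using True by (simp add: power2_eq_square)
    qed (simp add: psi_zero)
  qed
  also have "\<dots> = (1 / (4 * (1 + (hi - lo))) * (x \<bullet> x)) * (w - k)" using len by simp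
  also have "\<dots> = (w - k) / (1 + (hi - lo)) * ((x \<bullet> x) / 4)" by (simp add: mult_ac)
  also have "\<dots> \<le> 1 * ((x \<bullet> x) / 4)" using len by (intro mult_right_mono) auto
  finally show ?thesis by simp
qed

text \<open>The number \<open>\<delta>\<close> is chosen so that (GN) lets
  \<open>\<bar>a v \<bullet> x\<bar> < \<delta>\<close> hold on at most a quarter of the window's
  length. At least another quarter is left in the middle half, where \<open>\<psi>\<close> is at
  least \<open>c0\<close> times the fourth power of a quarter of the length. Hence the fifth power
  and the exponent \<open>2 / pg\<close> in \<open>lam\<close>.\<close>

lemma T_lower_unit:
  assumes x: "norm x = 1"
  shows "lam \<le> x \<bullet> (T *v x)"
proof -
  let ?l = "w - k"
  define \<delta> where "\<delta> = (?l / (4 * Cg)) powr (1 / pg)"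
  have \<delta>: "\<delta> > 0" "Cg * \<delta> powr pg = ?l / 4"
    using len Cg pg by (auto simp: \<delta>_def powr_powr)
  define M where "M = {k + ?l/4 .. w - ?l/4}"
  define S where "S = {v \<in> {lo..hi}. \<bar>a v \<bullet> x\<bar> < \<delta>}"
  have cont: "continuous_on UNIV (\<lambda>v. \<bar>a v \<bullet> x\<bar>)" by (intro continuous_intros a_cont)
  have m: "(\<lambda>v. \<bar>a v \<bullet> x\<bar>) \<in> borel_measurable borel" by (rule borel_measurable_continuous_onI[OF cont])
  have S_borel: "S \<in> sets borel"
  proof -
    have "{v. \<bar>a v \<bullet> x\<bar> < \<delta>} \<in> sets borel" using borel_measurable_less[OF m borel_measurable_const[of \<delta>]] by simp
    moreover have "S = {lo..hi} \<inter> {v. \<bar>a v \<bullet> x\<bar> < \<delta>}" by (auto simp: S_def)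
    ultimately show ?thesis by auto
  qed
  have mS: "measure lborel S \<le> ?l / 4" using GN[OF x \<delta>(1)] \<delta>(2) by (simp add: S_def)
  have mM: "measure lborel M = ?l / 2" using len by (simp add: M_def field_simps)
  have MS: "measure lborel (M - S) \<ge> ?l / 4"
  proof -
    have sub: "(M - S) \<union> S \<subseteq> {lo..hi}" 
    proof -
      have "lo \<le> k + ?l/4" "w - ?l/4 \<le> hi" using kw by argo+
      then have "M \<subseteq> {lo..hi}" unfolding M_def atLeastatMost_subset_iff by blast
      then show ?thesis by (auto simp: S_def)
    qed
    have sets: "(M - S) \<union> S \<in> sets lborel" "M \<in> sets lborel" using S_borel by (auto simp: M_def)
    have "emeasure lborel ((M - S) \<union> S) < \<infinity>"
      by (rule emeasure_bounded_finite[OF bounded_subset[OF bounded_closed_interval sub]])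
    then have "(M - S) \<union> S \<in> fmeasurable lborel" using sets by (intro fmeasurableI)
    then have "measure lborel M \<le> measure lborel ((M - S) \<union> S)"
      using sets by (intro measure_mono_fmeasurable) auto
    also have "\<dots> \<le> measure lborel (M - S) + measure lborel S"
      by (rule measure_Un_le) (use S_borel in \<open>auto simp: M_def\<close>)
    finally show ?thesis using mS mM by simp
  qed
  have "lam = c0 * (?l/4)^4 * \<delta>\<^sup>2 * (?l / 4)"
  proof -
    have "\<delta>\<^sup>2 = (?l / (4 * Cg)) powr (2 / pg)"
      using len Cg \<delta>(1) by (simp add: \<delta>_def powr_realpow[symmetric] powr_powr powr_numeral[symmetric] del: powr_numeral)
    moreover have "x ^ 5 = x ^ 4 * x" for x :: real by (simp add: eval_nat_numeral)
    ultimately show ?thesis unfolding lam_def by (simp only: mult_ac)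
  qed
  also have "\<dots> \<le> c0 * (?l/4)^4 * \<delta>\<^sup>2 * measure lborel (M - S)"
    using MS c0_pos len by (intro mult_left_mono) auto
  also have "\<dots> = (\<integral>v. (c0 * (?l/4)^4 * \<delta>\<^sup>2) * indicator (M - S) v \<partial>lborel)"
    using S_borel by (simp add: M_def)
  also have "\<dots> \<le> x \<bullet> (T *v x)"
    unfolding T_inner_eq
  proof (rule integral_mono[OF _ ax_integrable])
    show "integrable lborel (\<lambda>v. (c0 * (?l/4)^4 * \<delta>\<^sup>2) * indicator (M - S) v)"
      by (intro integrable_mult_right integrable_indicator_bounded) (use S_borel in \<open>auto simp: M_def intro: bounded_subset[OF bounded_closed_interval]\<close>)
    fix v
    show "(c0 * (?l/4)^4 * \<delta>\<^sup>2) * indicator (M - S) v \<le> \<psi> k w v * ((a v \<bullet> x) * (a v \<bullet> x))"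
    proof (cases "v \<in> M - S")
      case True
      then have vM: "k + ?l/4 \<le> v" "v \<le> w - ?l/4" by (simp_all add: M_def)
      then have v: "?l/4 \<le> v - k" "?l/4 \<le> w - v" using kw by argo+
      have "lo \<le> v" "v \<le> hi" using vM kw by argo+
      with True have av: "\<delta> \<le> \<bar>a v \<bullet> x\<bar>" by (auto simp: S_def)
      have "(?l/4)\<^sup>2 \<le> (max 0 (v - k))\<^sup>2" "(?l/4)\<^sup>2 \<le> (max 0 (w - v))\<^sup>2" using v len by (intro power_mono; simp)+
      then have "(?l/4)\<^sup>2 * (?l/4)\<^sup>2 \<le> (max 0 (v - k))\<^sup>2 * (max 0 (w - v))\<^sup>2" by (intro mult_mono) auto
      then have "c0 * (?l/4)^4 \<le> \<psi> k w v" unfolding \<psi>_def using c0_pos by (intro mult_left_mono) (auto simp flip: power_add)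
      moreover have "\<delta>\<^sup>2 \<le> (a v \<bullet> x)\<^sup>2" using power_mono[OF av, of 2] \<delta>(1) by simp
      ultimately have "c0 * (?l/4)^4 * \<delta>\<^sup>2 \<le> \<psi> k w v * (a v \<bullet> x)\<^sup>2" using psi_nonneg by (intro mult_mono) auto
      then show ?thesis using True by (simp add: power2_eq_square)
    qed (simp add: psi_nonneg)
  qed
  finally show ?thesis .
qed

lemma T_lower: "lam * (x \<bullet> x) \<le> x \<bullet> (T *v x)"
proof (cases "x = 0")
  case False
  let ?y = "(1 / norm x) *\<^sub>R x"
  have "lam \<le> ?y \<bullet> (T *v ?y)" using False by (intro T_lower_unit) simp
  also have "\<dots> = (x \<bullet> (T *v x)) / (norm x)\<^sup>2" by (simp add: matrix_vector_mult_scaleR power2_eq_square)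
  finally show ?thesis using False by (simp add: pos_le_divide_eq power2_norm_eq_inner)
qed simp

lemma T_inv: "T ** matrix_inv T = mat 1" "transpose (matrix_inv T) = matrix_inv T"
proof -
  have "inj (\<lambda>x. T *v x)"
  proof (rule linear_injective_0[THEN iffD2], simp, intro allI impI)
    fix x assume "T *v x = 0"
    then have "lam * (x \<bullet> x) \<le> 0" using T_lower[of x] by simp
    then have "x \<bullet> x \<le> 0" using lam_pos by (simp add: mult_le_0_iff)
    then show "x = 0" by (metis inner_eq_zero_iff inner_ge_zero order_antisym)
  qed
  then have inv: "invertible T" by (simp add: invertible_left_inverse matrix_left_invertible_injective)
  have "T ** matrix_inv T = mat 1 \<and> matrix_inv T ** T = mat 1"
    unfolding matrix_inv_def by (rule someI_ex) (use inv in \<open>simp add: invertible_def\<close>)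
  then show TA: "T ** matrix_inv T = mat 1" by simp
  have "transpose (matrix_inv T) ** T = mat 1"
    using arg_cong[OF TA, of transpose] by (simp add: matrix_transpose_mul T_sym transpose_mat)
  then have "transpose (matrix_inv T) ** T ** matrix_inv T = matrix_inv T" by simp
  then show "transpose (matrix_inv T) = matrix_inv T" by (simp add: matrix_mul_assoc[symmetric] TA)
qed

end

sublocale window \<subseteq> ellip T "matrix_inv T" lam
  by unfold_locales (fact T_sym T_inv lam_pos T_lower T_upper)+

section \<open>Cutoffs and entropy fluxes adapted to a window\<close>

lemma sum_swap_pairs:
  "(\<Sum>p\<in>P. \<Sum>q\<in>Q. \<Sum>j\<in>R. \<Sum>i\<in>S. F p q j i) = (\<Sum>j\<in>R. \<Sum>i\<in>S. \<Sum>p\<in>P. \<Sum>q\<in>Q. (F p q j i :: real))"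
proof -
  have "(\<Sum>p\<in>P. \<Sum>q\<in>Q. \<Sum>j\<in>R. \<Sum>i\<in>S. F p q j i) = (\<Sum>p\<in>P. \<Sum>j\<in>R. \<Sum>q\<in>Q. \<Sum>i\<in>S. F p q j i)"
    by (rule sum.cong[OF refl], rule sum.swap)
  also have "\<dots> = (\<Sum>j\<in>R. \<Sum>p\<in>P. \<Sum>q\<in>Q. \<Sum>i\<in>S. F p q j i)" by (rule sum.swap)
  also have "\<dots> = (\<Sum>j\<in>R. \<Sum>p\<in>P. \<Sum>i\<in>S. \<Sum>q\<in>Q. F p q j i)"
    by (rule sum.cong[OF refl], rule sum.cong[OF refl], rule sum.swap)
  also have "\<dots> = (\<Sum>j\<in>R. \<Sum>i\<in>S. \<Sum>p\<in>P. \<Sum>q\<in>Q. F p q j i)"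
    by (rule sum.cong[OF refl], rule sum.swap)
  finally show ?thesis .
qed

lemma flux_primitive_exists:
  fixes a :: "real \<Rightarrow> 'a::euclidean_space"
  assumes "continuous_on UNIV a" "\<And>v. (g has_real_derivative g' v) (at v)" "continuous_on UNIV g'" "\<forall>v. N < \<bar>v\<bar> \<longrightarrow> g' v = 0"
  shows "\<exists>G. G c = 0 \<and> fl a g g' G"
proof -
  have "continuous_on UNIV g" using assms(2) DERIV_isCont continuous_at_imp_continuous_on by blast
  then have "continuous_on UNIV (\<lambda>v. g v *\<^sub>R a v)" using assms(1) by (intro continuous_intros)
  from antiderivative_exists[OF this, of c] show ?thesis using assms(2-4) by (auto simp: fl_def)
qed

lemma step_1_pos: "step 1 > 0"
proof -
  obtain z where z: "3/8 < z" "z < 7/8" "step (7/8) - step (3/8) = (7/8 - 3/8) * bump z"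
    using MVT2[of "3/8" "7/8" step bump] DERIV_step by auto
  then have "step (7/8) > step (3/8)" using bump_lower[of z] by simp
  moreover have "step (7/8) \<le> step 1" by (rule step_mono) simp
  ultimately show ?thesis using step_bounds(1)[of "3/8"] by linarith
qed

lemma cutoff_exists:
  "\<exists>(\<xi>::'a::euclidean_space \<Rightarrow> real) \<xi>'. c1c (ball 0 1) \<xi> \<xi>' \<and> (\<forall>x. 0 \<le> \<xi> x \<and> \<xi> x \<le> 1) \<and> (\<forall>x\<in>cball 0 (3/4). \<xi> x = 1)"
proof -
  \<comment> \<open>An affine function of the squared norm that equals 1/4 at radius 3/4 and 1 at
    squared radius 13/16. These are the ends of the transition of \<open>step\<close>, and both
    radii are less than 1.\<close>
  define l where "l x = 1/4 + 3 * (x \<bullet> x - 9/16)" for x :: 'a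
  define \<xi> where "\<xi> x = 1 - step (l x) / step 1" for x :: 'a
  define \<xi>' where "\<xi>' x = - (bump (l x) / step 1 * 6) *\<^sub>R x" for x :: 'a
  have l: "(l has_derivative (\<lambda>h. 6 * (x \<bullet> h))) (at x)" for x :: 'a
    unfolding l_def[abs_def] by (auto intro!: derivative_eq_intros simp: inner_commute)
  have lc: "continuous_on UNIV l" unfolding l_def[abs_def] by (intro continuous_intros)
  have "c1c (ball 0 1) \<xi> \<xi>'"
    unfolding c1c_def
  proof (intro conjI allI exI[of _ "cball 0 (sqrt (13/16))"] impI)
    fix x :: 'a
    have "((\<lambda>x. step (l x)) has_derivative (\<lambda>h. 6 * (x \<bullet> h) * bump (l x))) (at x)"
      by (rule DERIV_compose_FDERIV[OF DERIV_step l])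
    then have "((\<lambda>x. 1 - step (l x) * (1 / step 1)) has_derivative (\<lambda>h. 0 - 6 * (x \<bullet> h) * bump (l x) * (1 / step 1))) (at x)"
      by (intro has_derivative_diff has_derivative_const has_derivative_mult_left)
    moreover have "(\<lambda>x. 1 - step (l x) * (1 / step 1)) = \<xi>" by (simp add: \<xi>_def[abs_def])
    ultimately show "(\<xi> has_derivative (\<bullet>) (\<xi>' x)) (at x)"
      by (auto elim!: has_derivative_eq_rhs simp: \<xi>'_def fun_eq_iff)
    show "continuous_on UNIV \<xi>'"
      unfolding \<xi>'_def[abs_def] using step_1_pos
      by (intro continuous_intros continuous_on_compose2[OF bump_continuous(1) lc]) auto
    show "cball 0 (sqrt (13/16)) \<subseteq> ball (0::'a) 1"
    proof -
      have "sqrt (13/16) < (1::real)" by (simp add: real_sqrt_lt_1_iff)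
      then show ?thesis by (metis subset_iff mem_ball mem_cball order_le_less_trans)
    qed
    assume "x \<notin> cball 0 (sqrt (13/16))"
    then have "sqrt (13/16) \<le> norm x" by simp
    then have "(sqrt (13/16))\<^sup>2 \<le> (norm x)\<^sup>2" by (intro power_mono) auto
    then have "1 \<le> l x" by (simp add: l_def power2_norm_eq_inner)
    then show "\<xi> x = 0" using step_eq_1[of "l x"] step_1_pos by (simp add: \<xi>_def)
  qed simp
  moreover have "0 \<le> \<xi> x \<and> \<xi> x \<le> 1" for x
  proof -
    have "step (l x) \<le> step 1" using step_mono[of "l x" "max 1 (l x)"] step_eq_1[of "max 1 (l x)"] by simp
    then show ?thesis using step_1_pos step_bounds(1)[of "l x"] by (simp add: \<xi>_def)
  qed
  moreover have "\<xi> x = 1" if "x \<in> cball 0 (3/4)" for x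
  proof -
    have "(norm x)\<^sup>2 \<le> (3/4)\<^sup>2" using that by (intro power_mono) auto
    then have "x \<bullet> x \<le> (3/4)\<^sup>2" unfolding power2_norm_eq_inner .
    then have "l x \<le> 1/4" by (simp add: l_def power2_eq_square)
    then show ?thesis using step_eq_0 by (simp add: \<xi>_def)
  qed
  ultimately show ?thesis by blast
qed

lemma vector_mvt_bound:
  fixes F :: "real \<Rightarrow> 'a::euclidean_space"
  assumes "\<And>t. (F has_vector_derivative f t) (at t)" "\<And>t. t \<in> {a..b} \<Longrightarrow> norm (f t) \<le> B" "a \<le> b"
  shows "norm (F b - F a) \<le> B * (b - a)"
proof -
  have "norm (F b - F a) \<le> B * norm (b - a)"
  proof (rule differentiable_bound[of "{a..b}" F "\<lambda>t h. h *\<^sub>R f t"])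
    show "(F has_derivative (\<lambda>h. h *\<^sub>R f x)) (at x within {a..b})" for x
      using assms(1)[of x] unfolding has_vector_derivative_def by (rule has_derivative_at_withinI)
    show "onorm (\<lambda>h. h *\<^sub>R f x) \<le> B" if "x \<in> {a..b}" for x
      using assms(2)[OF that] by (intro onorm_le) (simp add: mult.commute[of B] mult_left_mono)
  qed (use assms(3) in auto)
  then show ?thesis using assms(3) by simp
qed

context flux_gn
begin

definition Kg :: real where "Kg = Ba * (4 * c0 * (1 + \<bar>hi - lo\<bar>) ^ 3 + 1)"

lemma Kg_pos: "Kg > 0"
  unfolding Kg_def using Ba(1) c0_pos by (intro mult_pos_pos add_nonneg_pos) auto

text \<open>A majorant whose second derivative is at least 1 on every window above \<open>k\<close>,
  while its flux vanishes up to the level \<open>k0\<close>. Thus \<open>H (u x)\<close> lives on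
  the set where \<open>u\<close> exceeds \<open>k0\<close>, and the dissipation is controlled by the
  measure of that set. The decrease to 0 above \<open>hi\<close> only serves to make the support of
  \<open>h'\<close> bounded.\<close>

lemma ramp_exists:
  assumes "lo \<le> k0" "k0 < k" "k \<le> hi"
  shows "\<exists>h h' H. fl a h h' H \<and> (\<forall>v. 0 \<le> h' v) \<and> (\<forall>v\<in>{k..hi}. 1 \<le> h' v) \<and> (\<forall>s\<le>k0. H s = 0)
     \<and> (\<forall>s\<in>{lo..hi}. norm (H s) \<le> (hi - lo)\<^sup>2 * Ba)"
proof -
  define h' where "h' v = max 0 (min 1 ((v - k0) / (k - k0))) * max 0 (min 1 (hi + 1 - v))" for v
  have h'c: "continuous_on UNIV h'" unfolding h'_def[abs_def] using assms by (intro continuous_intros) auto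
  have h'0: "0 \<le> h' v" "h' v \<le> 1" for v
    unfolding h'_def by (auto intro!: mult_le_one)
  have h'z: "h' v = 0" if "v \<le> k0" for v
  proof -
    have "(v - k0) / (k - k0) \<le> 0" using that assms by (intro divide_nonpos_pos) auto
    then show ?thesis by (simp add: h'_def)
  qed
  have h'1: "h' v = 1" if "v \<in> {k..hi}" for v
  proof -
    have "1 \<le> (v - k0) / (k - k0)" using that assms by (simp add: le_divide_eq)
    then show ?thesis using that by (simp add: h'_def)
  qed
  obtain h where h: "h k0 = 0" "\<And>v. (h has_vector_derivative h' v) (at v)"
    using antiderivative_exists[OF h'c, of k0] by blast
  have hd: "(h has_real_derivative h' v) (at v)" for v
    using h(2) by (simp add: has_real_derivative_iff_has_vector_derivative)
  have h'N: "\<forall>v. \<bar>k0\<bar> + \<bar>hi\<bar> + 1 < \<bar>v\<bar> \<longrightarrow> h' v = 0"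
  proof (intro allI impI)
    fix v assume "\<bar>k0\<bar> + \<bar>hi\<bar> + 1 < \<bar>v\<bar>"
    then have "v \<le> k0 \<or> v \<ge> hi + 1" by linarith
    then show "h' v = 0" using h'z[of v] by (auto simp: h'_def)
  qed
  obtain H where H: "H k0 = 0" "fl a h h' H"
    using flux_primitive_exists[OF a_cont hd h'c h'N, of k0] by blast
  have hz: "h v = 0" if "v \<le> k0" for v
  proof -
    have "norm (h k0 - h v) \<le> 0 * (k0 - v)" by (rule vector_mvt_bound[OF h(2)]) (use h'z that in auto)
    then show ?thesis using h(1) by simp
  qed
  have hb: "\<bar>h v\<bar> \<le> hi - lo" if "v \<in> {k0..hi}" for v
  proof -
    have "norm (h v - h k0) \<le> 1 * (v - k0)" by (rule vector_mvt_bound[OF h(2)]) (use h'0 that in auto)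
    then show ?thesis using h(1) that assms by simp
  qed
  have Hd: "(H has_vector_derivative h v *\<^sub>R a v) (at v)" for v using H(2) by (auto simp: fl_def)
  have Hz: "H s = 0" if "s \<le> k0" for s
  proof -
    have "norm (H k0 - H s) \<le> 0 * (k0 - s)" by (rule vector_mvt_bound[OF Hd]) (use hz that in auto)
    then show ?thesis using H(1) by simp
  qed
  have Hb: "norm (H s) \<le> (hi - lo)\<^sup>2 * Ba" if "s \<in> {lo..hi}" for s
  proof (cases "s \<le> k0")
    case True
    then show ?thesis using Hz[OF True] Ba(1) by simp
  next
    case False
    have b: "norm (h t *\<^sub>R a t) \<le> (hi - lo) * Ba" if "t \<in> {k0..s}" for t
      unfolding norm_scaleR using hb[of t] Ba(2)[of t] that \<open>s \<in> {lo..hi}\<close> assms by (intro mult_mono) auto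
    have "norm (H s - H k0) \<le> (hi - lo) * Ba * (s - k0)"
      by (rule vector_mvt_bound[OF Hd b]) (use False in auto)
    also have "\<dots> \<le> (hi - lo) * Ba * (hi - lo)" using that assms Ba(1) by (intro mult_left_mono) auto
    finally show ?thesis using H(1) by (simp add: power2_eq_square mult_ac)
  qed
  show ?thesis
    by (intro exI[of _ h] exI[of _ h'] exI[of _ H]) (use H h'0 h'1 Hz Hb in auto)
qed

end

context window
begin

definition g :: "'d \<Rightarrow> real \<Rightarrow> real" where "g i v = \<psi> k w v * a v $ i"
definition g' :: "'d \<Rightarrow> real \<Rightarrow> real" where "g' i v = \<psi>' k w v * a v $ i + \<psi> k w v * a' v $ i"
text \<open>Row \<open>i\<close> of the matrix field of the window: entry \<open>j\<close> at level
  \<open>s\<close> is the integral of \<open>\<psi>\<close> times \<open>a v $ i * a v $ j\<close>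
  up to \<open>s\<close>. Each row is an entropy flux, which is how the kinetic inequality reaches
  the matrix field.\<close>

definition Gp :: "'d \<Rightarrow> real \<Rightarrow> real^'d" where "Gp i = (SOME G. G lo = 0 \<and> fl a (g i) (g' i) G)"

lemma g'_zero: "v \<notin> {k..w} \<Longrightarrow> g' i v = 0"
  by (simp add: g'_def psi_zero)

lemma Gp: "Gp i lo = 0" "fl a (g i) (g' i) (Gp i)"
proof -
  have d: "(g i has_real_derivative g' i v) (at v)" for v
    unfolding g_def[abs_def] g'_def using DERIV_mult[OF DERIV_psi[of k w v] a_comp_deriv[of i v]] by (simp add: mult_ac)
  have c: "continuous_on UNIV (g' i)"
    unfolding g'_def[abs_def] by (intro continuous_intros psi_cont a_cont a'_cont)
  have z: "\<forall>v. \<bar>k\<bar> + \<bar>w\<bar> < \<bar>v\<bar> \<longrightarrow> g' i v = 0" by (intro allI impI g'_zero) auto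
  have "Gp i lo = 0 \<and> fl a (g i) (g' i) (Gp i)"
    using someI_ex[OF flux_primitive_exists[OF a_cont d c z, of lo]] unfolding Gp_def .
  then show "Gp i lo = 0" "fl a (g i) (g' i) (Gp i)" by simp_all
qed

lemma g'_bound: "\<bar>g' i v\<bar> \<le> Kg * indicator {k..w} v"
proof (cases "v \<in> {k..w}")
  case True
  let ?D = "1 + \<bar>hi - lo\<bar>"
  have vb: "\<bar>a v $ i\<bar> \<le> Ba" "\<bar>a' v $ i\<bar> \<le> Ba"
    using component_le_norm_cart[of "a v" i] component_le_norm_cart[of "a' v" i] Ba(2,3)[of v] True kw by auto
  have b: "0 \<le> max 0 (v - k)" "max 0 (v - k) \<le> ?D" "0 \<le> max 0 (w - v)" "max 0 (w - v) \<le> ?D" using True kw by auto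
  have p3: "x * y\<^sup>2 \<le> ?D ^ 3" if "0 \<le> x" "x \<le> ?D" "0 \<le> y" "y \<le> ?D" for x y :: real
  proof -
    have "x * y\<^sup>2 \<le> ?D * ?D\<^sup>2" using that by (intro mult_mono power_mono) auto
    then show ?thesis by (simp add: power3_eq_cube power2_eq_square mult_ac)
  qed
  define P Q where "P = max 0 (v - k) * (max 0 (w - v))\<^sup>2" and "Q = max 0 (w - v) * (max 0 (v - k))\<^sup>2"
  have PQ: "0 \<le> P" "P \<le> ?D ^ 3" "0 \<le> Q" "Q \<le> ?D ^ 3"
    using p3[OF b] p3[OF b(3,4) b(1,2)] by (auto simp: P_def Q_def)
  have "2 * max 0 (v - k) * (max 0 (w - v))\<^sup>2 - (max 0 (v - k))\<^sup>2 * (2 * max 0 (w - v)) = 2 * P - 2 * Q"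
    by (simp add: P_def Q_def)
  then have "\<bar>2 * max 0 (v - k) * (max 0 (w - v))\<^sup>2 - (max 0 (v - k))\<^sup>2 * (2 * max 0 (w - v))\<bar> \<le> 4 * ?D ^ 3"
    using PQ by linarith
  then have "\<bar>\<psi>' k w v\<bar> \<le> c0 * (4 * ?D ^ 3)"
    unfolding \<psi>'_def abs_mult using c0_pos by (intro mult_mono) auto
  then have "\<bar>\<psi>' k w v * a v $ i\<bar> \<le> c0 * (4 * ?D ^ 3) * Ba"
    unfolding abs_mult using vb by (intro mult_mono) auto
  moreover have "\<bar>\<psi> k w v * a' v $ i\<bar> \<le> 1 * Ba"
  proof -
    have "1 \<le> Ba\<^sup>2" using Ba(1) by simp
    then have "1 \<le> 4 * (1 + (hi - lo)) * Ba\<^sup>2" using len mult_mono[of 1 "4 * (1 + (hi - lo))" 1 "Ba\<^sup>2"] by simp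
    then have "1 / (4 * (1 + (hi - lo)) * Ba\<^sup>2) \<le> 1" by simp
    then have "\<bar>\<psi> k w v\<bar> \<le> 1" using psi_le[of v] psi_nonneg[of k w v] by linarith
    then show ?thesis unfolding abs_mult using vb by (intro mult_mono) auto
  qed
  ultimately have "\<bar>g' i v\<bar> \<le> c0 * (4 * ?D ^ 3) * Ba + 1 * Ba"
    unfolding g'_def by (rule order_trans[OF abs_triangle_ineq add_mono])
  also have "\<dots> = Kg" by (simp add: Kg_def algebra_simps)
  finally show ?thesis using True by simp
qed (simp add: g'_zero)

lemma Gp_eq:
  assumes "lo \<le> s"
  shows "Gp i s $ j = (\<integral>v. indicator {lo..s} v * (\<psi> k w v * (a v $ i * a v $ j)) \<partial>lborel)"
proof -
  have d: "(Gp i has_vector_derivative g i v *\<^sub>R a v) (at v)" for v using Gp(2) by (auto simp: fl_def)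
  have dj: "((\<lambda>s. Gp i s $ j) has_vector_derivative (g i v *\<^sub>R a v) $ j) (at v)" for v
    by (rule bounded_linear.has_vector_derivative[OF bounded_linear_vec_nth d])
  have c: "continuous_on {lo..s} (\<lambda>v. (g i v *\<^sub>R a v) $ j)"
    unfolding g_def[abs_def] by (intro continuous_intros psi_cont a_cont)
  have "has_bochner_integral lborel (\<lambda>v. indicator {lo..s} v *\<^sub>R ((g i v *\<^sub>R a v) $ j)) (Gp i s $ j - Gp i lo $ j)"
    by (rule has_bochner_integral_FTC_Icc[OF assms has_vector_derivative_at_within[OF dj] c])
  then show ?thesis using Gp(1)[of i] by (simp add: has_bochner_integral_iff g_def mult_ac)
qed

lemma Gp_below: "lo \<le> s \<Longrightarrow> s \<le> k \<Longrightarrow> Gp i s $ j = 0"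
proof -
  assume s: "lo \<le> s" "s \<le> k"
  have "indicator {lo..s} v * (\<psi> k w v * (a v $ i * a v $ j)) = 0" for v
    using s by (cases "v \<in> {lo..s}") (auto simp: \<psi>_def)
  then have "(\<lambda>v. indicator {lo..s} v * (\<psi> k w v * (a v $ i * a v $ j))) = (\<lambda>v. 0)" by (rule ext)
  then show ?thesis unfolding Gp_eq[OF s(1)] by simp
qed

lemma Gp_above: "w \<le> s \<Longrightarrow> Gp i s $ j = T $ i $ j"
proof -
  assume s: "w \<le> s"
  have "indicator {lo..s} v * (\<psi> k w v * (a v $ i * a v $ j)) = \<psi> k w v * (a v $ i * a v $ j)" for v
    using s kw psi_zero(1)[of v k w] by (cases "v \<in> {k..w}") auto
  then have "(\<lambda>v. indicator {lo..s} v * (\<psi> k w v * (a v $ i * a v $ j))) = (\<lambda>v. \<psi> k w v * (a v $ i * a v $ j))" by (rule ext)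
  moreover have "lo \<le> s" using s kw by simp
  ultimately show ?thesis by (simp add: Gp_eq T_def)
qed

lemma Gp_bounded: "\<exists>B. \<forall>i. \<forall>s\<in>{lo..hi}. norm (Gp i s) \<le> B"
proof -
  have "bounded (Gp i ` {lo..hi})" for i
    by (rule compact_imp_bounded[OF compact_continuous_image[OF continuous_on_subset[OF fl_continuous[OF Gp(2)]]]]) auto
  then have "bounded (\<Union>i\<in>UNIV. Gp i ` {lo..hi})" by (intro bounded_UN) auto
  then show ?thesis by (auto simp: bounded_iff)
qed

text \<open>One of the two copies of \<open>T\<close> in the trace of \<open>T H T H\<close> is
  replaced by its definition as an average of \<open>a \<otimes> a\<close>. What is left is an
  average of the form of \<open>T\<close> at the vectors \<open>H a\<close>, which is visibly
  nonnegative.\<close>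

lemma tau_eq:
  assumes "\<And>i j. H i j = H j i"
  shows "\<tau> H = (\<integral>v. \<psi> k w v * (let y = (\<chi> i. \<Sum>j\<in>UNIV. H i j * a v $ j) in y \<bullet> (T *v y)) \<partial>lborel)"
proof -
  have "(let y = (\<chi> i. \<Sum>j\<in>UNIV. H i j * a v $ j) in y \<bullet> (T *v y))
     = (\<Sum>i\<in>UNIV. \<Sum>j\<in>UNIV. (\<Sum>p\<in>UNIV. \<Sum>q\<in>UNIV. T $ p $ q * (H j p * H q i)) * (a v $ i * a v $ j))" for v
  proof -
    have "(let y = (\<chi> i. \<Sum>j\<in>UNIV. H i j * a v $ j) in y \<bullet> (T *v y))
      = (\<Sum>p\<in>UNIV. \<Sum>q\<in>UNIV. T $ p $ q * ((\<Sum>j\<in>UNIV. H p j * a v $ j) * (\<Sum>i\<in>UNIV. H q i * a v $ i)))"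
      unfolding Let_def T_quadratic[symmetric] by simp
    also have "\<dots> = (\<Sum>p\<in>UNIV. \<Sum>q\<in>UNIV. \<Sum>j\<in>UNIV. \<Sum>i\<in>UNIV. T $ p $ q * (H j p * H q i) * (a v $ i * a v $ j))"
      unfolding sum_product unfolding sum_distrib_left
      by (intro sum.cong refl; subst assms; simp add: mult_ac)
    also have "\<dots> = (\<Sum>j\<in>UNIV. \<Sum>i\<in>UNIV. \<Sum>p\<in>UNIV. \<Sum>q\<in>UNIV. T $ p $ q * (H j p * H q i) * (a v $ i * a v $ j))"
      by (rule sum_swap_pairs)
    also have "\<dots> = (\<Sum>i\<in>UNIV. \<Sum>j\<in>UNIV. (\<Sum>p\<in>UNIV. \<Sum>q\<in>UNIV. T $ p $ q * (H j p * H q i)) * (a v $ i * a v $ j))"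
      by (subst sum.swap) (simp add: sum_distrib_right)
    finally show ?thesis .
  qed
  then have "(\<integral>v. \<psi> k w v * (let y = (\<chi> i. \<Sum>j\<in>UNIV. H i j * a v $ j) in y \<bullet> (T *v y)) \<partial>lborel)
    = (\<Sum>i\<in>UNIV. \<Sum>j\<in>UNIV. (\<Sum>p\<in>UNIV. \<Sum>q\<in>UNIV. T $ p $ q * (H j p * H q i)) * T $ i $ j)"
    by (simp only: integral_quadratic)
  also have "\<dots> = \<tau> H"
    unfolding \<tau>_def sum_distrib_right by (intro sum.cong refl) (simp only: mult_ac)
  finally show ?thesis by simp
qed

lemma T_nonneg: "0 \<le> y \<bullet> (T *v y)"
  using T_lower[of y] lam_pos by (meson inner_ge_zero less_imp_le mult_nonneg_nonneg order_trans)

lemma tau_nonneg: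
  assumes "\<And>i j. H i j = H j i"
  shows "0 \<le> \<tau> H"
  unfolding tau_eq[OF assms] Let_def
  by (intro Bochner_Integration.integral_nonneg mult_nonneg_nonneg psi_nonneg T_nonneg)

text \<open>For each \<open>v\<close>, the square of \<open>a \<bullet> H a\<close> is at most
  \<open>q a\<close> times the form of \<open>T\<close> at \<open>H a\<close>: Cauchy-Schwarz for
  \<open>T\<close> and the dual norm. Averaged over the window, the second factor becomes
  \<open>\<tau> H\<close> and the first the trace of the inverse of \<open>T\<close> times
  \<open>T\<close>, which is the dimension. No ellipticity constant enters.\<close>

lemma window_cauchy_schwarz:
  fixes e :: real
  assumes sym: "\<And>i j. H i j = H j i" and e: "e > 0" and s: "lo \<le> s"
  shows "\<bar>\<Sum>i\<in>UNIV. \<Sum>j\<in>UNIV. Gp i s $ j * H i j\<bar> \<le> (e * CARD('d) + \<tau> H / e) / 2"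
proof -
  let ?y = "\<lambda>v. \<chi> i. \<Sum>j\<in>UNIV. H i j * a v $ j"
  let ?aHa = "\<lambda>v. a v \<bullet> ?y v"
  let ?R = "\<lambda>v. ?y v \<bullet> (T *v ?y v)"
  have alg: "p * ((e * Q + R / e) / 2) = e / 2 * (p * Q) + 1 / (2 * e) * (p * R)" for p Q R :: real
    using e by (simp add: field_simps)
  have yc: "continuous_on UNIV ?y" by (intro continuous_intros continuous_on_vec_lambda a_cont)
  have Ryc: "continuous_on UNIV ?R"
    by (intro continuous_on_inner yc linear_continuous_on_compose[OF yc] matrix_vector_mul_linear)
  have qc: "continuous_on UNIV (\<lambda>v. q (a v))" by (intro continuous_on_compose2[OF q_continuous a_cont]) auto
  have ii: "integrable lborel (\<lambda>v. indicator {lo..s} v * (\<psi> k w v * (a v $ i * a v $ j)))" for i j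
    using integrable_real_mult_indicator[OF _ aa_integrable[of i j], of "{lo..s}"] by (simp add: mult.commute)
  have i2: "integrable lborel (\<lambda>v. indicator {lo..s} v * (\<psi> k w v * ?aHa v))"
    using integrable_real_mult_indicator[OF _ psi_prod_integrable[OF continuous_on_inner[OF a_cont yc]], of "{lo..s}"] by (simp add: mult.commute)
  have "(\<Sum>i\<in>UNIV. \<Sum>j\<in>UNIV. Gp i s $ j * H i j)
     = (\<integral>v. (\<Sum>i\<in>UNIV. \<Sum>j\<in>UNIV. (indicator {lo..s} v * (\<psi> k w v * (a v $ i * a v $ j))) * H i j) \<partial>lborel)"
    by (simp add: Gp_eq[OF s] ii Bochner_Integration.integrable_sum)
  also have "\<dots> = (\<integral>v. indicator {lo..s} v * (\<psi> k w v * ?aHa v) \<partial>lborel)"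
    by (simp add: inner_vec_def sum_distrib_left mult_ac)
  finally have eq: "(\<Sum>i\<in>UNIV. \<Sum>j\<in>UNIV. Gp i s $ j * H i j) = (\<integral>v. indicator {lo..s} v * (\<psi> k w v * ?aHa v) \<partial>lborel)" .
  have "\<bar>\<Sum>i\<in>UNIV. \<Sum>j\<in>UNIV. Gp i s $ j * H i j\<bar> \<le> (\<integral>v. \<psi> k w v * ((e * q (a v) + ?R v / e) / 2) \<partial>lborel)"
    unfolding eq
  proof (rule order_trans[OF integral_abs_bound], rule integral_mono)
    show "integrable lborel (\<lambda>v. \<bar>indicator {lo..s} v * (\<psi> k w v * ?aHa v)\<bar>)" using i2 by (rule integrable_abs)
    show "integrable lborel (\<lambda>v. \<psi> k w v * ((e * q (a v) + ?R v / e) / 2))"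
      using e by (intro psi_prod_integrable continuous_intros qc Ryc) auto
    fix v
    have "(?aHa v)\<^sup>2 \<le> q (a v) * ?R v"
      using T_cauchy_schwarz[of "matrix_inv T *v a v" "?y v"] by (simp add: T_inner T_A q_eq)
    then have "\<bar>?aHa v\<bar> \<le> (e * q (a v) + ?R v / e) / 2"
      by (rule AM_GM_sq) (rule q_nonneg, rule T_nonneg, rule e)
    then have "\<psi> k w v * \<bar>?aHa v\<bar> \<le> \<psi> k w v * ((e * q (a v) + ?R v / e) / 2)" by (intro mult_left_mono psi_nonneg)
    moreover have "\<bar>indicator {lo..s} v * (\<psi> k w v * ?aHa v)\<bar> \<le> \<psi> k w v * \<bar>?aHa v\<bar>"
      using psi_nonneg[of k w v] by (auto simp: indicator_def abs_mult)
    ultimately show "\<bar>indicator {lo..s} v * (\<psi> k w v * ?aHa v)\<bar> \<le> \<psi> k w v * ((e * q (a v) + ?R v / e) / 2)" by linarith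
  qed
  also have "\<dots> = (\<integral>v. e / 2 * (\<psi> k w v * q (a v)) + 1 / (2 * e) * (\<psi> k w v * ?R v) \<partial>lborel)"
    by (simp only: alg)
  also have "\<dots> = e / 2 * (\<integral>v. \<psi> k w v * q (a v) \<partial>lborel) + 1 / (2 * e) * (\<integral>v. \<psi> k w v * ?R v \<partial>lborel)"
    using psi_prod_integrable[OF qc] psi_prod_integrable[OF Ryc] by simp
  also have "(\<integral>v. \<psi> k w v * ?R v \<partial>lborel) = \<tau> H" using tau_eq[OF sym] by (simp add: Let_def)
  \<comment> \<open>The mean of \<open>q a\<close> is the pairing of \<open>T\<close> with its own
    inverse.\<close>
  also have "(\<integral>v. \<psi> k w v * q (a v) \<partial>lborel) = CARD('d)"
  proof -
    have "q (a v) = (\<Sum>i\<in>UNIV. \<Sum>j\<in>UNIV. matrix_inv T $ i $ j * (a v $ i * a v $ j))" for v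
      by (simp add: q_def inner_vec_def matrix_vector_mult_def sum_distrib_left mult_ac)
    then have "(\<integral>v. \<psi> k w v * q (a v) \<partial>lborel) = (\<Sum>i\<in>UNIV. \<Sum>j\<in>UNIV. matrix_inv T $ i $ j * T $ i $ j)"
      by (simp only: integral_quadratic)
    then show ?thesis using trace_TA by (simp add: mult.commute)
  qed
  finally have "\<bar>\<Sum>i\<in>UNIV. \<Sum>j\<in>UNIV. Gp i s $ j * H i j\<bar> \<le> e / 2 * CARD('d) + 1 / (2 * e) * \<tau> H" .
  also have "\<dots> = (e * CARD('d) + \<tau> H / e) / 2" using e alg[of 1 "real CARD('d)" "\<tau> H"] by simp
  finally show ?thesis .
qed

context
  fixes u :: "real^'d \<Rightarrow> real" and E :: "(real^'d) set"
  assumes u: "u \<in> borel_measurable borel" "\<And>x. u x \<in> {lo..hi}"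
    and E: "E \<in> sets borel" "E \<subseteq> cball 0 (1/4)"
begin

lemma Gp_u_measurable: "(\<lambda>x. Gp i (u x)) \<in> borel_measurable borel"
  using borel_measurable_continuous_onI[OF fl_continuous[OF Gp(2)]] u(1) by (rule measurable_compose_rev)

lemma GpX'_integrable: "0 < s \<Longrightarrow> s \<le> 1 \<Longrightarrow> integrable lborel (\<lambda>x. Gp i (u x) \<bullet> X' E s i x)"
proof -
  assume s: "0 < s" "s \<le> 1"
  note [measurable] = Gp_u_measurable[of i]
  obtain B where B: "\<And>s. s\<in>{lo..hi} \<Longrightarrow> norm (Gp i s) \<le> B" using Gp_bounded by blast
  obtain C where C: "\<And>x. norm (X' E s i x) \<le> C" using c1c_bounds[OF X_c1c[OF E s, of i]] by metis
  have [measurable]: "X' E s i \<in> borel_measurable borel"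
    using c1c_cont'[OF X_c1c[OF E s]] by (rule borel_measurable_continuous_onI)
  show ?thesis
  proof (rule integrable_bounded_support[OF _ _ bounded_cball[of 0 "3/4"]])
    show "norm (Gp i (u x) \<bullet> X' E s i x) \<le> B * C" for x
      using Cauchy_Schwarz_ineq2[of "Gp i (u x)" "X' E s i x"] B[OF u(2)[of x]] C[of x]
        mult_mono[OF B[OF u(2)[of x]] C[of x]] order_trans[OF norm_ge_zero B[OF u(2)[of x]]] by fastforce
    show "x \<notin> cball 0 (3/4) \<Longrightarrow> Gp i (u x) \<bullet> X' E s i x = 0" for x using X'_zero[OF E s] by simp
  qed measurable
qed

lemma window_inequality:
  fixes e D :: real
  assumes Ew: "\<And>x. x \<in> E \<Longrightarrow> w \<le> u x" and e: "e > 0"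
    and D: "\<And>J. (\<Sum>i\<in>UNIV. \<integral>x. Gp i (u x) \<bullet> X' E ((1/2)^J) i x \<partial>lborel) \<le> D"
  shows "cA * measure lborel E \<le> (\<integral>x. indicator {x. w \<le> u x} x * Fs E 1 x \<partial>lborel)
     + e * CARD('d) / 2 * measure lborel ({x. k < u x \<and> u x < w} \<inter> cball 0 (3/4)) + cA\<^sup>2 * measure lborel E / e + D"
proof -
  note [measurable] = u(1)
  obtain B where B: "\<And>i s. s\<in>{lo..hi} \<Longrightarrow> norm (Gp i s) \<le> B" using Gp_bounded by blast
  show ?thesis
  proof (rule key_inequality[OF E, where Tu = "\<lambda>x i j. Gp i (u x) $ j" and B = B])
    show "(\<lambda>x. Gp i (u x) $ j) \<in> borel_measurable borel" for i j
    proof -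
      note [measurable] = Gp_u_measurable[of i]
      have "(\<lambda>x. Gp i (u x) \<bullet> axis j 1) \<in> borel_measurable borel" by measurable
      then show ?thesis by (simp add: inner_axis)
    qed
    show "\<bar>Gp i (u x) $ j\<bar> \<le> B" for x i j
      using component_le_norm_cart[of "Gp i (u x)" j] B[OF u(2)[of x], of i] by linarith
    show "{x. w \<le> u x} \<in> sets borel" "{x. k < u x \<and> u x < w} \<in> sets borel" by measurable
    show "E \<subseteq> {x. w \<le> u x}" using Ew by auto
    show "Gp i (u x) $ j = T $ i $ j" if "x \<in> {x. w \<le> u x}" for x i j using that by (intro Gp_above) simp
    show "Gp i (u x) $ j = 0" if "x \<notin> {x. w \<le> u x}" "x \<notin> {x. k < u x \<and> u x < w}" for x i j
      using that u(2)[of x] by (intro Gp_below) auto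
    show "\<bar>\<Sum>i\<in>UNIV. \<Sum>j\<in>UNIV. Gp i (u x) $ j * H i j\<bar> \<le> (e * CARD('d) + \<tau> H / e) / 2"
      if "\<And>i j. H i j = H j i" for x H using that u(2)[of x] e by (intro window_cauchy_schwarz) auto
    show "0 \<le> \<tau> H" if "\<And>i j. H i j = H j i" for H by (rule tau_nonneg) (rule that)
    fix J
    have s: "0 < (1/2::real)^J" "(1/2::real)^J \<le> 1" by (auto simp: power_le_one)
    have "(\<integral>x. (\<Sum>i\<in>UNIV. \<Sum>j\<in>UNIV. Gp i (u x) $ j * X' E ((1/2)^J) i x $ j) \<partial>lborel)
      = (\<integral>x. (\<Sum>i\<in>UNIV. Gp i (u x) \<bullet> X' E ((1/2)^J) i x) \<partial>lborel)" by (simp add: inner_vec_def)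
    also have "\<dots> = (\<Sum>i\<in>UNIV. \<integral>x. Gp i (u x) \<bullet> X' E ((1/2)^J) i x \<partial>lborel)"
      by (rule Bochner_Integration.integral_sum) (rule GpX'_integrable[OF s])
    finally show "(\<integral>x. (\<Sum>i\<in>UNIV. \<Sum>j\<in>UNIV. Gp i (u x) $ j * X' E ((1/2)^J) i x $ j) \<partial>lborel) \<le> D" using D[of J] by simp
  qed (rule e)
qed

text \<open>The cutoff equals 1 on the ball that contains the supports of all components of the
  potential, so a sup bound \<open>M\<close> is already a domination by \<open>M * \<xi>\<close>.
  Likewise \<open>g'\<close> lives on the window, where the majorant is at least 1.\<close>

lemma window_kin:
  assumes kin: "kin a u (ball 0 1)" and h: "fl a h h' H" "\<And>v. 0 \<le> h' v" "\<And>v. v \<in> {k..w} \<Longrightarrow> 1 \<le> h' v"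
    and xi: "c1c (ball 0 1) \<xi> \<xi>'" "\<And>x. 0 \<le> \<xi> x" "\<And>x. x \<in> cball 0 (3/4) \<Longrightarrow> \<xi> x = 1"
    and M: "\<And>i x. \<bar>X E ((1/2)^J) i x\<bar> \<le> M"
  shows "(\<Sum>i\<in>UNIV. \<integral>x. Gp i (u x) \<bullet> X' E ((1/2)^J) i x \<partial>lborel) \<le> CARD('d) * (M * Kg * (\<integral>x. H (u x) \<bullet> \<xi>' x \<partial>lborel))"
proof -
  have s: "0 < (1/2::real)^J" "(1/2::real)^J \<le> 1" by (auto simp: power_le_one)
  have M0: "0 \<le> M" using M[of undefined undefined] by linarith
  have "(\<integral>x. Gp i (u x) \<bullet> X' E ((1/2)^J) i x \<partial>lborel) \<le> M * Kg * (\<integral>x. H (u x) \<bullet> \<xi>' x \<partial>lborel)" for i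
  proof -
    have X: "c1c (cball 0 (3/4)) (X E ((1/2)^J) i) (X' E ((1/2)^J) i)" by (rule X_c1c[OF E s])
    have sub: "cball 0 (3/4) \<subseteq> ball (0::real^'d) 1" by auto
    have "\<bar>X E ((1/2)^J) i x\<bar> \<le> M * \<xi> x" for x
    proof (cases "x \<in> cball 0 (3/4)")
      case True
      then show ?thesis using M xi(3) by simp
    next
      case False
      then have "X E ((1/2)^J) i x = 0" using c1c_support[OF X] by (metis subsetD)
      then show ?thesis using M0 xi(2) by simp
    qed
    moreover have "\<bar>g' i v\<bar> \<le> Kg * h' v" for v
    proof -
      have "indicator {k..w} v \<le> h' v" using h(2,3) by (auto simp: indicator_def)
      then have "Kg * indicator {k..w} v \<le> Kg * h' v" using Kg_pos by (intro mult_left_mono) auto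
      then show ?thesis using g'_bound[of i v] by linarith
    qed
    ultimately have "\<bar>\<integral>x. Gp i (u x) \<bullet> X' E ((1/2)^J) i x \<partial>lborel\<bar> \<le> M * Kg * (\<integral>x. H (u x) \<bullet> \<xi>' x \<partial>lborel)"
      using kin_bound[OF kin c1c_mono[OF X sub] xi(1) Gp(2) h(1)] by blast
    then show ?thesis by linarith
  qed
  then have "(\<Sum>i\<in>UNIV. \<integral>x. Gp i (u x) \<bullet> X' E ((1/2)^J) i x \<partial>lborel) \<le> (\<Sum>i\<in>(UNIV::'d set). M * Kg * (\<integral>x. H (u x) \<bullet> \<xi>' x \<partial>lborel))"
    by (intro sum_mono)
  then show ?thesis by simp
qed

end

end

section \<open>Kinetic solutions under dilation and reflection\<close>

lemma c1c_rescale: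
  fixes f :: "'a::euclidean_space \<Rightarrow> real"
  assumes f: "c1c {z. y + s *\<^sub>R z \<in> U} f f'" and s: "0 < s"
  shows "c1c U (\<lambda>x. f ((1/s) *\<^sub>R (x - y))) (\<lambda>x. (1/s) *\<^sub>R f' ((1/s) *\<^sub>R (x - y)))"
proof -
  obtain K where K: "compact K" "K \<subseteq> {z. y + s *\<^sub>R z \<in> U}" "\<And>x. x \<notin> K \<Longrightarrow> f x = 0"
    using c1c_support[OF f] by metis
  show ?thesis
    unfolding c1c_def
  proof (intro conjI allI exI[of _ "(\<lambda>z. y + s *\<^sub>R z) ` K"] impI)
    fix x
    have "((\<lambda>x. (1/s) *\<^sub>R (x - y)) has_derivative (\<lambda>h. (1/s) *\<^sub>R h)) (at x)"
      by (auto intro!: derivative_eq_intros simp: scaleR_diff_right)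
    from has_derivative_compose[OF this c1c_deriv[OF f, of "(1/s) *\<^sub>R (x - y)"]]
    show "((\<lambda>x. f ((1/s) *\<^sub>R (x - y))) has_derivative (\<bullet>) ((1/s) *\<^sub>R f' ((1/s) *\<^sub>R (x - y)))) (at x)"
      by (rule has_derivative_eq_rhs) (simp add: fun_eq_iff)
    show "continuous_on UNIV (\<lambda>x. (1/s) *\<^sub>R f' ((1/s) *\<^sub>R (x - y)))"
      by (intro continuous_intros continuous_on_compose2[OF c1c_cont'[OF f]]) auto
    show "compact ((\<lambda>z. y + s *\<^sub>R z) ` K)" by (intro compact_continuous_image continuous_intros K(1))
    show "(\<lambda>z. y + s *\<^sub>R z) ` K \<subseteq> U" using K(2) by auto
    assume x: "x \<notin> (\<lambda>z. y + s *\<^sub>R z) ` K"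
    have "(1/s) *\<^sub>R (x - y) \<notin> K"
    proof
      assume "(1/s) *\<^sub>R (x - y) \<in> K"
      then have "y + s *\<^sub>R ((1/s) *\<^sub>R (x - y)) \<in> (\<lambda>z. y + s *\<^sub>R z) ` K" by (rule imageI)
      then show False using x s by simp
    qed
    then show "f ((1/s) *\<^sub>R (x - y)) = 0" by (rule K(3))
  qed
qed

lemma integral_rescale:
  fixes G :: "real \<Rightarrow> 'a::euclidean_space" and u :: "'a \<Rightarrow> real"
  assumes u: "u \<in> borel_measurable borel" and G: "continuous_on UNIV G" and f: "continuous_on UNIV f'" and s: "0 < s"
  shows "(\<integral>x. G (u x) \<bullet> ((1/s) *\<^sub>R f' ((1/s) *\<^sub>R (x - y))) \<partial>lborel) = s ^ DIM('a) / s * (\<integral>z. G (u (y + s *\<^sub>R z)) \<bullet> f' z \<partial>lborel)"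
proof -
  have [measurable]: "(\<lambda>x. G (u x)) \<in> borel_measurable borel"
    using borel_measurable_continuous_onI[OF G] u by (rule measurable_compose_rev)
  have [measurable]: "f' \<in> borel_measurable borel" by (rule borel_measurable_continuous_onI[OF f])
  show ?thesis
    using lborel_integral_affine[of "\<lambda>x. G (u x) \<bullet> ((1/s) *\<^sub>R f' ((1/s) *\<^sub>R (x - y)))" s y] s by simp
qed

text \<open>Chain rule and change of variables multiply both sides by the same positive factor, so
  the inequality survives with the same \<open>a\<close> and the same constants. This makes every
  estimate on the unit ball available at all scales.\<close>

lemma kin_rescale:
  fixes u :: "'a::euclidean_space \<Rightarrow> real"
  assumes k: "kin a u U" and u: "u \<in> borel_measurable borel" and s: "0 < s"
  shows "kin a (\<lambda>z. u (y + s *\<^sub>R z)) {z. y + s *\<^sub>R z \<in> U}"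
  unfolding kin_def
proof (intro allI impI, elim conjE)
  fix f f' \<xi> \<xi>' g g' G h h' H
  assume f: "c1c {z. y + s *\<^sub>R z \<in> U} f f'" and x: "c1c {z. y + s *\<^sub>R z \<in> U} \<xi> \<xi>'"
    and g: "fl a g g' G" and h: "fl a h h' H" and fx: "\<forall>x. \<bar>f x\<bar> \<le> \<xi> x" and gh: "\<forall>v. \<bar>g' v\<bar> \<le> h' v"
  have c: "0 < s ^ DIM('a) / s" using s by simp
  have "\<bar>\<integral>x. G (u x) \<bullet> ((1/s) *\<^sub>R f' ((1/s) *\<^sub>R (x - y))) \<partial>lborel\<bar> \<le> (\<integral>x. H (u x) \<bullet> ((1/s) *\<^sub>R \<xi>' ((1/s) *\<^sub>R (x - y))) \<partial>lborel)"
    by (rule kinD[OF k c1c_rescale[OF f s] c1c_rescale[OF x s] g h]) (use fx gh in auto)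
  then show "\<bar>\<integral>z. G (u (y + s *\<^sub>R z)) \<bullet> f' z \<partial>lborel\<bar> \<le> (\<integral>z. H (u (y + s *\<^sub>R z)) \<bullet> \<xi>' z \<partial>lborel)"
    unfolding integral_rescale[OF u fl_continuous[OF g] c1c_cont'[OF f] s] integral_rescale[OF u fl_continuous[OF h] c1c_cont'[OF x] s]
    using c by (simp only: abs_mult abs_of_pos mult_le_cancel_left_pos)
qed

lemma kin_mono: "kin a u U \<Longrightarrow> V \<subseteq> U \<Longrightarrow> kin a u V"
  unfolding kin_def using c1c_mono by meson

lemma kin_rescale_ball:
  assumes "kin a u (ball x r)" "u \<in> borel_measurable borel" "0 < s" "ball y s \<subseteq> ball x r"
  shows "kin a (\<lambda>z. u (y + s *\<^sub>R z)) (ball 0 1)"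
proof (rule kin_mono[OF kin_rescale[OF assms(1-3)]])
  have "y + s *\<^sub>R z \<in> ball y s" if "z \<in> ball 0 1" for z using that assms(3) by (simp add: dist_norm)
  then show "ball 0 1 \<subseteq> {z. y + s *\<^sub>R z \<in> ball x r}" using assms(4) by blast
qed

lemma uminus_has_vector_derivative: "(uminus has_vector_derivative (- 1 :: real)) (at v)"
  using DERIV_minus[OF DERIV_ident, of v] by (simp add: has_real_derivative_iff_has_vector_derivative)

text \<open>The reversal of levels changes one sign, which can be placed on either side. The first
  form serves the test flux, where only the absolute value of the second derivative counts; the
  second keeps the sign of the second derivative, as a majorant requires.\<close>

lemma fl_reflect:
  assumes "fl (\<lambda>v. a (- v)) g g' G"
  shows "fl a (\<lambda>v. g (- v)) (\<lambda>v. - g' (- v)) (\<lambda>v. - G (- v))" "fl a (\<lambda>v. - g (- v)) (\<lambda>v. g' (- v)) (\<lambda>v. G (- v))"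
proof -
  have g: "((\<lambda>v. g (- v)) has_real_derivative - g' (- v)) (at v)" for v
    using DERIV_mirror[of "\<lambda>v. g v" "g' (- v)" v] assms by (simp add: fl_def)
  have G: "((\<lambda>v. G (- v)) has_vector_derivative - (g (- v) *\<^sub>R a v)) (at v)" for v
  proof -
    have "(G has_vector_derivative g (- v) *\<^sub>R a v) (at (- v))" using assms unfolding fl_def by (metis minus_minus)
    from vector_diff_chain_at[OF uminus_has_vector_derivative this] show ?thesis by (simp add: o_def)
  qed
  obtain N where N: "\<And>v. N < \<bar>v\<bar> \<Longrightarrow> g' v = 0" using assms by (auto simp: fl_def)
  have c: "continuous_on UNIV (\<lambda>v. g' (- v))"
  proof -
    have "continuous_on UNIV g'" using assms by (simp add: fl_def)
    then show ?thesis by (rule continuous_on_compose2) (auto intro!: continuous_intros)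
  qed
  have N': "\<exists>N. \<forall>v. N < \<bar>v\<bar> \<longrightarrow> g' (- v) = 0" using N by (intro exI[of _ N]) simp
  show "fl a (\<lambda>v. g (- v)) (\<lambda>v. - g' (- v)) (\<lambda>v. - G (- v))"
    unfolding fl_def using g has_vector_derivative_minus[OF G] continuous_on_minus[OF c] N' by simp
  show "fl a (\<lambda>v. - g (- v)) (\<lambda>v. g' (- v)) (\<lambda>v. G (- v))"
    unfolding fl_def using DERIV_minus[OF g] G c N' by simp
qed

lemma kin_reflect:
  assumes "kin a u U"
  shows "kin (\<lambda>v. a (- v)) (\<lambda>x. - u x) U"
  unfolding kin_def
proof (intro allI impI, elim conjE)
  fix f f' \<xi> \<xi>' g g' G h h' H
  assume f: "c1c U f f'" and x: "c1c U \<xi> \<xi>'"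
    and g: "fl (\<lambda>v. a (- v)) g g' G" and h: "fl (\<lambda>v. a (- v)) h h' H" and fx: "\<forall>x. \<bar>f x\<bar> \<le> \<xi> x" and gh: "\<forall>v. \<bar>g' v\<bar> \<le> h' v"
  have "\<bar>\<integral>x. - G (- u x) \<bullet> f' x \<partial>lborel\<bar> \<le> (\<integral>x. H (- u x) \<bullet> \<xi>' x \<partial>lborel)"
    by (rule kinD[OF assms f x fl_reflect(1)[OF g] fl_reflect(2)[OF h]]) (use fx gh in auto)
  then show "\<bar>\<integral>x. G (- u x) \<bullet> f' x \<partial>lborel\<bar> \<le> (\<integral>x. H (- u x) \<bullet> \<xi>' x \<partial>lborel)" by simp
qed

lemma flux_gn_reflect:
  assumes "flux_gn a a' lo hi Cg pg"
  shows "flux_gn (\<lambda>v. a (- v)) (\<lambda>v. - a' (- v)) (- hi) (- lo) Cg pg"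
proof -
  interpret flux_gn a a' lo hi Cg pg by fact
  show ?thesis
  proof
    show "((\<lambda>v. a (- v)) has_vector_derivative - a' (- v)) (at v)" for v
      using vector_diff_chain_at[OF uminus_has_vector_derivative a_deriv, of v] by (simp add: o_def)
    show "continuous_on UNIV (\<lambda>v. - a' (- v))"
      by (intro continuous_intros continuous_on_compose2[OF a'_cont]) auto
    fix \<xi> :: "real^'a" and \<delta> :: real assume x: "norm \<xi> = 1" "0 < \<delta>"
    have c: "continuous_on UNIV (\<lambda>v. \<bar>a v \<bullet> \<xi>\<bar>)" by (intro continuous_intros a_cont)
    have [measurable]: "(\<lambda>v. \<bar>a v \<bullet> \<xi>\<bar>) \<in> borel_measurable borel" by (rule borel_measurable_continuous_onI[OF c])
    have S: "{v \<in> {lo..hi}. \<bar>a v \<bullet> \<xi>\<bar> < \<delta>} \<in> sets borel" by measurable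
    have "measure lborel {v \<in> {- hi..- lo}. \<bar>a (- v) \<bullet> \<xi>\<bar> < \<delta>} = (\<integral>v. indicator {v \<in> {lo..hi}. \<bar>a v \<bullet> \<xi>\<bar> < \<delta>} (0 - v) \<partial>lborel)"
    proof -
      have "{v \<in> {- hi..- lo}. \<bar>a (- v) \<bullet> \<xi>\<bar> < \<delta>} \<in> sets borel"
      proof -
        have "(\<lambda>v. 0 - v) -` {v \<in> {lo..hi}. \<bar>a v \<bullet> \<xi>\<bar> < \<delta>} \<inter> space borel \<in> sets (borel :: real measure)"
          by (rule measurable_sets[OF _ S]) measurable
        moreover have "(\<lambda>v. 0 - v) -` {v \<in> {lo..hi}. \<bar>a v \<bullet> \<xi>\<bar> < \<delta>} \<inter> space borel = {v \<in> {- hi..- lo}. \<bar>a (- v) \<bullet> \<xi>\<bar> < \<delta>}" by auto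
        ultimately show ?thesis by simp
      qed
      then have "measure lborel {v \<in> {- hi..- lo}. \<bar>a (- v) \<bullet> \<xi>\<bar> < \<delta>} = (\<integral>v. indicator {v \<in> {- hi..- lo}. \<bar>a (- v) \<bullet> \<xi>\<bar> < \<delta>} v \<partial>lborel)" by simp
      also have "\<dots> = (\<integral>v. indicator {v \<in> {lo..hi}. \<bar>a v \<bullet> \<xi>\<bar> < \<delta>} (0 - v) \<partial>lborel)"
        by (intro Bochner_Integration.integral_cong refl) (auto simp: indicator_def)
      finally show ?thesis .
    qed
    also have "\<dots> = measure lborel {v \<in> {lo..hi}. \<bar>a v \<bullet> \<xi>\<bar> < \<delta>}"
      using lborel_integral_reflect[of "indicator {v \<in> {lo..hi}. \<bar>a v \<bullet> \<xi>\<bar> < \<delta>} :: real \<Rightarrow> real" 0] S by simp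
    finally show "measure lborel {v \<in> {- hi..- lo}. \<bar>a (- v) \<bullet> \<xi>\<bar> < \<delta>} \<le> Cg * \<delta> powr pg" using GN[OF x] by simp
  qed (rule Cg pg)+
qed

section \<open>Size of the kernel constants\<close>

context ellip
begin

text \<open>Around a point with \<open>sqrt (q e) = 3/4\<close>, a ball of radius
  \<open>sqrt lam / 8\<close> moves \<open>sqrt q\<close> by at most 1/8. On it \<open>q\<close>
  stays between 3/8 and 7/8, where \<open>bump\<close> is at least 1/4096 and the power of
  \<open>q\<close>, having exponent at most 1, is at least 3/8. The point is that the bound is a
  power of \<open>lam\<close>, hence of the window length.\<close>

lemma cA_lower: "2 * (3/8) * (1/4096) * (unit_vol * (sqrt lam / 8) ^ CARD('d)) \<le> cA"
proof -
  obtain x0 :: "real^'d" where x0: "x0 \<noteq> 0" using vector_choose_size[of 1] by (metis norm_zero zero_neq_one zero_le_one)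
  have q0: "q x0 > 0" using q_lower[of x0] x0 by (smt (verit) zero_less_norm_iff zero_less_power)
  define e where "e = (3 / (4 * sqrt (q x0))) *\<^sub>R x0"
  have qe: "sqrt (q e) = 3/4"
  proof -
    have "q e = (3/4)\<^sup>2" using q0 by (simp add: e_def q_scale power_divide power_mult_distrib power2_eq_square)
    then show ?thesis by simp
  qed
  have q_near: "3/8 \<le> q x \<and> q x \<le> 7/8" if "x \<in> cball e (sqrt lam / 8)" for x
  proof -
    have "norm (x - e) \<le> sqrt lam / 8" using that by (simp add: dist_norm norm_minus_commute)
    then have "(norm (x - e))\<^sup>2 \<le> (sqrt lam / 8)\<^sup>2" by (intro power_mono) auto
    then have "(norm (x - e))\<^sup>2 / lam \<le> (1/8)\<^sup>2" using lam by (simp add: power_divide divide_le_eq)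
    then have "q (x - e) \<le> (1/8)\<^sup>2" using q_upper[of "x - e"] by linarith
    then have d: "sqrt (q (x - e)) \<le> 1/8" by (intro real_le_lsqrt) auto
    have "q (e - x) = q (x - e)" using q_scale[of "-1" "x - e"] by simp
    then have "sqrt (q x) \<le> 3/4 + 1/8" "3/4 \<le> sqrt (q x) + 1/8"
      using q_add_le[of e "x - e"] q_add_le[of x "e - x"] d qe by auto
    then have "5/8 \<le> sqrt (q x)" "sqrt (q x) \<le> 7/8" by auto
    then have "(5/8)\<^sup>2 \<le> (sqrt (q x))\<^sup>2" "(sqrt (q x))\<^sup>2 \<le> (7/8)\<^sup>2" by (intro power_mono; simp add: q_nonneg)+
    then show ?thesis using q_nonneg[of x] by (simp add: power2_eq_square)
  qed
  have r: "2 * (3/8) * (1/4096) \<le> \<rho> x" if "x \<in> cball e (sqrt lam / 8)" for x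
  proof -
    have qx: "3/8 \<le> q x" "q x \<le> 7/8" using q_near[OF that] by auto
    have "q x powr 1 \<le> q x powr (1 - real CARD('d) / 2)" using qx by (intro powr_mono') auto
    then have "3/8 \<le> q x powr (1 - real CARD('d) / 2)" using qx by simp
    then have "3/8 * (1/4096) \<le> q x powr (1 - real CARD('d) / 2) * bump (q x)"
      using bump_lower[OF qx] by (intro mult_mono) auto
    then show ?thesis by (simp add: \<rho>_def)
  qed
  have "2 * (3/8) * (1/4096) * (unit_vol * (sqrt lam / 8) ^ CARD('d)) = (\<integral>x. 2 * (3/8) * (1/4096) * indicator (cball e (sqrt lam / 8)) x \<partial>lborel)"
    using measure_cball_scale[of "sqrt lam / 8" e] lam by simp
  also have "\<dots> \<le> cA" unfolding cA_def
    using r rho_nonneg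
    by (intro integral_mono rho_integrable integrable_mult_right integrable_indicator_bounded) (auto simp: indicator_def)
  finally show ?thesis .
qed

lemma unit_vol_pos: "unit_vol > 0"
  unfolding unit_vol_def using content_cball_pos[of 1 "0::real^'d"] by simp

lemma cA_pos: "cA > 0"
proof -
  have "0 < 2 * (3/8) * (1/4096) * (unit_vol * (sqrt lam / 8) ^ CARD('d))" using lam unit_vol_pos by simp
  then show ?thesis using cA_lower by linarith
qed

lemma lam_le_quarter: "lam \<le> 1/4"
proof -
  obtain x :: "real^'d" where x: "norm x = 1" using vector_choose_size[of 1] by auto
  then have "x \<bullet> x = 1" by (simp add: power2_norm_eq_inner[symmetric])
  then show ?thesis using T_lower[of x] T_upper[of x] by simp
qed

text \<open>The average at unit scale is bounded by the measure of \<open>E\<close>, not merely by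
  \<open>cA\<close>; multiplied by the measure of a superlevel set it becomes a quadratic
  remainder.\<close>

lemma Fs_sup:
  assumes E: "E \<in> sets borel" "E \<subseteq> cball 0 (1/4)"
  shows "Fs E 1 x \<le> measure lborel E * (2 * 4 ^ CARD('d))"
proof -
  have "norm (conv (indicator E) (\<rho>s 1) x) \<le> (\<integral>y. \<bar>indicator E y\<bar> \<partial>lborel) * (2 * 4 ^ CARD('d))"
    by (rule norm_conv_le[OF E_int[OF E]]) (use rhos_bounded[of 1] in auto)
  then show ?thesis using E(1) by (simp add: Fs_def[OF E])
qed

end

subsection \<open>De Giorgi iteration\<close>

lemma measure_rescale:
  fixes S :: "'a::euclidean_space set"
  assumes "S \<in> sets borel" "0 < s"
  shows "measure lborel (S \<inter> ball y s) = s ^ DIM('a) * measure lborel ({z. y + s *\<^sub>R z \<in> S} \<inter> ball 0 1)"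
proof -
  note [measurable] = assms(1)
  have m: "{z. y + s *\<^sub>R z \<in> S} \<in> sets borel"
  proof -
    have "(\<lambda>z. y + s *\<^sub>R z) -` S \<inter> space borel \<in> sets borel" by (rule measurable_sets[OF _ assms(1)]) measurable
    then show ?thesis by (simp add: vimage_def)
  qed
  have "measure lborel (S \<inter> ball y s) = (\<integral>x. indicator (S \<inter> ball y s) x \<partial>lborel)" using assms(1) by simp
  also have "\<dots> = s ^ DIM('a) * (\<integral>z. indicator (S \<inter> ball y s) (y + s *\<^sub>R z) \<partial>lborel)"
  proof -
    have "S \<inter> ball y s \<in> sets borel" using assms(1) by auto
    then have "(indicator (S \<inter> ball y s) :: 'a \<Rightarrow> real) \<in> borel_measurable borel" by (rule borel_measurable_indicator)
    from lborel_integral_affine[OF this, of s y] show ?thesis using assms(2) by simp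
  qed
  also have "(\<lambda>z. indicator (S \<inter> ball y s) (y + s *\<^sub>R z)) = (indicator ({z. y + s *\<^sub>R z \<in> S} \<inter> ball 0 1) :: 'a \<Rightarrow> real)"
    using assms(2) by (auto simp: fun_eq_iff indicator_def dist_norm)
  finally show ?thesis using m by simp
qed

lemma measure_mono_bounded:
  fixes S :: "'a::euclidean_space set"
  assumes "S \<subseteq> S'" "S \<in> sets borel" "S' \<in> sets borel" "bounded S'"
  shows "measure lborel S \<le> measure lborel S'"
  using emeasure_bounded_finite[OF assms(4)] assms(1-3) by (intro measure_mono_fmeasurable fmeasurableI) auto

lemma power_powr_scale:
  fixes h c0 Cg pg :: real
  assumes h: "h > 0" and Cg: "Cg > 0"
  shows "c0 * ((h/2) / 4) ^ 5 * ((h/2) / (4 * Cg)) powr (2 / pg) = (c0 * (1/8) ^ 5 * (1 / (8 * Cg)) powr (2 / pg)) * h powr (5 + 2 / pg)"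
proof -
  have "((h/2) / 4) ^ 5 = (1/8)^5 * h powr 5" using h by (simp add: powr_numeral power_divide)
  moreover have "((h/2) / (4 * Cg)) powr (2 / pg) = (1 / (8 * Cg)) powr (2 / pg) * h powr (2 / pg)"
    using h Cg by (simp add: powr_mult[symmetric])
  ultimately show ?thesis using h by (simp add: powr_add)
qed

lemma divide_powr_power:
  fixes h C c q :: real
  assumes h: "h > 0"
  shows "C / (c * h powr q) ^ (n + 1) = C / c ^ (n + 1) * h powr (- (q * (real n + 1)))"
proof -
  have "(h powr q) ^ (n + 1) = h powr (q * (real n + 1))"
    using h powr_realpow[of "h powr q" "n + 1"] by (simp add: powr_powr add.commute)
  then show ?thesis unfolding power_mult_distrib powr_minus by (simp add: divide_inverse mult_ac)
qed

section \<open>From one window to a De Giorgi step\<close>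

context flux_gn
begin

text \<open>The constant in front of the window term depends on the dimension alone, and every loss
  in the width \<open>w - k0\<close> is a negative power multiplying a superlinear term. The
  exponent \<open>1 + 1 / (2 d)\<close> comes from \<open>X_bound\<close> times one full power of
  the measure where the ramp flux lives.\<close>

lemma dg_window:
  "\<exists>\<Gamma>>0. \<exists>P>0. \<forall>k0 w u. lo \<le> k0 \<and> k0 < w \<and> w \<le> hi \<and> kin a u (ball 0 1) \<and> u \<in> borel_measurable borel \<and> (\<forall>x. u x \<in> {lo..hi}) \<longrightarrow>
     measure lborel ({x. w \<le> u x} \<inter> cball 0 (1/4)) \<le> 4 * real CARD('d) * measure lborel ({x. k0 < u x \<and> u x < w} \<inter> cball 0 (3/4))
       + \<Gamma> * (w - k0) powr (- P) * measure lborel ({x. k0 < u x} \<inter> ball 0 1) powr (1 + 1 / (2 * real CARD('d)))"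
proof -
  obtain \<xi> :: "real^'d \<Rightarrow> real" and \<xi>' where xi: "c1c (ball 0 1) \<xi> \<xi>'" "\<And>x. 0 \<le> \<xi> x" "\<And>x. x \<in> cball 0 (3/4) \<Longrightarrow> \<xi> x = 1"
    using cutoff_exists[where 'a = "real^'d"] by blast
  obtain Bx where Bx: "Bx > 0" "\<And>x. norm (\<xi>' x) \<le> Bx" using c1c_bounds[OF xi(1)] by metis
  have xi'_zero: "\<xi>' x = 0" if "x \<notin> ball 0 1" for x
  proof -
    obtain K where K: "K \<subseteq> ball 0 1" "\<And>x. x \<notin> K \<Longrightarrow> \<xi>' x = 0" using c1c_support[OF xi(1)] by metis
    then show ?thesis using that by blast
  qed
  define V where "V = measure lborel (cball (0::real^'d) 1)"
  have V: "V > 0" unfolding V_def using content_cball_pos[of 1 "0::real^'d"] by simp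
  let ?d = "real CARD('d)"
  define th where "th = 1 / (2 * ?d)"
  have d1: "?d \<ge> 1"
  proof -
    have "1 \<le> CARD('d)" by (simp add: Suc_leI)
    then show ?thesis by linarith
  qed
  have th: "0 < th" "th \<le> 1/2"
  proof -
    have "0 < 1 / (2 * c)" "1 / (2 * c) \<le> 1/2" if "1 \<le> c" for c :: real using that by (auto simp: field_simps)
    then show "0 < th" "th \<le> 1/2" unfolding th_def using d1 by blast+
  qed
  define CH where "CH = (hi - lo)\<^sup>2 * Ba"
  have CH: "CH \<ge> 0" unfolding CH_def using Ba(1) by simp
  define c2 where "c2 = 2 * (3/8) * (1/4096::real)"
  define C3 where "C3 = 8 ^ CARD('d) / (c2 * V)"
  have C3: "C3 > 0" unfolding C3_def c2_def using V by simp
  define P where "P = (5 + 2 / pg) * (?d + 1)"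
  have P: "P > 0" unfolding P_def using pg d1 by (intro mult_pos_pos add_pos_pos) auto
  define cL where "cL = c0 * (1/8) ^ 5 * (1 / (8 * Cg)) powr (2 / pg)"
  have cL: "cL > 0" unfolding cL_def using c0_pos Cg by simp
  define C4 where "C4 = (1 + V) * (2 * 4 ^ CARD('d) + 4 * ?d * 2 ^ CARD('d) * Kg * CH * Bx)"
  have C4: "C4 > 0" unfolding C4_def using V Kg_pos CH Bx d1 by (intro mult_pos_pos add_pos_nonneg) auto
  define \<Gamma> where "\<Gamma> = 2 * C3 / cL ^ (CARD('d) + 1) * C4"
  have \<Gamma>: "\<Gamma> > 0" unfolding \<Gamma>_def using C3 cL C4 by simp
  have "measure lborel ({x. w \<le> u x} \<inter> cball 0 (1/4)) \<le> 4 * ?d * measure lborel ({x. k0 < u x \<and> u x < w} \<inter> cball 0 (3/4))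
       + \<Gamma> * (w - k0) powr (- P) * measure lborel ({x. k0 < u x} \<inter> ball 0 1) powr (1 + th)"
    if k0w: "lo \<le> k0" "k0 < w" "w \<le> hi" and kin: "kin a u (ball 0 1)" and u: "u \<in> borel_measurable borel" "\<And>x. u x \<in> {lo..hi}"
    for k0 w and u :: "real^'d \<Rightarrow> real"
  proof -
    note [measurable] = u(1)
    \<comment> \<open>The window proper is the upper half \<open>[k, w]\<close>. The lower half
      gives the ramp room to rise from 0, so that its flux still vanishes at level
      \<open>k0\<close>.\<close>
    define k where "k = (k0 + w) / 2"
    have k: "k0 < k" "k < w" using k0w by (auto simp: k_def)
    interpret window a a' lo hi Cg pg k w by unfold_locales (use k0w k in auto)
    define E where "E = {x. w \<le> u x} \<inter> cball 0 (1/4)"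
    have E: "E \<in> sets borel" "E \<subseteq> cball 0 (1/4)" by (auto simp: E_def)
    define m where "m = measure lborel E"
    define b where "b = measure lborel ({x. k0 < u x} \<inter> ball 0 1)"
    define e where "e = measure lborel ({x. k0 < u x \<and> u x < w} \<inter> cball 0 (3/4))"
    have ball_m: "{x. k0 < u x} \<inter> ball 0 1 \<in> sets borel" by measurable
    have bint: "integrable lborel (indicator ({x. k0 < u x} \<inter> ball 0 1) :: real^'d \<Rightarrow> real)"
      by (rule integrable_indicator_bounded[OF bounded_subset[OF bounded_ball[of 0 1]] ball_m]) auto
    have m0: "0 \<le> m" "0 \<le> b" "0 \<le> e" by (auto simp: m_def b_def e_def)
    have mb: "m \<le> b" unfolding m_def b_def
      by (rule measure_mono_bounded[OF _ E(1) ball_m bounded_subset[OF bounded_ball[of 0 1]]]) (use k0w in \<open>auto simp: E_def\<close>)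
    have bV: "b \<le> V" unfolding b_def V_def
      by (rule measure_mono_bounded[OF _ ball_m _ bounded_cball]) auto
    have "k \<le> hi" using k k0w by simp
    from ramp_exists[OF k0w(1) k(1) this, folded CH_def]
    obtain h h' H where hh: "fl a h h' H \<and> (\<forall>v. 0 \<le> h' v) \<and> (\<forall>v\<in>{k..hi}. 1 \<le> h' v) \<and> (\<forall>s\<le>k0. H s = 0)
       \<and> (\<forall>s\<in>{lo..hi}. norm (H s) \<le> CH)" by (elim exE)
    then have h: "fl a h h' H" "\<And>v. 0 \<le> h' v" "\<And>v. v \<in> {k..hi} \<Longrightarrow> 1 \<le> h' v" "\<And>s. s \<le> k0 \<Longrightarrow> H s = 0"
      "\<And>s. s \<in> {lo..hi} \<Longrightarrow> norm (H s) \<le> CH" by simp_all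
    have Hm: "(\<lambda>x. H (u x)) \<in> borel_measurable borel"
      using borel_measurable_continuous_onI[OF fl_continuous[OF h(1)]] u(1) by (rule measurable_compose_rev)
    have xm: "\<xi>' \<in> borel_measurable borel" using c1c_cont'[OF xi(1)] by (rule borel_measurable_continuous_onI)
    note [measurable] = Hm xm
    have Hb: "\<bar>H (u x) \<bullet> \<xi>' x\<bar> \<le> CH * Bx * indicator ({x. k0 < u x} \<inter> ball 0 1) x" for x
    proof (cases "k0 < u x \<and> x \<in> ball 0 1")
      case True
      have "\<bar>H (u x) \<bullet> \<xi>' x\<bar> \<le> norm (H (u x)) * norm (\<xi>' x)" by (rule Cauchy_Schwarz_ineq2)
      also have "\<dots> \<le> CH * Bx" using h(5)[OF u(2)] Bx CH by (intro mult_mono) auto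
      finally show ?thesis using True by simp
    next
      case False
      then have "H (u x) \<bullet> \<xi>' x = 0" using h(4)[of "u x"] xi'_zero[of x] by (cases "k0 < u x") auto
      then show ?thesis using CH Bx by simp
    qed
    have Hi: "integrable lborel (\<lambda>x. H (u x) \<bullet> \<xi>' x)"
      by (rule Bochner_Integration.integrable_bound[OF integrable_mult_right[OF bint, of "CH * Bx"]])
        (use Hb in \<open>auto intro: order_trans[OF _ abs_ge_self]\<close>)
    have S: "(\<integral>x. H (u x) \<bullet> \<xi>' x \<partial>lborel) \<le> CH * Bx * b"
    proof -
      have "(\<integral>x. H (u x) \<bullet> \<xi>' x \<partial>lborel) \<le> (\<integral>x. CH * Bx * indicator ({x. k0 < u x} \<inter> ball 0 1) x \<partial>lborel)"
        by (rule integral_mono[OF Hi integrable_mult_right[OF bint]]) (use Hb in \<open>auto intro: order_trans[OF abs_ge_self]\<close>)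
      then show ?thesis using ball_m by (simp add: b_def)
    qed
    define M where "M = 4 * (2 ^ CARD('d) / lam) * (1 + V) * m powr th"
    have M0: "0 \<le> M" unfolding M_def using lam_pos V by simp
    have XM: "\<bar>X E ((1/2)^J) i x\<bar> \<le> M" for J i x
      using X_bound[OF E, of J i x] by (simp add: M_def m_def th_def V_def unit_vol_def)
    define D where "D = ?d * (M * Kg * (CH * Bx * b))"
    have D: "(\<Sum>i\<in>UNIV. \<integral>x. Gp i (u x) \<bullet> X' E ((1/2)^J) i x \<partial>lborel) \<le> D" for J
    proof -
      have "(\<Sum>i\<in>UNIV. \<integral>x. Gp i (u x) \<bullet> X' E ((1/2)^J) i x \<partial>lborel) \<le> ?d * (M * Kg * (\<integral>x. H (u x) \<bullet> \<xi>' x \<partial>lborel))"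
        by (rule window_kin[OF u E kin h(1,2) _ xi XM]) (use h(3) k0w in auto)
      also have "\<dots> \<le> D" unfolding D_def using M0 Kg_pos S by (intro mult_left_mono) auto
      finally show ?thesis .
    qed
    \<comment> \<open>With the parameter \<open>4 * cA\<close> the square term becomes a quarter of
      the left-hand side and is absorbed.\<close>
    have cA4: "4 * cA > 0" using cA_pos by simp
    have wi: "cA * m \<le> (\<integral>x. indicator {x. w \<le> u x} x * Fs E 1 x \<partial>lborel)
       + 4 * cA * ?d / 2 * measure lborel ({x. k < u x \<and> u x < w} \<inter> cball 0 (3/4)) + cA\<^sup>2 * m / (4 * cA) + D"
      unfolding m_def by (rule window_inequality[OF u E _ cA4 D]) (auto simp: E_def)
    \<comment> \<open>The average of \<open>E\<close> at unit scale is at most a multiple of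
      \<open>b\<close>, and it is integrated over a set of measure at most \<open>b\<close>. The
      resulting square is weakened to the power \<open>1 + th\<close> below, as \<open>b\<close> is
      bounded by the volume of the ball.\<close>
    have I: "(\<integral>x. indicator {x. w \<le> u x} x * Fs E 1 x \<partial>lborel) \<le> b * (2 * 4 ^ CARD('d)) * b"
    proof -
      have "(\<integral>x. indicator {x. w \<le> u x} x * Fs E 1 x \<partial>lborel) \<le> (\<integral>x. b * (2 * 4 ^ CARD('d)) * indicator ({x. k0 < u x} \<inter> ball 0 1) x \<partial>lborel)"
      proof (rule integral_mono[OF _ integrable_mult_right[OF bint]])
        show "integrable lborel (\<lambda>x. indicator {x. w \<le> u x} x * Fs E 1 x)"
          using integrable_real_mult_indicator[OF _ Fs_integrable[OF E, of 1], of "{x. w \<le> u x}"] by (simp add: mult.commute)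
        fix x
        have sup: "Fs E 1 x \<le> b * (2 * 4 ^ CARD('d))"
        proof -
          have "m * (2 * 4 ^ CARD('d)) \<le> b * (2 * 4 ^ CARD('d))" using mb by (intro mult_right_mono) auto
          then show ?thesis using Fs_sup[OF E, of x] unfolding m_def by linarith
        qed
        show "indicator {x. w \<le> u x} x * Fs E 1 x \<le> b * (2 * 4 ^ CARD('d)) * indicator ({x. k0 < u x} \<inter> ball 0 1) x"
        proof (cases "x \<in> ball 0 1")
          case True
          then show ?thesis using sup m0(2) k0w by (auto simp: indicator_def)
        next
          case False
          then have "Fs E 1 x = 0" by (intro Fs_zero[OF E]) auto
          then show ?thesis using m0(2) by simp
        qed
      qed
      then show ?thesis using ball_m by (simp add: b_def)
    qed
    have e_le: "measure lborel ({x. k < u x \<and> u x < w} \<inter> cball 0 (3/4)) \<le> e"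
      unfolding e_def by (rule measure_mono_bounded) (use k in auto)
    have main: "cA * m \<le> 4 * cA * ?d * e + 2 * (b * (2 * 4 ^ CARD('d)) * b + D)"
    proof -
      have q1: "cA\<^sup>2 * m / (4 * cA) = cA * m / 4" using cA_pos by (simp add: power2_eq_square)
      have q2: "4 * cA * ?d / 2 * measure lborel ({x. k < u x \<and> u x < w} \<inter> cball 0 (3/4)) \<le> 4 * cA * ?d / 2 * e"
        using cA_pos e_le by (intro mult_left_mono) auto
      have q3: "4 * cA * ?d / 2 * e = 2 * (cA * ?d * e)" by simp
      have "cA * m \<le> b * (2 * 4 ^ CARD('d)) * b + 2 * (cA * ?d * e) + (cA * m) / 4 + D"
        using wi I q2 unfolding q1 q3 by linarith
      moreover have "0 \<le> cA * ?d * e" using cA_pos m0 by simp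
      moreover have "0 \<le> b * (2 * 4 ^ CARD('d)) * b + D" unfolding D_def using m0 M0 Kg_pos CH Bx by simp
      ultimately show ?thesis by argo
    qed
    have bb: "b * b \<le> (1 + V) * b powr (1 + th)"
    proof (cases "b = 0")
      case False
      then have bp: "b > 0" using m0 by simp
      have "b powr (1 - th) \<le> 1 + V"
      proof (cases "b \<le> 1")
        case True
        then have "b powr (1 - th) \<le> 1" using bp th by (intro powr_le1) auto
        then show ?thesis using V by linarith
      next
        case False
        then have "b powr (1 - th) \<le> b powr 1" using th by (intro powr_mono) auto
        then show ?thesis using bV bp by simp
      qed
      then have "b powr (1 - th) * b powr (1 + th) \<le> (1 + V) * b powr (1 + th)" by (intro mult_right_mono) auto
      moreover have "b powr (1 - th) * b powr (1 + th) = b powr 2" by (simp add: powr_add[symmetric])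
      ultimately show ?thesis using bp by (simp add: powr_numeral power2_eq_square)
    qed (use V in simp)
    have lam1: "0 < lam" "lam \<le> 1" using lam_pos lam_le_quarter by auto
    have Dle: "D \<le> (1 / lam) * ((1 + V) * (4 * ?d * 2 ^ CARD('d) * Kg * CH * Bx)) * b powr (1 + th)"
    proof -
      have "m powr th * b \<le> b powr th * b" using mb m0 th by (intro mult_right_mono powr_mono2) auto
      also have "\<dots> = b powr (1 + th)" using m0 by (cases "b = 0") (auto simp: powr_add mult.commute)
      finally have *: "m powr th * b \<le> b powr (1 + th)" .
      have "D = ((1 / lam) * ((1 + V) * (4 * ?d * 2 ^ CARD('d) * Kg * CH * Bx))) * (m powr th * b)"
        by (simp add: D_def M_def mult_ac)
      also have "\<dots> \<le> ((1 / lam) * ((1 + V) * (4 * ?d * 2 ^ CARD('d) * Kg * CH * Bx))) * b powr (1 + th)"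
        using lam1 V Kg_pos CH Bx by (intro mult_left_mono[OF *]) auto
      finally show ?thesis .
    qed
    have B2: "b * (2 * 4 ^ CARD('d)) * b \<le> (1 / lam) * ((1 + V) * (2 * 4 ^ CARD('d))) * b powr (1 + th)"
    proof -
      have "b * (2 * 4 ^ CARD('d)) * b \<le> (2 * 4 ^ CARD('d)) * ((1 + V) * b powr (1 + th))"
        using mult_left_mono[OF bb, of "2 * 4 ^ CARD('d)"] by (simp add: mult_ac)
      also have "\<dots> \<le> (1 / lam) * ((2 * 4 ^ CARD('d)) * ((1 + V) * b powr (1 + th)))"
      proof -
        have "1 \<le> 1 / lam" using lam1 by simp
        then show ?thesis using mult_right_mono[of 1 "1 / lam" "(2 * 4 ^ CARD('d)) * ((1 + V) * b powr (1 + th))"] V by simp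
      qed
      finally show ?thesis by (simp add: mult_ac)
    qed
    have C: "b * (2 * 4 ^ CARD('d)) * b + D \<le> (1 / lam) * C4 * b powr (1 + th)"
      using B2 Dle unfolding C4_def by (simp only: distrib_left distrib_right)
    have "m \<le> 4 * ?d * e + 2 * ((1 / cA) * (1 / lam)) * C4 * b powr (1 + th)"
    proof -
      have "cA * m \<le> 4 * cA * ?d * e + 2 * ((1 / lam) * C4 * b powr (1 + th))"
        by (rule order_trans[OF main add_left_mono[OF mult_left_mono[OF C]]]) simp
      then have "m \<le> (4 * cA * ?d * e + 2 * ((1 / lam) * C4 * b powr (1 + th))) / cA"
        using cA_pos by (simp add: le_divide_eq mult.commute)
      also have "\<dots> = 4 * ?d * e + 2 * ((1 / cA) * (1 / lam)) * C4 * b powr (1 + th)"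
        using cA_pos by (simp add: add_divide_distrib mult_ac)
      finally show ?thesis .
    qed
    also have "\<dots> \<le> 4 * ?d * e + 2 * (C3 / cL ^ (CARD('d) + 1) * (w - k0) powr (- P)) * C4 * b powr (1 + th)"
    proof -
      have lam_eq: "lam = cL * (w - k0) powr (5 + 2 / pg)"
      proof -
        have wk: "w - k = (w - k0) / 2" by (simp add: k_def field_simps)
        show ?thesis unfolding lam_def wk cL_def by (rule power_powr_scale) (use k0w Cg in auto)
      qed
      \<comment> \<open>Replacing \<open>sqrt lam\<close> by the smaller \<open>lam\<close> keeps
        the exponents integral, at the cost of a worse power of the width.\<close>
      have "c2 * V * (lam / 8) ^ CARD('d) \<le> cA"
      proof -
        have "lam \<le> sqrt lam" using lam1 by (intro real_le_rsqrt) (simp add: power2_eq_square mult_left_le_one_le)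
        then have "(lam / 8) ^ CARD('d) \<le> (sqrt lam / 8) ^ CARD('d)" using lam1 by (intro power_mono divide_right_mono) auto
        then have s1: "c2 * V * (lam / 8) ^ CARD('d) \<le> c2 * V * (sqrt lam / 8) ^ CARD('d)"
          using V by (intro mult_left_mono) (auto simp: c2_def)
        have s2: "c2 * V * (sqrt lam / 8) ^ CARD('d) \<le> cA"
          using cA_lower unfolding c2_def V_def unit_vol_def by (simp only: mult.assoc)
        show ?thesis by (rule order_trans[OF s1 s2])
      qed
      then have "1 / cA \<le> 1 / (c2 * V * (lam / 8) ^ CARD('d))"
        using lam1 V by (intro divide_left_mono mult_pos_pos cA_pos) (auto simp: c2_def)
      also have "\<dots> = C3 * (1 / lam) ^ CARD('d)" by (simp add: C3_def power_divide)
      finally have "(1 / cA) * (1 / lam) \<le> C3 * (1 / lam) ^ CARD('d) * (1 / lam)" using lam1 by (intro mult_right_mono) auto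
      also have "\<dots> = C3 / lam ^ (CARD('d) + 1)" by (simp add: power_divide)
      also have "C3 / lam ^ (CARD('d) + 1) = C3 / cL ^ (CARD('d) + 1) * (w - k0) powr (- P)"
        unfolding P_def lam_eq by (rule divide_powr_power) (use k0w in auto)
      finally have *: "(1 / cA) * (1 / lam) \<le> C3 / cL ^ (CARD('d) + 1) * (w - k0) powr (- P)" .
      show ?thesis using C4 by (intro add_left_mono mult_right_mono mult_left_mono *) auto
    qed
    finally show ?thesis unfolding m_def[symmetric] E_def[symmetric] e_def[symmetric] b_def[symmetric] \<Gamma>_def by (simp add: mult_ac)
  qed
  then show ?thesis using \<Gamma> P unfolding th_def by blast
qed

end

context flux_gn
begin

text \<open>The range from \<open>k\<close> to \<open>w\<close> is cut into \<open>N\<close>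
  disjoint windows. Their linear terms telescope to at most \<open>4 * d * b\<close>, so on average
  each contributes \<open>4 * d / N\<close> times \<open>b\<close>. The value of \<open>N\<close>
  turns this into \<open>b / 4\<close> even after multiplication by \<open>4 ^ d\<close>, the factor
  for enlarging the ball of radius 1/4 to the unit ball. The price is the constant
  \<open>N powr P\<close> in the superlinear term.\<close>

lemma dg_step:
  "\<exists>\<Gamma>>0. \<exists>P>0. \<forall>k w u. lo \<le> k \<and> k < w \<and> w \<le> hi \<and> kin a u (ball 0 1) \<and> u \<in> borel_measurable borel \<and> (\<forall>x. u x \<in> {lo..hi}) \<longrightarrow>
     4 ^ CARD('d) * measure lborel ({x. w < u x} \<inter> ball 0 (1/4)) \<le> 1/4 * measure lborel ({x. k < u x} \<inter> ball 0 1)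
       + \<Gamma> * (w - k) powr (- P) * measure lborel ({x. k < u x} \<inter> ball 0 1) powr (1 + 1 / (2 * real CARD('d)))"
proof -
  let ?d = "real CARD('d)"
  define th where "th = 1 + 1 / (2 * ?d)"
  have th: "th > 0" unfolding th_def by (intro add_pos_nonneg) auto
  obtain \<Gamma> P where \<Gamma>: "\<Gamma> > 0" and P: "P > 0" and
    W: "\<forall>k0 w u. lo \<le> k0 \<and> k0 < w \<and> w \<le> hi \<and> kin a u (ball 0 1) \<and> u \<in> borel_measurable borel \<and> (\<forall>x. u x \<in> {lo..hi}) \<longrightarrow>
     measure lborel ({x. w \<le> u x} \<inter> cball 0 (1/4)) \<le> 4 * ?d * measure lborel ({x. k0 < u x \<and> u x < w} \<inter> cball 0 (3/4))
       + \<Gamma> * (w - k0) powr (- P) * measure lborel ({x. k0 < u x} \<inter> ball 0 1) powr th"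
    using dg_window unfolding th_def by blast
  define N where "N = 16 * CARD('d) * 4 ^ CARD('d)"
  have N: "N > 0" by (simp add: N_def)
  define \<Gamma>' where "\<Gamma>' = 4 ^ CARD('d) * \<Gamma> * real N powr P"
  have \<Gamma>': "\<Gamma>' > 0" using \<Gamma> N by (simp add: \<Gamma>'_def)
  have "4 ^ CARD('d) * measure lborel ({x. w < u x} \<inter> ball 0 (1/4)) \<le> 1/4 * measure lborel ({x. k < u x} \<inter> ball 0 1)
       + \<Gamma>' * (w - k) powr (- P) * measure lborel ({x. k < u x} \<inter> ball 0 1) powr th"
    if kw: "lo \<le> k" "k < w" "w \<le> hi" and kin: "kin a u (ball 0 1)" and u: "u \<in> borel_measurable borel" "\<And>x. u x \<in> {lo..hi}"
    for k w and u :: "real^'d \<Rightarrow> real"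
  proof -
    note [measurable] = u(1)
    define h where "h = (w - k) / real N"
    have h: "h > 0" using kw N by (simp add: h_def)
    have hN: "k + real N * h = w" using N by (simp add: h_def)
    define b where "b = measure lborel ({x. k < u x} \<inter> ball 0 1)"
    define m where "m = measure lborel ({x. w < u x} \<inter> ball 0 (1/4))"
    define \<beta> where "\<beta> i = measure lborel ({x. k + real i * h < u x} \<inter> cball 0 (3/4))" for i
    have step: "m \<le> 4 * ?d * (\<beta> i - \<beta> (Suc i)) + \<Gamma> * h powr (- P) * b powr th" if i: "i < N" for i
    proof -
      have ih: "0 \<le> real i * h" "real (Suc i) * h \<le> real N * h" using h i by (auto intro!: mult_right_mono)
      then have lev: "lo \<le> k + real i * h" "k + real i * h < k + real (Suc i) * h" "k + real (Suc i) * h \<le> w"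
        by - (use kw ih in linarith, use h in \<open>simp add: algebra_simps\<close>, use ih hN in linarith)
      have "m \<le> measure lborel ({x. k + real (Suc i) * h \<le> u x} \<inter> cball 0 (1/4))"
        unfolding m_def by (rule measure_mono_bounded) (use lev in auto)
      also have "\<dots> \<le> 4 * ?d * measure lborel ({x. k + real i * h < u x \<and> u x < k + real (Suc i) * h} \<inter> cball 0 (3/4))
        + \<Gamma> * (k + real (Suc i) * h - (k + real i * h)) powr (- P) * measure lborel ({x. k + real i * h < u x} \<inter> ball 0 1) powr th"
        using lev kw kin u by (intro W[rule_format]) auto
      finally have A: "m \<le> 4 * ?d * measure lborel ({x. k + real i * h < u x \<and> u x < k + real (Suc i) * h} \<inter> cball 0 (3/4))
        + \<Gamma> * h powr (- P) * measure lborel ({x. k + real i * h < u x} \<inter> ball 0 1) powr th"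
        by (simp add: algebra_simps)
      have fin: "emeasure lborel ({x. k + real i * h < u x} \<inter> cball 0 (3/4)) < \<infinity>"
        by (rule emeasure_bounded_finite[OF bounded_subset[OF bounded_cball[of 0 "3/4"]]]) auto
      have eq: "\<beta> i - \<beta> (Suc i) = measure lborel (({x. k + real i * h < u x} \<inter> cball 0 (3/4)) - ({x. k + real (Suc i) * h < u x} \<inter> cball 0 (3/4)))"
        unfolding \<beta>_def
      proof (rule measure_Diff[symmetric])
        show "{x. k + real (Suc i) * h < u x} \<inter> cball 0 (3/4) \<subseteq> {x. k + real i * h < u x} \<inter> cball 0 (3/4)"
          using lev(2) by force
      qed (use fin in auto)
      have "measure lborel ({x. k + real i * h < u x \<and> u x < k + real (Suc i) * h} \<inter> cball 0 (3/4)) \<le> \<beta> i - \<beta> (Suc i)"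
        unfolding eq by (rule measure_mono_bounded) (auto intro: bounded_subset[OF bounded_cball[of 0 "3/4"]])
      then have B1: "4 * ?d * measure lborel ({x. k + real i * h < u x \<and> u x < k + real (Suc i) * h} \<inter> cball 0 (3/4)) \<le> 4 * ?d * (\<beta> i - \<beta> (Suc i))"
        by (rule mult_left_mono) simp
      have "measure lborel ({x. k + real i * h < u x} \<inter> ball 0 1) \<le> b"
        unfolding b_def using ih by (intro measure_mono_bounded) (auto intro: bounded_subset[OF bounded_ball[of 0 1]])
      then have "measure lborel ({x. k + real i * h < u x} \<inter> ball 0 1) powr th \<le> b powr th"
        using th by (intro powr_mono2) auto
      then have "\<Gamma> * h powr (- P) * measure lborel ({x. k + real i * h < u x} \<inter> ball 0 1) powr th \<le> \<Gamma> * h powr (- P) * b powr th"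
        using \<Gamma> by (intro mult_left_mono) auto
      with A B1 show ?thesis by linarith
    qed
    have "real N * m = (\<Sum>i<N. m)" by simp
    also have "\<dots> \<le> (\<Sum>i<N. 4 * ?d * (\<beta> i - \<beta> (Suc i)) + \<Gamma> * h powr (- P) * b powr th)"
      by (intro sum_mono step) simp
    also have "\<dots> = 4 * ?d * (\<beta> 0 - \<beta> N) + real N * (\<Gamma> * h powr (- P) * b powr th)"
      by (simp add: sum.distrib sum_distrib_left[symmetric] sum_lessThan_telescope')
    also have "\<dots> \<le> 4 * ?d * b + real N * (\<Gamma> * h powr (- P) * b powr th)"
    proof -
      have "\<beta> 0 \<le> b" unfolding \<beta>_def b_def
        by (intro measure_mono_bounded) (auto intro: bounded_subset[OF bounded_ball[of 0 1]])
      moreover have "0 \<le> \<beta> N" by (simp add: \<beta>_def)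
      ultimately show ?thesis by (intro add_right_mono mult_left_mono) auto
    qed
    finally have "m \<le> (4 * ?d * b + real N * (\<Gamma> * h powr (- P) * b powr th)) / real N"
      using N by (simp add: le_divide_eq mult.commute)
    also have "\<dots> = 4 * ?d / real N * b + \<Gamma> * h powr (- P) * b powr th" using N by (simp add: add_divide_distrib)
    finally have "4 ^ CARD('d) * m \<le> 4 ^ CARD('d) * (4 * ?d / real N * b + \<Gamma> * h powr (- P) * b powr th)"
      by (intro mult_left_mono) auto
    also have "\<dots> = 1/4 * b + 4 ^ CARD('d) * \<Gamma> * h powr (- P) * b powr th"
      by (simp add: N_def field_simps)
    also have "h powr (- P) = (w - k) powr (- P) * real N powr P"
      using kw N by (simp add: h_def powr_divide powr_minus field_simps)
    finally show ?thesis by (simp add: m_def b_def \<Gamma>'_def mult_ac)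
  qed
  then show ?thesis using \<Gamma>' P unfolding th_def by blast
qed

text \<open>Radii \<open>(1/4) ^ j\<close> are paired with levels that increase geometrically to
  \<open>k + l\<close>. The increments shrink by \<open>\<kappa>\<close>, chosen so that the growth
  \<open>2 powr th\<close> of the constant at each step is exactly compensated by the gain from
  halving the measure in the superlinear term. The rescaled measures are thus halved at every
  step.\<close>

lemma dg_point:
  assumes l: "0 < (l::real)"
  shows "\<exists>\<delta>>0. \<forall>k v. lo \<le> k \<and> k + l \<le> hi \<and> kin a v (ball 0 1) \<and> v \<in> borel_measurable borel \<and> (\<forall>x. v x \<in> {lo..hi})
     \<and> measure lborel ({x. k < v x} \<inter> ball 0 1) \<le> \<delta> \<longrightarrow>
     (\<forall>j. measure lborel ({x. k + l < v x} \<inter> ball 0 ((1/4)^j)) \<le> ((1/4)^j) ^ CARD('d) * ((1/2)^j * \<delta>))"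
proof -
  let ?d = "real CARD('d)"
  define th where "th = 1 / (2 * ?d)"
  have th: "th > 0" by (simp add: th_def)
  obtain \<Gamma> P where \<Gamma>: "\<Gamma> > 0" and P: "P > 0" and
    W: "\<And>k w u. lo \<le> k \<Longrightarrow> k < w \<Longrightarrow> w \<le> hi \<Longrightarrow> kin a u (ball 0 1) \<Longrightarrow> u \<in> borel_measurable borel \<Longrightarrow> (\<And>x. u x \<in> {lo..hi}) \<Longrightarrow>
     4 ^ CARD('d) * measure lborel ({x. w < u x} \<inter> ball 0 (1/4)) \<le> 1/4 * measure lborel ({x. k < u x} \<inter> ball 0 1)
       + \<Gamma> * (w - k) powr (- P) * measure lborel ({x. k < u x} \<inter> ball 0 1) powr (1 + th)"
    using dg_step unfolding th_def by metis
  define \<kappa> where "\<kappa> = (2::real) powr (- th / P)"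
  have \<kappa>: "0 < \<kappa>" "\<kappa> < 1" "\<kappa> powr (- P) = 2 powr th"
  proof -
    show "0 < \<kappa>" by (simp add: \<kappa>_def)
    have "2 powr (- th / P) < 2 powr (0::real)" using th P by (intro powr_less_mono) (auto simp: divide_neg_pos)
    then show "\<kappa> < 1" by (simp add: \<kappa>_def)
    show "\<kappa> powr (- P) = 2 powr th" using P by (simp add: \<kappa>_def powr_powr)
  qed
  define c where "c = l * (1 - \<kappa>)"
  have c: "c > 0" using l \<kappa> by (simp add: c_def)
  \<comment> \<open>The threshold at which the superlinear term is worth a quarter of
    \<open>b j\<close>; the linear term is the other quarter.\<close>
  define \<delta> where "\<delta> = (1 / (4 * \<Gamma> * c powr (- P))) powr (1 / th)"
  have \<delta>: "\<delta> > 0" "\<Gamma> * c powr (- P) * \<delta> powr th = 1/4"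
    using \<Gamma> c th by (auto simp: \<delta>_def powr_powr)
  have "measure lborel ({x. k + l < v x} \<inter> ball 0 ((1/4)^j)) \<le> ((1/4)^j) ^ CARD('d) * ((1/2)^j * \<delta>)"
    if k: "lo \<le> k" "k + l \<le> hi" and kin: "kin a v (ball 0 1)" and v: "v \<in> borel_measurable borel" "\<And>x. v x \<in> {lo..hi}"
      and b0: "measure lborel ({x. k < v x} \<inter> ball 0 1) \<le> \<delta>"
    for k j and v :: "real^'d \<Rightarrow> real"
  proof -
    note [measurable] = v(1)
    define kk where "kk j = k + l * (1 - \<kappa> ^ j)" for j
    define vj where "vj j z = v (0 + ((1/4)^j) *\<^sub>R z)" for j z
    have vj: "vj j \<in> borel_measurable borel" "vj j x \<in> {lo..hi}" "kin a (vj j) (ball 0 1)" for j x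
    proof -
      show "vj j \<in> borel_measurable borel" unfolding vj_def[abs_def] by measurable
      show "vj j x \<in> {lo..hi}" unfolding vj_def by (rule v)
      show "kin a (vj j) (ball 0 1)"
        unfolding vj_def[abs_def]
        by (rule kin_rescale_ball[OF kin v(1)]) (auto intro!: subset_ball simp: power_le_one)
    qed
    have kpow: "0 < \<kappa> ^ j" "\<kappa> ^ j \<le> 1" for j using \<kappa> by (auto simp: power_le_one)
    have kk: "lo \<le> kk j" "kk j < kk (Suc j)" "kk (Suc j) \<le> hi" "kk (Suc j) - kk j = c * \<kappa> ^ j" "kk j \<le> k + l" for j
    proof -
      have "0 \<le> l * (1 - \<kappa> ^ j)" "l * (1 - \<kappa> ^ j) \<le> l" "l * (1 - \<kappa> ^ Suc j) \<le> l"
        using l kpow[of j] kpow[of "Suc j"] by (auto intro!: mult_left_le simp del: power_Suc)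
      then show "lo \<le> kk j" "kk (Suc j) \<le> hi" "kk j \<le> k + l" using k by (auto simp: kk_def)
      show eq: "kk (Suc j) - kk j = c * \<kappa> ^ j" by (simp add: kk_def c_def algebra_simps)
      then show "kk j < kk (Suc j)" using c kpow[of j] mult_pos_pos[OF c kpow(1)[of j]] by linarith
    qed
    define b where "b j = measure lborel ({z. kk j < vj j z} \<inter> ball 0 1)" for j
    have b_le: "b j \<le> (1/2)^j * \<delta>" for j
    proof (induction j)
      case 0
      then show ?case using b0 by (simp add: b_def kk_def vj_def)
    next
      case (Suc j)
      have eq: "b (Suc j) = 4 ^ CARD('d) * measure lborel ({z. kk (Suc j) < vj j z} \<inter> ball 0 (1/4))"
      proof -
        have "vj (Suc j) z = vj j (0 + (1/4) *\<^sub>R z)" for z by (simp add: vj_def)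
        moreover have "{z. kk (Suc j) < vj j z} \<in> sets borel" using vj(1)[of j] by measurable
        ultimately show ?thesis
          using measure_rescale[of "{z. kk (Suc j) < vj j z}" "1/4" 0] by (simp add: b_def power_divide)
      qed
      have b0: "0 \<le> b j" by (simp add: b_def)
      have W1: "b (Suc j) \<le> 1/4 * b j + \<Gamma> * (c * \<kappa> ^ j) powr (- P) * b j powr (1 + th)"
        unfolding eq using W[OF kk(1,2,3) vj(3,1,2), of j j] by (simp add: kk(4) b_def)
      also have "\<Gamma> * (c * \<kappa> ^ j) powr (- P) * b j powr (1 + th) \<le> 1/4 * b j"
      proof (cases "b j = 0")
        case False
        then have bp: "b j > 0" using b0 by simp
        have "(\<kappa> ^ j) powr (- P) = (2 powr th) ^ j"
        proof -
          have "(\<kappa> ^ j) powr (- P) = (\<kappa> powr (- P)) ^ j" using \<kappa>(1) by (simp add: powr_realpow[symmetric] powr_powr mult.commute)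
          then show ?thesis using \<kappa>(3) by simp
        qed
        moreover have "b j powr th \<le> ((1/2)^j * \<delta>) powr th" using Suc.IH b0 th by (intro powr_mono2) auto
        moreover have "((1/2)^j * \<delta>) powr th = (1 / (2 powr th) ^ j) * \<delta> powr th"
        proof -
          have "((1/2::real)^j) powr th = ((1/2) powr th) ^ j" by (simp add: powr_realpow[symmetric] powr_powr mult.commute)
          then show ?thesis using \<delta>(1) by (simp add: powr_mult powr_divide power_divide)
        qed
        ultimately have "\<Gamma> * (c * \<kappa> ^ j) powr (- P) * b j powr th \<le> \<Gamma> * (c powr (- P) * (2 powr th) ^ j) * ((1 / (2 powr th) ^ j) * \<delta> powr th)"
          using \<Gamma> c kpow[of j] by (intro mult_mono) (auto simp: powr_mult)
        also have "\<dots> = \<Gamma> * c powr (- P) * \<delta> powr th" by simp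
        finally have "\<Gamma> * (c * \<kappa> ^ j) powr (- P) * b j powr th \<le> 1/4" using \<delta>(2) by simp
        then have "\<Gamma> * (c * \<kappa> ^ j) powr (- P) * b j powr th * b j \<le> 1/4 * b j" using bp by (intro mult_right_mono) auto
        then show ?thesis using bp by (simp add: powr_add mult_ac)
      qed simp
      finally have "b (Suc j) \<le> 1/2 * b j" by simp
      then show ?case using Suc.IH by simp
    qed
    have "measure lborel ({x. k + l < v x} \<inter> ball 0 ((1/4)^j)) = ((1/4)^j) ^ CARD('d) * measure lborel ({z. k + l < vj j z} \<inter> ball 0 1)"
      using measure_rescale[of "{x. k + l < v x}" "(1/4)^j" 0] by (simp add: vj_def)
    also have "\<dots> \<le> ((1/4)^j) ^ CARD('d) * b j"
    proof (rule mult_left_mono)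
      show "measure lborel ({z. k + l < vj j z} \<inter> ball 0 1) \<le> b j"
        unfolding b_def
      proof (rule measure_mono_bounded)
        show "{z. k + l < vj j z} \<inter> ball 0 1 \<in> sets borel" "{z. kk j < vj j z} \<inter> ball 0 1 \<in> sets borel"
          using vj(1)[of j] by measurable
        show "bounded ({z. kk j < vj j z} \<inter> ball 0 1)" by (rule bounded_subset[OF bounded_ball[of 0 1]]) auto
      qed (use kk(5)[of j] in auto)
    qed simp
    also have "\<dots> \<le> ((1/4)^j) ^ CARD('d) * ((1/2)^j * \<delta>)" by (intro mult_left_mono b_le) auto
    finally show ?thesis .
  qed
  then show ?thesis using \<delta>(1) by blast
qed

text \<open>The radii of \<open>dg_point\<close> tend to 0, so one iteration only shows that the
  superlevel set has density 0 at the centre. Applied at every centre in the half ball, it shows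
  that the set has density 0 at each of its own points, and such a set is negligible.\<close>

lemma dg:
  assumes l: "0 < (l::real)"
  shows "\<exists>\<delta>>0. \<forall>k u. lo \<le> k \<and> k + l \<le> hi \<and> kin a u (ball 0 1) \<and> u \<in> borel_measurable borel \<and> (\<forall>x. u x \<in> {lo..hi})
     \<and> measure lborel ({x. k < u x} \<inter> ball 0 1) \<le> \<delta> \<longrightarrow> negligible ({x. k + l < u x} \<inter> ball 0 (1/2))"
proof -
  obtain \<delta> where \<delta>: "\<delta> > 0" and
    W: "\<And>k v j. lo \<le> k \<Longrightarrow> k + l \<le> hi \<Longrightarrow> kin a v (ball 0 1) \<Longrightarrow> v \<in> borel_measurable borel \<Longrightarrow> (\<And>x. v x \<in> {lo..hi}) \<Longrightarrow>
     measure lborel ({x. k < v x} \<inter> ball 0 1) \<le> \<delta> \<Longrightarrow>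
     measure lborel ({x. k + l < v x} \<inter> ball 0 ((1/4)^j)) \<le> ((1/4)^j) ^ CARD('d) * ((1/2)^j * \<delta>)"
    using dg_point[OF l] by metis
  have "negligible ({x. k + l < u x} \<inter> ball 0 (1/2))"
    if k: "lo \<le> k" "k + l \<le> hi" and kin: "kin a u (ball 0 1)" and u: "u \<in> borel_measurable borel" "\<And>x. u x \<in> {lo..hi}"
      and b0: "measure lborel ({x. k < u x} \<inter> ball 0 1) \<le> (1/2) ^ CARD('d) * \<delta>"
    for k and u :: "real^'d \<Rightarrow> real"
    unfolding negligible_eq_zero_density
  proof (intro ballI allI impI)
    note [measurable] = u(1)
    fix y r e assume y: "y \<in> {x. k + l < u x} \<inter> ball 0 (1/2)" and r: "(0::real) < r" and e: "(0::real) < e"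
    define v where "v z = u (y + (1/2) *\<^sub>R z)" for z
    have sub: "ball y (1/2) \<subseteq> ball 0 1"
    proof
      fix x assume "x \<in> ball y (1/2)"
      then show "x \<in> ball 0 1" using y norm_triangle_ineq[of y "x - y"] by (auto simp: dist_norm norm_minus_commute)
    qed
    have v: "v \<in> borel_measurable borel" "\<And>x. v x \<in> {lo..hi}" "kin a v (ball 0 1)"
      unfolding v_def[abs_def] using u kin_rescale_ball[OF kin u(1) _ sub] by auto
    have v0: "measure lborel ({x. k < v x} \<inter> ball 0 1) \<le> \<delta>"
    proof -
      have "(1/2) ^ CARD('d) * measure lborel ({x. k < v x} \<inter> ball 0 1) = measure lborel ({x. k < u x} \<inter> ball y (1/2))"
        using measure_rescale[of "{x. k < u x}" "1/2" y] by (simp add: v_def)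
      also have "\<dots> \<le> measure lborel ({x. k < u x} \<inter> ball 0 1)"
        by (rule measure_mono_bounded) (use sub in \<open>auto intro: bounded_subset[OF bounded_ball[of 0 1]]\<close>)
      also have "\<dots> \<le> (1/2) ^ CARD('d) * \<delta>" by (rule b0)
      finally show ?thesis using \<delta> by simp
    qed
    define V where "V = measure lborel (ball (0::real^'d) 1)"
    have V: "V > 0" unfolding V_def using content_ball_pos[of 1 "0::real^'d"] by simp
    obtain j1 where j1: "(1/2::real)^j1 < e * V / \<delta>" using real_arch_pow_inv[of "e * V / \<delta>" "1/2"] e V \<delta> by auto
    obtain j2 where j2: "(1/4::real)^j2 < 2 * r" using real_arch_pow_inv[of "2 * r" "1/4"] r by auto
    define j where "j = max j1 j2"
    have j: "(1/2::real)^j < e * V / \<delta>" "(1/4::real)^j < 2 * r"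
    proof -
      have "(1/2::real)^j \<le> (1/2)^j1" "(1/4::real)^j \<le> (1/4)^j2" by (auto intro!: power_decreasing simp: j_def)
      then show "(1/2::real)^j < e * V / \<delta>" "(1/4::real)^j < 2 * r" using j1 j2 by linarith+
    qed
    define s where "s = (1/2) * (1/4::real)^j"
    have s: "0 < s" "s \<le> r" using j(2) by (auto simp: s_def)
    let ?S = "{x. k + l < u x} \<inter> ball y s"
    have m1: "measure lborel ?S = s ^ CARD('d) * measure lborel ({z. k + l < u (y + s *\<^sub>R z)} \<inter> ball 0 1)"
      using measure_rescale[of "{x. k + l < u x}" s y] s by simp
    have m2: "measure lborel ({x. k + l < v x} \<inter> ball 0 ((1/4)^j)) = ((1/4)^j) ^ CARD('d) * measure lborel ({z. k + l < u (y + s *\<^sub>R z)} \<inter> ball 0 1)"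
      using measure_rescale[of "{x. k + l < v x}" "(1/4)^j" 0] v(1) by (simp add: v_def s_def)
    have "measure lborel ({z. k + l < u (y + s *\<^sub>R z)} \<inter> ball 0 1) \<le> (1/2)^j * \<delta>"
      using W[OF k v(3,1,2) v0, of j] unfolding m2 by simp
    also have "\<dots> < e * V" using j(1) \<delta> by (simp add: less_divide_eq)
    finally have "measure lborel ?S < s ^ CARD('d) * (e * V)" unfolding m1 using s by simp
    also have "s ^ CARD('d) * V = measure lborel (ball y s)"
      using measure_rescale[of UNIV s y] s by (simp add: V_def)
    then have "s ^ CARD('d) * (e * V) = e * measure lebesgue (ball y s)" by simp
    finally have lt: "measure lebesgue ?S < e * measure lebesgue (ball y s)" by simp
    have "?S \<in> lmeasurable"
      using bounded_set_imp_lmeasurable[of ?S] bounded_subset[OF bounded_ball[of y s], of ?S] by simp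
    then show "\<exists>d. 0 < d \<and> d \<le> r \<and> (\<exists>U. ({x. k + l < u x} \<inter> ball 0 (1/2)) \<inter> ball y d \<subseteq> U \<and> U \<in> lmeasurable \<and> measure lebesgue U < e * measure lebesgue (ball y d))"
      using s lt by (intro exI[of _ s] conjI exI[of _ ?S]) auto
  qed
  moreover have "(1/2) ^ CARD('d) * \<delta> > 0" using \<delta> by simp
  ultimately show ?thesis by blast
qed

end

subsection \<open>Vanishing dissipation and propagation of sublevel sets\<close>

lemma c1c_add: "c1c U f f' \<Longrightarrow> c1c U g g' \<Longrightarrow> c1c U (\<lambda>x. f x + g x) (\<lambda>x. f' x + g' x)"
proof -
  assume f: "c1c U f f'" and g: "c1c U g g'"
  obtain K1 K2 where K: "compact K1" "K1 \<subseteq> U" "\<And>x. x \<notin> K1 \<Longrightarrow> f x = 0" "compact K2" "K2 \<subseteq> U" "\<And>x. x \<notin> K2 \<Longrightarrow> g x = 0"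
    using f g by (auto simp: c1c_def)
  show ?thesis
    unfolding c1c_def
  proof (intro conjI allI exI[of _ "K1 \<union> K2"] impI)
    show "((\<lambda>x. f x + g x) has_derivative (\<bullet>) (f' x + g' x)) (at x)" for x
      using has_derivative_add[OF c1c_deriv[OF f, of x] c1c_deriv[OF g, of x]]
      by (rule has_derivative_eq_rhs) (simp add: fun_eq_iff inner_add_left)
    show "continuous_on UNIV (\<lambda>x. f' x + g' x)" by (intro continuous_intros c1c_cont'[OF f] c1c_cont'[OF g])
  qed (use K in auto)
qed

lemma c1c_zero: "c1c U (\<lambda>x. 0) (\<lambda>x. 0)"
  unfolding c1c_def by (intro conjI exI[of _ "{}"] allI has_derivative_eq_rhs[OF has_derivative_const]) auto

lemma c1c_sum:
  "(\<And>i. i < n \<Longrightarrow> c1c U (f i) (f' i)) \<Longrightarrow> c1c U (\<lambda>x. \<Sum>i<n. f i x) (\<lambda>x. \<Sum>i<n. f' i x)" for n :: nat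
  by (induction n) (auto intro: c1c_zero c1c_add)

lemma c1c_translate:
  fixes f :: "'a::euclidean_space \<Rightarrow> real"
  assumes "c1c UNIV f f'"
  shows "c1c UNIV (\<lambda>x. f (x - y)) (\<lambda>x. f' (x - y))"
  using c1c_rescale[of y 1 UNIV f f'] assms by simp

lemma fl_abs_majorant:
  fixes a :: "real \<Rightarrow> 'a::euclidean_space"
  assumes "fl a g g' G" "continuous_on UNIV a"
  obtains h H where "fl a h (\<lambda>v. \<bar>g' v\<bar>) H"
proof -
  obtain N where c: "continuous_on UNIV g'" and N: "\<forall>v. N < \<bar>v\<bar> \<longrightarrow> g' v = 0" using assms(1) by (auto simp: fl_def)
  have c': "continuous_on UNIV (\<lambda>v. \<bar>g' v\<bar>)" by (intro continuous_intros c)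
  obtain h where h: "\<And>v. (h has_vector_derivative \<bar>g' v\<bar>) (at v)" using antiderivative_exists[OF c', of 0] by blast
  then have "(h has_real_derivative \<bar>g' v\<bar>) (at v)" for v by (simp add: has_real_derivative_iff_has_vector_derivative)
  moreover have "\<forall>v. N < \<bar>v\<bar> \<longrightarrow> \<bar>g' v\<bar> = 0" using N by simp
  ultimately show ?thesis using flux_primitive_exists[OF assms(2) _ c', of h N 0] that by blast
qed

text \<open>A nonnegative majorant is needed for test functions of arbitrary support: the unit
  cutoff, dilated and multiplied by a bound of \<open>f\<close>.\<close>

lemma cutoff_large:
  fixes f :: "'a::euclidean_space \<Rightarrow> real"
  assumes "c1c UNIV f f'"
  obtains \<xi> \<xi>' \<rho> where "c1c (ball 0 \<rho>) \<xi> \<xi>'" "\<And>x. \<bar>f x\<bar> \<le> \<xi> x" "c1c (ball 0 \<rho>) f f'"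
proof -
  obtain \<xi>0 :: "'a \<Rightarrow> real" and \<xi>0' where x: "c1c (ball 0 1) \<xi>0 \<xi>0'" "\<And>x. 0 \<le> \<xi>0 x" "\<And>x. x \<in> cball 0 (3/4) \<Longrightarrow> \<xi>0 x = 1"
    using cutoff_exists[where 'a = 'a] by blast
  obtain K where K: "compact K" "\<And>x. x \<notin> K \<Longrightarrow> f x = 0" using assms by (auto simp: c1c_def)
  obtain R where R: "R > 0" "K \<subseteq> ball 0 R" using bounded_subset_ballD[OF compact_imp_bounded[OF K(1)], of 0] by auto
  obtain B where B: "B > 0" "\<And>x. \<bar>f x\<bar> \<le> B" using c1c_bounds[OF assms] by metis
  define s where "s = 2 * R"
  have s: "s > 0" using R by (simp add: s_def)
  have "{z. 0 + s *\<^sub>R z \<in> ball (0::'a) s} = ball 0 1" using s by auto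
  then have "c1c {z. 0 + s *\<^sub>R z \<in> ball 0 s} \<xi>0 \<xi>0'" using x(1) by simp
  from c1c_scale[OF c1c_rescale[OF this s], of B]
  have "c1c (ball 0 s) (\<lambda>y. B * \<xi>0 ((1/s) *\<^sub>R (y - 0))) (\<lambda>x. B *\<^sub>R (1/s) *\<^sub>R \<xi>0' ((1/s) *\<^sub>R (x - 0)))" .
  moreover have "\<bar>f y\<bar> \<le> B * \<xi>0 ((1/s) *\<^sub>R (y - 0))" for y
  proof (cases "y \<in> ball 0 R")
    case True
    then have "(1/s) *\<^sub>R (y - 0) \<in> cball 0 (3/4)" using R by (simp add: s_def divide_le_eq)
    then show ?thesis using x(3) B by simp
  next
    case False
    then have "f y = 0" using K R by blast
    then show ?thesis using x(2) B by simp
  qed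
  moreover have "c1c (ball 0 s) f f'"
  proof -
    have "K \<subseteq> ball 0 s" using R by (auto simp: s_def)
    then show ?thesis using assms K unfolding c1c_def by blast
  qed
  ultimately show ?thesis using that by blast
qed

text \<open>\<open>un r\<close> is the blow-up at scale \<open>r\<close>, and \<open>F\<close> the
  filter along which \<open>r\<close> becomes small. Domains grow with the magnification, so on a
  fixed ball the kinetic inequality is only asked for eventually. \<open>diss\<close> is the
  vanishing of the dissipation.\<close>

locale flow = flux_gn a a' lo hi Cg pg for a a' :: "real \<Rightarrow> real^'d" and lo hi Cg pg +
  fixes un :: "real \<Rightarrow> real^'d \<Rightarrow> real" and F :: "real filter"
  assumes un: "\<And>r. un r \<in> borel_measurable borel" "\<And>r x. un r x \<in> {lo..hi}"
    and un_kin: "\<And>\<rho>. \<forall>\<^sub>F r in F. kin a (un r) (ball 0 \<rho>)"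
    and diss: "\<And>\<xi> \<xi>' h h' H. c1c UNIV \<xi> \<xi>' \<Longrightarrow> (\<And>x. 0 \<le> \<xi> x) \<Longrightarrow> fl a h h' H \<Longrightarrow> (\<And>v. 0 \<le> h' v) \<Longrightarrow>
       ((\<lambda>r. \<integral>x. H (un r x) \<bullet> \<xi>' x \<partial>lborel) \<longlongrightarrow> 0) F"
begin

text \<open>The pairing of any entropy flux is dominated by that of its majorant with second
  derivative \<open>\<bar>g' v\<bar>\<close>, and the latter is a dissipation. In the limit every
  entropy flux becomes divergence free, not only those of convex entropies.\<close>

lemma flux_tendsto_0:
  assumes f: "c1c UNIV f f'" and g: "fl a g g' G"
  shows "((\<lambda>r. \<integral>x. G (un r x) \<bullet> f' x \<partial>lborel) \<longlongrightarrow> 0) F"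
proof -
  obtain \<xi> \<xi>' \<rho> where x: "c1c (ball 0 \<rho>) \<xi> \<xi>'" "\<And>x. \<bar>f x\<bar> \<le> \<xi> x" "c1c (ball 0 \<rho>) f f'" using cutoff_large[OF f] by metis
  obtain h H where h: "fl a h (\<lambda>v. \<bar>g' v\<bar>) H" using fl_abs_majorant[OF g a_cont] by metis
  have x0: "0 \<le> \<xi> y" for y using x(2)[of y] by linarith
  have lim: "((\<lambda>r. \<integral>x. H (un r x) \<bullet> \<xi>' x \<partial>lborel) \<longlongrightarrow> 0) F"
    by (rule diss[OF c1c_mono[OF x(1)] x0 h]) auto
  show ?thesis
  proof (rule Lim_null_comparison[OF _ lim])
    show "\<forall>\<^sub>F r in F. norm (\<integral>x. G (un r x) \<bullet> f' x \<partial>lborel) \<le> (\<integral>x. H (un r x) \<bullet> \<xi>' x \<partial>lborel)"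
      using un_kin[of \<rho>]
    proof eventually_elim
      case (elim r)
      show ?case using kinD[OF elim x(3) x(1) g h x(2)] by simp
    qed
  qed
qed

text \<open>In terms of weak limits of the indicators of sublevel sets: the limit for
  \<open>p\<close> at a point is at most the limit for \<open>q\<close> at that point shifted by
  \<open>z\<close>. Stated with test functions along the filter, it requires no extraction of a
  limit.\<close>

definition spread :: "real \<Rightarrow> real \<Rightarrow> real^'d \<Rightarrow> bool" where
  "spread p q z \<longleftrightarrow> (\<forall>\<sigma> \<sigma>' e. c1c UNIV \<sigma> \<sigma>' \<and> (\<forall>x. 0 \<le> \<sigma> x) \<and> 0 < e \<longrightarrow>
     (\<forall>\<^sub>F r in F. (\<integral>x. indicator {x. un r x < p} x * \<sigma> x \<partial>lborel) \<le> (\<integral>x. indicator {x. un r x < q} x * \<sigma> (x - z) \<partial>lborel) + e))"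

lemma level_integrable:
  assumes "c1c UNIV \<sigma> \<sigma>'" "k \<in> borel_measurable borel" "\<And>x. \<bar>k x\<bar> \<le> B"
  shows "integrable lborel (\<lambda>x. k x * \<sigma> x)"
proof -
  obtain K where K: "compact K" "\<And>x. x \<notin> K \<Longrightarrow> \<sigma> x = 0" using assms(1) by (auto simp: c1c_def)
  show ?thesis
    using integrable_bounded_times_compact_support[OF c1c_cont[OF assms(1)] K assms(2,3)] by simp
qed

lemma indicator_level_integrable:
  assumes "c1c UNIV \<sigma> \<sigma>'"
  shows "integrable lborel (\<lambda>x. indicator {x. un r x < p} x * \<sigma> x)"
proof -
  note [measurable] = un(1)
  have "(indicator {x. un r x < p} :: real^'d \<Rightarrow> real) \<in> borel_measurable borel" by measurable
  then show ?thesis by (rule level_integrable[OF assms, of _ 1]) (simp add: indicator_def)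
qed

lemma spread_trans:
  assumes "spread p m z1" "spread m q z2"
  shows "spread p q (z1 + z2)"
  unfolding spread_def
proof (intro allI impI, elim conjE)
  fix \<sigma> \<sigma>' e assume s: "c1c UNIV \<sigma> \<sigma>'" and s0: "\<forall>x. 0 \<le> \<sigma> (x::real^'d)" and e: "(0::real) < e"
  have e2: "0 < e / 2" using e by simp
  have 1: "\<forall>\<^sub>F r in F. (\<integral>x. indicator {x. un r x < p} x * \<sigma> x \<partial>lborel) \<le> (\<integral>x. indicator {x. un r x < m} x * \<sigma> (x - z1) \<partial>lborel) + e/2"
    using assms(1) s s0 e2 unfolding spread_def by blast
  have 2: "\<forall>\<^sub>F r in F. (\<integral>x. indicator {x. un r x < m} x * \<sigma> (x - z1) \<partial>lborel) \<le> (\<integral>x. indicator {x. un r x < q} x * \<sigma> (x - z2 - z1) \<partial>lborel) + e/2"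
    using assms(2) c1c_translate[OF s, of z1] s0 e2 unfolding spread_def by blast
  from 1 2 show "\<forall>\<^sub>F r in F. (\<integral>x. indicator {x. un r x < p} x * \<sigma> x \<partial>lborel) \<le> (\<integral>x. indicator {x. un r x < q} x * \<sigma> (x - (z1 + z2)) \<partial>lborel) + e"
  proof eventually_elim
    case (elim r)
    have "x - z2 - z1 = x - (z1 + z2)" for x :: "real^'d" by simp
    then show ?case using elim by (simp only:)
  qed
qed

lemma spread_zero:
  assumes "p \<le> q"
  shows "spread p q 0"
  unfolding spread_def
proof (intro allI impI, elim conjE)
  fix \<sigma> \<sigma>' e assume s: "c1c UNIV \<sigma> \<sigma>'" and s0: "\<forall>x. 0 \<le> \<sigma> (x::real^'d)" and e: "(0::real) < e"
  have "(\<integral>x. indicator {x. un r x < p} x * \<sigma> x \<partial>lborel) \<le> (\<integral>x. indicator {x. un r x < q} x * \<sigma> x \<partial>lborel)" for r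
    by (rule integral_mono[OF indicator_level_integrable[OF s] indicator_level_integrable[OF s]])
      (use s0 assms in \<open>auto simp: indicator_def\<close>)
  then show "\<forall>\<^sub>F r in F. (\<integral>x. indicator {x. un r x < p} x * \<sigma> x \<partial>lborel) \<le> (\<integral>x. indicator {x. un r x < q} x * \<sigma> (x - 0) \<partial>lborel) + e"
    using e by (intro always_eventually allI) (simp add: add_increasing2)
qed

text \<open>A discrete line integral: \<open>f\<close> is nearly an antiderivative of \<open>\<sigma> - \<sigma>(\<cdot> - c)\<close> in direction \<open>c\<close>.\<close>

lemma line_average:
  assumes s: "c1c UNIV \<sigma> \<sigma>'" and e: "e > 0"
  obtains f f' where "c1c UNIV f f'" "\<And>x. \<bar>f' x \<bullet> c - (\<sigma> x - \<sigma> (x - c))\<bar> \<le> e"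
    "(\<integral>x. norm (f' x) \<partial>lborel) \<le> (\<integral>x. norm (\<sigma>' x) \<partial>lborel)"
    "\<And>x. norm x > R + norm c \<Longrightarrow> (\<And>y. norm y > R \<Longrightarrow> \<sigma> y = 0 \<and> \<sigma>' y = 0) \<Longrightarrow> f' x \<bullet> c - (\<sigma> x - \<sigma> (x - c)) = 0"
proof -
  have e': "e / (norm c + 1) > 0" using e by (simp add: add_nonneg_pos)
  obtain d where d: "d > 0" "\<And>x h. norm h < d \<Longrightarrow> \<bar>\<sigma> (x + h) - \<sigma> x - \<sigma>' x \<bullet> h\<bar> \<le> e / (norm c + 1) * norm h"
    using c1c_uniform_deriv[OF s e'] by auto
  obtain N0 :: nat where N0: "norm c / d < real N0" using reals_Archimedean2 by blast
  define N where "N = Suc N0"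
  define t where "t = 1 / real N"
  have t: "0 < t" "real N * t = 1" by (auto simp: t_def N_def)
  have tc: "norm (t *\<^sub>R c) < d"
  proof -
    have "norm c < d * real N" using N0 d(1) by (simp add: N_def field_simps)
    then show ?thesis by (simp add: t_def N_def field_simps)
  qed
  \<comment> \<open>A Riemann sum for the mean of \<open>\<sigma>\<close> over the segment from
    \<open>x - c\<close> to \<open>x\<close>. As a finite sum of translates it is C1 at once, and
    the L1 norm of its gradient does not exceed that of \<open>\<sigma>'\<close>, however small the
    accuracy.\<close>
  define f where "f x = (\<Sum>j<N. t * \<sigma> (x - (real j * t) *\<^sub>R c))" for x
  define f' where "f' x = (\<Sum>j<N. t *\<^sub>R \<sigma>' (x - (real j * t) *\<^sub>R c))" for x
  have f: "c1c UNIV f f'"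
    unfolding f_def[abs_def] f'_def[abs_def] by (intro c1c_sum c1c_scale c1c_translate s)
  have tele: "\<sigma> x - \<sigma> (x - c) = (\<Sum>j<N. \<sigma> (x - (real j * t) *\<^sub>R c) - \<sigma> (x - (real (Suc j) * t) *\<^sub>R c))" for x
    using sum_lessThan_telescope'[of "\<lambda>j. \<sigma> (x - (real j * t) *\<^sub>R c)" N] t(2) by simp
  have dif: "f' x \<bullet> c - (\<sigma> x - \<sigma> (x - c)) = (\<Sum>j<N. (\<sigma> (x - (real (Suc j) * t) *\<^sub>R c) - \<sigma> (x - (real j * t) *\<^sub>R c)) + \<sigma>' (x - (real j * t) *\<^sub>R c) \<bullet> (t *\<^sub>R c))" for x
    unfolding tele f'_def inner_sum_left by (simp add: sum_subtractf[symmetric] algebra_simps)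
  have "\<bar>f' x \<bullet> c - (\<sigma> x - \<sigma> (x - c))\<bar> \<le> e" for x
  proof -
    have "\<bar>f' x \<bullet> c - (\<sigma> x - \<sigma> (x - c))\<bar> \<le> (\<Sum>j<N. \<bar>(\<sigma> (x - (real (Suc j) * t) *\<^sub>R c) - \<sigma> (x - (real j * t) *\<^sub>R c)) + \<sigma>' (x - (real j * t) *\<^sub>R c) \<bullet> (t *\<^sub>R c)\<bar>)"
      unfolding dif by (rule sum_abs)
    also have "\<dots> \<le> (\<Sum>j<N. e / (norm c + 1) * (t * norm c))"
    proof (rule sum_mono)
      fix j
      have "x - (real (Suc j) * t) *\<^sub>R c = (x - (real j * t) *\<^sub>R c) + - (t *\<^sub>R c)" by (simp add: algebra_simps)
      then show "\<bar>(\<sigma> (x - (real (Suc j) * t) *\<^sub>R c) - \<sigma> (x - (real j * t) *\<^sub>R c)) + \<sigma>' (x - (real j * t) *\<^sub>R c) \<bullet> (t *\<^sub>R c)\<bar> \<le> e / (norm c + 1) * (t * norm c)"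
        using d(2)[of "- (t *\<^sub>R c)" "x - (real j * t) *\<^sub>R c"] tc t(1) by (simp only: norm_minus_cancel inner_minus_right) simp
    qed
    also have "\<dots> = e / (norm c + 1) * norm c * (real N * t)" by (simp add: mult_ac)
    also have "\<dots> \<le> e"
    proof -
      define n where "n = norm c"
      have "n \<ge> 0" by (simp add: n_def)
      then show ?thesis unfolding n_def[symmetric] t(2) using e by (simp add: field_simps)
    qed
    finally show ?thesis .
  qed
  moreover have "(\<integral>x. norm (f' x) \<partial>lborel) \<le> (\<integral>x. norm (\<sigma>' x) \<partial>lborel)"
  proof -
    obtain K where K: "compact K" "\<And>x. x \<notin> K \<Longrightarrow> \<sigma>' x = 0" using c1c_support[OF s] by metis
    have i0: "integrable lborel \<sigma>'" by (rule integrable_compact_support[OF c1c_cont'[OF s] K])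
    have [measurable]: "\<sigma>' \<in> borel_measurable borel" using c1c_cont'[OF s] by (rule borel_measurable_continuous_onI)
    have i: "integrable lborel (\<lambda>x. \<sigma>' (x - y))" for y
      using integrable_lborel_reflect[OF integrable_lborel_reflect[OF i0, of 0], of y] by simp
    have eq: "(\<integral>x. norm (\<sigma>' (x - y)) \<partial>lborel) = (\<integral>x. norm (\<sigma>' x) \<partial>lborel)" for y
      using lborel_integral_translate[of "\<lambda>x. norm (\<sigma>' x)" "- y"] by simp
    have "(\<integral>x. norm (f' x) \<partial>lborel) \<le> (\<integral>x. (\<Sum>j<N. t * norm (\<sigma>' (x - (real j * t) *\<^sub>R c))) \<partial>lborel)"
    proof (rule integral_mono)
      show "integrable lborel (\<lambda>x. norm (f' x))" unfolding f'_def
        by (intro integrable_norm Bochner_Integration.integrable_sum integrable_scaleR_right i)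
      show "integrable lborel (\<lambda>x. \<Sum>j<N. t * norm (\<sigma>' (x - (real j * t) *\<^sub>R c)))"
        by (intro Bochner_Integration.integrable_sum integrable_mult_right integrable_norm i)
      show "norm (f' x) \<le> (\<Sum>j<N. t * norm (\<sigma>' (x - (real j * t) *\<^sub>R c)))" for x
        unfolding f'_def by (rule order_trans[OF norm_sum]) (use t in simp)
    qed
    also have "\<dots> = (\<Sum>j<N. t * (\<integral>x. norm (\<sigma>' (x - (real j * t) *\<^sub>R c)) \<partial>lborel))"
      by (simp add: i integrable_norm)
    also have "\<dots> = (real N * t) * (\<integral>x. norm (\<sigma>' x) \<partial>lborel)" unfolding eq by simp
    finally show ?thesis unfolding t(2) by simp
  qed
  moreover have "f' x \<bullet> c - (\<sigma> x - \<sigma> (x - c)) = 0"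
    if x: "norm x > R + norm c" and R: "\<And>y. norm y > R \<Longrightarrow> \<sigma> y = 0 \<and> \<sigma>' y = 0" for x
  proof -
    have far: "norm (x - (real j * t) *\<^sub>R c) > R" if "j \<le> N" for j
    proof -
      have "real j * t \<le> real N * t" using that t(1) by (intro mult_right_mono) auto
      then have jt: "0 \<le> real j * t" "real j * t \<le> 1" using t by auto
      have "norm ((real j * t) *\<^sub>R c) \<le> norm c" using jt t(1) by (simp add: abs_mult mult_left_le_one_le)
      moreover have "norm x \<le> norm (x - (real j * t) *\<^sub>R c) + norm ((real j * t) *\<^sub>R c)"
        using norm_triangle_ineq[of "x - (real j * t) *\<^sub>R c" "(real j * t) *\<^sub>R c"] by simp
      ultimately show ?thesis using x by linarith
    qed
    show ?thesis unfolding dif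
    proof (rule sum.neutral, rule ballI)
      fix j assume "j \<in> {..<N}"
      then show "\<sigma> (x - (real (Suc j) * t) *\<^sub>R c) - \<sigma> (x - (real j * t) *\<^sub>R c) + \<sigma>' (x - (real j * t) *\<^sub>R c) \<bullet> t *\<^sub>R c = 0"
        using R[OF far[of j]] R[OF far[of "Suc j"]] by simp
    qed
  qed
  ultimately show ?thesis using that[OF f] by blast
qed

text \<open>On a thin window above \<open>v\<close> the flux of \<open>\<psi>\<close> is nearly its
  primitive \<open>S\<close> times \<open>a v\<close>. Since fluxes vanish in the limit,
  \<open>S (un r x)\<close> is asymptotically invariant in the direction \<open>a v\<close>. The
  function \<open>1 - S (un r x) / S w\<close> lies between the indicators of the sublevel sets for
  \<open>p\<close> and \<open>q\<close>, which gives the claim at the cost of raising the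
  level.\<close>

lemma spread_single:
  assumes pq: "lo \<le> p" "p < v" "v < q" "q \<le> hi"
  shows "spread p q (t *\<^sub>R a v)"
  unfolding spread_def
proof (intro allI impI, elim conjE)
  fix \<sigma> \<sigma>' e assume s: "c1c UNIV \<sigma> \<sigma>'" and s0: "\<forall>x. 0 \<le> \<sigma> (x::real^'d)" and e: "(0::real) < e"
  define c where "c = t *\<^sub>R a v"
  define L where "L = (\<integral>x. norm (\<sigma>' x) \<partial>lborel)"
  have L: "L \<ge> 0" by (simp add: L_def)
  obtain K where K: "compact K" "\<And>x. x \<notin> K \<Longrightarrow> \<sigma> x = 0" "\<And>x. x \<notin> K \<Longrightarrow> \<sigma>' x = 0" using c1c_support[OF s] by metis
  obtain R where R: "R > 0" "K \<subseteq> ball 0 R" using bounded_subset_ballD[OF compact_imp_bounded[OF K(1)], of 0] by auto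
  have Rz: "\<sigma> y = 0 \<and> \<sigma>' y = 0" if "norm y > R" for y
  proof -
    have "y \<notin> K" using that R(2) by auto
    then show ?thesis using K by simp
  qed
  define VS where "VS = measure lborel (cball (0::real^'d) (R + norm c))"
  have VS: "VS \<ge> 0" by (simp add: VS_def)
  \<comment> \<open>The width of the window: small enough that it ends below \<open>q\<close>, and
    that freezing \<open>a\<close> at \<open>v\<close>, tested with a gradient of L1 norm at most
    \<open>L\<close>, costs no more than \<open>e / 4\<close> relative to
    \<open>S w\<close>.\<close>
  define \<eta> where "\<eta> = min (q - v) (e / (4 * (\<bar>t\<bar> * Ba * L + 1)))"
  have bL: "0 \<le> \<bar>t\<bar> * Ba * L" using Ba(1) L by simp
  have \<eta>: "\<eta> > 0" "\<eta> \<le> q - v" "\<eta> * (\<bar>t\<bar> * Ba * L) \<le> e / 4"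
  proof -
    show "\<eta> > 0" "\<eta> \<le> q - v" using pq e bL by (auto simp: \<eta>_def)
    have "\<eta> * (\<bar>t\<bar> * Ba * L) \<le> e / (4 * (\<bar>t\<bar> * Ba * L + 1)) * (\<bar>t\<bar> * Ba * L)"
      using bL by (intro mult_right_mono) (auto simp: \<eta>_def)
    also have "\<dots> \<le> e / 4" using bL e by (simp add: field_simps)
    finally show "\<eta> * (\<bar>t\<bar> * Ba * L) \<le> e / 4" .
  qed
  have e2: "e / (4 * (VS + 1)) > 0" using e VS by simp
  obtain f f' where f: "c1c UNIV f f'" "\<And>x. \<bar>f' x \<bullet> c - (\<sigma> x - \<sigma> (x - c))\<bar> \<le> e / (4 * (VS + 1))"
    "(\<integral>x. norm (f' x) \<partial>lborel) \<le> L"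
    "\<And>x. norm x > R + norm c \<Longrightarrow> f' x \<bullet> c - (\<sigma> x - \<sigma> (x - c)) = 0"
    using line_average[OF s e2, of c R] Rz unfolding L_def by metis
  define w where "w = v + \<eta>"
  have w: "v < w" "w \<le> q" using \<eta> by (auto simp: w_def)
  define h where "h x = \<psi> v w x" for x
  obtain S where S: "S v = 0" "\<And>x. (S has_vector_derivative h x) (at x)"
    using antiderivative_exists[of h v] psi_cont unfolding h_def[abs_def] by blast
  have Sd: "(S has_real_derivative h x) (at x)" for x using S(2) by (simp add: has_real_derivative_iff_has_vector_derivative)
  have hn: "0 \<le> h x" for x unfolding h_def by (rule psi_nonneg)
  have Smono: "S x \<le> S y" if "x \<le> y" for x y
    using DERIV_nonneg_imp_nondecreasing[OF that] Sd hn by blast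
  have Slow: "S x = 0" if "x \<le> v" for x
  proof -
    have "norm (S v - S x) \<le> 0 * (v - x)" by (rule vector_mvt_bound[OF S(2)]) (use that in \<open>auto simp: h_def \<psi>_def\<close>)
    then show ?thesis using S(1) by simp
  qed
  have Shigh: "S x = S w" if "w \<le> x" for x
  proof -
    have "norm (S x - S w) \<le> 0 * (x - w)" by (rule vector_mvt_bound[OF S(2)]) (use that in \<open>auto simp: h_def \<psi>_def\<close>)
    then show ?thesis by simp
  qed
  have Spos: "S w > 0"
  proof -
    have "\<exists>z. v < z \<and> z < w \<and> S w - S v = (w - v) * h z" using MVT2[OF w(1), of S h] Sd by blast
    then obtain z where "v < z" "z < w" "S w - S v = (w - v) * h z" by blast
    moreover from this have "h z > 0" using c0_pos by (simp add: h_def \<psi>_def)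
    ultimately show ?thesis using S(1) w by simp
  qed
  obtain G where G: "G v = 0" "fl a h (\<psi>' v w) G"
  proof -
    have z: "\<forall>x. \<bar>v\<bar> + \<bar>w\<bar> < \<bar>x\<bar> \<longrightarrow> \<psi>' v w x = 0" by (intro allI impI psi_zero(2)) auto
    show ?thesis
      using flux_primitive_exists[OF a_cont _ _ z, of h v] DERIV_psi psi_cont that unfolding h_def[abs_def] by blast
  qed
  have Gd: "(G has_vector_derivative h x *\<^sub>R a x) (at x)" for x using G(2) by (auto simp: fl_def)
  \<comment> \<open>The error must be proportional to \<open>S w\<close>, which itself tends to 0
    with the width. A plain Lipschitz bound for \<open>G\<close> would be too coarse; the mean value
    inequality is therefore used with a multiple of \<open>S\<close> as the comparison
    function.\<close>
  have GS: "norm (G x - S x *\<^sub>R a v) \<le> \<eta> * Ba * S w" if x: "x \<in> {lo..hi}" for x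
  proof -
    have key: "norm (G y - S y *\<^sub>R a v) \<le> \<eta> * Ba * S y" if y: "v \<le> y" "y \<le> w" for y
    proof -
      have "norm ((G y - S y *\<^sub>R a v) - (G v - S v *\<^sub>R a v)) \<le> \<eta> * Ba * (S y - S v)"
      proof (cases "v = y")
        case False
        then have vy: "v < y" using y by simp
        have bnd: "norm (h z *\<^sub>R a z - h z *\<^sub>R a v) \<le> \<eta> * Ba * h z" if z: "v < z" "z < y" for z
        proof -
          have "norm (a z - a v) \<le> Ba * (z - v)"
            by (rule vector_mvt_bound[OF a_deriv]) (use z y w pq Ba(3) in auto)
          also have "\<dots> \<le> Ba * \<eta>" using z y Ba(1) by (intro mult_left_mono) (auto simp: w_def)
          finally have "h z * norm (a z - a v) \<le> h z * (Ba * \<eta>)" by (rule mult_left_mono) (rule hn)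
          moreover have "norm (h z *\<^sub>R a z - h z *\<^sub>R a v) = h z * norm (a z - a v)"
            using hn[of z] by (simp add: scaleR_diff_right[symmetric])
          ultimately show ?thesis by (simp add: mult_ac)
        qed
        have d1: "((\<lambda>x. G x - S x *\<^sub>R a v) has_vector_derivative (h z *\<^sub>R a z - h z *\<^sub>R a v)) (at z)" for z
          by (rule has_vector_derivative_diff[OF Gd]) (rule derivative_eq_intros Sd S(2) | simp)+
        have d2: "((\<lambda>x. \<eta> * Ba * S x) has_vector_derivative (\<eta> * Ba * h z)) (at z)" for z
          using DERIV_cmult[OF Sd[of z], of "\<eta> * Ba"] by (simp add: has_real_derivative_iff_has_vector_derivative)
        have "norm ((G y - S y *\<^sub>R a v) - (G v - S v *\<^sub>R a v)) \<le> \<eta> * Ba * S y - \<eta> * Ba * S v"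
        proof (rule differentiable_bound_general[OF vy _ _ d1 d2 bnd])
          show "continuous_on {v..y} (\<lambda>x. G x - S x *\<^sub>R a v)" "continuous_on {v..y} (\<lambda>x. \<eta> * Ba * S x)"
            using d1 d2 by (auto intro!: continuous_at_imp_continuous_on has_vector_derivative_continuous)
        qed auto
        then show ?thesis by (simp add: right_diff_distrib)
      qed simp
      then show ?thesis using G(1) S(1) by simp
    qed
    consider "x < v" | "v \<le> x" "x \<le> w" | "w < x" by linarith
    then show ?thesis
    proof cases
      case 1
      have "norm (G v - G x) \<le> 0 * (v - x)"
        by (rule vector_mvt_bound[OF Gd]) (use 1 in \<open>auto simp: h_def \<psi>_def\<close>)
      then have "G x = 0" using G(1) by simp
      then show ?thesis using Slow[of x] 1 \<eta>(1) Ba(1) Spos by simp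
    next
      case 2
      then have "\<eta> * Ba * S x \<le> \<eta> * Ba * S w" using Smono \<eta>(1) Ba(1) by (intro mult_left_mono) auto
      then show ?thesis using key[OF 2] by linarith
    next
      case 3
      have "norm (G x - G w) \<le> 0 * (x - w)"
        by (rule vector_mvt_bound[OF Gd]) (use 3 in \<open>auto simp: h_def \<psi>_def\<close>)
      then have "G x = G w" by simp
      then show ?thesis using Shigh[of x] key[of w] w 3 by simp
    qed
  qed
  have Sb: "0 \<le> S x" "S x \<le> S w" for x
  proof -
    have "S (min x v) \<le> S x" "S x \<le> S (max x w)" by (auto intro: Smono)
    then show "0 \<le> S x" "S x \<le> S w" using Slow[of "min x v"] Shigh[of "max x w"] by auto
  qed
  have "continuous_on UNIV S" using Sd DERIV_isCont continuous_at_imp_continuous_on by blast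
  then have [measurable]: "S \<in> borel_measurable borel" by (rule borel_measurable_continuous_onI)
  have [measurable]: "G \<in> borel_measurable borel" using fl_continuous[OF G(2)] by (rule borel_measurable_continuous_onI)
  note [measurable] = un(1)
  obtain BG where BG: "\<And>y. y \<in> {lo..hi} \<Longrightarrow> norm (G y) \<le> BG"
    using compact_imp_bounded[OF compact_continuous_image[OF continuous_on_subset[OF fl_continuous[OF G(2)]] compact_Icc[of lo hi]]]
    unfolding bounded_iff by blast
  have st: "c1c UNIV (\<lambda>x. \<sigma> (x - c)) (\<lambda>x. \<sigma>' (x - c))" by (rule c1c_translate[OF s])
  have \<sigma>i: "integrable lborel \<sigma>" by (rule integrable_compact_support[OF c1c_cont[OF s] K(1,2)])
  have \<sigma>ci: "integrable lborel (\<lambda>x. \<sigma> (x - c))"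
    using level_integrable[OF st, of "\<lambda>_. 1" 1] by simp
  have \<sigma>eq: "(\<integral>x. \<sigma> (x - c) \<partial>lborel) = (\<integral>x. \<sigma> x \<partial>lborel)"
    using lborel_integral_translate[of \<sigma> "- c"] c1c_cont[OF s] by (simp add: borel_measurable_continuous_onI)
  obtain Kf where Kf: "compact Kf" "\<And>x. x \<notin> Kf \<Longrightarrow> f' x = 0" using c1c_support[OF f(1)] by metis
  obtain Bf where Bf: "\<And>x. norm (f' x) \<le> Bf" using c1c_bounds[OF f(1)] by metis
  have [measurable]: "f' \<in> borel_measurable borel" using c1c_cont'[OF f(1)] by (rule borel_measurable_continuous_onI)
  have f'i: "integrable lborel (\<lambda>x. norm (f' x))"
    using integrable_compact_support[OF c1c_cont'[OF f(1)] Kf] by (rule integrable_norm)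
  have Gi: "integrable lborel (\<lambda>x. G (un r x) \<bullet> f' x)" for r
  proof (rule integrable_bounded_support[OF _ _ compact_imp_bounded[OF Kf(1)]])
    show "norm (G (un r x) \<bullet> f' x) \<le> BG * Bf" for x
    proof -
      have "norm (G (un r x) \<bullet> f' x) \<le> norm (G (un r x)) * norm (f' x)" by (simp add: Cauchy_Schwarz_ineq2)
      also have "\<dots> \<le> BG * Bf" using BG[OF un(2)] Bf by (intro mult_mono') auto
      finally show ?thesis .
    qed
  qed (use Kf in auto)
  have tend: "\<forall>\<^sub>F r in F. \<bar>t * (\<integral>x. G (un r x) \<bullet> f' x \<partial>lborel)\<bar> < S w * e / 4"
  proof -
    have "((\<lambda>r. t * (\<integral>x. G (un r x) \<bullet> f' x \<partial>lborel)) \<longlongrightarrow> t * 0) F"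
      by (intro tendsto_intros flux_tendsto_0[OF f(1) G(2)])
    from tendstoD[OF this, of "S w * e / 4"] show ?thesis using Spos e by (simp add: dist_real_def)
  qed
  have "\<forall>\<^sub>F r in F. (\<integral>x. indicator {x. un r x < p} x * \<sigma> x \<partial>lborel) \<le> (\<integral>x. indicator {x. un r x < q} x * \<sigma> (x - c) \<partial>lborel) + e"
    using tend
  proof eventually_elim
    case (elim r)
    have SSi: "integrable lborel (\<lambda>x. S (un r x) * \<sigma> x)" "integrable lborel (\<lambda>x. S (un r x) * \<sigma> (x - c))"
      using Sb by (auto intro!: level_integrable[OF s, of _ "S w"] level_integrable[OF st, of _ "S w"])
    have cbi: "integrable lborel (\<lambda>x. indicator (cball 0 (R + norm c)) x :: real)" for R :: real and c :: "real^'d"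
      by (rule integrable_indicator_bounded) auto
    have pt: "\<bar>S (un r x) * \<sigma> x - S (un r x) * \<sigma> (x - c) - t * (G (un r x) \<bullet> f' x)\<bar>
        \<le> S w * (e / (4 * (VS + 1))) * indicator (cball 0 (R + norm c)) x + \<bar>t\<bar> * (\<eta> * Ba * S w) * norm (f' x)" for x
    proof -
      let ?s = "S (un r x)" and ?D = "f' x \<bullet> c - (\<sigma> x - \<sigma> (x - c))"
      \<comment> \<open>Two errors are separated: \<open>f\<close> is only approximately an
        antiderivative along \<open>c\<close>, and \<open>G\<close> is only approximately
        \<open>S\<close> times \<open>a v\<close>. The first is supported in a fixed ball, the
        second is weighted by the gradient of \<open>f\<close>.\<close>
      have "?s * \<sigma> x - ?s * \<sigma> (x - c) - t * (G (un r x) \<bullet> f' x) = - (?s * ?D) - t * ((G (un r x) - ?s *\<^sub>R a v) \<bullet> f' x)"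
        by (simp add: c_def algebra_simps inner_commute)
      moreover have "\<bar>?s * ?D\<bar> \<le> S w * (e / (4 * (VS + 1))) * indicator (cball 0 (R + norm c)) x"
      proof (cases "norm x > R + norm c")
        case True
        then show ?thesis using f(4) by simp
      next
        case False
        have "\<bar>?s * ?D\<bar> = ?s * \<bar>?D\<bar>" using Sb(1) by (simp add: abs_mult)
        also have "\<dots> \<le> S w * (e / (4 * (VS + 1)))" using Sb f(2)[of x] Spos by (intro mult_mono) auto
        finally show ?thesis using False by simp
      qed
      moreover have "\<bar>t * ((G (un r x) - ?s *\<^sub>R a v) \<bullet> f' x)\<bar> \<le> \<bar>t\<bar> * (\<eta> * Ba * S w) * norm (f' x)"
      proof -
        have "\<bar>(G (un r x) - ?s *\<^sub>R a v) \<bullet> f' x\<bar> \<le> norm (G (un r x) - ?s *\<^sub>R a v) * norm (f' x)" by (rule Cauchy_Schwarz_ineq2)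
        also have "\<dots> \<le> (\<eta> * Ba * S w) * norm (f' x)" by (intro mult_right_mono GS un) auto
        finally show ?thesis unfolding abs_mult mult.assoc by (intro mult_left_mono) (auto simp: mult.assoc)
      qed
      ultimately show ?thesis by linarith
    qed
    let ?I = "\<integral>x. (S (un r x) * \<sigma> x - S (un r x) * \<sigma> (x - c) - t * (G (un r x) \<bullet> f' x)) \<partial>lborel"
    have "norm ?I \<le> (\<integral>x. S w * (e / (4 * (VS + 1))) * indicator (cball 0 (R + norm c)) x + \<bar>t\<bar> * (\<eta> * Ba * S w) * norm (f' x) \<partial>lborel)"
    proof (rule Bochner_Integration.integral_norm_bound_integral)
      show "integrable lborel (\<lambda>x. S (un r x) * \<sigma> x - S (un r x) * \<sigma> (x - c) - t * (G (un r x) \<bullet> f' x))"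
        by (intro Bochner_Integration.integrable_diff SSi integrable_mult_right Gi)
      show "integrable lborel (\<lambda>x. S w * (e / (4 * (VS + 1))) * indicator (cball 0 (R + norm c)) x + \<bar>t\<bar> * (\<eta> * Ba * S w) * norm (f' x))"
        by (intro Bochner_Integration.integrable_add integrable_mult_right cbi f'i)
    qed (use pt in auto)
    also have "\<dots> = S w * (e / (4 * (VS + 1))) * VS + \<bar>t\<bar> * (\<eta> * Ba * S w) * (\<integral>x. norm (f' x) \<partial>lborel)"
      using cbi[of R c] f'i by (subst Bochner_Integration.integral_add) (auto simp: VS_def)
    finally have I1: "\<bar>?I\<bar> \<le> S w * (e / (4 * (VS + 1))) * VS + \<bar>t\<bar> * (\<eta> * Ba * S w) * (\<integral>x. norm (f' x) \<partial>lborel)" by simp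
    have I2: "S w * (e / (4 * (VS + 1))) * VS \<le> S w * (e / 4)"
    proof -
      have "e / (4 * (VS + 1)) * VS \<le> e / 4" using VS e by (simp add: field_simps)
      then show ?thesis unfolding mult.assoc using Spos by (intro mult_left_mono) auto
    qed
    have I3: "\<bar>t\<bar> * (\<eta> * Ba * S w) * (\<integral>x. norm (f' x) \<partial>lborel) \<le> S w * (e / 4)"
    proof -
      have "\<bar>t\<bar> * (\<eta> * Ba * S w) * (\<integral>x. norm (f' x) \<partial>lborel) \<le> \<bar>t\<bar> * (\<eta> * Ba * S w) * L"
        using \<eta>(1) Ba(1) Spos by (intro mult_left_mono f(3)) auto
      also have "\<dots> = S w * (\<eta> * (\<bar>t\<bar> * Ba * L))" by simp
      also have "\<dots> \<le> S w * (e / 4)" using Spos by (intro mult_left_mono \<eta>(3)) auto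
      finally show ?thesis .
    qed
    have Ieq: "?I = (\<integral>x. S (un r x) * \<sigma> x \<partial>lborel) - (\<integral>x. S (un r x) * \<sigma> (x - c) \<partial>lborel) - t * (\<integral>x. G (un r x) \<bullet> f' x \<partial>lborel)"
      using SSi Gi[of r] by simp
    define A1 where "A1 = (\<integral>x. S (un r x) * \<sigma> x \<partial>lborel)"
    define A2 where "A2 = (\<integral>x. S (un r x) * \<sigma> (x - c) \<partial>lborel)"
    have "\<bar>A1 - A2 - t * (\<integral>x. G (un r x) \<bullet> f' x \<partial>lborel)\<bar> \<le> S w * (e/4) + S w * (e/4)"
      using I1 I2 I3 unfolding Ieq A1_def A2_def by linarith
    then have dA: "A2 - A1 \<le> S w * e" using elim by linarith
    have Ki: "integrable lborel (\<lambda>x. (1 - S (un r x) / S w) * \<sigma> x)" "integrable lborel (\<lambda>x. (1 - S (un r x) / S w) * \<sigma> (x - c))"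
      using Sb Spos by (auto intro!: level_integrable[OF s, of _ 1] level_integrable[OF st, of _ 1] simp: divide_le_eq)
    have "(\<integral>x. indicator {x. un r x < p} x * \<sigma> x \<partial>lborel) \<le> (\<integral>x. (1 - S (un r x) / S w) * \<sigma> x \<partial>lborel)"
    proof (rule integral_mono[OF indicator_level_integrable[OF s] Ki(1)])
      fix x
      have "indicator {x. un r x < p} x \<le> 1 - S (un r x) / S w"
        using Slow[of "un r x"] pq Sb[of "un r x"] Spos by (auto simp: indicator_def divide_le_eq)
      then show "indicator {x. un r x < p} x * \<sigma> x \<le> (1 - S (un r x) / S w) * \<sigma> x" using s0 by (intro mult_right_mono) auto
    qed
    also have "\<dots> = (\<integral>x. \<sigma> x \<partial>lborel) - A1 / S w"
      using SSi(1) \<sigma>i by (simp add: left_diff_distrib A1_def)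
    also have "\<dots> \<le> (\<integral>x. \<sigma> (x - c) \<partial>lborel) - A2 / S w + e"
    proof -
      have "(A2 - A1) / S w \<le> e" using dA Spos by (simp add: divide_le_eq mult.commute)
      then show ?thesis unfolding \<sigma>eq by (simp add: diff_divide_distrib)
    qed
    also have "(\<integral>x. \<sigma> (x - c) \<partial>lborel) - A2 / S w = (\<integral>x. (1 - S (un r x) / S w) * \<sigma> (x - c) \<partial>lborel)"
      using SSi(2) \<sigma>ci by (simp add: left_diff_distrib A2_def)
    also have "(\<integral>x. (1 - S (un r x) / S w) * \<sigma> (x - c) \<partial>lborel) \<le> (\<integral>x. indicator {x. un r x < q} x * \<sigma> (x - c) \<partial>lborel)"
    proof (rule integral_mono[OF Ki(2) indicator_level_integrable[OF st]])
      fix x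
      have "1 - S (un r x) / S w \<le> indicator {x. un r x < q} x"
        using Shigh[of "un r x"] w Sb[of "un r x"] Spos by (auto simp: indicator_def)
      then show "(1 - S (un r x) / S w) * \<sigma> (x - c) \<le> indicator {x. un r x < q} x * \<sigma> (x - c)" using s0 by (intro mult_right_mono) auto
    qed
    finally show ?case by simp
  qed
  then show "\<forall>\<^sub>F r in F. (\<integral>x. indicator {x. un r x < p} x * \<sigma> x \<partial>lborel) \<le> (\<integral>x. indicator {x. un r x < q} x * \<sigma> (x - t *\<^sub>R a v) \<partial>lborel) + e"
    unfolding c_def .
qed

end

section \<open>The kernel density as a test function\<close>

context ellip
begin

lemma powr_bump'_continuous: "continuous_on UNIV (\<lambda>t. t powr p * bump' t)"
proof -
  have "continuous_on ({0<..} \<union> {..<1/4}) (\<lambda>t. t powr p * bump' t)"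
  proof (rule continuous_on_open_Un)
    show "continuous_on {0<..} (\<lambda>t. t powr p * bump' t)"
      by (auto intro!: continuous_intros bump_continuous)
    show "continuous_on {..<1/4} (\<lambda>t. t powr p * bump' t)"
      using bump_eq_0 by (subst continuous_on_cong[of _ _ _ "\<lambda>_. 0"]) auto
  qed auto
  moreover have "{0<..} \<union> {..<1/4} = (UNIV :: real set)" by auto
  ultimately show ?thesis by simp
qed

lemma DERIV_powr_bump:
  "((\<lambda>t. t powr p * bump t) has_real_derivative p * (t powr (p - 1) * bump t) + t powr p * bump' t) (at t)"
proof (cases "0 < t")
  case True
  have "((\<lambda>t. t powr p) has_real_derivative p * t powr (p - 1)) (at t)" using has_real_derivative_powr[OF True, of p] .
  from DERIV_mult[OF this DERIV_bump] show ?thesis by (rule DERIV_cong) simp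
next
  case False
  then have t: "t \<in> {..<1/4}" by simp
  have "((\<lambda>t. t powr p * bump t) has_real_derivative 0) (at t)"
    by (rule has_field_derivative_transform_within_open[OF DERIV_const[of 0] open_lessThan t]) (use bump_eq_0 in auto)
  then show ?thesis using bump_eq_0[of t] t by simp
qed

text \<open>Spreading is tested with C1 functions, and the one it is needed for is
  \<open>\<rho>\<close>. The powers of \<open>q\<close> cause no trouble at the origin because
  \<open>bump\<close> vanishes near 0.\<close>

lemma rho_c1c: "\<exists>\<rho>'. c1c UNIV \<rho> \<rho>'"
proof -
  let ?p = "1 - real CARD('d) / 2"
  let ?f' = "\<lambda>t. ?p * (t powr (?p - 1) * bump t) + t powr ?p * bump' t"
  have d: "(\<rho> has_derivative (\<lambda>h. ((4 * ?f' (q x)) *\<^sub>R (A *v x)) \<bullet> h)) (at x)" for x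
  proof -
    have "((\<lambda>x. (\<lambda>t. t powr ?p * bump t) (q x)) has_derivative (\<lambda>h. 2 * ((A *v x) \<bullet> h) * ?f' (q x))) (at x)"
      by (rule DERIV_compose_FDERIV[OF DERIV_powr_bump q_has_derivative])
    from has_derivative_mult_right[OF this, of 2] show ?thesis
      unfolding \<rho>_def[abs_def] mult.assoc by (rule has_derivative_eq_rhs) (simp add: fun_eq_iff)
  qed
  have "continuous_on UNIV ?f'" by (intro continuous_intros powr_bump_continuous powr_bump'_continuous)
  then have "continuous_on UNIV (\<lambda>x. ?f' (q x))" by (rule continuous_on_compose2[OF _ q_continuous]) auto
  moreover have "continuous_on UNIV (\<lambda>x. A *v x)"
    by (rule linear_continuous_on) (rule matrix_vector_mul_bounded_linear)
  ultimately have c: "continuous_on UNIV (\<lambda>x. (4 * ?f' (q x)) *\<^sub>R (A *v x))"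
    by (intro continuous_on_scaleR continuous_on_mult_left)
  have "c1c UNIV \<rho> (\<lambda>x. (4 * ?f' (q x)) *\<^sub>R (A *v x))"
    unfolding c1c_def
  proof (intro conjI allI exI[of _ "cball 0 (1/2)"] impI)
    show "x \<notin> cball 0 (1/2) \<Longrightarrow> \<rho> x = 0" for x using rho_zero[of x] by auto
    show "(\<rho> has_derivative (\<bullet>) ((4 * ?f' (q x)) *\<^sub>R (A *v x))) (at x)" for x using d[of x] .
  qed (use c in auto)
  then show ?thesis by blast
qed

end

context flow
begin

text \<open>Otherwise \<open>a v\<close> would be orthogonal to one unit vector for all
  \<open>v\<close> between \<open>p\<close> and \<open>q\<close>. The value of
  \<open>\<delta>\<close> makes (GN) allow this on half of that length at most.\<close>

lemma span_velocities:
  assumes "lo \<le> p" "p < q" "q \<le> hi"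
  shows "span (a ` {p<..<q}) = UNIV"
proof (rule ccontr)
  assume "span (a ` {p<..<q}) \<noteq> UNIV"
  then obtain n0 where n0: "n0 \<noteq> 0" "\<And>x. x \<in> span (a ` {p<..<q}) \<Longrightarrow> n0 \<bullet> x = 0"
    using span_not_UNIV_orthogonal by blast
  define n where "n = n0 /\<^sub>R norm n0"
  have n: "norm n = 1" using n0(1) by (simp add: n_def)
  have an: "a v \<bullet> n = 0" if "v \<in> {p<..<q}" for v
    using n0(2)[OF span_base[OF imageI[OF that]]] by (simp add: n_def inner_commute)
  define \<delta> where "\<delta> = ((q - p) / (2 * Cg)) powr (1 / pg)"
  have \<delta>: "\<delta> > 0" "Cg * \<delta> powr pg = (q - p) / 2"
    using assms Cg pg by (auto simp: \<delta>_def powr_powr)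
  have [measurable]: "a \<in> borel_measurable borel" using a_cont by (rule borel_measurable_continuous_onI)
  have "{v \<in> {lo..hi}. \<bar>a v \<bullet> n\<bar> < \<delta>} \<in> sets borel" by measurable
  then have "measure lborel {p<..<q} \<le> measure lborel {v \<in> {lo..hi}. \<bar>a v \<bullet> n\<bar> < \<delta>}"
    using an \<delta> assms by (intro measure_mono_bounded) (auto intro: bounded_subset[OF bounded_closed_interval[of lo hi]])
  also have "\<dots> \<le> (q - p) / 2" using GN[OF n \<delta>(1)] \<delta>(2) by simp
  finally show False using assms by simp
qed

text \<open>Each application of \<open>spread_single\<close> raises the level past the velocity it
  uses. The velocities are therefore used in increasing order, with an intermediate level
  \<open>m\<close> below the last one, which is why the induction inserts a maximum.\<close>

lemma spread_finite:
  assumes "finite V"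
  shows "lo \<le> p \<Longrightarrow> p < q \<Longrightarrow> q \<le> hi \<Longrightarrow> V \<subseteq> {p<..<q} \<Longrightarrow> spread p q (\<Sum>v\<in>V. c v *\<^sub>R a v)"
  using assms
proof (induction V arbitrary: q rule: finite_linorder_max_induct)
  case empty
  then show ?case using spread_zero[of p q] by simp
next
  case (insert b V)
  define m where "m = (Max (insert p V) + b) / 2"
  have mb: "Max (insert p V) < b" using insert by (subst Max_less_iff) auto
  have "x \<le> Max (insert p V)" if "x \<in> insert p V" for x using that insert.hyps(1) by (intro Max_ge) auto
  then have V: "x < m" if "x \<in> insert p V" for x using mb that unfolding m_def by fastforce
  have m: "p < m" "m < b" "b < q" using V mb insert.prems by (auto simp: m_def)
  have 1: "spread p m (\<Sum>v\<in>V. c v *\<^sub>R a v)" using V m insert.prems by (intro insert.IH) auto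
  have 2: "spread m q (c b *\<^sub>R a b)" using m insert.prems by (intro spread_single) auto
  have "b \<notin> V" using insert.hyps(2) by auto
  then show ?case using spread_trans[OF 1 2] insert.hyps(1) by (simp add: add.commute)
qed

lemma spread_all:
  assumes "lo \<le> p" "p < q" "q \<le> hi"
  shows "spread p q z"
proof -
  have "z \<in> span (a ` {p<..<q})" using span_velocities[OF assms] by simp
  then obtain t r where t: "finite t" "t \<subseteq> a ` {p<..<q}" "z = (\<Sum>b\<in>t. r b *\<^sub>R b)"
    unfolding span_explicit by blast
  obtain V where V: "V \<subseteq> {p<..<q}" "inj_on a V" "t = a ` V" using t(2) by (auto simp: subset_image_inj)
  have "finite V" using finite_imageD t(1) V by blast
  have "z = (\<Sum>v\<in>V. r (a v) *\<^sub>R a v)" unfolding t(3) V(3) by (subst sum.reindex[OF V(2)]) simp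
  then show ?thesis using spread_finite[OF \<open>finite V\<close> assms V(1)] by simp
qed

text \<open>For fixed displacements spreading holds eventually, but it will be used at all points of
  a set that depends on \<open>r\<close>. Both integrals are Lipschitz in the centre with a constant
  independent of \<open>r\<close>, so a finite net of the ball of radius 2 is enough.\<close>

lemma spread_uniform:
  fixes e :: real
  assumes s: "c1c UNIV \<sigma> \<sigma>'" and s0: "\<And>x. 0 \<le> \<sigma> x" and pq: "lo \<le> p" "p < q" "q \<le> hi" and e: "e > 0"
  shows "\<forall>\<^sub>F r in F. \<forall>z\<in>cball 0 2. \<forall>x\<in>cball 0 2. (\<integral>y. indicator {y. un r y < p} y * \<sigma> (y - z) \<partial>lborel)
     \<le> (\<integral>y. indicator {y. un r y < q} y * \<sigma> (y - x) \<partial>lborel) + e"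
proof -
  obtain B where B: "B > 0" "\<And>x. norm (\<sigma>' x) \<le> B" using c1c_bounds[OF s] by metis
  obtain K where K: "compact K" "\<And>x. x \<notin> K \<Longrightarrow> \<sigma> x = 0" using c1c_support[OF s] by metis
  obtain R where R: "R > 0" "K \<subseteq> ball 0 R" using bounded_subset_ballD[OF compact_imp_bounded[OF K(1)], of 0] by auto
  define V where "V = measure lborel (cball (0::real^'d) (R + 2))"
  have V: "V \<ge> 0" by (simp add: V_def)
  define \<eta> where "\<eta> = e / (3 * (B * V + 1))"
  have BV: "0 \<le> B * V" using B V by simp
  have \<eta>: "\<eta> > 0" "B * \<eta> * V \<le> e / 3"
  proof -
    show "\<eta> > 0" using BV e by (simp add: \<eta>_def)
    have "e / (3 * (b + 1)) * b \<le> e / 3" if "0 \<le> b" for b :: real using that e by (simp add: field_simps)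
    from this[OF BV] show "B * \<eta> * V \<le> e / 3" by (simp add: \<eta>_def mult_ac)
  qed
  let ?Q = "\<lambda>r m z. \<integral>y. indicator {y. un r y < m} y * \<sigma> (y - z) \<partial>lborel"
  have near: "\<bar>?Q r m z - ?Q r m z'\<bar> \<le> e / 3" if z: "z \<in> cball 0 2" "z' \<in> cball 0 2" "dist z z' < \<eta>" for r m z z'
  proof -
    have i: "integrable lborel (\<lambda>y. indicator {y. un r y < m} y * \<sigma> (y - z))" for z
      by (rule indicator_level_integrable[OF c1c_translate[OF s]])
    have cb: "integrable lborel (indicator (cball (0::real^'d) (R + 2)) :: _ \<Rightarrow> real)"
      by (rule integrable_indicator_bounded) auto
    have far: "\<sigma> (y - z) = 0" if "norm y > R + 2" "norm z \<le> 2" for y z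
    proof -
      have "norm y \<le> norm (y - z) + norm z" using norm_triangle_ineq[of "y - z" z] by simp
      then have "y - z \<notin> ball 0 R" using that by simp
      then show ?thesis using K R by blast
    qed
    have pt: "\<bar>indicator {y. un r y < m} y * \<sigma> (y - z) - indicator {y. un r y < m} y * \<sigma> (y - z')\<bar> \<le> B * \<eta> * indicator (cball 0 (R + 2)) y" for y
    proof (cases "norm y > R + 2")
      case True
      then show ?thesis using far z by simp
    next
      case False
      have "\<bar>\<sigma> ((y - z') + (z' - z)) - \<sigma> (y - z')\<bar> \<le> B * norm (z' - z)" by (rule c1c_lipschitz[OF s B(2)])
      also have "\<dots> \<le> B * \<eta>" using z(3) B(1) by (intro mult_left_mono) (auto simp: dist_norm norm_minus_commute)
      finally show ?thesis using False B(1) \<eta>(1) by (auto simp: indicator_def)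
    qed
    have "norm (\<integral>y. indicator {y. un r y < m} y * \<sigma> (y - z) - indicator {y. un r y < m} y * \<sigma> (y - z') \<partial>lborel)
      \<le> (\<integral>y. B * \<eta> * indicator (cball (0::real^'d) (R + 2)) y \<partial>lborel)"
      by (rule Bochner_Integration.integral_norm_bound_integral[OF Bochner_Integration.integrable_diff[OF i i] integrable_mult_right[OF cb]]) (use pt in auto)
    also have "\<dots> = B * \<eta> * V" by (simp add: V_def)
    finally show ?thesis using \<eta>(2) by (simp add: i)
  qed
  obtain Z where Z: "Z \<subseteq> cball (0::real^'d) 2" "finite Z" "cball 0 2 \<subseteq> (\<Union>x\<in>Z. ball x \<eta>)"
    by (rule compactE_image[of "cball (0::real^'d) 2" "cball 0 2" "\<lambda>x. ball x \<eta>"]) (use \<eta>(1) in auto)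
  have "\<forall>\<^sub>F r in F. \<forall>z\<in>Z. \<forall>x\<in>Z. ?Q r p z \<le> ?Q r q x + e / 3"
  proof (intro eventually_ball_finite Z(2) ballI)
    fix z x assume "z \<in> Z" "x \<in> Z"
    have "0 < e / 3" using e by simp
    then have "\<forall>\<^sub>F r in F. ?Q r p z \<le> (\<integral>y. indicator {y. un r y < q} y * \<sigma> (y - (x - z) - z) \<partial>lborel) + e / 3"
      using spread_all[OF pq, of "x - z"] c1c_translate[OF s, of z] s0 unfolding spread_def by blast
    then show "\<forall>\<^sub>F r in F. ?Q r p z \<le> ?Q r q x + e / 3" by simp
  qed
  then show ?thesis
  proof eventually_elim
    case (elim r)
    show ?case
    proof (intro ballI)
      fix z x :: "real^'d" assume zx: "z \<in> cball 0 2" "x \<in> cball 0 2"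
      obtain z' x' where z': "z' \<in> Z" "dist z' z < \<eta>" and x': "x' \<in> Z" "dist x' x < \<eta>"
        using subsetD[OF Z(3) zx(1)] subsetD[OF Z(3) zx(2)] unfolding UN_iff mem_ball by blast
      have "\<bar>?Q r p z - ?Q r p z'\<bar> \<le> e / 3" "\<bar>?Q r q x - ?Q r q x'\<bar> \<le> e / 3"
        using near[of z z'] near[of x x'] zx z' x' Z(1) by (auto simp: dist_commute)
      moreover have "?Q r p z' \<le> ?Q r q x' + e / 3" using elim z' x' by blast
      ultimately show "?Q r p z \<le> ?Q r q x + e" by linarith
    qed
  qed
qed

end

context ellip
begin

text \<open>Fubini: the average of \<open>E\<close> seen from \<open>B\<close> is the average of
  \<open>B\<close> seen from \<open>E\<close>, with \<open>\<rho>\<close> evaluated at the same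
  difference.\<close>

lemma Fs_pairing:
  fixes B :: "(real^'d) set"
  assumes E: "E \<in> sets borel" "E \<subseteq> cball 0 (1/4)" and B: "B \<in> sets borel"
    and c: "\<And>x. x \<in> E \<Longrightarrow> c \<le> (\<integral>y. indicator B y * \<rho> (y - x) \<partial>lborel)"
  shows "c * measure lborel E \<le> (\<integral>y. indicator B y * Fs E 1 y \<partial>lborel)"
proof -
  note [measurable] = E(1) B
  let ?f = "\<lambda>x y. indicator E x * (indicator B y * \<rho> (y - x))"
  have b: "\<bar>?f x y\<bar> \<le> 2 * 4 ^ CARD('d)" for x y
    using rho_le[of "y - x"] rho_nonneg(1)[of "y - x"] by (auto simp: indicator_def)
  have z: "?f x y = 0" if "x \<notin> cball 0 (1/4) \<or> y \<notin> cball 0 1" for x y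
  proof (cases "x \<in> E")
    case True
    then have "norm x \<le> 1/4" "norm y > 1" using E(2) that by auto
    then have "norm (y - x) \<ge> 1/2" using norm_triangle_ineq2[of y x] by linarith
    then show ?thesis using rho_zero by simp
  qed simp
  have F: "(\<integral>x. (\<integral>y. ?f x y \<partial>lborel) \<partial>lborel) = (\<integral>y. (\<integral>x. ?f x y \<partial>lborel) \<partial>lborel)" "integrable lborel (\<lambda>x. \<integral>y. ?f x y \<partial>lborel)"
    by (rule Fubini_bounded_support[OF _ b bounded_cball[of 0 "1/4"] bounded_cball[of 0 1] z]; measurable)+
  have "c * measure lborel E = (\<integral>x. c * indicator E x \<partial>lborel)" using E(1) by simp
  also have "\<dots> \<le> (\<integral>x. (\<integral>y. ?f x y \<partial>lborel) \<partial>lborel)"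
  proof (rule integral_mono[OF integrable_mult_right[OF E_int[OF E]] F(2)])
    show "c * indicator E x \<le> (\<integral>y. ?f x y \<partial>lborel)" for x using c[of x] by (cases "x \<in> E") auto
  qed
  also have "\<dots> = (\<integral>y. indicator B y * Fs E 1 y \<partial>lborel)"
    unfolding F(1)
  proof (rule Bochner_Integration.integral_cong[OF refl])
    fix y
    have "(\<integral>x. ?f x y \<partial>lborel) = (\<integral>x. indicator B y * (indicator E x * \<rho> (y - x)) \<partial>lborel)"
      by (rule Bochner_Integration.integral_cong[OF refl]) simp
    then show "(\<integral>x. ?f x y \<partial>lborel) = indicator B y * Fs E 1 y"
      by (simp add: Fs_def[OF E] conv_def rhos_1)
  qed
  finally show ?thesis .
qed

text \<open>The centre is averaged over the ball of radius 2. A point of the unit ball sees the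
  whole mass \<open>cA\<close> of \<open>\<rho>\<close> among these centres, because the support of
  \<open>\<rho>\<close> has radius 1/2. Read backwards, a large part of \<open>B\<close> in the unit
  ball is noticed from some centre.\<close>

lemma rho_averaging:
  fixes B :: "(real^'d) set"
  assumes B: "B \<in> sets borel" and Q: "\<And>z. z \<in> cball 0 2 \<Longrightarrow> (\<integral>y. indicator B y * \<rho> (y - z) \<partial>lborel) \<le> Q"
  shows "cA * measure lborel (B \<inter> ball 0 1) \<le> Q * measure lborel (cball (0::real^'d) 2)"
proof -
  note [measurable] = B
  have [measurable]: "cball (0::real^'d) 2 \<in> sets borel" by simp
  let ?f = "\<lambda>z y. indicator (cball 0 2) z * (indicator B y * \<rho> (y - z))"
  have b: "\<bar>?f x y\<bar> \<le> 2 * 4 ^ CARD('d)" for x y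
    using rho_le[of "y - x"] rho_nonneg(1)[of "y - x"] by (auto simp: indicator_def)
  have z: "?f z y = 0" if "z \<notin> cball 0 2 \<or> y \<notin> cball 0 3" for z y
  proof (cases "z \<in> cball 0 2")
    case True
    then have "norm z \<le> 2" "norm y > 3" using that by auto
    then have "norm (y - z) \<ge> 1/2" using norm_triangle_ineq2[of y z] by linarith
    then show ?thesis using rho_zero by simp
  qed simp
  have F: "(\<integral>z. (\<integral>y. ?f z y \<partial>lborel) \<partial>lborel) = (\<integral>y. (\<integral>z. ?f z y \<partial>lborel) \<partial>lborel)" "integrable lborel (\<lambda>z. \<integral>y. ?f z y \<partial>lborel)"
    by (rule Fubini_bounded_support[OF _ b bounded_cball[of 0 2] bounded_cball[of 0 3] z]; measurable)+
  have z': "?f z y = 0" if "y \<notin> cball 0 3 \<or> z \<notin> cball 0 2" for z y using z that by blast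
  have F2: "integrable lborel (\<lambda>y. \<integral>z. ?f z y \<partial>lborel)"
    by (rule Fubini_bounded_support(2)[OF _ b bounded_cball[of 0 3] bounded_cball[of 0 2] z']; measurable)
  have i1: "integrable lborel (indicator (B \<inter> ball 0 1) :: real^'d \<Rightarrow> real)"
    by (rule integrable_indicator_bounded) (auto intro: bounded_subset[OF bounded_ball[of 0 1]])
  have i2: "integrable lborel (indicator (cball 0 2) :: real^'d \<Rightarrow> real)"
    by (rule integrable_indicator_bounded) auto
  have "B \<inter> ball 0 1 \<in> sets borel" by measurable
  then have "cA * measure lborel (B \<inter> ball 0 1) = (\<integral>y. cA * indicator (B \<inter> ball 0 1) y \<partial>lborel)" by simp
  also have "\<dots> \<le> (\<integral>y. (\<integral>z. ?f z y \<partial>lborel) \<partial>lborel)"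
  proof (rule integral_mono[OF integrable_mult_right[OF i1] F2])
    fix y
    show "cA * indicator (B \<inter> ball 0 1) y \<le> (\<integral>z. ?f z y \<partial>lborel)"
    proof (cases "y \<in> B \<inter> ball 0 1")
      case True
      have "?f z y = \<rho> (y - z)" for z
      proof (cases "z \<in> cball 0 2")
        case False
        then have "norm (y - z) \<ge> 1/2" using True norm_triangle_ineq2[of z y] by (auto simp: norm_minus_commute)
        then show ?thesis using False rho_zero by simp
      qed (use True in simp)
      then have "(\<integral>z. ?f z y \<partial>lborel) = cA" unfolding cA_def by (simp only: lborel_integral_reflect[OF rho_borel(1)])
      then show ?thesis using True by simp
    next
      case False
      have "0 \<le> (\<integral>z. ?f z y \<partial>lborel)" using rho_nonneg by (intro Bochner_Integration.integral_nonneg) auto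
      then show ?thesis using False by simp
    qed
  qed
  also have "\<dots> \<le> (\<integral>z. Q * indicator (cball (0::real^'d) 2) z \<partial>lborel)"
    unfolding F(1)[symmetric]
  proof (rule integral_mono[OF F(2) integrable_mult_right[OF i2]])
    show "(\<integral>y. ?f z y \<partial>lborel) \<le> Q * indicator (cball 0 2) z" for z
      using Q[of z] by (cases "z \<in> cball 0 2") auto
  qed
  also have "\<dots> = Q * measure lborel (cball (0::real^'d) 2)" by simp
  finally show ?thesis .
qed

end

section \<open>The alternative between two levels\<close>

context flow
begin

text \<open>The total mass of \<open>Fs 1\<close> is \<open>cA\<close> times that of
  \<open>E\<close>, so in the window inequality the left-hand side minus the leading term is exactly
  the mass of \<open>Fs 1\<close> in the sublevel set for \<open>w\<close>. If the sublevel set for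
  \<open>p\<close> fills a measure \<open>\<delta>\<close> of the unit ball, averaging finds it from
  some centre, spreading makes it visible at level \<open>w\<close> from every point of
  \<open>E\<close>, and the difference is at least \<open>\<epsilon> * m\<close>.\<close>

lemma window_alternative:
  fixes L \<theta> \<delta> :: real
  assumes kw: "lo \<le> p" "p \<le> k" "lo < k" "k < w" "w \<le> hi" and L: "L > 0" and th: "\<theta> > 0" and \<delta>: "\<delta> > 0"
  defines "V \<equiv> measure lborel (cball (0::real^'d) 2)"
  shows "\<forall>\<^sub>F r in F. \<delta> \<le> measure lborel ({x. un r x < p} \<inter> ball 0 1) \<longrightarrow>
     \<delta> / (2 * V) * measure lborel ({x. w \<le> un r x} \<inter> cball 0 (1/4))
       \<le> L * real CARD('d) / 2 * measure lborel ({x. k < un r x \<and> un r x < w} \<inter> cball 0 (3/4))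
         + measure lborel ({x. w \<le> un r x} \<inter> cball 0 (1/4)) / L + \<theta>"
proof -
  interpret W: window a a' lo hi Cg pg k w by unfold_locales (use kw in auto)
  note [measurable] = un(1)
  have V: "V > 0" unfolding V_def using content_cball_pos[of 2 "0::real^'d"] by simp
  obtain \<rho>' where rho: "c1c UNIV W.\<rho> \<rho>'" using W.rho_c1c by blast
  \<comment> \<open>Averaging guarantees \<open>2 * \<epsilon>\<close> at some centre; one
    \<open>\<epsilon>\<close> is the error allowed to spreading.\<close>
  define \<epsilon> where "\<epsilon> = W.cA * \<delta> / (2 * V)"
  have eps: "\<epsilon> > 0" using W.cA_pos \<delta> V by (simp add: \<epsilon>_def)
  have "p < w" using kw by simp
  from spread_uniform[OF rho W.rho_nonneg(1) kw(1) this kw(5) eps]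
  have ev1: "\<forall>\<^sub>F r in F. \<forall>z\<in>cball 0 2. \<forall>x\<in>cball 0 2. (\<integral>y. indicator {y. un r y < p} y * W.\<rho> (y - z) \<partial>lborel)
     \<le> (\<integral>y. indicator {y. un r y < w} y * W.\<rho> (y - x) \<partial>lborel) + \<epsilon>" .
  obtain \<xi> :: "real^'d \<Rightarrow> real" and \<xi>' where xi: "c1c (ball 0 1) \<xi> \<xi>'" "\<And>x. 0 \<le> \<xi> x" "\<And>x. x \<in> cball 0 (3/4) \<Longrightarrow> \<xi> x = 1"
    using cutoff_exists[where 'a = "real^'d"] by blast
  have "k \<le> hi" using kw by simp
  from ramp_exists[OF order_refl kw(3) this]
  obtain h h' H where hh: "fl a h h' H \<and> (\<forall>v. 0 \<le> h' v) \<and> (\<forall>v\<in>{k..hi}. 1 \<le> h' v) \<and> (\<forall>s\<le>lo. H s = 0)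
     \<and> (\<forall>s\<in>{lo..hi}. norm (H s) \<le> (hi - lo)\<^sup>2 * Ba)" by (elim exE)
  then have h: "fl a h h' H" "\<And>v. 0 \<le> h' v" "\<And>v. v \<in> {k..hi} \<Longrightarrow> 1 \<le> h' v" by simp_all
  define V4 where "V4 = measure lborel (cball (0::real^'d) (1/4))"
  define M where "M = 4 * (2 ^ CARD('d) / W.lam) * (1 + W.unit_vol) * V4 powr (1 / (2 * real CARD('d)))"
  define D where "D r = real CARD('d) * (M * Kg * (\<integral>x. H (un r x) \<bullet> \<xi>' x \<partial>lborel))" for r
  have "(D \<longlongrightarrow> real CARD('d) * (M * Kg * 0)) F"
    unfolding D_def[abs_def] by (intro tendsto_intros diss[OF c1c_mono[OF xi(1)] xi(2) h(1,2)]) auto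
  then have "\<forall>\<^sub>F r in F. D r < \<theta> * W.cA"
    using W.cA_pos th by (intro order_tendstoD) auto
  from ev1 this un_kin[of 1] show ?thesis
  proof eventually_elim
    case (elim r)
    define E where "E = {x. w \<le> un r x} \<inter> cball 0 (1/4)"
    have E: "E \<in> sets borel" "E \<subseteq> cball 0 (1/4)" by (auto simp: E_def)
    define m where "m = measure lborel E"
    define \<beta> where "\<beta> = measure lborel ({x. k < un r x \<and> un r x < w} \<inter> cball 0 (3/4))"
    have m4: "0 \<le> m" "m \<le> V4" unfolding m_def V4_def by (simp, rule measure_mono_bounded[OF E(2,1)]) auto
    have XM: "\<bar>W.X E ((1/2)^J) i x\<bar> \<le> M" for J i x
    proof -
      have "m powr (1 / (2 * real CARD('d))) \<le> V4 powr (1 / (2 * real CARD('d)))" using m4 by (intro powr_mono2) auto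
      moreover have "0 \<le> 4 * (2 ^ CARD('d) / W.lam) * (1 + W.unit_vol)" using W.lam_pos W.unit_vol_pos by simp
      ultimately show ?thesis
        unfolding M_def m_def by (intro order_trans[OF W.X_bound[OF E, of J i x]] mult_left_mono)
    qed
    have Dr: "(\<Sum>i\<in>UNIV. \<integral>x. W.Gp i (un r x) \<bullet> W.X' E ((1/2)^J) i x \<partial>lborel) \<le> D r" for J
      unfolding D_def by (rule W.window_kin[OF un E elim(3) h(1,2) _ xi XM]) (use h(3) kw in auto)
    \<comment> \<open>The factor \<open>cA\<close> makes all terms divisible by it, leaving the free
      parameter \<open>L\<close> to balance the window term against the square term.\<close>
    have LA: "W.cA * L > 0" using W.cA_pos L by simp
    have wi: "W.cA * m \<le> (\<integral>x. indicator {x. w \<le> un r x} x * W.Fs E 1 x \<partial>lborel)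
       + W.cA * L * real CARD('d) / 2 * \<beta> + W.cA\<^sup>2 * m / (W.cA * L) + D r"
      unfolding m_def \<beta>_def by (rule W.window_inequality[OF un E _ LA Dr]) (auto simp: E_def)
    show ?case
    proof
      assume low: "\<delta> \<le> measure lborel ({x. un r x < p} \<inter> ball 0 1)"
      have c: "\<epsilon> \<le> (\<integral>y. indicator {y. un r y < w} y * W.\<rho> (y - x) \<partial>lborel)" if x: "x \<in> E" for x
      proof -
        define Q where "Q = (\<integral>y. indicator {y. un r y < w} y * W.\<rho> (y - x) \<partial>lborel) + \<epsilon>"
        have x2: "x \<in> cball 0 2" using E(2) x by auto
        have "(\<integral>y. indicator {y. un r y < p} y * W.\<rho> (y - z) \<partial>lborel) \<le> Q" if "z \<in> cball 0 2" for z
          using elim(1) x2 that unfolding Q_def by blast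
        then have "W.cA * measure lborel ({x. un r x < p} \<inter> ball 0 1) \<le> Q * V"
          unfolding V_def by (intro W.rho_averaging) auto
        moreover have "W.cA * \<delta> \<le> W.cA * measure lborel ({x. un r x < p} \<inter> ball 0 1)"
          using low W.cA_pos by (intro mult_left_mono) auto
        ultimately have "W.cA * \<delta> \<le> Q * V" by linarith
        then have "W.cA * \<delta> / V \<le> Q" using V by (simp add: divide_le_eq)
        moreover have "W.cA * \<delta> / V = 2 * \<epsilon>" by (simp add: \<epsilon>_def)
        ultimately show ?thesis unfolding Q_def by linarith
      qed
      have P: "\<epsilon> * m \<le> (\<integral>y. indicator {y. un r y < w} y * W.Fs E 1 y \<partial>lborel)"
        unfolding m_def by (rule W.Fs_pairing[OF E _ c]) auto
      have Fi: "integrable lborel (W.Fs E 1)" by (rule W.Fs_integrable[OF E]) auto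
      have Fi2: "integrable lborel (\<lambda>x. indicator S x * W.Fs E 1 x)" if "S \<in> sets borel" for S
        using integrable_real_mult_indicator[OF _ Fi, of S] that by (simp add: mult.commute)
      have "(\<integral>x. indicator {x. w \<le> un r x} x * W.Fs E 1 x \<partial>lborel) + (\<integral>y. indicator {y. un r y < w} y * W.Fs E 1 y \<partial>lborel)
         = (\<integral>x. indicator {x. w \<le> un r x} x * W.Fs E 1 x + indicator {x. un r x < w} x * W.Fs E 1 x \<partial>lborel)"
        by (rule Bochner_Integration.integral_add[symmetric]) (rule Fi2, measurable)+
      also have "\<dots> = (\<integral>x. W.Fs E 1 x \<partial>lborel)"
        by (rule Bochner_Integration.integral_cong[OF refl]) (auto simp: indicator_def)
      also have "\<dots> = W.cA * m" unfolding m_def by (rule W.Fs_integral[OF E]) simp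
      finally have "\<epsilon> * m \<le> W.cA * L * real CARD('d) / 2 * \<beta> + W.cA\<^sup>2 * m / (W.cA * L) + D r"
        using P wi by linarith
      moreover have "\<epsilon> * m = W.cA * (\<delta> / (2 * V) * m)" by (simp add: \<epsilon>_def)
      moreover have "W.cA\<^sup>2 * m / (W.cA * L) = W.cA * (m / L)" using W.cA_pos by (simp add: power2_eq_square)
      moreover have "W.cA * L * real CARD('d) / 2 * \<beta> = W.cA * (L * real CARD('d) / 2 * \<beta>)" by simp
      ultimately have "W.cA * (\<delta> / (2 * V) * m) \<le> W.cA * (L * real CARD('d) / 2 * \<beta>) + W.cA * (m / L) + W.cA * \<theta>"
        using elim(2) by (simp only: mult.commute[of \<theta>])
      then have "W.cA * (\<delta> / (2 * V) * m) \<le> W.cA * (L * real CARD('d) / 2 * \<beta> + m / L + \<theta>)"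
        by (simp only: distrib_left)
      then show "\<delta> / (2 * V) * measure lborel ({x. w \<le> un r x} \<inter> cball 0 (1/4))
       \<le> L * real CARD('d) / 2 * measure lborel ({x. k < un r x \<and> un r x < w} \<inter> cball 0 (3/4))
         + measure lborel ({x. w \<le> un r x} \<inter> cball 0 (1/4)) / L + \<theta>"
        using W.cA_pos unfolding m_def[unfolded E_def, symmetric] \<beta>_def[symmetric] by (simp only: mult_le_cancel_left_pos)
    qed
  qed
qed

text \<open>If both sets exceeded \<open>\<delta>\<close>, each of \<open>N\<close> windows between
  the levels would yield at least \<open>\<gamma>\<close>. The choice of \<open>L\<close> reduces
  the square term to \<open>\<gamma> / 4\<close>, the dissipation is another
  \<open>\<gamma> / 4\<close>, and the window terms telescope. For the chosen \<open>N\<close> their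
  sum stays below \<open>N * \<gamma> / 4\<close>, which is a contradiction.\<close>

lemma dichotomy:
  fixes \<delta> :: real
  assumes kk: "lo \<le> k" "k < k'" "k' \<le> hi" and \<delta>: "\<delta> > 0"
  shows "\<forall>\<^sub>F r in F. measure lborel ({x. un r x < k} \<inter> ball 0 1) \<le> \<delta> \<or> measure lborel ({x. k' < un r x} \<inter> cball 0 (1/4)) \<le> \<delta>"
proof -
  note [measurable] = un(1)
  define V where "V = measure lborel (cball (0::real^'d) 2)"
  have V: "V > 0" unfolding V_def using content_cball_pos[of 2 "0::real^'d"] by simp
  define \<gamma> where "\<gamma> = \<delta>\<^sup>2 / (2 * V)"
  have \<gamma>: "\<gamma> > 0" using \<delta> V by (simp add: \<gamma>_def)
  define L where "L = 4 * V / \<gamma>"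
  have L: "L > 0" "V / L = \<gamma> / 4" using V \<gamma> by (auto simp: L_def)
  obtain N0 :: nat where N0: "L * real CARD('d) / 2 * V / (\<gamma> / 4) < real N0" using reals_Archimedean2 by blast
  define N where "N = Suc N0"
  have N: "0 < N" "L * real CARD('d) / 2 * V < real N * (\<gamma> / 4)"
  proof -
    have "L * real CARD('d) / 2 * V / (\<gamma> / 4) < real N" using N0 by (simp add: N_def)
    then show "L * real CARD('d) / 2 * V < real N * (\<gamma> / 4)" using \<gamma> by (simp only: pos_divide_less_eq)
  qed (simp add: N_def)
  \<comment> \<open>The windows occupy the upper half of the range, so that the lowest one starts
    strictly above \<open>lo\<close>, as the ramp below it requires.\<close>
  define m where "m = (k + k') / 2"
  have m: "lo < m" "k \<le> m" "m < k'" using kk by (auto simp: m_def)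
  define h where "h = (k' - m) / real N"
  have h: "h > 0" "m + real N * h = k'" using m N by (auto simp: h_def)
  define lv where "lv i = m + real i * h" for i
  have lv: "k \<le> lv i" "lo < lv i" "lv i < lv (Suc i)" for i
  proof -
    have "0 \<le> real i * h" using h by simp
    then show "k \<le> lv i" "lo < lv i" using m by (auto simp: lv_def)
    show "lv i < lv (Suc i)" using h by (simp add: lv_def algebra_simps)
  qed
  have lvN: "lv (Suc i) \<le> k'" if "i < N" for i
  proof -
    have "real (Suc i) * h \<le> real N * h" using that h by (intro mult_right_mono) auto
    then show ?thesis unfolding lv_def using h(2) by linarith
  qed
  have \<gamma>4: "\<gamma> / 4 > 0" using \<gamma> by simp
  have "\<forall>\<^sub>F r in F. \<forall>i\<in>{..<N}. \<delta> \<le> measure lborel ({x. un r x < k} \<inter> ball 0 1) \<longrightarrow>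
     \<delta> / (2 * V) * measure lborel ({x. lv (Suc i) \<le> un r x} \<inter> cball 0 (1/4))
       \<le> L * real CARD('d) / 2 * measure lborel ({x. lv i < un r x \<and> un r x < lv (Suc i)} \<inter> cball 0 (3/4))
         + measure lborel ({x. lv (Suc i) \<le> un r x} \<inter> cball 0 (1/4)) / L + \<gamma> / 4"
  proof (intro eventually_ball_finite ballI)
    fix i assume "i \<in> {..<N}"
    then have "lv (Suc i) \<le> hi" using lvN[of i] kk by simp
    from window_alternative[OF kk(1) lv(1,2,3) this L(1) \<gamma>4 \<delta>]
    show "\<forall>\<^sub>F r in F. \<delta> \<le> measure lborel ({x. un r x < k} \<inter> ball 0 1) \<longrightarrow>
     \<delta> / (2 * V) * measure lborel ({x. lv (Suc i) \<le> un r x} \<inter> cball 0 (1/4))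
       \<le> L * real CARD('d) / 2 * measure lborel ({x. lv i < un r x \<and> un r x < lv (Suc i)} \<inter> cball 0 (3/4))
         + measure lborel ({x. lv (Suc i) \<le> un r x} \<inter> cball 0 (1/4)) / L + \<gamma> / 4"
      unfolding V_def .
  qed simp
  then show ?thesis
  proof eventually_elim
    case (elim r)
    show ?case
    proof (rule ccontr)
      assume "\<not> ?thesis"
      then have big: "\<delta> < measure lborel ({x. un r x < k} \<inter> ball 0 1)" "\<delta> < measure lborel ({x. k' < un r x} \<inter> cball 0 (1/4))"
        by auto
      define \<beta> where "\<beta> i = measure lborel ({x. lv i < un r x} \<inter> cball 0 (3/4))" for i
      have step: "\<gamma> \<le> L * real CARD('d) / 2 * (\<beta> i - \<beta> (Suc i)) + \<gamma> / 4 + \<gamma> / 4" if i: "i < N" for i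
      proof -
        define E where "E = measure lborel ({x. lv (Suc i) \<le> un r x} \<inter> cball 0 (1/4))"
        have "measure lborel ({x. k' < un r x} \<inter> cball 0 (1/4)) \<le> E"
          unfolding E_def by (rule measure_mono_bounded) (use lvN[OF i] in auto)
        then have Eb: "\<delta> \<le> E" using big by simp
        have EV: "E \<le> V" unfolding E_def V_def by (rule measure_mono_bounded) auto
        have "\<gamma> = \<delta> / (2 * V) * \<delta>" by (simp add: \<gamma>_def power2_eq_square)
        also have "\<dots> \<le> \<delta> / (2 * V) * E" using Eb \<delta> V by (intro mult_left_mono) auto
        finally have A: "\<gamma> \<le> \<delta> / (2 * V) * E" .
        have B: "E / L \<le> \<gamma> / 4" unfolding L(2)[symmetric] using EV L by (intro divide_right_mono) auto
        have eq: "\<beta> i - \<beta> (Suc i) = measure lborel (({x. lv i < un r x} \<inter> cball 0 (3/4)) - ({x. lv (Suc i) < un r x} \<inter> cball 0 (3/4)))"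
          unfolding \<beta>_def
        proof (rule measure_Diff[symmetric])
          show "{x. lv (Suc i) < un r x} \<inter> cball 0 (3/4) \<subseteq> {x. lv i < un r x} \<inter> cball 0 (3/4)"
            using lv(3)[of i] by force
          have "emeasure lborel ({x. lv i < un r x} \<inter> cball 0 (3/4)) < \<infinity>"
            by (rule emeasure_bounded_finite[OF bounded_subset[OF bounded_cball[of 0 "3/4"]]]) auto
          then show "emeasure lborel ({x. lv i < un r x} \<inter> cball 0 (3/4)) \<noteq> \<infinity>" by simp
        qed auto
        have "measure lborel ({x. lv i < un r x \<and> un r x < lv (Suc i)} \<inter> cball 0 (3/4)) \<le> \<beta> i - \<beta> (Suc i)"
          unfolding eq by (rule measure_mono_bounded) (auto intro: bounded_subset[OF bounded_cball[of 0 "3/4"]])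
        then have C: "L * real CARD('d) / 2 * measure lborel ({x. lv i < un r x \<and> un r x < lv (Suc i)} \<inter> cball 0 (3/4)) \<le> L * real CARD('d) / 2 * (\<beta> i - \<beta> (Suc i))"
          using L by (intro mult_left_mono) auto
        have "\<delta> / (2 * V) * E \<le> L * real CARD('d) / 2 * measure lborel ({x. lv i < un r x \<and> un r x < lv (Suc i)} \<inter> cball 0 (3/4)) + E / L + \<gamma> / 4"
          using elim i big(1) unfolding E_def by simp
        then show ?thesis using A B C by linarith
      qed
      have "real N * \<gamma> = (\<Sum>i<N. \<gamma>)" by simp
      also have "\<dots> \<le> (\<Sum>i<N. L * real CARD('d) / 2 * (\<beta> i - \<beta> (Suc i)) + \<gamma> / 4 + \<gamma> / 4)"
        by (intro sum_mono step) simp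
      also have "\<dots> = L * real CARD('d) / 2 * (\<beta> 0 - \<beta> N) + real N * (\<gamma> / 4 + \<gamma> / 4)"
      proof -
        have "(\<Sum>i<N. c * (\<beta> i - \<beta> (Suc i)) + \<gamma> / 4 + \<gamma> / 4) = c * (\<beta> 0 - \<beta> N) + real N * (\<gamma> / 4 + \<gamma> / 4)" for c
          by (simp add: sum.distrib sum_distrib_left[symmetric] sum_lessThan_telescope' distrib_left)
        then show ?thesis .
      qed
      also have "\<dots> \<le> L * real CARD('d) / 2 * V + real N * (\<gamma> / 4 + \<gamma> / 4)"
      proof -
        have "\<beta> 0 \<le> V" unfolding \<beta>_def V_def by (rule measure_mono_bounded) auto
        moreover have "0 \<le> \<beta> N" by (simp add: \<beta>_def)
        ultimately show ?thesis using L by (intro add_right_mono mult_left_mono) auto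
      qed
      also have "\<dots> < real N * (\<gamma> / 4) + real N * (\<gamma> / 4 + \<gamma> / 4)" by (intro add_strict_right_mono N(2))
      finally have "real N * \<gamma> < real N * (\<gamma> / 4) + real N * (\<gamma> / 4 + \<gamma> / 4)" .
      moreover have "0 < real N * \<gamma>" using N \<gamma> by simp
      ultimately show False by argo
    qed
  qed
qed

end

section \<open>Small oscillation of the blow-ups\<close>

lemma measure_negligible:
  fixes S :: "'a::euclidean_space set"
  assumes "negligible S" "S \<in> sets borel"
  shows "measure lborel S = 0"
  using negligible_imp_measure0[OF assms(1)] assms(2) by simp

context flow
begin

text \<open>The estimate from below is the one from above for \<open>- u\<close> and the flux
  \<open>a (- v)\<close>, with the smaller of the two thresholds. The dilation by 1/4 moves the
  hypothesis to the ball on which the dichotomy gives information.\<close>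

lemma dg_rescaled:
  fixes h :: real
  assumes h: "h > 0"
  shows "\<exists>\<delta>>0. \<forall>k u. lo \<le> k \<and> k + h \<le> hi \<and> kin a u (ball 0 1) \<and> u \<in> borel_measurable borel \<and> (\<forall>x. u x \<in> {lo..hi}) \<longrightarrow>
     (measure lborel ({x. k < u x} \<inter> ball 0 (1/4)) \<le> \<delta> \<longrightarrow> measure lborel ({x. k + h < u x} \<inter> ball 0 (1/8)) = 0) \<and>
     (measure lborel ({x. u x < k + h} \<inter> ball 0 (1/4)) \<le> \<delta> \<longrightarrow> measure lborel ({x. u x < k} \<inter> ball 0 (1/8)) = 0)"
proof -
  interpret R: flux_gn "\<lambda>v. a (- v)" "\<lambda>v. - a' (- v)" "- hi" "- lo" Cg pg
    by (rule flux_gn_reflect) unfold_locales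
  obtain \<delta>1 where \<delta>1: "\<delta>1 > 0" and W1: "\<forall>k u. lo \<le> k \<and> k + h \<le> hi \<and> kin a u (ball 0 1) \<and> u \<in> borel_measurable borel \<and> (\<forall>x. u x \<in> {lo..hi})
     \<and> measure lborel ({x. k < u x} \<inter> ball 0 1) \<le> \<delta>1 \<longrightarrow> negligible ({x. k + h < u x} \<inter> ball 0 (1/2))"
    using dg[OF h] by blast
  obtain \<delta>2 where \<delta>2: "\<delta>2 > 0" and W2: "\<forall>k u. - hi \<le> k \<and> k + h \<le> - lo \<and> kin (\<lambda>v. a (- v)) u (ball 0 1) \<and> u \<in> borel_measurable borel \<and> (\<forall>x. u x \<in> {- hi..- lo})
     \<and> measure lborel ({x. k < u x} \<inter> ball 0 1) \<le> \<delta>2 \<longrightarrow> negligible ({x. k + h < u x} \<inter> ball 0 (1/2))"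
    using R.dg[OF h] by blast
  define \<delta> where "\<delta> = (1/4) ^ CARD('d) * min \<delta>1 \<delta>2"
  have "(measure lborel ({x. k < u x} \<inter> ball 0 (1/4)) \<le> \<delta> \<longrightarrow> measure lborel ({x. k + h < u x} \<inter> ball 0 (1/8)) = 0) \<and>
     (measure lborel ({x. u x < k + h} \<inter> ball 0 (1/4)) \<le> \<delta> \<longrightarrow> measure lborel ({x. u x < k} \<inter> ball 0 (1/8)) = 0)"
    if k: "lo \<le> k" "k + h \<le> hi" and kin: "kin a u (ball 0 1)" and u: "u \<in> borel_measurable borel" "\<And>x. u x \<in> {lo..hi}"
    for k and u :: "real^'d \<Rightarrow> real"
  proof -
    note [measurable] = u(1)
    define v where "v z = u (0 + (1/4) *\<^sub>R z)" for z
    have v: "v \<in> borel_measurable borel" "\<And>x. v x \<in> {lo..hi}" "kin a v (ball 0 1)"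
      unfolding v_def[abs_def] using u kin_rescale_ball[OF kin u(1), of "1/4" 0] by (auto simp: subset_ball)
    note [measurable] = v(1)
    have mv: "(\<lambda>x. - v x) \<in> borel_measurable borel" by measurable
    have s1: "measure lborel ({x. u x \<in> S} \<inter> ball 0 (1/4)) = (1/4) ^ CARD('d) * measure lborel ({x. v x \<in> S} \<inter> ball 0 1)"
      if [measurable]: "S \<in> sets borel" for S
    proof -
      have "{x. u x \<in> S} \<in> sets borel" by measurable
      from measure_rescale[OF this, of "1/4" 0] show ?thesis by (simp add: v_def)
    qed
    have s2: "measure lborel ({x. u x \<in> S} \<inter> ball 0 (1/8)) = 0"
      if [measurable]: "S \<in> sets borel" and n: "negligible ({x. v x \<in> S} \<inter> ball 0 (1/2))" for S
    proof -
      have 1: "{x. u x \<in> S} \<in> sets borel" "{x. v x \<in> S} \<in> sets borel" by measurable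
      then have "{x. v x \<in> S} \<inter> ball 0 (1/2) \<in> sets borel" by measurable
      from measure_negligible[OF n this]
      have "measure lborel ({x. u ((1/8) *\<^sub>R x) \<in> S} \<inter> ball 0 1) = 0"
        using measure_rescale[OF 1(2), of "1/2" 0] by (simp add: v_def)
      then show ?thesis using measure_rescale[OF 1(1), of "1/8" 0] by simp
    qed
    have "measure lborel ({x. k + h < u x} \<inter> ball 0 (1/8)) = 0" if "measure lborel ({x. k < u x} \<inter> ball 0 (1/4)) \<le> \<delta>"
    proof -
      have "measure lborel ({x. k < v x} \<inter> ball 0 1) \<le> \<delta>1" using that s1[of "{k<..}"] by (simp add: \<delta>_def)
      then have "negligible ({x. k + h < v x} \<inter> ball 0 (1/2))" using W1 k v by blast
      then show ?thesis using s2[of "{k + h<..}"] by simp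
    qed
    moreover have "measure lborel ({x. u x < k} \<inter> ball 0 (1/8)) = 0" if "measure lborel ({x. u x < k + h} \<inter> ball 0 (1/4)) \<le> \<delta>"
    proof -
      have e: "{x. - (k + h) < - v x} = {x. v x < k + h}" "{x. - (k + h) + h < - v x} = {x. v x < k}" by auto
      have "measure lborel ({x. v x < k + h} \<inter> ball 0 1) \<le> \<delta>2" using that s1[of "{..<k + h}"] by (simp add: \<delta>_def)
      then have "- hi \<le> - (k + h) \<and> - (k + h) + h \<le> - lo \<and> kin (\<lambda>v. a (- v)) (\<lambda>x. - v x) (ball 0 1) \<and> (\<lambda>x. - v x) \<in> borel_measurable borel
         \<and> (\<forall>x. - v x \<in> {- hi..- lo}) \<and> measure lborel ({x. - (k + h) < - v x} \<inter> ball 0 1) \<le> \<delta>2"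
        unfolding e using k v(2) mv kin_reflect[OF v(3)] by auto
      from W2[rule_format, OF this] have "negligible ({x. v x < k} \<inter> ball 0 (1/2))" unfolding e .
      then show ?thesis using s2[of "{..<k}"] by simp
    qed
    ultimately show ?thesis by blast
  qed
  moreover have "\<delta> > 0" using \<delta>1 \<delta>2 by (simp add: \<delta>_def)
  ultimately show ?thesis by blast
qed

text \<open>At each level of the grid the dichotomy feeds one of the two De Giorgi estimates, so up
  to null sets \<open>u\<close> is at least \<open>lv (i - 1)\<close> or at most
  \<open>lv (i + 2)\<close>. At the last index where the first option holds, the second must hold
  for the next index. This traps the values in four steps of the grid, whence the condition
  \<open>4 * h \<le> l\<close>.\<close>

lemma oscillation:
  fixes l :: real
  assumes lohi: "lo < hi" and l: "l > 0"
  shows "\<forall>\<^sub>F r in F. \<exists>c. measure lborel ({x. un r x < c} \<inter> ball 0 (1/8)) = 0 \<and> measure lborel ({x. c + l < un r x} \<inter> ball 0 (1/8)) = 0"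
proof -
  obtain N0 :: nat where N0: "4 * (hi - lo) / l < real N0" using reals_Archimedean2 by blast
  define n where "n = Suc N0"
  define h where "h = (hi - lo) / real n"
  have h: "h > 0" "lo + real n * h = hi" using lohi by (auto simp: h_def n_def)
  have hl: "4 * h \<le> l"
  proof -
    have "4 * (hi - lo) / l < real n" using N0 by (simp add: n_def)
    then have "4 * (hi - lo) < real n * l" using l by (simp only: pos_divide_less_eq)
    then show ?thesis by (simp add: h_def n_def field_simps)
  qed
  define lv where "lv i = lo + real i * h" for i :: nat
  have lvm: "lv i \<le> lv j" if "i \<le> j" for i j using that h by (auto simp: lv_def)
  have lv0: "lv 0 = lo" "lv n = hi" using h by (auto simp: lv_def)
  have lvS: "lv (Suc i) = lv i + h" for i by (simp add: lv_def algebra_simps)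
  obtain \<delta> where \<delta>: "\<delta> > 0" and W: "\<forall>k u. lo \<le> k \<and> k + h \<le> hi \<and> kin a u (ball 0 1) \<and> u \<in> borel_measurable borel \<and> (\<forall>x. u x \<in> {lo..hi}) \<longrightarrow>
     (measure lborel ({x. k < u x} \<inter> ball 0 (1/4)) \<le> \<delta> \<longrightarrow> measure lborel ({x. k + h < u x} \<inter> ball 0 (1/8)) = 0) \<and>
     (measure lborel ({x. u x < k + h} \<inter> ball 0 (1/4)) \<le> \<delta> \<longrightarrow> measure lborel ({x. u x < k} \<inter> ball 0 (1/8)) = 0)"
    using dg_rescaled[OF h(1)] by blast
  have "\<forall>\<^sub>F r in F. \<forall>i\<in>{..<n}. measure lborel ({x. un r x < lv i} \<inter> ball 0 1) \<le> \<delta> \<or> measure lborel ({x. lv (Suc i) < un r x} \<inter> cball 0 (1/4)) \<le> \<delta>"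
  proof (intro eventually_ball_finite ballI)
    fix i assume "i \<in> {..<n}"
    then show "\<forall>\<^sub>F r in F. measure lborel ({x. un r x < lv i} \<inter> ball 0 1) \<le> \<delta> \<or> measure lborel ({x. lv (Suc i) < un r x} \<inter> cball 0 (1/4)) \<le> \<delta>"
      using lvm[of 0 i] lvm[of "Suc i" n] lv0 lvS[of i] h(1) \<delta> by (intro dichotomy) auto
  qed simp
  from this un_kin[of 1] show ?thesis
  proof eventually_elim
    case (elim r)
    note [measurable] = un(1)[of r]
    \<comment> \<open>Subtraction is truncated: at \<open>i = 0\<close> the level is
      \<open>lo\<close>, so \<open>?A 0\<close> holds trivially and the maximum taken below
      exists.\<close>
    let ?A = "\<lambda>i. measure lborel ({x. un r x < lv (i - 1)} \<inter> ball 0 (1/8)) = 0"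
    let ?B = "\<lambda>i. measure lborel ({x. lv (i + 2) < un r x} \<inter> ball 0 (1/8)) = 0"
    have Wr: "(measure lborel ({x. lv i < un r x} \<inter> ball 0 (1/4)) \<le> \<delta> \<longrightarrow> measure lborel ({x. lv (Suc i) < un r x} \<inter> ball 0 (1/8)) = 0) \<and>
     (measure lborel ({x. un r x < lv (Suc i)} \<inter> ball 0 (1/4)) \<le> \<delta> \<longrightarrow> measure lborel ({x. un r x < lv i} \<inter> ball 0 (1/8)) = 0)"
      if "i < n" for i
    proof -
      have "lo \<le> lv i" "lv i + h \<le> hi" using lvm[of 0 i] lvm[of "Suc i" n] lv0 lvS[of i] that by auto
      then show ?thesis using W un elim(2) unfolding lvS by blast
    qed
    have A0: "?A 0" using un(2)[of r] lv0 by (simp add: not_less[symmetric])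
    have Bn: "?B i" if "n \<le> i + 2" for i
    proof -
      have "un r x \<le> lv (i + 2)" for x using un(2)[of r x] lvm[OF that] lv0 by simp
      then have "{x. lv (i + 2) < un r x} = {}" by (auto simp: not_less)
      then show ?thesis by simp
    qed
    have AB: "?A i \<or> ?B i" if i: "i < n" for i
    proof (cases "measure lborel ({x. un r x < lv i} \<inter> ball 0 1) \<le> \<delta>")
      case True
      show ?thesis
      proof (cases i)
        case 0
        then show ?thesis using A0 by simp
      next
        case (Suc j)
        have "measure lborel ({x. un r x < lv i} \<inter> ball 0 (1/4)) \<le> measure lborel ({x. un r x < lv i} \<inter> ball 0 1)"
          by (rule measure_mono_bounded) (auto intro: bounded_subset[OF bounded_ball[of 0 1]])
        then have "measure lborel ({x. un r x < lv (Suc j)} \<inter> ball 0 (1/4)) \<le> \<delta>" using True Suc by simp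
        then show ?thesis using Wr[of j] i Suc by simp
      qed
    next
      case False
      then have f: "measure lborel ({x. lv (Suc i) < un r x} \<inter> cball 0 (1/4)) \<le> \<delta>" using elim(1) i by auto
      show ?thesis
      proof (cases "Suc i < n")
        case True
        have "measure lborel ({x. lv (Suc i) < un r x} \<inter> ball 0 (1/4)) \<le> measure lborel ({x. lv (Suc i) < un r x} \<inter> cball 0 (1/4))"
          by (rule measure_mono_bounded) (auto intro: bounded_subset[OF bounded_cball[of 0 "1/4"]])
        then show ?thesis using Wr[OF True] f by simp
      next
        case False
        then show ?thesis using Bn by simp
      qed
    qed
    define i where "i = Max {i. i < n \<and> ?A i}"
    have n0: "0 < n" by (simp add: n_def)
    have fin: "finite {i. i < n \<and> ?A i}" by simp
    have "i \<in> {i. i < n \<and> ?A i}" unfolding i_def using A0 n0 by (intro Max_in[OF fin]) blast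
    then have i: "i < n" "?A i" by auto
    have "?B (i + 1)"
    proof (cases "i + 1 < n")
      case True
      have "\<not> ?A (i + 1)" using Max_ge[OF fin, of "i + 1"] True unfolding i_def[symmetric] by auto
      then show ?thesis using AB[OF True] by blast
    next
      case False
      then show ?thesis using Bn[of "i + 1"] by simp
    qed
    moreover have "measure lborel ({x. lv (i - 1) + l < un r x} \<inter> ball 0 (1/8)) \<le> measure lborel ({x. lv (i + 1 + 2) < un r x} \<inter> ball 0 (1/8))"
    proof (rule measure_mono_bounded)
      have "lv (i + 1 + 2) \<le> lv ((i - 1) + 4)" by (rule lvm) simp
      also have "\<dots> = lv (i - 1) + 4 * h" by (simp add: lv_def algebra_simps)
      finally show "{x. lv (i - 1) + l < un r x} \<inter> ball 0 (1/8) \<subseteq> {x. lv (i + 1 + 2) < un r x} \<inter> ball 0 (1/8)" using hl by auto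
    qed (auto intro: bounded_subset[OF bounded_ball[of 0 "1/8"]])
    ultimately have "measure lborel ({x. lv (i - 1) + l < un r x} \<inter> ball 0 (1/8)) = 0"
      by (simp add: measure_le_0_iff)
    then show ?case using i(2) by blast
  qed
qed

end

subsection \<open>From the kinetic measure to blow-ups\<close>

lemma slice_derivs:
  fixes \<phi> :: "'a::euclidean_space \<times> real \<Rightarrow> real"
  assumes "(\<phi> has_derivative (\<lambda>h. D \<bullet> h)) (at (x, s))"
  shows "((\<lambda>y. \<phi> (y, s)) has_derivative (\<lambda>h. fst D \<bullet> h)) (at x)" "((\<lambda>w. \<phi> (x, w)) has_real_derivative snd D) (at s)"
proof -
  have 1: "((\<lambda>y. (y, s)) has_derivative (\<lambda>h. (h, 0))) (at x)" by (intro has_derivative_Pair has_derivative_ident has_derivative_const)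
  have 2: "((\<lambda>w. (x, w)) has_derivative (\<lambda>h. (0, h))) (at s)" by (intro has_derivative_Pair has_derivative_ident has_derivative_const)
  show "((\<lambda>y. \<phi> (y, s)) has_derivative (\<lambda>h. fst D \<bullet> h)) (at x)"
    using has_derivative_compose[OF 1 assms] by (rule has_derivative_eq_rhs) (cases D, simp add: fun_eq_iff)
  show "((\<lambda>w. \<phi> (x, w)) has_real_derivative snd D) (at s)"
    unfolding has_field_derivative_def
    using has_derivative_compose[OF 2 assms] by (rule has_derivative_eq_rhs) (cases D, simp add: fun_eq_iff)
qed

text \<open>The kinetic function is the signed indicator of the interval between 0 and
  \<open>v x\<close>, with endpoints forming a finite set, so the fundamental theorem applies with
  either orientation.\<close>

lemma kinetic_function_integral:
  fixes g :: "real \<Rightarrow> real"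
  assumes g: "continuous_on UNIV g" and G: "\<And>s. (G has_vector_derivative g s) (at s)"
  shows "(\<integral>s. kinetic_function v x s * g s \<partial>lborel) = G (v x) - G 0"
proof -
  have F: "(\<integral>s. indicator {p..q} s *\<^sub>R g s \<partial>lborel) = G q - G p" if "p \<le> q" for p q
    by (rule integral_FTC_Icc[OF that has_vector_derivative_at_within[OF G] continuous_on_subset[OF g subset_UNIV]])
  show ?thesis
  proof (cases "0 \<le> v x")
    case True
    have "(\<integral>s. kinetic_function v x s * g s \<partial>lborel) = (\<integral>s. indicator {0..v x} s *\<^sub>R g s \<partial>lborel)"
      by (rule integral_discrete_difference[of "{0, v x}"]) (use True in \<open>auto simp: kinetic_function_def indicator_def\<close>)
    then show ?thesis using F[OF True] by simp
  next
    case False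
    have "(\<integral>s. kinetic_function v x s * g s \<partial>lborel) = (\<integral>s. - (indicator {v x..0} s *\<^sub>R g s) \<partial>lborel)"
      by (rule integral_discrete_difference[of "{0, v x}"]) (use False in \<open>auto simp: kinetic_function_def indicator_def\<close>)
    then show ?thesis using F[of "v x" 0] False by simp
  qed
qed

lemma borel_measurable_lebesgue_negligible:
  fixes f g :: "'a::euclidean_space \<Rightarrow> real"
  assumes [measurable]: "g \<in> borel_measurable borel" and N: "negligible N" "\<And>z. z \<notin> N \<Longrightarrow> f z = g z"
  shows "f \<in> borel_measurable lebesgue"
proof (rule measurableI)
  fix S :: "real set" assume [measurable]: "S \<in> sets borel"
  have "g -` S \<in> sets borel" using measurable_sets[OF assms(1), of S] by simp
  then have "g -` S - N \<in> sets lebesgue" using negligible_imp_sets[OF N(1)] by (intro sets.Diff) auto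
  moreover have "f -` S \<inter> N \<in> sets lebesgue" by (rule negligible_imp_sets) (rule negligible_subset[OF N(1)], auto)
  moreover have "f -` S = (g -` S - N) \<union> (f -` S \<inter> N)" using N(2) by auto
  ultimately show "f -` S \<inter> space lebesgue \<in> sets lebesgue" by (metis sets.Un Int_UNIV_right space_borel space_completion space_lborel)
qed simp

lemma fl_bounded:
  assumes "fl a g g' G"
  shows "\<exists>B>0. \<forall>s. \<bar>g s\<bar> \<le> B"
proof -
  obtain N where d: "\<And>s. (g has_real_derivative g' s) (at s)" and N: "\<And>s. N < \<bar>s\<bar> \<Longrightarrow> g' s = 0"
    using assms by (auto simp: fl_def)
  have d': "(g has_vector_derivative g' s) (at s)" for s using d[of s] by (simp add: has_real_derivative_iff_has_vector_derivative)
  define M where "M = \<bar>N\<bar> + 1"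
  have c: "continuous_on {-M..M} g" by (intro continuous_at_imp_continuous_on ballI DERIV_isCont[OF d])
  obtain B where "\<forall>y\<in>g ` {-M..M}. norm y \<le> B"
    using compact_imp_bounded[OF compact_continuous_image[OF c compact_Icc]] unfolding bounded_iff by blast
  then have B: "\<bar>g s\<bar> \<le> B" if "s \<in> {-M..M}" for s using that by simp
  have "\<bar>g s\<bar> \<le> B" for s
  proof -
    consider "s \<in> {-M..M}" | "M < s" | "s < - M" by fastforce
    then show ?thesis
    proof cases
      case 2
      have "norm (g s - g M) \<le> 0 * (s - M)" by (rule vector_mvt_bound[OF d']) (use 2 N in \<open>auto simp: M_def\<close>)
      then show ?thesis using B[of M] by (simp add: M_def)
    next
      case 3
      have "norm (g (- M) - g s) \<le> 0 * (- M - s)" by (rule vector_mvt_bound[OF d']) (use 3 N in \<open>auto simp: M_def\<close>)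
      then show ?thesis using B[of "- M"] by (simp add: M_def)
    qed (rule B)
  qed
  then show ?thesis by (intro exI[of _ "max B 1"]) (auto simp: le_max_iff_disj)
qed

text \<open>\<open>v\<close> is a Borel representative of \<open>u\<close> on
  \<open>\<Omega>\<close>, bounded everywhere. With it the kinetic function is Borel on the product,
  and Fubini can be used for \<open>lborel\<close> in place of the completed measure.\<close>

locale kinetic_rep =
  fixes \<Omega> :: "'a::euclidean_space set" and a :: "real \<Rightarrow> 'a" and u v :: "'a \<Rightarrow> real" and S :: real
    and \<mu> :: "('a \<times> real) measure"
  assumes open_\<Omega>: "open \<Omega>" and a_continuous: "continuous_on UNIV a"
    and v: "v \<in> borel_measurable borel" "\<And>x. \<bar>v x\<bar> \<le> S"
    and uv: "AE x in lborel. x \<in> \<Omega> \<longrightarrow> u x = v x"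
    and \<mu>: "kinetic_measure \<Omega> a u \<mu>"
begin

lemma sets_\<mu>: "sets \<mu> = sets (restrict_space borel (\<Omega> \<times> UNIV))"
  and \<mu>_finite: "compact K \<Longrightarrow> K \<subseteq> \<Omega> \<times> UNIV \<Longrightarrow> emeasure \<mu> K < \<infinity>"
  using \<mu> unfolding kinetic_measure_def by blast+

lemma open_cyl: "open (\<Omega> \<times> (UNIV :: real set))" using open_\<Omega> by (intro open_Times) auto

lemma sets_\<mu>_iff: "X \<in> sets \<mu> \<longleftrightarrow> X \<in> sets borel \<and> X \<subseteq> \<Omega> \<times> UNIV"
  unfolding sets_\<mu> using open_cyl by (subst sets_restrict_space_iff) auto

lemma borel_measurable_\<mu>: "f \<in> borel_measurable borel \<Longrightarrow> f \<in> borel_measurable \<mu>"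
  using measurable_cong_sets[OF sets_\<mu> refl] measurable_restrict_space1 by blast

lemma integrable_\<mu>:
  fixes f :: "'a \<times> real \<Rightarrow> real"
  assumes f: "f \<in> borel_measurable borel" "\<And>z. \<bar>f z\<bar> \<le> B" "\<And>z. z \<notin> X \<Longrightarrow> f z = 0"
    and X: "X \<in> sets borel" "X \<subseteq> \<Omega> \<times> UNIV" "emeasure \<mu> X < \<infinity>"
  shows "integrable \<mu> f" "\<bar>\<integral>z. f z \<partial>\<mu>\<bar> \<le> B * measure \<mu> X"
proof -
  have iX: "integrable \<mu> (\<lambda>z. B * indicator X z)" using X sets_\<mu>_iff by (intro integrable_mult_right integrable_real_indicator) auto
  have b: "\<bar>f z\<bar> \<le> B * indicator X z" for z using f(2,3) by (cases "z \<in> X") auto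
  show i: "integrable \<mu> f"
  proof (rule Bochner_Integration.integrable_bound[OF iX borel_measurable_\<mu>[OF f(1)]])
    show "AE z in \<mu>. norm (f z) \<le> norm (B * indicator X z)"
      by (intro AE_I2) (metis b abs_ge_self order_trans real_norm_def)
  qed
  have "\<bar>\<integral>z. f z \<partial>\<mu>\<bar> \<le> (\<integral>z. \<bar>f z\<bar> \<partial>\<mu>)" by (rule integral_abs_bound)
  also have "\<dots> \<le> (\<integral>z. B * indicator X z \<partial>\<mu>)" by (rule integral_mono[OF integrable_abs[OF i] iX]) (rule b)
  also have "\<dots> = B * measure \<mu> X" using X sets_\<mu>_iff by simp
  finally show "\<bar>\<integral>z. f z \<partial>\<mu>\<bar> \<le> B * measure \<mu> X" .
qed

definition kf :: "'a \<times> real \<Rightarrow> real" where "kf z = kinetic_function v (fst z) (snd z)"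

lemma kf_measurable [measurable]: "kf \<in> borel_measurable borel"
proof -
  note [measurable] = v(1)
  have "(\<lambda>z. if 0 < snd z \<and> snd z < v (fst z) then 1 else if v (fst z) < snd z \<and> snd z < 0 then - 1 else 0 :: real) \<in> borel_measurable (borel \<Otimes>\<^sub>M borel)"
    by measurable
  then show ?thesis by (simp add: kf_def[abs_def] kinetic_function_def[abs_def] borel_prod)
qed

lemma kf_bound: "\<bar>kf z\<bar> \<le> 1" by (simp add: kf_def kinetic_function_def)

lemma kf_integrable:
  fixes f' :: "'a \<times> real \<Rightarrow> 'a \<times> real"
  assumes "continuous_on UNIV f'" "compact K" "\<And>z. z \<notin> K \<Longrightarrow> f' z = 0"
  shows "integrable lborel (\<lambda>z. kf z * (a (snd z) \<bullet> fst (f' z)))"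
proof -
  have "continuous_on UNIV (\<lambda>z. a (snd z))" by (rule continuous_on_compose2[OF a_continuous]) (auto intro!: continuous_intros)
  then have "continuous_on UNIV (\<lambda>z. a (snd z) \<bullet> fst (f' z))" by (intro continuous_intros assms(1))
  from integrable_bounded_times_compact_support[OF this assms(2) _ kf_measurable kf_bound] assms(3) show ?thesis by simp
qed

text \<open>The two integrands agree outside \<open>N \<times> UNIV\<close>, where \<open>N\<close>
  is the null set on which \<open>u\<close> and \<open>v\<close> differ. That cylinder is null in
  the product, so the integrals over the completed and the Borel measure coincide.\<close>

lemma kinetic_test:
  assumes \<phi>: "\<phi> \<in> test_functions (\<Omega> \<times> UNIV)" "c1c K \<phi> (grad \<phi>)" and K: "K \<subseteq> \<Omega> \<times> UNIV"
  shows "(\<integral>z. kf z * (a (snd z) \<bullet> fst (grad \<phi> z)) \<partial>lborel) = (\<integral>z. snd (grad \<phi> z) \<partial>\<mu>)"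
proof -
  obtain L where L: "compact L" "L \<subseteq> K" "\<And>z. z \<notin> L \<Longrightarrow> grad \<phi> z = 0" using c1c_support[OF \<phi>(2)] by metis
  have g1: "grad (\<lambda>y. \<phi> (y, s)) x = fst (grad \<phi> (x, s))" for x s
    by (rule grad_eqI[OF slice_derivs(1)[OF c1c_deriv[OF \<phi>(2)]]])
  have g2: "deriv (\<lambda>w. \<phi> (x, w)) s = snd (grad \<phi> (x, s))" for x s
    by (rule DERIV_imp_deriv[OF slice_derivs(2)[OF c1c_deriv[OF \<phi>(2)]]])
  let ?f = "\<lambda>z. kf z * (a (snd z) \<bullet> fst (grad \<phi> z))"
  have fi: "integrable lborel ?f" by (rule kf_integrable[OF c1c_cont'[OF \<phi>(2)] L(1,3)])
  then have fm: "?f \<in> borel_measurable borel" by auto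
  obtain N where N: "\<And>x. x \<notin> N \<Longrightarrow> x \<in> \<Omega> \<Longrightarrow> u x = v x" "N \<in> null_sets lborel" using AE_E3[OF uv] by auto
  let ?F = "\<lambda>z. indicator (\<Omega> \<times> UNIV) z *\<^sub>R (case z of (x, s) \<Rightarrow> kinetic_function u x s * (a s \<bullet> grad (\<lambda>y. \<phi> (y, s)) x))"
  have eq: "?F z = ?f z" if "z \<notin> N \<times> UNIV" for z
  proof (cases "z \<in> \<Omega> \<times> UNIV")
    case True
    then have "u (fst z) = v (fst z)" using N(1) that by (auto simp: mem_Times_iff)
    then show ?thesis using True by (simp add: kf_def kinetic_function_def g1 case_prod_beta)
  next
    case False
    then have "grad \<phi> z = 0" using L K by blast
    then show ?thesis using False by simp
  qed
  have null: "N \<times> UNIV \<in> null_sets (lborel :: ('a \<times> real) measure)"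
  proof -
    have "emeasure (lborel \<Otimes>\<^sub>M lborel) (N \<times> (UNIV :: real set)) = emeasure lborel N * emeasure lborel (UNIV :: real set)"
      using N(2) by (intro lborel.emeasure_pair_measure_Times) auto
    also have "\<dots> = 0" using N(2) by auto
    finally have "emeasure lborel (N \<times> (UNIV :: real set)) = 0" by (simp add: lborel_prod)
    moreover have "N \<times> (UNIV :: real set) \<in> sets (borel \<Otimes>\<^sub>M borel)" using N(2) by (intro pair_measureI) auto
    then have "N \<times> (UNIV :: real set) \<in> sets borel" unfolding borel_prod .
    ultimately show ?thesis by (simp add: null_sets_def)
  qed
  have neg: "negligible (N \<times> (UNIV :: real set))"
    using null null_sets_completionI[OF null] by (simp add: negligible_iff_null_sets)
  have fml: "?f \<in> borel_measurable lebesgue" using fm by (simp add: measurable_completion)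
  have "(LINT (x, s)|lebesgue_on (\<Omega> \<times> UNIV). kinetic_function u x s * (a s \<bullet> grad (\<lambda>y. \<phi> (y, s)) x)) = (\<integral>z. ?F z \<partial>lebesgue)"
    using open_cyl by (intro integral_restrict_space) (auto intro: sets_completionI_sets)
  also have "\<dots> = (\<integral>z. ?f z \<partial>lebesgue)"
  proof (rule integral_cong_AE[OF borel_measurable_lebesgue_negligible[OF fm neg eq] fml])
    show "AE z in lebesgue. ?F z = ?f z"
      by (rule AE_I'[OF null_sets_completionI[OF null]]) (use eq in blast)
  qed
  also have "\<dots> = (\<integral>z. ?f z \<partial>lborel)" using fm by (intro integral_completion) auto
  finally have "(\<integral>z. ?f z \<partial>lborel) = (LINT (x, s)|lebesgue_on (\<Omega> \<times> UNIV). kinetic_function u x s * (a s \<bullet> grad (\<lambda>y. \<phi> (y, s)) x))" ..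
  also have "\<dots> = (LINT (x, s)|\<mu>. deriv (\<lambda>w. \<phi> (x, w)) s)"
    using \<mu> \<phi>(1) unfolding kinetic_measure_def by blast
  also have "\<dots> = (\<integral>z. snd (grad \<phi> z) \<partial>\<mu>)"
    by (simp add: g2 case_prod_beta')
  finally show ?thesis .
qed

text \<open>Approximation by test functions supported in one compact set, on which both Lebesgue
  measure and \<open>\<mu>\<close> are finite. Each side then moves by at most a multiple of the
  accuracy.\<close>

lemma kinetic_c1c:
  assumes f: "c1c (\<Omega> \<times> UNIV) f f'"
  shows "(\<integral>z. kf z * (a (snd z) \<bullet> fst (f' z)) \<partial>lborel) = (\<integral>z. snd (f' z) \<partial>\<mu>)" (is "?L = ?R")
proof -
  obtain K where K: "compact K" "K \<subseteq> \<Omega> \<times> UNIV" and app: "\<And>e. e > 0 \<Longrightarrow> \<exists>\<phi>\<in>test_functions (\<Omega> \<times> UNIV). c1c K \<phi> (grad \<phi>) \<and> (\<forall>x. \<bar>\<phi> x - f x\<bar> \<le> e \<and> norm (grad \<phi> x - f' x) \<le> e)"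
    using c1c_smooth_approx[OF open_cyl f] by metis
  have zK: "\<psi>' z = 0" if "c1c K \<psi> \<psi>'" "z \<notin> K" for \<psi> \<psi>' z
    using c1c_support[OF that(1)] that(2) by (metis subsetD)
  have f'0: "f' z = 0" if "z \<notin> K" for z
  proof -
    have "norm (f' z) \<le> 0 + e" if e: "e > 0" for e
    proof -
      obtain \<phi> where "c1c K \<phi> (grad \<phi>)" "norm (grad \<phi> z - f' z) \<le> e" using app[OF e] by blast
      then show ?thesis using zK[of \<phi> "grad \<phi>" z] \<open>z \<notin> K\<close> by simp
    qed
    then have "norm (f' z) \<le> 0" by (rule field_le_epsilon)
    then show ?thesis by simp
  qed
  have "continuous_on K (\<lambda>z. a (snd z))" by (rule continuous_on_compose2[OF a_continuous]) (auto intro!: continuous_intros)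
  from compact_imp_bounded[OF compact_continuous_image[OF this K(1)]]
  obtain A where A: "\<And>z. z \<in> K \<Longrightarrow> norm (a (snd z)) \<le> A" "A > 0" by (auto simp: bounded_pos)
  define C where "C = A * measure lborel K + measure \<mu> K"
  have C: "C \<ge> 0" using A(2) by (simp add: C_def)
  have Kb: "K \<in> sets borel" using K(1) by (simp add: borel_compact)
  have iK: "integrable lborel (indicator K :: _ \<Rightarrow> real)" by (rule integrable_indicator_bounded[OF compact_imp_bounded[OF K(1)] Kb])
  have fn: "norm (fst z) \<le> norm z" for z :: "'a \<times> real" using norm_fst_le[of "fst z" "snd z"] by simp
  have est: "\<bar>?L - ?R\<bar> \<le> e * C" if e: "e > 0" for e
  proof -
    obtain \<phi> where \<phi>: "\<phi> \<in> test_functions (\<Omega> \<times> UNIV)" "c1c K \<phi> (grad \<phi>)" "\<And>z. norm (grad \<phi> z - f' z) \<le> e"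
      using app[OF e] by blast
    have i1: "integrable lborel (\<lambda>z. kf z * (a (snd z) \<bullet> fst (grad \<phi> z)))"
      by (rule kf_integrable[OF c1c_cont'[OF \<phi>(2)] K(1)]) (rule zK[OF \<phi>(2)])
    have i2: "integrable lborel (\<lambda>z. kf z * (a (snd z) \<bullet> fst (f' z)))"
      by (rule kf_integrable[OF c1c_cont'[OF f] K(1)]) (rule f'0)
    have "\<bar>(\<integral>z. kf z * (a (snd z) \<bullet> fst (grad \<phi> z)) \<partial>lborel) - ?L\<bar> = norm (\<integral>z. kf z * (a (snd z) \<bullet> fst (grad \<phi> z)) - kf z * (a (snd z) \<bullet> fst (f' z)) \<partial>lborel)"
      using i1 i2 by simp
    also have "\<dots> \<le> (\<integral>z. e * A * indicator K z \<partial>lborel)"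
    proof (rule Bochner_Integration.integral_norm_bound_integral[OF Bochner_Integration.integrable_diff[OF i1 i2] integrable_mult_right[OF iK]])
      fix z
      have "\<bar>kf z * (a (snd z) \<bullet> fst (grad \<phi> z - f' z))\<bar> \<le> e * A * indicator K z"
      proof (cases "z \<in> K")
        case True
        have "\<bar>a (snd z) \<bullet> fst (grad \<phi> z - f' z)\<bar> \<le> norm (a (snd z)) * norm (fst (grad \<phi> z - f' z))" by (rule Cauchy_Schwarz_ineq2)
        also have "\<dots> \<le> A * e" using A True order_trans[OF fn \<phi>(3)[of z]] by (intro mult_mono) auto
        finally have "\<bar>kf z\<bar> * \<bar>a (snd z) \<bullet> fst (grad \<phi> z - f' z)\<bar> \<le> 1 * (A * e)" using kf_bound by (intro mult_mono) auto
        then show ?thesis using True by (simp add: abs_mult mult.commute)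
      next
        case False
        then show ?thesis using zK[OF \<phi>(2)] f'0 by simp
      qed
      then show "norm (kf z * (a (snd z) \<bullet> fst (grad \<phi> z)) - kf z * (a (snd z) \<bullet> fst (f' z))) \<le> e * A * indicator K z"
        by (simp add: inner_diff_right right_diff_distrib fst_diff)
    qed
    also have "\<dots> = e * A * measure lborel K" using Kb by simp
    finally have 1: "\<bar>(\<integral>z. kf z * (a (snd z) \<bullet> fst (grad \<phi> z)) \<partial>lborel) - ?L\<bar> \<le> e * A * measure lborel K" .
    have m: "(\<lambda>z. snd (\<psi> z)) \<in> borel_measurable borel" if "continuous_on UNIV \<psi>" for \<psi> :: "'a \<times> real \<Rightarrow> 'a \<times> real"
      by (rule borel_measurable_continuous_onI) (intro continuous_intros that)
    obtain B1 B2 where B: "\<And>z. norm (grad \<phi> z) \<le> B1" "\<And>z. norm (f' z) \<le> B2" using c1c_bounds[OF \<phi>(2)] c1c_bounds[OF f] by metis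
    have sn: "\<bar>snd z\<bar> \<le> norm z" for z :: "'a \<times> real" using norm_snd_le[of "snd z" "fst z"] by simp
    have j1: "integrable \<mu> (\<lambda>z. snd (grad \<phi> z))"
      by (rule integrable_\<mu>(1)[OF m[OF c1c_cont'[OF \<phi>(2)]] order_trans[OF sn B(1)] _ Kb K(2) \<mu>_finite[OF K]]) (simp add: zK[OF \<phi>(2)])
    have j2: "integrable \<mu> (\<lambda>z. snd (f' z))"
      by (rule integrable_\<mu>(1)[OF m[OF c1c_cont'[OF f]] order_trans[OF sn B(2)] _ Kb K(2) \<mu>_finite[OF K]]) (simp add: f'0)
    have "\<bar>\<integral>z. snd (grad \<phi> z - f' z) \<partial>\<mu>\<bar> \<le> e * measure \<mu> K"
      by (rule integrable_\<mu>(2)[OF m order_trans[OF sn \<phi>(3)] _ Kb K(2) \<mu>_finite[OF K]])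
        (auto intro!: continuous_intros c1c_cont'[OF \<phi>(2)] c1c_cont'[OF f] simp: zK[OF \<phi>(2)] f'0)
    then have 2: "\<bar>(\<integral>z. snd (grad \<phi> z) \<partial>\<mu>) - ?R\<bar> \<le> e * measure \<mu> K" using j1 j2 by simp
    show ?thesis using 1 2 kinetic_test[OF \<phi>(1,2) K(2)] by (simp add: C_def distrib_left mult.assoc)
  qed
  show ?thesis
  proof (rule ccontr)
    assume "?L \<noteq> ?R"
    then have D: "\<bar>?L - ?R\<bar> > 0" by simp
    then have "\<bar>?L - ?R\<bar> \<le> \<bar>?L - ?R\<bar> / (C + 1) * C" using C by (intro est) simp
    also have "\<dots> < \<bar>?L - ?R\<bar>" using D C by (simp add: divide_less_eq)
    finally show False by simp
  qed
qed

text \<open>For a product test function the integral over \<open>v\<close> is explicit and turns the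
  kinetic function into the entropy flux. The constant \<open>G 0\<close> that appears is harmless,
  as the gradient of \<open>\<eta>\<close> has integral 0.\<close>

lemma kinetic_separated:
  assumes \<eta>: "c1c \<Omega> \<eta> \<eta>'" and \<gamma>: "c1c UNIV \<gamma> (\<gamma>' :: real \<Rightarrow> real)" and G: "\<And>s. (G has_vector_derivative \<gamma> s *\<^sub>R a s) (at s)"
  shows "(\<integral>x. G (v x) \<bullet> \<eta>' x \<partial>lborel) = (\<integral>z. \<eta> (fst z) * \<gamma>' (snd z) \<partial>\<mu>)"
proof -
  note [measurable] = v(1)
  obtain K1 where K1: "compact K1" "K1 \<subseteq> \<Omega>" "\<And>x. x \<notin> K1 \<Longrightarrow> \<eta> x = 0" "\<And>x. x \<notin> K1 \<Longrightarrow> \<eta>' x = 0" using c1c_support[OF \<eta>] by metis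
  obtain K2 where K2: "compact K2" "\<And>x. x \<notin> K2 \<Longrightarrow> \<gamma> x = 0" using c1c_support[OF \<gamma>] by metis
  define f where "f z = \<eta> (fst z) * \<gamma> (snd z)" for z :: "'a \<times> real"
  define f' where "f' z = (\<gamma> (snd z) *\<^sub>R \<eta>' (fst z), \<eta> (fst z) * \<gamma>' (snd z))" for z :: "'a \<times> real"
  have cf: "continuous_on UNIV (\<lambda>z. p (fst z :: 'a))" if "continuous_on UNIV p" for p :: "'a \<Rightarrow> 'c::topological_space"
    by (rule continuous_on_compose2[OF that]) (auto intro!: continuous_intros)
  have cs: "continuous_on UNIV (\<lambda>z. p (snd z :: real))" if "continuous_on UNIV p" for p :: "real \<Rightarrow> 'c::topological_space"
    by (rule continuous_on_compose2[OF that]) (auto intro!: continuous_intros)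
  have f: "c1c (\<Omega> \<times> UNIV) f f'"
    unfolding c1c_def
  proof (intro conjI allI exI[of _ "K1 \<times> K2"] impI)
    show "(f has_derivative (\<bullet>) (f' z)) (at z)" for z
    proof -
      have 1: "((\<lambda>z. \<eta> (fst z)) has_derivative (\<lambda>h. \<eta>' (fst z) \<bullet> fst h)) (at z)"
        by (rule has_derivative_compose[OF has_derivative_fst[OF has_derivative_ident] c1c_deriv[OF \<eta>]])
      have 2: "((\<lambda>z. \<gamma> (snd z)) has_derivative (\<lambda>h. \<gamma>' (snd z) \<bullet> snd h)) (at z)"
        by (rule has_derivative_compose[OF has_derivative_snd[OF has_derivative_ident] c1c_deriv[OF \<gamma>]])
      show ?thesis unfolding f_def[abs_def]
        using has_derivative_mult[OF 1 2] by (rule has_derivative_eq_rhs) (simp add: fun_eq_iff f'_def inner_prod_def)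
    qed
    show "continuous_on UNIV f'" unfolding f'_def[abs_def]
      by (intro continuous_on_Pair continuous_on_scaleR continuous_on_mult cf cs c1c_cont[OF \<eta>] c1c_cont'[OF \<eta>] c1c_cont[OF \<gamma>] c1c_cont'[OF \<gamma>])
    show "f z = 0" if "z \<notin> K1 \<times> K2" for z using that K1(3) K2(2) by (auto simp: f_def mem_Times_iff)
  qed (use K1 K2 in \<open>auto intro: compact_Times\<close>)
  obtain L where L: "compact L" "\<And>z. z \<notin> L \<Longrightarrow> f' z = 0" using c1c_support[OF f] by metis
  have i: "integrable (lborel \<Otimes>\<^sub>M lborel) (\<lambda>z. kf z * (a (snd z) \<bullet> fst (f' z)))"
    unfolding lborel_prod by (rule kf_integrable[OF c1c_cont'[OF f] L])
  have Gc: "continuous_on UNIV G" by (intro continuous_at_imp_continuous_on ballI has_vector_derivative_continuous[OF G])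
  have [measurable]: "G \<in> borel_measurable borel" by (rule borel_measurable_continuous_onI[OF Gc])
  have [measurable]: "\<eta>' \<in> borel_measurable borel" by (rule borel_measurable_continuous_onI[OF c1c_cont'[OF \<eta>]])
  obtain B1 where B1: "\<And>y. y \<in> {-S..S} \<Longrightarrow> norm (G y) \<le> B1"
    using compact_imp_bounded[OF compact_continuous_image[OF continuous_on_subset[OF Gc subset_UNIV] compact_Icc[of "- S" S]]] unfolding bounded_iff by blast
  obtain B2 where B2: "\<And>x. norm (\<eta>' x) \<le> B2" using c1c_bounds[OF \<eta>] by metis
  have Gi: "integrable lborel (\<lambda>x. G (v x) \<bullet> \<eta>' x)"
  proof (rule integrable_bounded_support[OF _ _ compact_imp_bounded[OF K1(1)]])
    show "norm (G (v x) \<bullet> \<eta>' x) \<le> B1 * B2" for x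
    proof -
      have "v x \<in> {-S..S}" using v(2)[of x] by auto
      have "norm (G (v x) \<bullet> \<eta>' x) \<le> norm (G (v x)) * norm (\<eta>' x)" by (simp add: Cauchy_Schwarz_ineq2)
      also have "\<dots> \<le> B1 * B2" using B1[OF \<open>v x \<in> {-S..S}\<close>] B2 by (intro mult_mono') auto
      finally show ?thesis .
    qed
  qed (use K1 in auto)
  have \<eta>'i: "integrable lborel \<eta>'" by (rule integrable_compact_support[OF c1c_cont'[OF \<eta>] K1(1,4)])
  have "(\<integral>z. \<eta> (fst z) * \<gamma>' (snd z) \<partial>\<mu>) = (\<integral>z. kf z * (a (snd z) \<bullet> fst (f' z)) \<partial>lborel)"
    unfolding kinetic_c1c[OF f] by (simp add: f'_def)
  also have "\<dots> = (\<integral>z. kf z * (a (snd z) \<bullet> fst (f' z)) \<partial>(lborel \<Otimes>\<^sub>M lborel))" by (simp only: lborel_prod)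
  also have "\<dots> = (\<integral>x. (\<integral>s. kf (x, s) * (a (snd (x, s)) \<bullet> fst (f' (x, s))) \<partial>lborel) \<partial>lborel)"
    by (rule lborel_pair.integral_fst'[OF i, symmetric])
  also have "\<dots> = (\<integral>x. G (v x) \<bullet> \<eta>' x - \<eta>' x \<bullet> G 0 \<partial>lborel)"
  proof (rule Bochner_Integration.integral_cong[OF refl])
    fix x
    have c: "continuous_on UNIV (\<lambda>s. (\<gamma> s *\<^sub>R a s) \<bullet> \<eta>' x)" by (intro continuous_intros c1c_cont[OF \<gamma>] a_continuous)
    have "((\<lambda>s. G s \<bullet> \<eta>' x) has_vector_derivative (\<gamma> s *\<^sub>R a s) \<bullet> \<eta>' x) (at s)" for s
      using bounded_linear.has_vector_derivative[OF bounded_linear_inner_left G] .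
    then have "(\<integral>s. kinetic_function v x s * ((\<gamma> s *\<^sub>R a s) \<bullet> \<eta>' x) \<partial>lborel) = G (v x) \<bullet> \<eta>' x - G 0 \<bullet> \<eta>' x"
      by (rule kinetic_function_integral[OF c])
    then show "(\<integral>s. kf (x, s) * (a (snd (x, s)) \<bullet> fst (f' (x, s))) \<partial>lborel) = G (v x) \<bullet> \<eta>' x - \<eta>' x \<bullet> G 0"
      by (simp add: kf_def f'_def inner_commute)
  qed
  also have "\<dots> = (\<integral>x. G (v x) \<bullet> \<eta>' x \<partial>lborel) - (\<integral>x. \<eta>' x \<bullet> G 0 \<partial>lborel)"
    by (rule Bochner_Integration.integral_diff[OF Gi integrable_inner_left]) (use \<eta>'i in auto)
  also have "(\<integral>x. \<eta>' x \<bullet> G 0 \<partial>lborel) = 0" by (rule integral_c1c_deriv_eq_0[OF \<eta>])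
  finally show ?thesis by simp
qed

text \<open>Here the entropy derivative \<open>g\<close> need not vanish at infinity, only
  \<open>g'\<close> does. Cutting \<open>g\<close> off at height \<open>n\<close> adds a term of
  size 1/n. It is integrated over a whole cylinder, which is why finiteness of \<open>\<mu>\<close>
  on the cylinder over the ball is assumed.\<close>

lemma kinetic_flux:
  assumes B: "ball x0 r0 \<subseteq> \<Omega>" "emeasure \<mu> (ball x0 r0 \<times> UNIV) < \<infinity>"
    and \<eta>: "c1c (ball x0 r0) \<eta> \<eta>'" and g: "fl a g g' G"
  shows "(\<integral>x. G (v x) \<bullet> \<eta>' x \<partial>lborel) = (\<integral>z. \<eta> (fst z) * g' (snd z) \<partial>\<mu>)" (is "?L = ?R")
proof -
  obtain \<omega> :: "real \<Rightarrow> real" and \<omega>' where w: "c1c (ball 0 1) \<omega> \<omega>'" "\<And>s. s \<in> cball 0 (3/4) \<Longrightarrow> \<omega> s = 1"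
    using cutoff_exists[where 'a = real] by blast
  obtain N where gd: "\<And>s. (g has_real_derivative g' s) (at s)" and g'c: "continuous_on UNIV g'" and N: "\<And>s. N < \<bar>s\<bar> \<Longrightarrow> g' s = 0"
    and Gd: "\<And>s. (G has_vector_derivative g s *\<^sub>R a s) (at s)" using g by (auto simp: fl_def)
  have gc: "continuous_on UNIV g" using gd DERIV_isCont continuous_at_imp_continuous_on by blast
  obtain Bg where Bg: "Bg > 0" "\<And>s. \<bar>g s\<bar> \<le> Bg" using fl_bounded[OF g] by blast
  obtain Bw where Bw: "Bw > 0" "\<And>s. \<bar>\<omega>' s\<bar> \<le> Bw" using c1c_bounds[OF w(1)] by (metis real_norm_def)
  obtain Bx where Bx: "Bx > 0" "\<And>x. \<bar>\<eta> x\<bar> \<le> Bx" using c1c_bounds[OF \<eta>] by metis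
  obtain Bh where Bh: "Bh > 0" "\<And>s. \<bar>g' s\<bar> \<le> Bh"
  proof -
    have "\<And>s. s \<notin> {-\<bar>N\<bar>..\<bar>N\<bar>} \<Longrightarrow> g' s = 0" using N by fastforce
    from compact_support_bounded[OF g'c compact_Icc this] show ?thesis using that by auto
  qed
  have \<eta>0: "\<eta> x = 0" if "x \<notin> ball x0 r0" for x using c1c_support[OF \<eta>] that by (metis subsetD)
  let ?X = "ball x0 r0 \<times> (UNIV :: real set)"
  have X: "?X \<in> sets borel" "?X \<subseteq> \<Omega> \<times> UNIV" using B by (auto intro: borel_open open_Times)
  have cf: "continuous_on UNIV (\<lambda>z. \<eta> (fst z :: 'a))"
    by (rule continuous_on_compose2[OF c1c_cont[OF \<eta>]]) (auto intro!: continuous_intros)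
  have m: "(\<lambda>z. \<eta> (fst z) * p (snd z)) \<in> borel_measurable borel" if "continuous_on UNIV p" for p :: "real \<Rightarrow> real"
  proof -
    have "continuous_on UNIV (\<lambda>z. p (snd z :: real))"
      by (rule continuous_on_compose2[OF that]) (auto intro!: continuous_intros)
    then show ?thesis by (intro borel_measurable_continuous_onI continuous_on_mult cf)
  qed
  have ib: "integrable \<mu> (\<lambda>z. \<eta> (fst z) * p (snd z))" "\<bar>\<integral>z. \<eta> (fst z) * p (snd z) \<partial>\<mu>\<bar> \<le> Bx * P * measure \<mu> ?X"
    if "continuous_on UNIV p" "\<And>s. \<bar>p s\<bar> \<le> P" for p P
  proof -
    have b: "\<bar>\<eta> (fst z) * p (snd z)\<bar> \<le> Bx * P" for z unfolding abs_mult using Bx that(2) by (intro mult_mono) auto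
    have z: "\<eta> (fst z) * p (snd z) = 0" if "z \<notin> ?X" for z using that \<eta>0 by (auto simp: mem_Times_iff)
    show "integrable \<mu> (\<lambda>z. \<eta> (fst z) * p (snd z))" "\<bar>\<integral>z. \<eta> (fst z) * p (snd z) \<partial>\<mu>\<bar> \<le> Bx * P * measure \<mu> ?X"
      by (rule integrable_\<mu>[OF m[OF that(1)] b z X B(2)]; assumption)+
  qed
  have est: "\<bar>?L - ?R\<bar> \<le> Bx * (Bg * Bw) * measure \<mu> ?X / n" if n: "n > 0" "2 * (\<bar>N\<bar> + \<bar>S\<bar>) \<le> n" for n :: real
  proof -
    have one: "\<omega> (s / n) = 1" if "\<bar>s\<bar> \<le> \<bar>N\<bar> + \<bar>S\<bar>" for s
    proof (rule w(2))
      have "t \<le> 3/4 * n" if "2 * t \<le> n" for t using that n(1) by simp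
      then have "\<bar>s\<bar> \<le> 3/4 * n" using that n(2) by simp
      then show "s / n \<in> cball 0 (3/4)" using n by (simp add: abs_divide divide_le_eq)
    qed
    define \<gamma> where "\<gamma> s = g s * \<omega> (s / n)" for s
    define \<gamma>' where "\<gamma>' s = g' s + g s * \<omega>' (s / n) / n" for s
    have wc: "continuous_on UNIV (\<lambda>s. \<omega> (s / n))" "continuous_on UNIV (\<lambda>s. \<omega>' (s / n))"
      by (rule continuous_on_compose2[OF c1c_cont[OF w(1)]] continuous_on_compose2[OF c1c_cont'[OF w(1)]]; use n in \<open>auto intro!: continuous_intros\<close>)+
    have wd: "((\<lambda>s. \<omega> (s / n)) has_real_derivative \<omega>' (s / n) * (1 / n)) (at s)" for s
    proof -
      have "(\<omega> has_real_derivative \<omega>' (s / n)) (at (s / n))"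
        using c1c_deriv[OF w(1), of "s / n"] by (simp add: has_field_derivative_def)
      moreover have "((\<lambda>s. s / n) has_real_derivative 1 / n) (at s)" by (rule DERIV_cdivide[OF DERIV_ident])
      ultimately show ?thesis by (rule DERIV_chain2)
    qed
    have \<gamma>d: "(\<gamma> has_real_derivative \<gamma>' s) (at s)" for s
    proof -
      \<comment> \<open>The cutoff is already 1 on the support of \<open>g'\<close>, so the product
        rule leaves \<open>g'\<close> intact.\<close>
      have "g' s * \<omega> (s / n) = g' s" using one[of s] N[of s] by (cases "N < \<bar>s\<bar>") auto
      then show ?thesis unfolding \<gamma>_def[abs_def]
        using DERIV_mult[OF gd wd, of s] by (rule_tac DERIV_cong) (auto simp: \<gamma>'_def mult_ac)
    qed
    have \<gamma>c: "c1c UNIV \<gamma> \<gamma>'"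
      unfolding c1c_def
    proof (intro conjI allI exI[of _ "{-n..n}"] impI)
      show "(\<gamma> has_derivative (\<bullet>) (\<gamma>' s)) (at s)" for s
        using \<gamma>d[of s] by (simp add: has_field_derivative_def)
      show "continuous_on UNIV \<gamma>'" unfolding \<gamma>'_def[abs_def] using n by (intro continuous_intros g'c gc wc) auto
      show "\<gamma> s = 0" if "s \<notin> {-n..n}" for s
      proof -
        have "s / n \<notin> ball 0 1" using that n by (auto simp: abs_divide divide_less_eq)
        then have "\<omega> (s / n) = 0" using c1c_support[OF w(1)] by (metis subsetD)
        then show ?thesis by (simp add: \<gamma>_def)
      qed
    qed auto
    have "continuous_on UNIV (\<lambda>s. \<gamma> s *\<^sub>R a s)" by (intro continuous_intros c1c_cont[OF \<gamma>c] a_continuous)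
    from antiderivative_exists[OF this, of 0] obtain G0 where G0: "G0 0 = 0" "\<And>s. (G0 has_vector_derivative \<gamma> s *\<^sub>R a s) (at s)" by blast
    \<comment> \<open>The additive constant is fixed by agreement with \<open>G\<close> at 0; on the
      range of \<open>v\<close> the two primitives then coincide, because the cutoff is 1
      there.\<close>
    define Gn where "Gn s = G0 s + G 0" for s
    have Gn: "(Gn has_vector_derivative \<gamma> s *\<^sub>R a s) (at s)" for s
      unfolding Gn_def[abs_def] using has_vector_derivative_add[OF G0(2)[of s] has_vector_derivative_const[of "G 0"]] by simp
    have Gn_eq: "Gn y = G y" if y: "\<bar>y\<bar> \<le> S" for y
    proof -
      have d: "((\<lambda>s. Gn s - G s) has_vector_derivative (\<gamma> s *\<^sub>R a s - g s *\<^sub>R a s)) (at s)" for s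
        by (rule has_vector_derivative_diff[OF Gn Gd])
      have z: "norm (\<gamma> t *\<^sub>R a t - g t *\<^sub>R a t) \<le> 0" if "\<bar>t\<bar> \<le> S" for t using one[of t] that by (simp add: \<gamma>_def)
      have "Gn y - G y = Gn 0 - G 0"
      proof (cases "0 \<le> y")
        case True
        have "norm ((Gn y - G y) - (Gn 0 - G 0)) \<le> 0 * (y - 0)" by (rule vector_mvt_bound[OF d z]) (use True y in auto)
        then show ?thesis by simp
      next
        case False
        have "norm ((Gn 0 - G 0) - (Gn y - G y)) \<le> 0 * (0 - y)" by (rule vector_mvt_bound[OF d z]) (use False y in auto)
        then show ?thesis by simp
      qed
      then show ?thesis using G0(1) by (simp add: Gn_def)
    qed
    have pc: "continuous_on UNIV (\<lambda>s. g s * \<omega>' (s / n) / n)" using n by (intro continuous_intros gc wc) auto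
    have pb: "\<bar>g s * \<omega>' (s / n) / n\<bar> \<le> Bg * Bw / n" for s
      unfolding abs_divide abs_mult using n Bg Bw(2)[of "s / n"] Bg(2)[of s] by (intro frac_le mult_mono) auto
    have "?L = (\<integral>x. Gn (v x) \<bullet> \<eta>' x \<partial>lborel)" using Gn_eq v(2) by simp
    also have "\<dots> = (\<integral>z. \<eta> (fst z) * \<gamma>' (snd z) \<partial>\<mu>)" by (rule kinetic_separated[OF c1c_mono[OF \<eta> B(1)] \<gamma>c Gn])
    also have "\<dots> = (\<integral>z. \<eta> (fst z) * g' (snd z) + \<eta> (fst z) * (g (snd z) * \<omega>' (snd z / n) / n) \<partial>\<mu>)"
      by (simp add: \<gamma>'_def distrib_left)
    also have "\<dots> = ?R + (\<integral>z. \<eta> (fst z) * (g (snd z) * \<omega>' (snd z / n) / n) \<partial>\<mu>)"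
      by (rule Bochner_Integration.integral_add[OF ib(1)[OF g'c Bh(2)] ib(1)[OF pc pb]])
    finally have "\<bar>?L - ?R\<bar> = \<bar>\<integral>z. \<eta> (fst z) * (g (snd z) * \<omega>' (snd z / n) / n) \<partial>\<mu>\<bar>" by simp
    also have "\<dots> \<le> Bx * (Bg * Bw / n) * measure \<mu> ?X" by (rule ib(2)[OF pc pb])
    finally show ?thesis by simp
  qed
  show ?thesis
  proof (rule ccontr)
    assume "?L \<noteq> ?R"
    then have D: "\<bar>?L - ?R\<bar> > 0" by simp
    define C where "C = Bx * (Bg * Bw) * measure \<mu> ?X"
    have C: "C \<ge> 0" using Bx Bg Bw by (simp add: C_def)
    define n where "n = 2 * (\<bar>N\<bar> + \<bar>S\<bar>) + 1 + C / \<bar>?L - ?R\<bar>"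
    have n: "n > 0" "2 * (\<bar>N\<bar> + \<bar>S\<bar>) \<le> n" "C / \<bar>?L - ?R\<bar> < n"
    proof -
      have gen: "0 < 2 * p + 1 + q \<and> 2 * p \<le> 2 * p + 1 + q \<and> q < 2 * p + 1 + q" if "0 \<le> p" "0 \<le> q" for p q :: real
        using that by simp
      have "C / \<bar>?L - ?R\<bar> \<ge> 0" using C D by simp
      from gen[OF _ this, of "\<bar>N\<bar> + \<bar>S\<bar>"]
      show "n > 0" "2 * (\<bar>N\<bar> + \<bar>S\<bar>) \<le> n" "C / \<bar>?L - ?R\<bar> < n" unfolding n_def by simp_all
    qed
    have "\<bar>?L - ?R\<bar> \<le> C / n" using est[OF n(1,2)] by (simp add: C_def)
    moreover have "C / n < \<bar>?L - ?R\<bar>" using n(1,3) D by (simp add: divide_less_eq mult.commute)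
    ultimately show False by linarith
  qed
qed

lemma kinetic_bound:
  assumes B: "ball x0 r0 \<subseteq> \<Omega>" "emeasure \<mu> (ball x0 r0 \<times> UNIV) < \<infinity>" and g: "fl a g g' G" "\<And>s. \<bar>g' s\<bar> \<le> P"
    and \<eta>: "c1c (ball x0 r) \<eta> \<eta>'" "\<And>x. \<bar>\<eta> x\<bar> \<le> M" and r: "r \<le> r0"
  shows "integrable \<mu> (\<lambda>z. \<eta> (fst z) * g' (snd z))" "\<bar>\<integral>x. G (v x) \<bullet> \<eta>' x \<partial>lborel\<bar> \<le> M * P * measure \<mu> (ball x0 r \<times> UNIV)"
proof -
  let ?X = "ball x0 r \<times> (UNIV :: real set)"
  have sub: "ball x0 r \<subseteq> ball x0 r0" using r by (rule subset_ball)
  have X: "?X \<in> sets borel" "?X \<subseteq> \<Omega> \<times> UNIV" using sub B by (auto intro: borel_open open_Times)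
  have X0: "ball x0 r0 \<times> UNIV \<in> sets \<mu>" using B unfolding sets_\<mu>_iff by (auto intro: borel_open open_Times)
  have fin: "emeasure \<mu> ?X < \<infinity>"
    by (rule le_less_trans[OF emeasure_mono[OF _ X0] B(2)]) (use sub in auto)
  have g'c: "continuous_on UNIV g'" using g(1) by (simp add: fl_def)
  have cf: "continuous_on UNIV (\<lambda>z. \<eta> (fst z :: 'a))" "continuous_on UNIV (\<lambda>z. g' (snd z :: real))"
    by (rule continuous_on_compose2[OF c1c_cont[OF \<eta>(1)]] continuous_on_compose2[OF g'c]; auto intro!: continuous_intros)+
  have m: "(\<lambda>z. \<eta> (fst z) * g' (snd z)) \<in> borel_measurable borel"
    by (intro borel_measurable_continuous_onI continuous_on_mult cf)
  have M: "0 \<le> M" using \<eta>(2)[of undefined] by linarith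
  have b: "\<bar>\<eta> (fst z) * g' (snd z)\<bar> \<le> M * P" for z unfolding abs_mult using M \<eta>(2) g(2) by (intro mult_mono) auto
  have z: "\<eta> (fst z) * g' (snd z) = 0" if "z \<notin> ?X" for z
  proof -
    have "fst z \<notin> ball x0 r" using that by (auto simp: mem_Times_iff)
    then have "\<eta> (fst z) = 0" using c1c_support[OF \<eta>(1)] by (metis subsetD)
    then show ?thesis by simp
  qed
  show "integrable \<mu> (\<lambda>z. \<eta> (fst z) * g' (snd z))" by (rule integrable_\<mu>(1)[OF m b z X fin])
  show "\<bar>\<integral>x. G (v x) \<bullet> \<eta>' x \<partial>lborel\<bar> \<le> M * P * measure \<mu> ?X"
    unfolding kinetic_flux[OF B c1c_mono[OF \<eta>(1) sub] g(1)] by (rule integrable_\<mu>(2)[OF m b z X fin])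
qed

text \<open>Both pairings are integrals against the nonnegative \<open>\<mu>\<close>, so the
  pointwise dominations pass to the integrals.\<close>

lemma kinetic_kin:
  assumes B: "ball x0 r0 \<subseteq> \<Omega>" "emeasure \<mu> (ball x0 r0 \<times> UNIV) < \<infinity>"
  shows "kin a v (ball x0 r0)"
  unfolding kin_def
proof (intro allI impI, elim conjE)
  fix f f' \<xi> \<xi>' g g' G h h' H
  assume f: "c1c (ball x0 r0) f f'" and x: "c1c (ball x0 r0) \<xi> \<xi>'" and g: "fl a g g' G" and h: "fl a h h' H"
    and fx: "\<forall>x. \<bar>f x\<bar> \<le> \<xi> x" and gh: "\<forall>v. \<bar>g' v\<bar> \<le> h' v"
  have bd: "\<exists>P. \<forall>s. \<bar>g' s\<bar> \<le> P" if gg: "fl a g g' G" for g g' :: "real \<Rightarrow> real" and G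
  proof -
    obtain N where c: "continuous_on UNIV g'" and N: "\<And>s. N < \<bar>s\<bar> \<Longrightarrow> g' s = 0" using gg by (auto simp: fl_def)
    have "\<And>s. s \<notin> {-\<bar>N\<bar>..\<bar>N\<bar>} \<Longrightarrow> g' s = 0" using N by fastforce
    from compact_support_bounded[OF c compact_Icc this] show ?thesis unfolding real_norm_def by blast
  qed
  obtain P1 P2 where P: "\<And>s. \<bar>g' s\<bar> \<le> P1" "\<And>s. \<bar>h' s\<bar> \<le> P2" using bd[OF g] bd[OF h] by blast
  obtain M1 M2 where M: "\<And>x. \<bar>f x\<bar> \<le> M1" "\<And>x. \<bar>\<xi> x\<bar> \<le> M2" using c1c_bounds[OF f] c1c_bounds[OF x] by metis
  have i: "integrable \<mu> (\<lambda>z. f (fst z) * g' (snd z))" "integrable \<mu> (\<lambda>z. \<xi> (fst z) * h' (snd z))"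
    by (rule kinetic_bound(1)[OF B g P(1) f M(1) order_refl] kinetic_bound(1)[OF B h P(2) x M(2) order_refl])+
  have "\<bar>\<integral>z. f (fst z) * g' (snd z) \<partial>\<mu>\<bar> \<le> (\<integral>z. \<bar>f (fst z) * g' (snd z)\<bar> \<partial>\<mu>)" by (rule integral_abs_bound)
  also have "\<dots> \<le> (\<integral>z. \<xi> (fst z) * h' (snd z) \<partial>\<mu>)"
  proof (rule integral_mono[OF integrable_abs[OF i(1)] i(2)])
    show "\<bar>f (fst z) * g' (snd z)\<bar> \<le> \<xi> (fst z) * h' (snd z)" for z
      unfolding abs_mult using fx gh by (intro mult_mono') auto
  qed
  finally show "\<bar>\<integral>x. G (v x) \<bullet> f' x \<partial>lborel\<bar> \<le> (\<integral>x. H (v x) \<bullet> \<xi>' x \<partial>lborel)"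
    unfolding kinetic_flux[OF B f g] kinetic_flux[OF B x h] .
qed

end

section \<open>Blow-ups at a point outside the jump set\<close>

lemma flow_blowup:
  fixes a a' :: "real \<Rightarrow> real^'d"
  assumes gn: "flux_gn a a' lo hi Cg pg" and kr: "kinetic_rep \<Omega> a u v S \<mu>" and vr: "\<And>x. v x \<in> {lo..hi}"
    and x0: "x0 \<in> \<Omega>" "x0 \<notin> jump_set \<Omega> \<mu>"
  shows "flow a a' lo hi Cg pg (\<lambda>r z. v (x0 + r *\<^sub>R z)) (at_right 0)"
proof -
  interpret flux_gn a a' lo hi Cg pg by fact
  interpret kinetic_rep \<Omega> a u v S \<mu> by fact
  let ?d = "CARD('d)"
  let ?m = "\<lambda>r. emeasure \<mu> (ball x0 r \<times> UNIV)"
  have "\<not> 0 < Limsup (at_right 0) (\<lambda>r. ?m r / ennreal (r ^ (?d - 1)))" using x0 by (simp add: jump_set_def)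
  then have L0: "Limsup (at_right 0) (\<lambda>r. ?m r / ennreal (r ^ (?d - 1))) = 0" by (simp add: not_less)
  have lim: "\<forall>\<^sub>F r in at_right 0. ?m r / ennreal (r ^ (?d - 1)) < y" if "0 < y" for y
    by (rule Limsup_lessD) (unfold L0, rule that)
  obtain r1 where r1: "r1 > 0" "ball x0 r1 \<subseteq> \<Omega>" using open_\<Omega> x0(1) by (auto simp: open_contains_ball)
  obtain b where b: "b > 0" "\<And>r. 0 < r \<Longrightarrow> r < b \<Longrightarrow> ?m r / ennreal (r ^ (?d - 1)) < 1"
    using lim[of 1] unfolding eventually_at_right_field by auto
  define r0 where "r0 = min r1 b / 2"
  have r0: "0 < r0" "r0 < b" "r0 \<le> r1" using r1 b by (auto simp: r0_def)
  have B1: "ball x0 r0 \<subseteq> \<Omega>" using r1(2) subset_ball[OF r0(3), of x0] by blast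
  \<comment> \<open>The measure \<open>\<mu>\<close> is given as finite on compact sets, and a
    cylinder is not compact. Outside the jump set, however, the density quotient is eventually less
    than 1, which forces a finite value at small radii.\<close>
  have B2: "?m r0 < \<infinity>"
  proof (rule ccontr)
    assume "\<not> ?m r0 < \<infinity>"
    then have "?m r0 = top" by (simp add: not_less top_unique)
    then have "?m r0 / ennreal (r0 ^ (?d - 1)) = top" by (simp add: ennreal_top_divide)
    then show False using b(2)[OF r0(1,2)] by simp
  qed
  have X0: "ball x0 r0 \<times> UNIV \<in> sets \<mu>" using B1 unfolding sets_\<mu>_iff by (auto intro: borel_open open_Times)
  define mr where "mr r = measure \<mu> (ball x0 r \<times> UNIV)" for r
  have m_eq: "?m r = ennreal (mr r)" if "r \<le> r0" for r
  proof -
    have "?m r \<le> ?m r0" by (rule emeasure_mono[OF _ X0]) (use subset_ball[OF that, of x0] in auto)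
    then have "?m r \<noteq> top" using B2 by (auto simp: top_unique)
    then show ?thesis unfolding mr_def by (rule emeasure_eq_ennreal_measure)
  qed
  have mlim: "((\<lambda>r. mr r / r ^ (?d - 1)) \<longlongrightarrow> 0) (at_right 0)"
  proof (rule tendstoI)
    fix e :: real assume e: "0 < e"
    have "\<forall>\<^sub>F r in at_right 0. ?m r / ennreal (r ^ (?d - 1)) < ennreal e" using e by (intro lim) simp
    moreover have "\<forall>\<^sub>F r in at_right 0. 0 < r \<and> r < r0"
      unfolding eventually_at_right_field using r0 by auto
    ultimately show "\<forall>\<^sub>F r in at_right 0. dist (mr r / r ^ (?d - 1)) 0 < e"
    proof eventually_elim
      case (elim r)
      have r: "0 < r ^ (?d - 1)" "r \<le> r0" using elim by auto
      have mr: "0 \<le> mr r" by (simp add: mr_def)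
      have "ennreal (mr r / r ^ (?d - 1)) < ennreal e"
        using elim(1) unfolding m_eq[OF r(2)] divide_ennreal[OF mr r(1)] .
      then have "mr r / r ^ (?d - 1) < e" using mr r by (simp add: ennreal_less_iff)
      then show ?case using mr r by simp
    qed
  qed
  show ?thesis
  proof
    show "(\<lambda>z. v (x0 + r *\<^sub>R z)) \<in> borel_measurable borel" for r
    proof -
      note [measurable] = v(1)
      show ?thesis by measurable
    qed
    show "v (x0 + r *\<^sub>R x) \<in> {lo..hi}" for r x by (rule vr)
    have small: "\<forall>\<^sub>F r in at_right 0. 0 < r \<and> r * \<rho> \<le> r0" for \<rho> :: real
    proof -
      have "r * \<rho> \<le> r0" if "0 < r" "r < r0 / (\<bar>\<rho>\<bar> + 1)" for r
      proof -
        have "r * \<rho> \<le> r * (\<bar>\<rho>\<bar> + 1)" using that by (intro mult_left_mono) auto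
        also have "\<dots> \<le> r0" using that(2) by (simp add: less_divide_eq add_pos_nonneg less_imp_le)
        finally show ?thesis .
      qed
      moreover have "0 < r0 / (\<bar>\<rho>\<bar> + 1)" using r0 by simp
      ultimately show ?thesis unfolding eventually_at_right_field by blast
    qed
    show "\<forall>\<^sub>F r in at_right 0. kin a (\<lambda>z. v (x0 + r *\<^sub>R z)) (ball 0 \<rho>)" for \<rho>
      using small[of \<rho>]
    proof eventually_elim
      case (elim r)
      then have r: "0 < r" by simp
      show ?case
      proof (rule kin_mono[OF kin_rescale[OF kinetic_kin[OF B1 B2] v(1) r]])
        show "ball 0 \<rho> \<subseteq> {z. x0 + r *\<^sub>R z \<in> ball x0 r0}"
        proof
          fix z :: "real^'d" assume "z \<in> ball 0 \<rho>"
          then have "r * norm z < r * \<rho>" using r by simp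
          then have "r * norm z < r0" using elim by linarith
          then show "z \<in> {z. x0 + r *\<^sub>R z \<in> ball x0 r0}" using r by (simp add: dist_norm)
        qed
      qed
    qed
    fix \<xi> :: "real^'d \<Rightarrow> real" and \<xi>' :: "real^'d \<Rightarrow> real^'d" and h h' :: "real \<Rightarrow> real" and H
    assume x: "c1c UNIV \<xi> \<xi>'" and h: "fl a h h' H"
    obtain \<zeta> \<zeta>' \<rho>0 where x0': "c1c (ball 0 \<rho>0) \<zeta> \<zeta>'" "\<And>x. \<bar>\<xi> x\<bar> \<le> \<zeta> x" "c1c (ball 0 \<rho>0) \<xi> \<xi>'" using cutoff_large[OF x] by metis
    define \<rho> where "\<rho> = \<bar>\<rho>0\<bar> + 1"
    have \<rho>: "\<rho> > 0" by (simp add: \<rho>_def)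
    have x1: "c1c (ball 0 \<rho>) \<xi> \<xi>'" by (rule c1c_mono[OF x0'(3)]) (auto simp: \<rho>_def)
    obtain M where M: "M > 0" "\<And>x. \<bar>\<xi> x\<bar> \<le> M" using c1c_bounds[OF x] by metis
    obtain P where P: "P > 0" "\<And>s. \<bar>h' s\<bar> \<le> P"
    proof -
      obtain N where c: "continuous_on UNIV h'" and N: "\<And>s. N < \<bar>s\<bar> \<Longrightarrow> h' s = 0" using h by (auto simp: fl_def)
      have "\<And>s. s \<notin> {-\<bar>N\<bar>..\<bar>N\<bar>} \<Longrightarrow> h' s = 0" using N by fastforce
      from compact_support_bounded[OF c compact_Icc this] show ?thesis using that unfolding real_norm_def by blast
    qed
    have l8: "filterlim (\<lambda>r. r * \<rho>) (at_right 0) (at_right 0)"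
      unfolding filterlim_at
    proof
      show "\<forall>\<^sub>F r in at_right 0. r * \<rho> \<in> {0<..} \<and> r * \<rho> \<noteq> 0" using small[of 0] by eventually_elim (use \<rho> in auto)
      show "((\<lambda>r. r * \<rho>) \<longlongrightarrow> 0) (at_right 0)" by (intro tendsto_eq_intros) auto
    qed
    have l9: "((\<lambda>r. M * P * \<rho> ^ (?d - 1) * (mr (r * \<rho>) / (r * \<rho>) ^ (?d - 1))) \<longlongrightarrow> M * P * \<rho> ^ (?d - 1) * 0) (at_right 0)"
      by (intro tendsto_intros filterlim_compose[OF mlim l8])
    \<comment> \<open>A dilation by \<open>r\<close> turns the pairing over radius
      \<open>\<rho>\<close> into one over radius \<open>r * \<rho>\<close> with a factor of order
      \<open>d - 1\<close> in \<open>r\<close>. This is the denominator in the definition of the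
      jump set, so the rescaled dissipation is bounded by the density quotient.\<close>
    have bd: "\<forall>\<^sub>F r in at_right 0. norm (\<integral>x. H (v (x0 + r *\<^sub>R x)) \<bullet> \<xi>' x \<partial>lborel) \<le> M * P * \<rho> ^ (?d - 1) * (mr (r * \<rho>) / (r * \<rho>) ^ (?d - 1))"
      using small[of \<rho>]
    proof eventually_elim
      case (elim r)
      then have r: "0 < r" "r * \<rho> \<le> r0" by auto
      have "{z. x0 + r *\<^sub>R z \<in> ball x0 (r * \<rho>)} = ball 0 \<rho>" using r by (auto simp: dist_norm)
      then have "c1c {z. x0 + r *\<^sub>R z \<in> ball x0 (r * \<rho>)} \<xi> \<xi>'" using x1 by simp
      from kinetic_bound(2)[OF B1 B2 h P(2) c1c_rescale[OF this r(1)] M(2) r(2)]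
      have "\<bar>r ^ ?d / r * (\<integral>z. H (v (x0 + r *\<^sub>R z)) \<bullet> \<xi>' z \<partial>lborel)\<bar> \<le> M * P * mr (r * \<rho>)"
        unfolding integral_rescale[OF v(1) fl_continuous[OF h] c1c_cont'[OF x] r(1), of x0] by (simp add: mr_def)
      moreover have "r ^ ?d / r = r ^ (?d - 1)" using r by (simp add: power_diff)
      ultimately have "r ^ (?d - 1) * \<bar>\<integral>z. H (v (x0 + r *\<^sub>R z)) \<bullet> \<xi>' z \<partial>lborel\<bar> \<le> M * P * mr (r * \<rho>)"
        using r by (simp add: abs_mult)
      then have "\<bar>\<integral>z. H (v (x0 + r *\<^sub>R z)) \<bullet> \<xi>' z \<partial>lborel\<bar> \<le> M * P * mr (r * \<rho>) / r ^ (?d - 1)"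
        using r by (simp add: le_divide_eq mult.commute)
      also have "\<dots> = M * P * \<rho> ^ (?d - 1) * (mr (r * \<rho>) / (r * \<rho>) ^ (?d - 1))"
        using r \<rho> by (simp add: power_mult_distrib)
      finally show ?case by simp
    qed
    show "((\<lambda>r. \<integral>x. H (v (x0 + r *\<^sub>R x)) \<bullet> \<xi>' x \<partial>lborel) \<longlongrightarrow> 0) (at_right 0)"
      by (rule Lim_null_comparison[OF bd]) (use l9 in simp)
  qed
qed

lemma blowup_oscillation:
  fixes a a' :: "real \<Rightarrow> real^'d"
  assumes gn: "flux_gn a a' lo hi Cg pg" and kr: "kinetic_rep \<Omega> a u v S \<mu>" and vr: "\<And>x. v x \<in> {lo..hi}"
    and x0: "x0 \<in> \<Omega>" "x0 \<notin> jump_set \<Omega> \<mu>" and l: "0 < l"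
  shows "\<forall>\<^sub>F r in at_right 0. \<exists>c. measure lborel ({x. v x < c} \<inter> ball x0 r) = 0 \<and> measure lborel ({x. c + l < v x} \<inter> ball x0 r) = 0"
proof (cases "lo < hi")
  case False
  then have v0: "v x = lo" for x using vr[of x] by auto
  show ?thesis by (intro always_eventually allI exI[of _ lo]) (use l in \<open>simp add: v0\<close>)
next
  case True
  interpret flow a a' lo hi Cg pg "\<lambda>r z. v (x0 + r *\<^sub>R z)" "at_right 0"
    by (rule flow_blowup[OF gn kr vr x0])
  interpret kinetic_rep \<Omega> a u v S \<mu> by fact
  note [measurable] = v(1)
  have pos: "\<forall>\<^sub>F r::real in at_right 0. 0 < r" by (rule eventually_at_right_less)
  \<comment> \<open>The oscillation is controlled on the ball of radius 1/8 of the blow-up; the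
    blow-up at scale \<open>8 * r\<close> therefore describes the ball of radius
    \<open>r\<close>.\<close>
  have "filterlim (\<lambda>r::real. 8 * r) (at_right 0) (at_right 0)"
    unfolding filterlim_at
  proof
    show "\<forall>\<^sub>F r::real in at_right 0. 8 * r \<in> {0<..} \<and> 8 * r \<noteq> 0" using pos by eventually_elim auto
    show "((\<lambda>r::real. 8 * r) \<longlongrightarrow> 0) (at_right 0)" by (intro tendsto_eq_intros) auto
  qed
  from eventually_compose_filterlim[OF oscillation[OF True l] this] pos show ?thesis
  proof eventually_elim
    case (elim r)
    have tr: "measure lborel ({x. v x \<in> T} \<inter> ball x0 r) = 0"
      if [measurable]: "T \<in> sets borel" and m: "measure lborel ({x. v (x0 + (8 * r) *\<^sub>R x) \<in> T} \<inter> ball 0 (1/8)) = 0" for T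
    proof -
      have 1: "{x. v x \<in> T} \<in> sets borel" "{x. v (x0 + (8 * r) *\<^sub>R x) \<in> T} \<in> sets borel" by measurable
      show ?thesis
        using measure_rescale[OF 1(1), of r x0] measure_rescale[OF 1(2), of "1/8" 0] m elim(2) by simp
    qed
    from elim(1) obtain c where "measure lborel ({x. v (x0 + (8 * r) *\<^sub>R x) < c} \<inter> ball 0 (1/8)) = 0"
      "measure lborel ({x. c + l < v (x0 + (8 * r) *\<^sub>R x)} \<inter> ball 0 (1/8)) = 0" by blast
    then show ?case using tr[of "{..<c}"] tr[of "{c + l<..}"] by (intro exI[of _ c]) simp
  qed
qed

text \<open>Since the space is not null, some point satisfies both almost everywhere bounds. It
  makes the essential supremum and infimum finite, so that the subtraction in \<open>ereal\<close>
  is genuine, and it shows that the difference is nonnegative.\<close>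

lemma esssup_minus_essinf:
  fixes u :: "'a \<Rightarrow> real"
  assumes u: "u \<in> borel_measurable M" and AE: "AE x in M. c \<le> u x \<and> u x \<le> c + l" and M: "emeasure M (space M) \<noteq> 0"
  shows "0 \<le> esssup M (\<lambda>x. ereal (u x)) - essinf M (\<lambda>x. ereal (u x))"
    "esssup M (\<lambda>x. ereal (u x)) - essinf M (\<lambda>x. ereal (u x)) \<le> ereal l"
proof -
  note [measurable] = u
  define s where "s = esssup M (\<lambda>x. ereal (u x))"
  define t where "t = esssup M (\<lambda>x. - ereal (u x))"
  have s1: "s \<le> ereal (c + l)" unfolding s_def by (rule esssup_I) (use AE in auto)
  have t1: "t \<le> ereal (- c)" unfolding t_def by (rule esssup_I) (use AE in auto)
  have "AE x in M. ereal (u x) \<le> s \<and> - ereal (u x) \<le> t"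
    unfolding s_def t_def using esssup_AE[of "\<lambda>x. ereal (u x)" M] esssup_AE[of "\<lambda>x. - ereal (u x)" M] by eventually_elim simp
  moreover have "ae_filter M \<noteq> bot" using M by (simp add: ae_filter_eq_bot_iff)
  ultimately obtain x where x: "ereal (u x) \<le> s" "- ereal (u x) \<le> t" using eventually_happens' by blast
  obtain s' where s': "s = ereal s'" using s1 x(1) by (cases s) auto
  obtain t' where t': "t = ereal t'" using t1 x(2) by (cases t) auto
  have "esssup M (\<lambda>x. ereal (u x)) - essinf M (\<lambda>x. ereal (u x)) = ereal (s' + t')"
    unfolding essinf_def s_def[symmetric] t_def[symmetric] s' t' by simp
  moreover have "0 \<le> s' + t'" "s' + t' \<le> l" using s1 t1 x by (auto simp: s' t')
  ultimately show "0 \<le> esssup M (\<lambda>x. ereal (u x)) - essinf M (\<lambda>x. ereal (u x))"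
    "esssup M (\<lambda>x. ereal (u x)) - essinf M (\<lambda>x. ereal (u x)) \<le> ereal l" by auto
qed

theorem theorem1p2:
  fixes A a :: "real \<Rightarrow> real ^ 'd"
    and \<Omega> :: "(real ^ 'd) set"
    and u :: "real ^ 'd \<Rightarrow> real"
    and I :: "real set"
    and \<mu> :: "((real ^ 'd) \<times> real) measure"
  assumes A_deriv: "\<And>v. (A has_vector_derivative a v) (at v)"
    and open_Omega: "open \<Omega>"
    and u_Linf: "u \<in> Linfinity \<Omega>"
    and entropy: "entropy_solution \<Omega> a u"
    and I_interval: "closed I" "is_interval I"
    and I_image: "AE x in lebesgue_on \<Omega>. u x \<in> I"
    and GN: "genuinely_nonlinear a I"
    and mu: "kinetic_measure \<Omega> a u \<mu>"
  shows "\<forall>x \<in> \<Omega> - jump_set \<Omega> \<mu>.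
           ((\<lambda>r. esssup (lebesgue_on (ball x r)) (\<lambda>y. ereal (u y))
                - essinf (lebesgue_on (ball x r)) (\<lambda>y. ereal (u y))) \<longlongrightarrow> 0) (at_right 0)"
proof
  fix x0 assume "x0 \<in> \<Omega> - jump_set \<Omega> \<mu>"
  then have x0: "x0 \<in> \<Omega>" "x0 \<notin> jump_set \<Omega> \<mu>" by auto
  have leb: "S \<inter> space lebesgue \<in> sets lebesgue" "S \<in> sets lebesgue" if "open S" for S :: "(real^'d) set"
    using borel_open[OF that] by (auto intro: sets_completionI_sets)
  have posm: "emeasure (lebesgue_on (ball x0 r)) (space (lebesgue_on (ball x0 r))) \<noteq> 0" if "0 < r" for r
  proof -
    have "emeasure lborel (ball x0 r) \<noteq> 0"
      using content_ball_pos[OF that, of x0] by (metis measure_def enn2real_0 less_irrefl)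
    then show ?thesis using leb[of "ball x0 r"] by (simp add: emeasure_restrict_space space_restrict_space)
  qed
  obtain r1 where r1: "r1 > 0" "ball x0 r1 \<subseteq> \<Omega>" using open_Omega x0(1) by (auto simp: open_contains_ball)
  obtain K where um: "u \<in> borel_measurable (lebesgue_on \<Omega>)" and K: "AE x in lebesgue_on \<Omega>. \<bar>u x\<bar> \<le> K"
    using u_Linf by (auto simp: Linfinity_def)
  have "AE x in lebesgue_on \<Omega>. u x \<in> I \<inter> {-K..K}" using I_image K by eventually_elim auto
  then have range: "AE x in lebesgue. x \<in> \<Omega> \<longrightarrow> u x \<in> I \<inter> {-K..K}"
    by (simp only: AE_restrict_space_iff[OF leb(1)[OF open_Omega]])
  have "is_interval (I \<inter> {-K..K})" using I_interval by (intro is_interval_Int is_interval_cc) auto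
  moreover have "compact (I \<inter> {-K..K})" using I_interval by (intro closed_Int_compact) auto
  ultimately obtain lo hi where lohi: "I \<inter> {-K..K} = {lo..hi}" using is_interval_compact[of "I \<inter> {-K..K}"] by auto
  \<comment> \<open>The compact interval could a priori be empty; it is not, because
    \<open>u\<close> takes values in it almost everywhere on a ball of positive measure.\<close>
  have "lo \<le> hi"
  proof -
    have "AE x in lebesgue. x \<in> ball x0 r1 \<longrightarrow> u x \<in> {lo..hi}"
      using range unfolding lohi by eventually_elim (use r1(2) in blast)
    then have "AE x in lebesgue_on (ball x0 r1). u x \<in> {lo..hi}"
      by (simp only: AE_restrict_space_iff[OF leb(1)[OF open_ball]])
    moreover have "ae_filter (lebesgue_on (ball x0 r1)) \<noteq> bot" using posm[OF r1(1)] by (simp add: ae_filter_eq_bot_iff)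
    ultimately obtain x where "u x \<in> {lo..hi}" using eventually_happens' by blast
    then show ?thesis by simp
  qed
  have "(\<lambda>x. if x \<in> \<Omega> then u x else 0) \<in> borel_measurable lebesgue"
    by (rule borel_measurable_if_I[OF um leb(2)[OF open_Omega]])
  from completion_ex_borel_measurable_real[OF this] obtain g where
    g: "g \<in> borel_measurable borel" "AE x in lborel. (if x \<in> \<Omega> then u x else 0) = g x" by auto
  \<comment> \<open>Clamping a Borel representative makes the bounds hold at every point. Almost
    everywhere on \<open>\<Omega>\<close> it changes nothing.\<close>
  define v where "v x = max lo (min hi (g x))" for x
  have v: "v \<in> borel_measurable borel" "\<And>x. v x \<in> {lo..hi}"
    using g(1) \<open>lo \<le> hi\<close> by (auto simp: v_def[abs_def])
  have "AE x in lborel. x \<in> \<Omega> \<longrightarrow> u x \<in> {lo..hi}" using range unfolding lohi by (simp add: AE_completion_iff)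
  with g(2) have uv: "AE x in lborel. x \<in> \<Omega> \<longrightarrow> u x = v x"
    by eventually_elim (auto simp: v_def)
  obtain a' where a': "\<And>v. (a has_vector_derivative a' v) (at v)" "continuous_on UNIV a'"
    using GN by (auto simp: genuinely_nonlinear_def C1_differentiable_on_def)
  have ac: "continuous_on UNIV a" by (intro continuous_at_imp_continuous_on ballI has_vector_derivative_continuous[OF a'(1)])
  have vb: "\<bar>v x\<bar> \<le> \<bar>lo\<bar> + \<bar>hi\<bar>" for x using v(2)[of x] by auto
  have kr: "kinetic_rep \<Omega> a u v (\<bar>lo\<bar> + \<bar>hi\<bar>) \<mu>"
    by unfold_locales (fact open_Omega ac v(1) vb uv mu)+
  obtain al C where al: "0 < al" "0 < C" "\<And>\<xi> \<delta>. norm \<xi> = 1 \<Longrightarrow> 0 < \<delta> \<Longrightarrow> emeasure lebesgue {v \<in> I. \<bar>a v \<bullet> \<xi>\<bar> < \<delta>} \<le> ennreal (C * \<delta> powr al)"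
    using GN unfolding genuinely_nonlinear_def by blast
  have gn: "flux_gn a a' lo hi C al"
  proof
    fix \<xi> :: "real^'d" and \<delta> :: real assume x: "norm \<xi> = 1" "0 < \<delta>"
    have "continuous_on UNIV (\<lambda>v. \<bar>a v \<bullet> \<xi>\<bar>)" by (intro continuous_intros ac)
    then have [measurable]: "(\<lambda>v. \<bar>a v \<bullet> \<xi>\<bar>) \<in> borel_measurable borel" by (rule borel_measurable_continuous_onI)
    have [measurable]: "I \<in> sets borel" using I_interval(1) by (rule borel_closed)
    have T: "{v \<in> {lo..hi}. \<bar>a v \<bullet> \<xi>\<bar> < \<delta>} \<in> sets borel" "{v \<in> I. \<bar>a v \<bullet> \<xi>\<bar> < \<delta>} \<in> sets borel" by measurable
    have "emeasure lborel {v \<in> {lo..hi}. \<bar>a v \<bullet> \<xi>\<bar> < \<delta>} \<le> emeasure lborel {v \<in> I. \<bar>a v \<bullet> \<xi>\<bar> < \<delta>}"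
      using T lohi by (intro emeasure_mono) auto
    also have "\<dots> \<le> ennreal (C * \<delta> powr al)" using al(3)[OF x] T(2) by (simp add: emeasure_completion)
    finally have le: "emeasure lborel {v \<in> {lo..hi}. \<bar>a v \<bullet> \<xi>\<bar> < \<delta>} \<le> ennreal (C * \<delta> powr al)" .
    then have "emeasure lborel {v \<in> {lo..hi}. \<bar>a v \<bullet> \<xi>\<bar> < \<delta>} \<noteq> top" by (auto simp: top_unique)
    from emeasure_eq_ennreal_measure[OF this] le
    show "measure lborel {v \<in> {lo..hi}. \<bar>a v \<bullet> \<xi>\<bar> < \<delta>} \<le> C * \<delta> powr al"
      using al(2) x(2) by (simp add: ennreal_le_iff)
  qed (use a' al in auto)
  let ?o = "\<lambda>r. esssup (lebesgue_on (ball x0 r)) (\<lambda>y. ereal (u y)) - essinf (lebesgue_on (ball x0 r)) (\<lambda>y. ereal (u y))"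
  have osc: "\<forall>\<^sub>F r in at_right 0. 0 \<le> ?o r \<and> ?o r \<le> ereal l" if l: "0 < l" for l
  proof -
    have "\<forall>\<^sub>F r in at_right 0. 0 < r \<and> r < r1" unfolding eventually_at_right_field using r1 by auto
    with blowup_oscillation[OF gn kr v(2) x0 l] show ?thesis
    proof eventually_elim
      case (elim r)
      then obtain c where c: "measure lborel ({x. v x < c} \<inter> ball x0 r) = 0" "measure lborel ({x. c + l < v x} \<inter> ball x0 r) = 0" by blast
      have sub: "ball x0 r \<subseteq> \<Omega>" using r1(2) elim(2) by auto
      have nul: "AE x in lborel. \<not> (P x \<and> x \<in> ball x0 r)" if m: "measure lborel ({x. P x} \<inter> ball x0 r) = 0" and s: "{x. P x} \<in> sets borel" for P
      proof -
        have "emeasure lborel ({x. P x} \<inter> ball x0 r) < \<infinity>"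
          by (rule emeasure_bounded_finite) (auto intro: bounded_subset[OF bounded_ball])
        then have "emeasure lborel ({x. P x} \<inter> ball x0 r) = 0" using m by (simp add: emeasure_eq_ennreal_measure less_top)
        then have "{x. P x} \<inter> ball x0 r \<in> null_sets lborel" using s by (intro null_setsI) auto
        then show ?thesis by (rule AE_I') auto
      qed
      have "{x. v x < c} \<in> sets borel" "{x. c + l < v x} \<in> sets borel" using v(1) by measurable
      from nul[OF c(1) this(1)] nul[OF c(2) this(2)] uv
      have "AE x in lborel. x \<in> ball x0 r \<longrightarrow> c \<le> u x \<and> u x \<le> c + l"
        by eventually_elim (use sub in auto)
      then have "AE x in lebesgue_on (ball x0 r). c \<le> u x \<and> u x \<le> c + l"
        unfolding AE_restrict_space_iff[OF leb(1)[OF open_ball]] by (rule AE_completion)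
      from esssup_minus_essinf[OF measurable_restrict_mono[OF um sub] this posm] elim(2) show ?case by blast
    qed
  qed
  show "(?o \<longlongrightarrow> 0) (at_right 0)"
  proof (rule order_tendstoI)
    fix y :: ereal assume "y < 0"
    with osc[of 1] show "\<forall>\<^sub>F r in at_right 0. y < ?o r" by (auto elim!: eventually_mono intro: less_le_trans)
  next
    fix y :: ereal assume "0 < y"
    then obtain l where l: "0 < ereal l" "ereal l < y" using ereal_dense2 by blast
    then have "0 < l" by simp
    with osc[OF this] l(2) show "\<forall>\<^sub>F r in at_right 0. ?o r < y" by (auto elim!: eventually_mono intro: le_less_trans)
  qed
qed

end
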